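(* Let $n\ge 1$ be an integer, $\beta\in\mathbb{R}$, $b_0>0$, and let $p\in(1,\infty)$ if $n=1,2$ and $p\in\left(1,\frac{n}{n-2}\right]$ if $n\ge 3$. Let $(u_0,u_1)\in H^1(\mathbb{R}^n)\times L^2(\mathbb{R}^n)$. Then the Cauchy problem $$u_{tt}-\Delta u-\frac{b_0}{(1+t)^{\beta}}\Delta u_t=|u|^p\quad (x\in\mathbb{R}^n,\ t>0),\qquad u(0,x)=u_0(x),\quad u_t(0,x)=u_1(x)\quad (x\in\mathbb{R}^n)$$ admits a unique maximal mild solution $$u\in C([0,T_{\max}),H^1(\mathbb{R}^n))\cap C^1([0,T_{\max}),L^2(\mathbb{R}^n)),$$ where $0<T_{\max}\le\infty$. Moreover, if $T_{\max}<\infty$, then $$\|u(t)\|_{H^1}+\|u_t(t)\|_{L^2}\to\infty\qquad\text{as } t\to T_{\max}.$$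
   Context: All functions are real-valued. Solution operators. Consider the linear homogeneous equation $w_{tt}-\Delta w-\frac{b_0}{(1+t)^{\beta}}\Delta w_t=0$. For $s\ge 0$ and $(g_0,g_1)\in H^2(\mathbb{R}^n)\times H^2(\mathbb{R}^n)$, let $R(t,s)(g_0,g_1)$, $t\ge s$, denote the value at time $t$ of the unique strong solution $w\in C^1([s,\infty);H^2(\mathbb{R}^n))\cap C^2([s,\infty);L^2(\mathbb{R}^n))$ (equation satisfied in the sense of $L^2(\mathbb{R}^n)$) with $w(s)=g_0$, $w_t(s)=g_1$. By the energy estimates, $R(\cdot,s)$ extends uniquely by density to an operator from $H^1(\mathbb{R}^n)\times L^2(\mathbb{R}^n)$ to $C([s,\infty);H^1(\mathbb{R}^n))\cap C^1([s,\infty);L^2(\mathbb{R}^n))$. Set $S(t,s)g:=R(t,s)(0,g)$. Mild solution. A function $u\in C([0,T];H^1(\mathbb{R}^n))\cap C^1([0,T];L^2(\mathbb{R}^n))$ is a mild solution on $[0,T]$ of the Cauchy problem if $u(0)=u_0$, $u_t(0)=u_1$ and $$u(t)=R(t,0)(u_0,u_1)+\int_0^tS(t,s)|u(s)|^p\,ds$$ in the sense of $H^1(\mathbb{R}^n)$, for $t\in[0,T]$. A mild solution on $[0,T_{\max})$ is a function whose restriction to $[0,T]$ is a mild solution for every $0<T<T_{\max}$; it is maximal if it cannot be extended to a mild solution on a strictly larger interval. *)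

theory Defs
  imports "HOL-Analysis.Analysis" "HOL-Computational_Algebra.Polynomial"
begin

section \<open>The Hilbert space of square-integrable functions\<close>

definition square_integrable :: "(real ^ 'n \<Rightarrow> real) \<Rightarrow> bool" where
  "square_integrable f \<longleftrightarrow> f \<in> borel_measurable lborel \<and> integrable lborel (\<lambda>x. (f x)\<^sup>2)"

lemma square_integrable_meas: "square_integrable f \<Longrightarrow> f \<in> borel_measurable borel"
  by (simp add: square_integrable_def)

lemma square_integrable_zero: "square_integrable (\<lambda>x. 0)"
  by (simp add: square_integrable_def)

lemma square_integrable_mult:
  assumes "square_integrable f" "square_integrable g"
  shows "integrable lborel (\<lambda>x. f x * g x)"
proof (rule Bochner_Integration.integrable_bound)
  show "integrable lborel (\<lambda>x. (f x)\<^sup>2 + (g x)\<^sup>2)"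
    using assms by (auto simp: square_integrable_def)
  show "(\<lambda>x. f x * g x) \<in> borel_measurable lborel"
    using assms by (auto simp: square_integrable_def)
  have "\<bar>a * b\<bar> \<le> a\<^sup>2 + b\<^sup>2" for a b :: real
  proof -
    have "0 \<le> \<bar>a\<bar> * \<bar>b\<bar>" by simp
    then show ?thesis
      using sum_squares_bound[of "\<bar>a\<bar>" "\<bar>b\<bar>"] unfolding abs_mult power2_abs by linarith
  qed
  then show "AE x in lborel. norm (f x * g x) \<le> norm ((f x)\<^sup>2 + (g x)\<^sup>2)"
    by auto
qed

lemma square_integrable_add:
  assumes "square_integrable f" "square_integrable g"
  shows "square_integrable (\<lambda>x. f x + g x)"
proof -
  have "integrable lborel (\<lambda>x. (f x)\<^sup>2 + (g x)\<^sup>2 + 2 * (f x * g x))"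
    using assms square_integrable_mult[OF assms] by (auto simp: square_integrable_def)
  then show ?thesis
    using assms by (auto simp: square_integrable_def power2_sum mult.assoc)
qed

lemma square_integrable_scale:
  assumes "square_integrable f" shows "square_integrable (\<lambda>x. c * f x)"
  using assms by (auto simp: square_integrable_def power_mult_distrib)

lemma square_integrable_uminus: "square_integrable f \<Longrightarrow> square_integrable (\<lambda>x. - f x)"
  by (auto simp: square_integrable_def)

lemma square_integrable_diff:
  "square_integrable f \<Longrightarrow> square_integrable g \<Longrightarrow> square_integrable (\<lambda>x. f x - g x)"
  using square_integrable_add[OF _ square_integrable_uminus] by fastforce

definition L2_rel :: "(real ^ 'n \<Rightarrow> real) \<Rightarrow> (real ^ 'n \<Rightarrow> real) \<Rightarrow> bool" where
  "L2_rel f g \<longleftrightarrow> square_integrable f \<and> square_integrable g \<and> (AE x in lborel. f x = g x)"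

lemma part_equivp_L2_rel: "part_equivp L2_rel"
proof (rule part_equivpI)
  show "\<exists>f. L2_rel f f"
    using square_integrable_zero by (auto simp: L2_rel_def)
  show "symp L2_rel"
    by (auto simp: symp_def L2_rel_def elim: eventually_mono)
  show "transp L2_rel"
    by (auto simp: transp_def L2_rel_def elim: eventually_elim2)
qed

quotient_type (overloaded) 'n L2 = "real ^ ('n :: finite) \<Rightarrow> real" / partial: L2_rel
  by (rule part_equivp_L2_rel)

instantiation L2 :: (finite) real_inner
begin

lift_definition zero_L2 :: "'a L2" is "\<lambda>x. 0"
  using square_integrable_zero by (auto simp: L2_rel_def)

lift_definition plus_L2 :: "'a L2 \<Rightarrow> 'a L2 \<Rightarrow> 'a L2" is "\<lambda>f g x. f x + g x"
  by (auto simp: L2_rel_def square_integrable_add elim: eventually_elim2)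

lift_definition scaleR_L2 :: "real \<Rightarrow> 'a L2 \<Rightarrow> 'a L2" is "\<lambda>c f x. c * f x"
  by (auto simp: L2_rel_def square_integrable_scale elim: eventually_mono)

lift_definition uminus_L2 :: "'a L2 \<Rightarrow> 'a L2" is "\<lambda>f x. - f x"
  by (auto simp: L2_rel_def square_integrable_uminus elim: eventually_mono)

lift_definition minus_L2 :: "'a L2 \<Rightarrow> 'a L2 \<Rightarrow> 'a L2" is "\<lambda>f g x. f x - g x"
  by (auto simp: L2_rel_def square_integrable_diff elim: eventually_elim2)

lift_definition inner_L2 :: "'a L2 \<Rightarrow> 'a L2 \<Rightarrow> real" is "\<lambda>f g. LINT x|lborel. f x * g x"
proof (rule integral_cong_AE)
  fix f f' g g' :: "real ^ 'a \<Rightarrow> real"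
  assume "L2_rel f f'" "L2_rel g g'"
  then show "(\<lambda>x. f x * g x) \<in> borel_measurable lborel"
    "(\<lambda>x. f' x * g' x) \<in> borel_measurable lborel"
    "AE x in lborel. f x * g x = f' x * g' x"
    by (auto simp: L2_rel_def square_integrable_def elim: eventually_elim2)
qed

definition norm_L2 :: "'a L2 \<Rightarrow> real" where "norm_L2 f = sqrt (inner f f)"
definition dist_L2 :: "'a L2 \<Rightarrow> 'a L2 \<Rightarrow> real" where "dist_L2 f g = norm (f - g)"
definition sgn_L2 :: "'a L2 \<Rightarrow> 'a L2" where "sgn_L2 f = scaleR (inverse (norm f)) f"
definition uniformity_L2 :: "('a L2 \<times> 'a L2) filter" where
  "uniformity_L2 = (INF e\<in>{0<..}. principal {(x, y). dist x y < e})"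
definition open_L2 :: "'a L2 set \<Rightarrow> bool" where
  "open_L2 U \<longleftrightarrow> (\<forall>x\<in>U. eventually (\<lambda>(x', y). x' = x \<longrightarrow> y \<in> U) uniformity)"

instance
proof
  fix f g h :: "'a L2" and a b :: real and U :: "'a L2 set"
  show "f + g + h = f + (g + h)"
    by transfer (auto simp: L2_rel_def square_integrable_add add.assoc)
  show "f + g = g + f"
    by transfer (auto simp: L2_rel_def square_integrable_add add.commute)
  show "0 + f = f"
    by transfer (auto simp: L2_rel_def)
  show "- f + f = 0"
    by transfer (auto simp: L2_rel_def square_integrable_zero)
  show "f - g = f + - g"
    by transfer (auto simp: L2_rel_def square_integrable_diff)
  show "a *\<^sub>R (f + g) = a *\<^sub>R f + a *\<^sub>R g"
    by transfer (auto simp: L2_rel_def distrib_left square_integrable_add square_integrable_scale)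
  show "(a + b) *\<^sub>R f = a *\<^sub>R f + b *\<^sub>R f"
    by transfer (auto simp: L2_rel_def distrib_right square_integrable_add square_integrable_scale)
  show "a *\<^sub>R b *\<^sub>R f = (a * b) *\<^sub>R f"
    by transfer (auto simp: L2_rel_def mult.assoc square_integrable_scale)
  show "1 *\<^sub>R f = f"
    by transfer (auto simp: L2_rel_def)
  show "inner f g = inner g f"
    by transfer (simp add: mult.commute)
  show "inner (f + g) h = inner f h + inner g h"
    by transfer
      (auto simp: L2_rel_def distrib_right square_integrable_mult intro!: Bochner_Integration.integral_add)
  show "inner (a *\<^sub>R f) g = a * inner f g"
    by transfer (simp add: mult.assoc)
  show "0 \<le> inner f f"
    by transfer auto
  show "inner f f = 0 \<longleftrightarrow> f = 0"
  proof transfer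
    fix f :: "real ^ 'a \<Rightarrow> real"
    assume f: "L2_rel f f"
    then have "integrable lborel (\<lambda>x. f x * f x)"
      by (auto simp: L2_rel_def square_integrable_mult)
    then have "(LINT x|lborel. f x * f x) = 0 \<longleftrightarrow> (AE x in lborel. f x * f x = 0)"
      by (intro integral_nonneg_eq_0_iff_AE) auto
    then show "(LINT x|lborel. f x * f x) = 0 \<longleftrightarrow> L2_rel f (\<lambda>x. 0)"
      using f by (auto simp: L2_rel_def square_integrable_zero)
  qed
qed (simp_all add: norm_L2_def dist_L2_def sgn_L2_def uniformity_L2_def open_L2_def)

end

lemma square_integrable_rep_L2: "square_integrable (rep_L2 u)"
  using Quotient3_rep_reflp[OF Quotient3_L2, of u] by (simp add: L2_rel_def)

lemma rep_abs_L2: "square_integrable f \<Longrightarrow> AE x in lborel. rep_L2 (abs_L2 f) x = f x"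
  using rep_abs_rsp_left[OF Quotient3_L2, of f f] by (simp add: L2_rel_def)

lemma L2_eqI: "AE x in lborel. rep_L2 u x = rep_L2 v x \<Longrightarrow> u = v"
  using Quotient3_rel_rep[OF Quotient3_L2, of u v]
  by (simp add: L2_rel_def square_integrable_rep_L2)

lemma inner_L2_abs: "square_integrable f \<Longrightarrow>
    inner u (abs_L2 f) = (LINT x|lborel. rep_L2 u x * f x)"
  unfolding inner_L2_def map_fun_def comp_def id_def
  by (intro integral_cong_AE)
    (auto intro!: borel_measurable_times square_integrable_rep_L2[THEN square_integrable_meas]
       square_integrable_meas[of f] dest: rep_abs_L2 elim: eventually_mono)


section \<open>Test functions\<close>

definition pderivative :: "'n \<Rightarrow> (real ^ 'n \<Rightarrow> real) \<Rightarrow> real ^ 'n \<Rightarrow> real" where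
  "pderivative i f x = frechet_derivative f (at x) (axis i 1)"

primrec Ck :: "nat \<Rightarrow> (real ^ 'n \<Rightarrow> real) \<Rightarrow> bool" where
  "Ck 0 f \<longleftrightarrow> continuous_on UNIV f"
| "Ck (Suc k) f \<longleftrightarrow> (\<forall>x. f differentiable (at x)) \<and> (\<forall>i. Ck k (pderivative i f))"

definition test_function :: "(real ^ 'n \<Rightarrow> real) \<Rightarrow> bool" where
  "test_function \<phi> \<longleftrightarrow> (\<forall>k. Ck k \<phi>) \<and> compact (closure {x. \<phi> x \<noteq> 0})"

lemma pderivative_eqI:
  "(f has_derivative f') (at x) \<Longrightarrow> pderivative i f x = f' (axis i 1)"
  unfolding pderivative_def by (simp add: frechet_derivative_at[symmetric])

lemma Ck_SucI:
  assumes "\<And>x. (f has_derivative f' x) (at x)" "\<And>i. Ck k (\<lambda>x. f' x (axis i 1))"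
  shows "Ck (Suc k) f"
proof -
  have "pderivative i f = (\<lambda>x. f' x (axis i 1))" for i
    using assms(1) by (auto intro: pderivative_eqI)
  with assms show ?thesis by (auto simp: differentiable_def)
qed

lemma Ck_SucD: "Ck (Suc k) f \<Longrightarrow> Ck k f"
proof (induction k arbitrary: f)
  case 0
  then show ?case
    by (auto intro!: continuous_at_imp_continuous_on differentiable_imp_continuous_within)
qed auto

lemma Ck_const: "Ck k (\<lambda>x. c)"
proof (induction k arbitrary: c)
  case (Suc k)
  show ?case by (rule Ck_SucI[where f' = "\<lambda>_ _. 0"]) (auto intro: Suc)
qed auto

lemma Ck_add: "Ck k f \<Longrightarrow> Ck k g \<Longrightarrow> Ck k (\<lambda>x. f x + g x)"
proof (induction k arbitrary: f g)
  case (Suc k)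
  show ?case
  proof (rule Ck_SucI)
    show "((\<lambda>x. f x + g x) has_derivative
        (\<lambda>h. frechet_derivative f (at x) h + frechet_derivative g (at x) h)) (at x)" for x
      using Suc.prems by (auto intro!: has_derivative_add simp: frechet_derivative_works[symmetric])
    show "Ck k (\<lambda>x. frechet_derivative f (at x) (axis i 1) + frechet_derivative g (at x) (axis i 1))" for i
      using Suc.IH[of "pderivative i f" "pderivative i g"] Suc.prems by (simp add: pderivative_def[abs_def])
  qed
qed (auto intro: continuous_intros)

lemma Ck_mult: "Ck k f \<Longrightarrow> Ck k g \<Longrightarrow> Ck k (\<lambda>x. f x * g x)"
proof (induction k arbitrary: f g)
  case (Suc k)
  show ?case
  proof (rule Ck_SucI)
    show "((\<lambda>x. f x * g x) has_derivative
        (\<lambda>h. f x * frechet_derivative g (at x) h + frechet_derivative f (at x) h * g x)) (at x)" for x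
      using Suc.prems by (auto intro!: has_derivative_mult simp: frechet_derivative_works[symmetric])
    show "Ck k (\<lambda>x. f x * frechet_derivative g (at x) (axis i 1) +
        frechet_derivative f (at x) (axis i 1) * g x)" for i
      using Ck_add[OF Suc.IH[of f "pderivative i g"] Suc.IH[of "pderivative i f" g]]
        Suc.prems Ck_SucD[OF Suc.prems(1)] Ck_SucD[OF Suc.prems(2)]
      by (simp add: pderivative_def[abs_def])
  qed
qed (auto intro: continuous_intros)

lemma Ck_prod: "finite I \<Longrightarrow> (\<And>i. i \<in> I \<Longrightarrow> Ck k (f i)) \<Longrightarrow> Ck k (\<lambda>x. \<Prod>i\<in>I. f i x)"
  by (induction I rule: finite_induct) (auto intro: Ck_const Ck_mult)

lemma Ck_continuous: "Ck k f \<Longrightarrow> continuous_on UNIV f"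
proof (induction k)
  case (Suc k)
  then show ?case using Ck_SucD by blast
qed simp

definition cutoff :: "real poly \<Rightarrow> real \<Rightarrow> real" where
  "cutoff p t = (if t > 0 then poly p (1 / t) * exp (- (1 / t)) else 0)"

lemma cutoff_derivative:
  "(cutoff p has_real_derivative cutoff ([:0, 0, 1:] * (p - pderiv p)) t) (at t)"
proof -
  consider "t > 0" | "t < 0" | "t = 0" by linarith
  then show ?thesis
  proof cases
    case 1
    have "((\<lambda>t. poly p (1 / t) * exp (- (1 / t))) has_real_derivative
        cutoff ([:0, 0, 1:] * (p - pderiv p)) t) (at t)"
    proof -
      have "((\<lambda>t. 1 / t) has_real_derivative - (1 / t\<^sup>2)) (at t)"
        using 1 by (auto intro!: derivative_eq_intros simp: power2_eq_square)
      note d = DERIV_mult[OF DERIV_chain2[OF poly_DERIV this]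
          DERIV_chain2[OF DERIV_exp DERIV_minus[OF this]]]
      show ?thesis
        by (rule DERIV_cong[OF d]) (use 1 in \<open>simp add: cutoff_def power2_eq_square algebra_simps\<close>)
    qed
    moreover have "\<forall>\<^sub>F s in nhds t. s \<in> {0<..}"
      using 1 by (intro eventually_nhds_in_open) auto
    then have "\<forall>\<^sub>F s in nhds t. cutoff p s = poly p (1 / s) * exp (- (1 / s))"
      by eventually_elim (auto simp: cutoff_def)
    ultimately show ?thesis
      by (rule DERIV_cong_ev[OF refl _ refl, THEN iffD2, rotated])
  next
    case 2
    have "((\<lambda>t. 0) has_real_derivative cutoff ([:0, 0, 1:] * (p - pderiv p)) t) (at t)"
      using 2 by (auto simp: cutoff_def)
    moreover have "\<forall>\<^sub>F s in nhds t. s \<in> {..<0}"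
      using 2 by (intro eventually_nhds_in_open) auto
    then have "\<forall>\<^sub>F s in nhds t. cutoff p s = 0"
      by eventually_elim (auto simp: cutoff_def)
    ultimately show ?thesis
      by (rule DERIV_cong_ev[OF refl _ refl, THEN iffD2, rotated])
  next
    case 3
    have lim: "((\<lambda>x. poly q x / exp x) \<longlongrightarrow> 0) at_top" for q :: "real poly"
    proof -
      have "((\<lambda>x. \<Sum>i\<le>degree q. coeff q i * (x ^ i / exp x)) \<longlongrightarrow> (\<Sum>i\<le>degree q. coeff q i * 0)) at_top"
        by (intro tendsto_sum tendsto_mult_left tendsto_power_div_exp_0)
      then show ?thesis by (simp add: poly_altdef sum_divide_distrib)
    qed
    have "((\<lambda>h. cutoff p h / h) \<longlongrightarrow> 0) (at_right 0)"
    proof -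
      have "((\<lambda>h. poly ([:0, 1:] * p) (inverse h) / exp (inverse h)) \<longlongrightarrow> 0) (at_right 0)"
        by (rule filterlim_compose[OF lim filterlim_inverse_at_top_right])
      moreover have "\<forall>\<^sub>F h in at_right 0. poly ([:0, 1:] * p) (inverse h) / exp (inverse h) = cutoff p h / h"
        by (auto simp: eventually_at_filter cutoff_def inverse_eq_divide exp_minus)
      ultimately show ?thesis by (rule Lim_transform_eventually)
    qed
    moreover have "((\<lambda>h. cutoff p h / h) \<longlongrightarrow> 0) (at_left 0)"
      by (rule Lim_transform_eventually[OF tendsto_const])
        (auto simp: eventually_at_filter cutoff_def)
    ultimately have "((\<lambda>h. cutoff p h / h) \<longlongrightarrow> 0) (at 0)"
      by (rule filterlim_split_at[rotated])
    moreover have "cutoff q 0 = 0" for q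
      by (simp add: cutoff_def)
    ultimately show ?thesis
      unfolding 3 DERIV_def by simp
  qed
qed

lemma Ck_cutoff: "Ck k (\<lambda>x :: real ^ 'n. cutoff p (c + d * x $ i))"
proof (induction k arbitrary: p)
  case 0
  have "continuous_on UNIV (cutoff p)"
    using cutoff_derivative by (auto intro!: continuous_at_imp_continuous_on DERIV_isCont)
  moreover have "continuous_on UNIV (\<lambda>x :: real ^ 'n. c + d * x $ i)"
    by (intro continuous_intros)
  ultimately have "continuous_on UNIV (\<lambda>x :: real ^ 'n. cutoff p (c + d * x $ i))"
    by (rule continuous_on_compose2) simp
  then show ?case by simp
next
  case (Suc k)
  let ?q = "[:0, 0, 1:] * (p - pderiv p)"
  show ?case
  proof (rule Ck_SucI)
    show "((\<lambda>x :: real ^ 'n. cutoff p (c + d * x $ i)) has_derivative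
        (\<lambda>h. cutoff ?q (c + d * x $ i) * (d * h $ i))) (at x)" for x
      by (rule has_derivative_compose[OF _ cutoff_derivative[unfolded has_field_derivative_def]])
        (auto intro!: derivative_eq_intros bounded_linear.has_derivative[OF bounded_linear_vec_nth])
    show "Ck k (\<lambda>x :: real ^ 'n. cutoff ?q (c + d * x $ i) * (d * axis j 1 $ i))" for j
      by (intro Ck_mult Ck_const Suc.IH)
  qed
qed

lemma pderivative_zero:
  assumes "x \<notin> closure {x. \<phi> x \<noteq> 0}" shows "pderivative i \<phi> x = 0"
proof -
  have "(\<phi> has_derivative (\<lambda>h. 0)) (at x)"
  proof (rule has_derivative_transform_within_open[where f = "\<lambda>x. 0"])
    show "open (- closure {x. \<phi> x \<noteq> 0})" by auto
    show "x \<in> - closure {x. \<phi> x \<noteq> 0}" using assms by simp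
    show "0 = \<phi> y" if "y \<in> - closure {x. \<phi> x \<noteq> 0}" for y
      using that closure_subset[of "{x. \<phi> x \<noteq> 0}"] by auto
  qed auto
  then show ?thesis by (simp add: pderivative_eqI)
qed

lemma square_integrable_compact_support:
  fixes f :: "real ^ 'n \<Rightarrow> real"
  assumes "continuous_on UNIV f" "compact K" "\<And>x. x \<notin> K \<Longrightarrow> f x = 0"
  shows "square_integrable f"
proof -
  have "integrable lborel (\<lambda>x. indicator K x *\<^sub>R (f x)\<^sup>2)"
    using assms by (intro borel_integrable_compact continuous_intros) (auto intro: continuous_on_subset)
  moreover have "(\<lambda>x. indicator K x *\<^sub>R (f x)\<^sup>2) = (\<lambda>x. (f x)\<^sup>2)"
    using assms(3) by (intro ext) (simp add: indicator_def split: if_splits, metis)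
  ultimately show ?thesis
    using assms(1) by (auto simp: square_integrable_def intro: borel_measurable_continuous_onI)
qed

lemma test_function_square_integrable:
  assumes "test_function \<phi>"
  shows "square_integrable \<phi>" "square_integrable (pderivative i \<phi>)"
proof -
  have "Ck (Suc 0) \<phi>" using assms by (simp only: test_function_def)
  then have "continuous_on UNIV \<phi>" "continuous_on UNIV (pderivative i \<phi>)"
    using Ck_continuous by (auto simp del: Ck.simps(2)) (simp)
  moreover have "compact (closure {x. \<phi> x \<noteq> 0})"
    using assms by (simp add: test_function_def)
  moreover have "\<phi> x = 0" if "x \<notin> closure {x. \<phi> x \<noteq> 0}" for x
    using that closure_subset[of "{x. \<phi> x \<noteq> 0}"] by auto
  ultimately show "square_integrable \<phi>" "square_integrable (pderivative i \<phi>)"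
    using square_integrable_compact_support pderivative_zero by metis+
qed

definition box_bump :: "real ^ 'n \<Rightarrow> real ^ 'n \<Rightarrow> real \<Rightarrow> real ^ 'n \<Rightarrow> real" where
  "box_bump a b m x =
    (\<Prod>i\<in>UNIV. cutoff 1 (- m * a $ i + m * x $ i) * cutoff 1 (m * b $ i + (- m) * x $ i))"

lemma cutoff_bounds: "0 \<le> cutoff 1 t" "cutoff 1 t \<le> 1"
  by (auto simp: cutoff_def)

lemma box_bump_bounds: "0 \<le> box_bump a b m x" "box_bump a b m x \<le> 1"
  unfolding box_bump_def
  by (auto intro!: prod_nonneg prod_le_1 mult_le_one mult_nonneg_nonneg cutoff_bounds)

lemma box_bump_zero:
  assumes "m > 0" "x \<notin> box a b" shows "box_bump a b m x = 0"
proof -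
  obtain i where i: "\<not> (a $ i < x $ i \<and> x $ i < b $ i)"
    using assms(2) by (auto simp: mem_box_cart)
  have "cutoff 1 (- m * a $ i + m * x $ i) * cutoff 1 (m * b $ i + (- m) * x $ i) = 0"
    using i assms(1) by (auto simp: cutoff_def)
  then show ?thesis unfolding box_bump_def by (auto intro!: prod_zero)
qed

lemma test_function_box_bump:
  fixes a b :: "real ^ 'n"
  assumes "m > 0" shows "test_function (box_bump a b m)"
proof -
  have "{x. box_bump a b m x \<noteq> 0} \<subseteq> box a b"
    using box_bump_zero[OF assms] by blast
  then have "compact (closure {x. box_bump a b m x \<noteq> 0})"
    unfolding compact_closure using bounded_subset bounded_box by blast
  moreover have "Ck k (box_bump a b m)" for k
    unfolding box_bump_def[abs_def] by (intro Ck_prod Ck_mult Ck_cutoff) auto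
  ultimately show ?thesis by (simp add: test_function_def)
qed

lemma cutoff_tendsto:
  assumes "s > 0" shows "(\<lambda>k. cutoff 1 (real (Suc k) * s)) \<longlonglongrightarrow> 1"
proof -
  have "(\<lambda>k. (1 / s) * inverse (real (Suc k))) \<longlonglongrightarrow> (1 / s) * 0"
    by (intro tendsto_mult_left LIMSEQ_inverse_real_of_nat)
  then have "(\<lambda>k. exp (- ((1 / s) * inverse (real (Suc k))))) \<longlonglongrightarrow> exp (- ((1 / s) * 0))"
    by (intro tendsto_exp tendsto_minus)
  moreover have "cutoff 1 (real (Suc k) * s) = exp (- ((1 / s) * inverse (real (Suc k))))" for k
    using assms by (simp add: cutoff_def field_simps del: of_nat_Suc)
  ultimately show ?thesis by simp
qed

lemma box_bump_tendsto:
  fixes a b :: "real ^ 'n"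
  shows "(\<lambda>k. box_bump a b (real (Suc k)) x) \<longlonglongrightarrow> indicator (box a b) x"
proof (cases "x \<in> box a b")
  case True
  have "(\<lambda>k. box_bump a b (real (Suc k)) x) \<longlonglongrightarrow> (\<Prod>i\<in>(UNIV :: 'n set). 1 * 1)"
    unfolding box_bump_def
  proof (rule tendsto_prod, rule tendsto_mult)
    fix i :: 'n
    have "x $ i - a $ i > 0" "b $ i - x $ i > 0" using True by (auto simp: mem_box_cart)
    from this[THEN cutoff_tendsto]
    show "(\<lambda>k. cutoff 1 (- real (Suc k) * a $ i + real (Suc k) * x $ i)) \<longlonglongrightarrow> 1"
      "(\<lambda>k. cutoff 1 (real (Suc k) * b $ i + - real (Suc k) * x $ i)) \<longlonglongrightarrow> 1"
      by (simp_all add: right_diff_distrib del: of_nat_Suc)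
  qed
  then show ?thesis using True by simp
next
  case False
  then have "box_bump a b (real (Suc k)) x = 0" for k
    by (intro box_bump_zero) auto
  then show ?thesis using False by simp
qed

lemma square_integrable_indicator_box: "square_integrable (indicator (box a b) :: real ^ 'n \<Rightarrow> real)"
proof -
  have "(\<lambda>x. (indicator (box a b) x :: real)\<^sup>2) = indicator (box a b)"
    by (auto simp: indicator_def)
  then show ?thesis
    by (auto simp: square_integrable_def emeasure_lborel_box_eq)
qed

lemma orthogonal_test_functions_box:
  fixes h :: "real ^ 'n \<Rightarrow> real"
  assumes h: "square_integrable h"
    and orth: "\<And>\<phi>. test_function \<phi> \<Longrightarrow> (LINT x|lborel. h x * \<phi> x) = 0"
  shows "(LINT x|lborel. h x * indicator (box a b) x) = 0"
proof -
  have "(\<lambda>k. LINT x|lborel. h x * box_bump a b (real (Suc k)) x) \<longlonglongrightarrow>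
      (LINT x|lborel. h x * indicator (box a b) x)"
  proof (rule integral_dominated_convergence[where w = "\<lambda>x. \<bar>h x * indicator (box a b) x\<bar>"])
    show "integrable lborel (\<lambda>x. \<bar>h x * indicator (box a b) x\<bar>)"
      by (intro integrable_abs square_integrable_mult h square_integrable_indicator_box)
    show "(\<lambda>x. h x * indicator (box a b) x) \<in> borel_measurable lborel"
      using h by (auto simp: square_integrable_def)
    show "(\<lambda>x. h x * box_bump a b (real (Suc k)) x) \<in> borel_measurable lborel" for k
      using h test_function_square_integrable(1)[OF test_function_box_bump[of "real (Suc k)" a b]]
      by (auto simp: square_integrable_def)
    show "AE x in lborel. (\<lambda>k. h x * box_bump a b (real (Suc k)) x) \<longlonglongrightarrow> h x * indicator (box a b) x"
      by (intro AE_I2 tendsto_mult_left box_bump_tendsto)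
    show "AE x in lborel. norm (h x * box_bump a b (real (Suc k)) x) \<le> \<bar>h x * indicator (box a b) x\<bar>" for k
    proof (rule AE_I2)
      fix x
      have "\<bar>box_bump a b (real (Suc k)) x\<bar> \<le> indicator (box a b) x"
        using box_bump_bounds[of a b "real (Suc k)" x] box_bump_zero[of "real (Suc k)" x a b]
        by (auto simp: indicator_def simp del: of_nat_Suc)
      then show "norm (h x * box_bump a b (real (Suc k)) x) \<le> \<bar>h x * indicator (box a b) x\<bar>"
        by (auto simp: abs_mult intro!: mult_left_mono)
    qed
  qed
  moreover have "(LINT x|lborel. h x * box_bump a b (real (Suc k)) x) = 0" for k
    by (intro orth test_function_box_bump) simp
  ultimately show ?thesis using LIMSEQ_unique[OF _ tendsto_const] by fastforce
qed

lemma fundamental_lemma: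
  fixes h :: "real ^ 'n \<Rightarrow> real"
  assumes h: "square_integrable h"
    and orth: "\<And>\<phi>. test_function \<phi> \<Longrightarrow> (LINT x|lborel. h x * \<phi> x) = 0"
  shows "AE x in lborel. h x = 0"
proof -
  have zero: "AE x in lborel. h x * indicator (box a b) x = 0" for a b :: "real ^ 'n"
  proof (rule sigma_finite_measure.density_zero[OF sigma_finite_lborel])
    let ?f = "\<lambda>x. h x * indicator (box a b) x"
    show int: "integrable lborel ?f"
      by (intro square_integrable_mult h square_integrable_indicator_box)
    have si: "set_integrable lborel A ?f" if "A \<in> sets borel" for A
      unfolding set_integrable_def using that by (intro integrable_mult_indicator int) auto
    fix A :: "(real ^ 'n) set" assume "A \<in> sets lborel"
    then have A: "A \<in> sigma_sets UNIV (range (\<lambda>(a, b). box a b))"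
      by (simp add: borel_eq_box)
    have "Int_stable (range (\<lambda>(a, b). box a b :: (real ^ 'n) set))"
      by (auto simp: Int_stable_def box_Int_box)
    moreover have "range (\<lambda>(a, b). box a b :: (real ^ 'n) set) \<subseteq> Pow UNIV"
      by simp
    ultimately show "set_lebesgue_integral lborel A ?f = 0"
      using A
    proof (induction rule: sigma_sets_induct_disjoint)
      case (basic B)
      then obtain c d where B: "B = box c d" by auto
      obtain p q where pq: "box c d \<inter> box a b = box p q" by (auto simp: box_Int_box)
      have "set_lebesgue_integral lborel B ?f = (LINT x|lborel. h x * indicator (box p q) x)"
        unfolding set_lebesgue_integral_def B pq[symmetric]
        by (auto intro!: Bochner_Integration.integral_cong simp: indicator_def)
      then show ?case using orthogonal_test_functions_box[OF h orth] by simp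
    next
      case empty
      then show ?case by (simp add: set_lebesgue_integral_def)
    next
      case (compl B)
      then have B: "B \<in> sets borel" by (simp add: borel_eq_box)
      have "set_lebesgue_integral lborel (UNIV - B) ?f =
          (LINT x|lborel. ?f x - indicator B x *\<^sub>R ?f x)"
        unfolding set_lebesgue_integral_def
        by (auto intro!: Bochner_Integration.integral_cong simp: indicator_def)
      also have "\<dots> = (LINT x|lborel. ?f x) - set_lebesgue_integral lborel B ?f"
        unfolding set_lebesgue_integral_def
        using si[OF B] int by (intro Bochner_Integration.integral_diff) (auto simp: set_integrable_def)
      finally show ?case
        using compl orthogonal_test_functions_box[OF h orth] by simp
    next
      case (union B)
      then have B: "B i \<in> sets lborel" for i by (auto simp: borel_eq_box)
      then have "set_lebesgue_integral lborel (\<Union>i. B i) ?f = (\<Sum>i. set_lebesgue_integral lborel (B i) ?f)"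
        using union by (intro lebesgue_integral_countable_add si) (auto simp: disjoint_family_on_def)
      then show ?case using union by simp
    qed
  qed
  have "AE x in lborel. \<forall>N :: nat. h x * indicator (box (\<chi> i. - real N) (\<chi> i. real N)) x = 0"
    by (intro AE_all_countable[THEN iffD2] allI zero)
  then show ?thesis
  proof eventually_elim
    case (elim x)
    obtain N :: nat where N: "norm x < real N" using reals_Archimedean2 by blast
    have "\<bar>x $ i\<bar> < real N" for i
      using component_le_norm_cart[of x i] N by linarith
    then have "x \<in> box (\<chi> i. - real N) (\<chi> i. real N)"
      by (auto simp: mem_box_cart abs_less_iff) (smt (verit))
    then show ?case using elim[rule_format, of N] by simp
  qed
qed


section \<open>Weak derivatives and Sobolev spaces\<close>

definition has_weak_derivative :: "'n L2 \<Rightarrow> 'n \<Rightarrow> 'n::finite L2 \<Rightarrow> bool" where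
  "has_weak_derivative u i v \<longleftrightarrow> (\<forall>\<phi>. test_function \<phi> \<longrightarrow>
    (LINT x|lborel. rep_L2 u x * pderivative i \<phi> x) = - (LINT x|lborel. rep_L2 v x * \<phi> x))"

lemma has_weak_derivative_inner:
  "has_weak_derivative u i v \<longleftrightarrow> (\<forall>\<phi>. test_function \<phi> \<longrightarrow>
    inner u (abs_L2 (pderivative i \<phi>)) = - inner v (abs_L2 \<phi>))"
  unfolding has_weak_derivative_def by (simp add: inner_L2_abs test_function_square_integrable)

lemma L2_eq_test_functionI:
  assumes "\<And>\<phi>. test_function \<phi> \<Longrightarrow> inner v (abs_L2 \<phi>) = inner w (abs_L2 \<phi>)"
  shows "v = w"
proof -
  have "AE x in lborel. rep_L2 (v - w) x = 0"
  proof (rule fundamental_lemma[OF square_integrable_rep_L2])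
    fix \<phi> :: "real ^ 'a \<Rightarrow> real" assume "test_function \<phi>"
    then show "(LINT x|lborel. rep_L2 (v - w) x * \<phi> x) = 0"
      using assms[of \<phi>]
      by (simp flip: inner_L2_abs add: test_function_square_integrable inner_diff_left)
  qed
  moreover have "AE x in lborel. rep_L2 (0 :: 'a L2) x = 0"
    unfolding zero_L2_def by (intro rep_abs_L2 square_integrable_zero)
  ultimately have "v - w = 0"
    by (intro L2_eqI) (auto elim: eventually_elim2)
  then show ?thesis by simp
qed

lemma has_weak_derivative_unique:
  "has_weak_derivative u i v \<Longrightarrow> has_weak_derivative u i w \<Longrightarrow> v = w"
  by (rule L2_eq_test_functionI) (simp add: has_weak_derivative_inner)

lemma has_weak_derivative_zero: "has_weak_derivative 0 i 0"
  by (simp add: has_weak_derivative_inner)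

lemma has_weak_derivative_add:
  "has_weak_derivative u i v \<Longrightarrow> has_weak_derivative u' i v' \<Longrightarrow> has_weak_derivative (u + u') i (v + v')"
  by (simp add: has_weak_derivative_inner inner_add_left)

lemma has_weak_derivative_scaleR:
  "has_weak_derivative u i v \<Longrightarrow> has_weak_derivative (c *\<^sub>R u) i (c *\<^sub>R v)"
  by (simp add: has_weak_derivative_inner)

lemma has_weak_derivative_uminus:
  "has_weak_derivative u i v \<Longrightarrow> has_weak_derivative (- u) i (- v)"
  by (simp add: has_weak_derivative_inner)

lemma has_weak_derivative_diff:
  "has_weak_derivative u i v \<Longrightarrow> has_weak_derivative u' i v' \<Longrightarrow> has_weak_derivative (u - u') i (v - v')"
  by (simp add: has_weak_derivative_inner inner_diff_left)

typedef (overloaded) 'n H1 = "{u :: 'n::finite L2. \<forall>i. \<exists>v. has_weak_derivative u i v}"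
  morphisms L2_of_H1 Abs_H1
  using has_weak_derivative_zero by blast

setup_lifting type_definition_H1

definition weak_derivative :: "'n \<Rightarrow> 'n::finite H1 \<Rightarrow> 'n L2" where
  "weak_derivative i u = (THE v. has_weak_derivative (L2_of_H1 u) i v)"

lemma weak_derivative_eqI: "has_weak_derivative (L2_of_H1 u) i v \<Longrightarrow> weak_derivative i u = v"
  unfolding weak_derivative_def by (intro the_equality has_weak_derivative_unique)

lemma has_weak_derivative_weak_derivative: "has_weak_derivative (L2_of_H1 u) i (weak_derivative i u)"
  using L2_of_H1[of u] weak_derivative_eqI by fastforce

instantiation H1 :: (finite) real_inner
begin

lift_definition zero_H1 :: "'a H1" is 0
  using has_weak_derivative_zero by blast
lift_definition plus_H1 :: "'a H1 \<Rightarrow> 'a H1 \<Rightarrow> 'a H1" is "(+)"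
  using has_weak_derivative_add by blast
lift_definition scaleR_H1 :: "real \<Rightarrow> 'a H1 \<Rightarrow> 'a H1" is scaleR
  using has_weak_derivative_scaleR by blast
lift_definition uminus_H1 :: "'a H1 \<Rightarrow> 'a H1" is uminus
  using has_weak_derivative_uminus by blast
lift_definition minus_H1 :: "'a H1 \<Rightarrow> 'a H1 \<Rightarrow> 'a H1" is "(-)"
  using has_weak_derivative_diff by blast

definition inner_H1 :: "'a H1 \<Rightarrow> 'a H1 \<Rightarrow> real" where
  "inner_H1 u v = inner (L2_of_H1 u) (L2_of_H1 v) +
    (\<Sum>i\<in>UNIV. inner (weak_derivative i u) (weak_derivative i v))"
definition norm_H1 :: "'a H1 \<Rightarrow> real" where "norm_H1 f = sqrt (inner f f)"
definition dist_H1 :: "'a H1 \<Rightarrow> 'a H1 \<Rightarrow> real" where "dist_H1 f g = norm (f - g)"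
definition sgn_H1 :: "'a H1 \<Rightarrow> 'a H1" where "sgn_H1 f = scaleR (inverse (norm f)) f"
definition uniformity_H1 :: "('a H1 \<times> 'a H1) filter" where
  "uniformity_H1 = (INF e\<in>{0<..}. principal {(x, y). dist x y < e})"
definition open_H1 :: "'a H1 set \<Rightarrow> bool" where
  "open_H1 U \<longleftrightarrow> (\<forall>x\<in>U. eventually (\<lambda>(x', y). x' = x \<longrightarrow> y \<in> U) uniformity)"

lemma weak_derivative_add: "weak_derivative i (u + v) = weak_derivative i u + weak_derivative i v"
  by (rule weak_derivative_eqI)
    (simp add: plus_H1.rep_eq has_weak_derivative_add has_weak_derivative_weak_derivative)

lemma weak_derivative_scaleR: "weak_derivative i (scaleR c u) = scaleR c (weak_derivative i u)"
  by (rule weak_derivative_eqI)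
    (simp add: scaleR_H1.rep_eq has_weak_derivative_scaleR has_weak_derivative_weak_derivative)

lemma weak_derivative_zero: "weak_derivative i 0 = 0"
  by (rule weak_derivative_eqI) (simp add: zero_H1.rep_eq has_weak_derivative_zero)

instance
proof
  fix u v w :: "'a H1" and a b :: real
  show "u + v + w = u + (v + w)" "u + v = v + u" "0 + u = u" "- u + u = 0" "u - v = u + - v"
    "a *\<^sub>R (u + v) = a *\<^sub>R u + a *\<^sub>R v" "(a + b) *\<^sub>R u = a *\<^sub>R u + b *\<^sub>R u"
    "a *\<^sub>R b *\<^sub>R u = (a * b) *\<^sub>R u" "1 *\<^sub>R u = u"
    by (transfer; simp add: algebra_simps)+
  show "inner u v = inner v u"
    by (simp add: inner_H1_def inner_commute)
  show "inner (u + v) w = inner u w + inner v w"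
    by (simp add: inner_H1_def plus_H1.rep_eq weak_derivative_add inner_add_left sum.distrib)
  show "inner (a *\<^sub>R u) v = a * inner u v"
    by (simp add: inner_H1_def scaleR_H1.rep_eq weak_derivative_scaleR sum_distrib_left distrib_left)
  show "0 \<le> inner u u"
    by (simp add: inner_H1_def sum_nonneg)
  show "inner u u = 0 \<longleftrightarrow> u = 0"
  proof
    assume "inner u u = 0"
    moreover have "0 \<le> (\<Sum>i\<in>UNIV. inner (weak_derivative i u) (weak_derivative i u))"
      by (simp add: sum_nonneg)
    moreover have "0 \<le> inner (L2_of_H1 u) (L2_of_H1 u)" by simp
    ultimately have "inner (L2_of_H1 u) (L2_of_H1 u) = 0"
      unfolding inner_H1_def by linarith
    then show "u = 0"
      by (simp add: L2_of_H1_inject[symmetric] zero_H1.rep_eq)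
  qed (simp add: inner_H1_def zero_H1.rep_eq weak_derivative_zero)
qed (simp_all add: norm_H1_def dist_H1_def sgn_H1_def uniformity_H1_def open_H1_def)

end

lemma weak_derivative_uminus: "weak_derivative i (- u) = - weak_derivative i u"
  using weak_derivative_scaleR[of i "-1" u] by simp

lemma weak_derivative_diff: "weak_derivative i (u - v) = weak_derivative i u - weak_derivative i v"
  using weak_derivative_add[of i u "- v"] by (simp add: weak_derivative_uminus)

typedef (overloaded) 'n H2 = "{u :: 'n::finite H1. \<forall>i. weak_derivative i u \<in> range L2_of_H1}"
  morphisms H1_of_H2 Abs_H2
  by (rule exI[of _ 0]) (auto simp: weak_derivative_zero zero_H1.rep_eq[symmetric])

setup_lifting type_definition_H2

definition weak_derivative_H2 :: "'n \<Rightarrow> 'n::finite H2 \<Rightarrow> 'n H1" where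
  "weak_derivative_H2 i u = (THE v. L2_of_H1 v = weak_derivative i (H1_of_H2 u))"

lemma weak_derivative_H2_eqI:
  "L2_of_H1 v = weak_derivative i (H1_of_H2 u) \<Longrightarrow> weak_derivative_H2 i u = v"
  unfolding weak_derivative_H2_def by (rule the_equality) (auto simp: L2_of_H1_inject[symmetric])

lemma L2_of_weak_derivative_H2: "L2_of_H1 (weak_derivative_H2 i u) = weak_derivative i (H1_of_H2 u)"
proof -
  obtain v where "L2_of_H1 v = weak_derivative i (H1_of_H2 u)"
    using H1_of_H2[of u] by (metis (mono_tags, lifting) mem_Collect_eq rangeE)
  then show ?thesis using weak_derivative_H2_eqI by metis
qed

instantiation H2 :: (finite) real_inner
begin

lift_definition zero_H2 :: "'a H2" is 0
  by (metis weak_derivative_zero zero_H1.rep_eq rangeI)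
lift_definition plus_H2 :: "'a H2 \<Rightarrow> 'a H2 \<Rightarrow> 'a H2" is "(+)"
  by (metis weak_derivative_add plus_H1.rep_eq rangeE rangeI)
lift_definition scaleR_H2 :: "real \<Rightarrow> 'a H2 \<Rightarrow> 'a H2" is scaleR
  by (metis weak_derivative_scaleR scaleR_H1.rep_eq rangeE rangeI)
lift_definition uminus_H2 :: "'a H2 \<Rightarrow> 'a H2" is uminus
  by (metis weak_derivative_uminus uminus_H1.rep_eq rangeE rangeI)
lift_definition minus_H2 :: "'a H2 \<Rightarrow> 'a H2 \<Rightarrow> 'a H2" is "(-)"
  by (metis weak_derivative_diff minus_H1.rep_eq rangeE rangeI)

definition inner_H2 :: "'a H2 \<Rightarrow> 'a H2 \<Rightarrow> real" where
  "inner_H2 u v = inner (L2_of_H1 (H1_of_H2 u)) (L2_of_H1 (H1_of_H2 v)) +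
    (\<Sum>i\<in>UNIV. inner (weak_derivative_H2 i u) (weak_derivative_H2 i v))"
definition norm_H2 :: "'a H2 \<Rightarrow> real" where "norm_H2 f = sqrt (inner f f)"
definition dist_H2 :: "'a H2 \<Rightarrow> 'a H2 \<Rightarrow> real" where "dist_H2 f g = norm (f - g)"
definition sgn_H2 :: "'a H2 \<Rightarrow> 'a H2" where "sgn_H2 f = scaleR (inverse (norm f)) f"
definition uniformity_H2 :: "('a H2 \<times> 'a H2) filter" where
  "uniformity_H2 = (INF e\<in>{0<..}. principal {(x, y). dist x y < e})"
definition open_H2 :: "'a H2 set \<Rightarrow> bool" where
  "open_H2 U \<longleftrightarrow> (\<forall>x\<in>U. eventually (\<lambda>(x', y). x' = x \<longrightarrow> y \<in> U) uniformity)"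

lemma weak_derivative_H2_add:
  "weak_derivative_H2 i (u + v) = weak_derivative_H2 i u + weak_derivative_H2 i v"
  by (rule weak_derivative_H2_eqI)
    (simp add: plus_H1.rep_eq plus_H2.rep_eq weak_derivative_add L2_of_weak_derivative_H2)

lemma weak_derivative_H2_scaleR:
  "weak_derivative_H2 i (scaleR c u) = scaleR c (weak_derivative_H2 i u)"
  by (rule weak_derivative_H2_eqI)
    (simp add: scaleR_H1.rep_eq scaleR_H2.rep_eq weak_derivative_scaleR L2_of_weak_derivative_H2)

lemma weak_derivative_H2_zero: "weak_derivative_H2 i 0 = 0"
  by (rule weak_derivative_H2_eqI) (simp add: zero_H1.rep_eq zero_H2.rep_eq weak_derivative_zero)

instance
proof
  fix u v w :: "'a H2" and a b :: real
  show "u + v + w = u + (v + w)" "u + v = v + u" "0 + u = u" "- u + u = 0" "u - v = u + - v"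
    "a *\<^sub>R (u + v) = a *\<^sub>R u + a *\<^sub>R v" "(a + b) *\<^sub>R u = a *\<^sub>R u + b *\<^sub>R u"
    "a *\<^sub>R b *\<^sub>R u = (a * b) *\<^sub>R u" "1 *\<^sub>R u = u"
    by (transfer; simp add: algebra_simps)+
  show "inner u v = inner v u"
    by (simp add: inner_H2_def inner_commute)
  show "inner (u + v) w = inner u w + inner v w"
    by (simp add: inner_H2_def plus_H1.rep_eq plus_H2.rep_eq weak_derivative_H2_add inner_add_left
        sum.distrib)
  show "inner (a *\<^sub>R u) v = a * inner u v"
    by (simp add: inner_H2_def scaleR_H1.rep_eq scaleR_H2.rep_eq weak_derivative_H2_scaleR
        sum_distrib_left distrib_left)
  show "0 \<le> inner u u"
    by (simp add: inner_H2_def sum_nonneg)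
  show "inner u u = 0 \<longleftrightarrow> u = 0"
  proof
    assume "inner u u = 0"
    moreover have "0 \<le> (\<Sum>i\<in>UNIV. inner (weak_derivative_H2 i u) (weak_derivative_H2 i u))"
      by (simp add: sum_nonneg)
    moreover have "0 \<le> inner (L2_of_H1 (H1_of_H2 u)) (L2_of_H1 (H1_of_H2 u))" by simp
    ultimately have "inner (L2_of_H1 (H1_of_H2 u)) (L2_of_H1 (H1_of_H2 u)) = 0"
      unfolding inner_H2_def by linarith
    then show "u = 0"
      by (simp add: L2_of_H1_inject[symmetric] H1_of_H2_inject[symmetric] zero_H1.rep_eq zero_H2.rep_eq)
  qed (simp add: inner_H2_def zero_H1.rep_eq zero_H2.rep_eq weak_derivative_H2_zero)
qed (simp_all add: norm_H2_def dist_H2_def sgn_H2_def uniformity_H2_def open_H2_def)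

end

abbreviation L2_of_H2 :: "'n::finite H2 \<Rightarrow> 'n L2" where
  "L2_of_H2 u \<equiv> L2_of_H1 (H1_of_H2 u)"

definition laplacian :: "'n::finite H2 \<Rightarrow> 'n L2" where
  "laplacian u = (\<Sum>i\<in>UNIV. weak_derivative i (weak_derivative_H2 i u))"


section \<open>The linear problem and its solution operators\<close>

text \<open>\<open>f\<close> belongs to \<open>C\<^sup>1(I; X)\<close> with derivative \<open>f'\<close>; one-sided derivatives at end points of
  \<open>I\<close> that belong to \<open>I\<close>.\<close>

definition C1_with_derivative ::
    "real set \<Rightarrow> (real \<Rightarrow> 'a::real_normed_vector) \<Rightarrow> (real \<Rightarrow> 'a) \<Rightarrow> bool" where
  "C1_with_derivative I f f' \<longleftrightarrow>
    (\<forall>t\<in>I. (f has_vector_derivative f' t) (at t within I)) \<and> continuous_on I f'"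

text \<open>As the inclusion of \<open>H\<^sup>2\<close> in \<open>L\<^sup>2\<close> is bounded, the first derivative of \<open>w\<close> as an \<open>L\<^sup>2\<close>-valued
  function is the image of its \<open>H\<^sup>2\<close>-valued derivative \<open>w'\<close>, so \<open>w \<in> C\<^sup>2([s,\<infinity>); L\<^sup>2)\<close> amounts to
  \<open>w' \<in> C\<^sup>1([s,\<infinity>); L\<^sup>2)\<close>.\<close>

definition strong_solution ::
    "real \<Rightarrow> real \<Rightarrow> real \<Rightarrow> 'n::finite H2 \<Rightarrow> 'n H2 \<Rightarrow> (real \<Rightarrow> 'n H2) \<Rightarrow> bool" where
  "strong_solution b0 \<beta> s g0 g1 w \<longleftrightarrow> (\<exists>w' w''.
    C1_with_derivative {s..} w w' \<and>
    C1_with_derivative {s..} (\<lambda>t. L2_of_H2 (w' t)) w'' \<and>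
    w s = g0 \<and> w' s = g1 \<and>
    (\<forall>t\<ge>s. w'' t - laplacian (w t) - (b0 / (1 + t) powr \<beta>) *\<^sub>R laplacian (w' t) = 0))"

definition R_strong :: "real \<Rightarrow> real \<Rightarrow> real \<Rightarrow> real \<Rightarrow> 'n::finite H2 \<Rightarrow> 'n H2 \<Rightarrow> 'n H2" where
  "R_strong b0 \<beta> t s g0 g1 = (THE v. \<exists>w. strong_solution b0 \<beta> s g0 g1 w \<and> v = w t)"

text \<open>Continuous linear extension of \<open>(g0, g1) \<mapsto> R_strong b0 \<beta> \<cdot> s g0 g1\<close> from
  \<open>H\<^sup>2 \<times> H\<^sup>2\<close> to an operator from \<open>H\<^sup>1 \<times> L\<^sup>2\<close> to \<open>C([s,\<infinity>); H\<^sup>1) \<inter> C\<^sup>1([s,\<infinity>); L\<^sup>2)\<close>, the latter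
  with the topology of locally uniform convergence of a function and its derivative.\<close>

definition extends_R_strong ::
    "real \<Rightarrow> real \<Rightarrow> real \<Rightarrow> ('n::finite H1 \<times> 'n L2 \<Rightarrow> real \<Rightarrow> 'n H1) \<Rightarrow> bool" where
  "extends_R_strong b0 \<beta> s F \<longleftrightarrow>
    (\<forall>g0 g1. \<forall>t\<ge>s. F (H1_of_H2 g0, L2_of_H2 g1) t = H1_of_H2 (R_strong b0 \<beta> t s g0 g1)) \<and>
    (\<forall>t\<ge>s. linear (\<lambda>g. F g t)) \<and>
    (\<exists>F'. (\<forall>g. continuous_on {s..} (F g) \<and>
            C1_with_derivative {s..} (\<lambda>t. L2_of_H1 (F g t)) (F' g)) \<and>
          (\<forall>T\<ge>s. \<exists>C. \<forall>g. \<forall>t\<in>{s..T}. norm (F g t) + norm (F' g t) \<le> C * norm g))"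

definition solution_operator :: "real \<Rightarrow> real \<Rightarrow> real \<Rightarrow> real \<Rightarrow> 'n::finite H1 \<times> 'n L2 \<Rightarrow> 'n H1" where
  "solution_operator b0 \<beta> t s g = (THE v. \<exists>F. extends_R_strong b0 \<beta> s F \<and> v = F g t)"

definition duhamel_operator :: "real \<Rightarrow> real \<Rightarrow> real \<Rightarrow> real \<Rightarrow> 'n::finite L2 \<Rightarrow> 'n H1" where
  "duhamel_operator b0 \<beta> t s g = solution_operator b0 \<beta> t s (0, g)"


section \<open>Mild solutions\<close>

text \<open>\<open>f s\<close> is the element \<open>|u(s)|\<^sup>p\<close> of \<open>L\<^sup>2\<close>. The integral of the continuous \<open>H\<^sup>1\<close>-valued
  integrand is a Riemann integral, for which \<^const>\<open>has_integral\<close> suffices.\<close>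

definition mild_solution_on ::
    "real \<Rightarrow> real \<Rightarrow> real \<Rightarrow> 'n::finite H1 \<Rightarrow> 'n L2 \<Rightarrow> real \<Rightarrow> (real \<Rightarrow> 'n H1) \<Rightarrow> bool" where
  "mild_solution_on b0 \<beta> p u0 u1 T u \<longleftrightarrow>
    continuous_on {0..T} u \<and>
    (\<exists>u'. C1_with_derivative {0..T} (\<lambda>t. L2_of_H1 (u t)) u' \<and> u' 0 = u1) \<and>
    u 0 = u0 \<and>
    (\<exists>f :: real \<Rightarrow> 'n L2.
      (\<forall>s\<in>{0..T}. AE x in lborel. rep_L2 (f s) x = \<bar>rep_L2 (L2_of_H1 (u s)) x\<bar> powr p) \<and>
      (\<forall>t\<in>{0..T}. ((\<lambda>s. duhamel_operator b0 \<beta> t s (f s)) has_integral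
        u t - solution_operator b0 \<beta> t 0 (u0, u1)) {0..t}))"

definition mild_solution_before ::
    "real \<Rightarrow> real \<Rightarrow> real \<Rightarrow> 'n::finite H1 \<Rightarrow> 'n L2 \<Rightarrow> ereal \<Rightarrow> (real \<Rightarrow> 'n H1) \<Rightarrow> bool" where
  "mild_solution_before b0 \<beta> p u0 u1 Tmax u \<longleftrightarrow>
    (\<forall>T. 0 < T \<and> ereal T < Tmax \<longrightarrow> mild_solution_on b0 \<beta> p u0 u1 T u)"

text \<open>An extension to a larger interval, be it \<open>[0, T)\<close> with \<open>T > Tmax\<close> or \<open>[0, T]\<close> with
  \<open>T \<ge> Tmax\<close>, restricts to an extension to a closed interval \<open>[0, T]\<close> with \<open>T \<ge> Tmax\<close>.\<close>

definition maximal_mild_solution ::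
    "real \<Rightarrow> real \<Rightarrow> real \<Rightarrow> 'n::finite H1 \<Rightarrow> 'n L2 \<Rightarrow> ereal \<Rightarrow> (real \<Rightarrow> 'n H1) \<Rightarrow> bool" where
  "maximal_mild_solution b0 \<beta> p u0 u1 Tmax u \<longleftrightarrow>
    0 < Tmax \<and> mild_solution_before b0 \<beta> p u0 u1 Tmax u \<and>
    \<not> (\<exists>T v. Tmax \<le> ereal T \<and> mild_solution_on b0 \<beta> p u0 u1 T v \<and>
          (\<forall>t. 0 \<le> t \<and> ereal t < Tmax \<longrightarrow> v t = u t))"

end

theory Submission
  imports Defs
begin

text \<open>Energy estimates turn the linear equation into an evolution family on \<open>H\<^sup>1 \<times> L\<^sup>2\<close>, and
  \<open>u \<mapsto> |u|\<^sup>p\<close> is locally Lipschitz from \<open>H\<^sup>1\<close> to \<open>L\<^sup>2\<close> because \<open>H\<^sup>1\<close> embeds in \<open>L\<^sup>2\<^sup>p\<close>. So Picard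
  iteration on steps whose length depends only on the norm of the data yields the maximal solution
  and the blow-up alternative.

  For the linear equation, \<open>q = w + b w\<^sub>t\<close> leads to a degenerate parabolic system in \<open>L\<^sup>2 \<times> L\<^sup>2\<close>, solved
  as a limit of ordinary differential equations with difference operators in place of \<open>\<Delta>\<close>. As these
  commute with translations, \<open>H\<^sup>1\<close> and \<open>H\<^sup>2\<close> regularity of the data is preserved. The embedding comes
  from cutting \<open>|u|\<close> into dyadic slices: comparing a slice with its averages over a suitable cube bounds
  the measure of \<open>{|u| > 2\<^sup>k\<^sup>+\<^sup>1}\<close> by \<open>4\<^sup>-\<^sup>k\<close> times \<open>|{|u| > 2\<^sup>k}|\<^sup>2\<^sup>/\<^sup>n\<close> times the energy of the slice, up to a constant.\<close>


section \<open>Completeness of the spaces\<close>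

text \<open>The obstacle in the linear part is the damping: as a system in \<open>(w, w')\<close>
  the equation has second-order operators in two entries, one with a time-dependent coefficient.
  Since it reads \<open>w'' = \<Delta>(w + b w')\<close>, the variable \<open>q\<close> gathers all
  second-order terms in one dissipative diagonal entry, and the remaining coupling is bounded on L2.
  Shifts commute with the whole construction, so difference quotients take the role of the Fourier
  transform: they commute with the approximations and detect weak derivatives.

  The system for \<open>(w, q)\<close> is solved in L2, while the nonlinearity calls for the energy
  space \<open>H1 \<times> L2\<close>. The bridge is the energy identity for \<open>H2\<close> data,
  extended by density; a bounded extension from a dense set is unique, which meets the descriptions
  defining the solution operators.

  The definition of a mild solution mentions only the first component of the evolution. The fixed
  point argument runs on pairs, so the Duhamel integral must be shown differentiable in L2 with the
  second component as derivative. Both norms of the blow-up alternative are then controlled by the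
  norm of the pair.\<close>

lemma rep_L2_diff: "AE x in lborel. rep_L2 (u - v) x = rep_L2 u x - rep_L2 v x"
  unfolding minus_L2_def map_fun_def comp_def id_def
  by (intro rep_abs_L2 square_integrable_diff square_integrable_rep_L2)

lemma norm_L2_squared: "(norm f)\<^sup>2 = (LINT x|lborel. (rep_L2 f x)\<^sup>2)"
  unfolding power2_norm_eq_inner inner_L2_def map_fun_def comp_def id_def
  by (simp add: power2_eq_square)

lemma norm_abs_L2_squared:
  assumes "square_integrable f" shows "(norm (abs_L2 f))\<^sup>2 = (LINT x|lborel. (f x)\<^sup>2)"
  unfolding norm_L2_squared
  by (intro integral_cong_AE)
    (use assms square_integrable_rep_L2[of "abs_L2 f"] rep_abs_L2[OF assms] in
      \<open>auto simp: square_integrable_def elim: eventually_mono\<close>)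

lemma nn_integral_norm_L2:
  "(\<integral>\<^sup>+x. ennreal ((rep_L2 f x)\<^sup>2) \<partial>lborel) = ennreal ((norm f)\<^sup>2)"
  unfolding norm_L2_squared
  by (intro nn_integral_eq_integral)
    (use square_integrable_rep_L2[of f] in \<open>auto simp: square_integrable_def\<close>)

lemma measurable_rep_L2 [measurable]: "rep_L2 f \<in> borel_measurable borel"
  by (rule square_integrable_meas[OF square_integrable_rep_L2])

text \<open>The Riesz-Fischer argument: the squared increments are at most \<open>(1/4) ^ k\<close>
  and stay summable after multiplication by \<open>2 ^ k\<close>. This gives pointwise convergence
  almost everywhere, and Fatou's lemma turns the pointwise limit into a limit in norm.\<close>

lemma L2_rapidly_Cauchy_convergent:
  fixes X :: "nat \<Rightarrow> 'n::finite L2"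
  assumes X: "\<And>k. norm (X (Suc k) - X k) \<le> (1/2) ^ k"
  shows "convergent X"
proof -
  define f where "f k = rep_L2 (X k)" for k
  have [measurable]: "f k \<in> borel_measurable borel" for k
    unfolding f_def by simp
  have diff: "(\<integral>\<^sup>+x. ennreal ((f j x - f k x)\<^sup>2) \<partial>lborel) = ennreal ((norm (X j - X k))\<^sup>2)" for j k
    unfolding nn_integral_norm_L2[symmetric] f_def
    by (intro nn_integral_cong_AE eventually_mono[OF rep_L2_diff[of "X j" "X k"]]) auto
  have "AE x in lborel. (\<Sum>k. ennreal (2 ^ k * (f (Suc k) x - f k x)\<^sup>2)) \<noteq> \<infinity>"
  proof (rule nn_integral_PInf_AE)
    have "(\<integral>\<^sup>+x. (\<Sum>k. ennreal (2 ^ k * (f (Suc k) x - f k x)\<^sup>2)) \<partial>lborel)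
        = (\<Sum>k. ennreal (2 ^ k) * (\<integral>\<^sup>+x. ennreal ((f (Suc k) x - f k x)\<^sup>2) \<partial>lborel))"
      by (subst nn_integral_suminf) (auto simp: nn_integral_cmult ennreal_mult)
    also have "\<dots> = (\<Sum>k. ennreal (2 ^ k * (norm (X (Suc k) - X k))\<^sup>2))"
      by (simp add: diff ennreal_mult)
    also have "\<dots> \<le> (\<Sum>k. ennreal ((1/2) ^ k))"
    proof (intro suminf_le ennreal_leI)
      fix k
      have "(norm (X (Suc k) - X k))\<^sup>2 \<le> ((1/2) ^ k)\<^sup>2"
        using X[of k] by (intro power_mono) auto
      then have "2 ^ k * (norm (X (Suc k) - X k))\<^sup>2 \<le> 2 ^ k * ((1/2) ^ k)\<^sup>2"
        by (intro mult_left_mono) auto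
      also have "\<dots> = (1/2 :: real) ^ k"
        by (simp add: power_divide power2_eq_square)
      finally show "2 ^ k * (norm (X (Suc k) - X k))\<^sup>2 \<le> (1/2) ^ k" .
    qed auto
    also have "\<dots> = ennreal (\<Sum>k. (1/2) ^ k)"
      by (intro suminf_ennreal2) (auto intro: summable_geometric)
    finally show "(\<integral>\<^sup>+x. (\<Sum>k. ennreal (2 ^ k * (f (Suc k) x - f k x)\<^sup>2)) \<partial>lborel) \<noteq> \<infinity>"
      by (auto simp: top_unique)
  qed simp
  then have conv: "AE x in lborel. convergent (\<lambda>k. f k x)"
  proof eventually_elim
    case (elim x)
    then have "(\<Sum>k. ennreal (2 ^ k * (f (Suc k) x - f k x)\<^sup>2)) \<noteq> top"
      unfolding infinity_ennreal_def .
    then have "summable (\<lambda>k. 2 ^ k * (f (Suc k) x - f k x)\<^sup>2)"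
      by (rule summable_suminf_not_top[rotated]) simp
    then have s: "summable (\<lambda>k. (1/2) ^ k + 2 ^ k * (f (Suc k) x - f k x)\<^sup>2)"
      by (intro summable_add) (auto intro: summable_geometric)
    \<comment> \<open>An increment \<open>?a\<close> above \<open>(1/2) ^ k\<close> satisfies
      \<open>1 \<le> 2 ^ k * ?a\<close>, hence \<open>?a\<close> is at most \<open>2 ^ k\<close>
      times its square.\<close>
    have "summable (\<lambda>k. f (Suc k) x - f k x)"
    proof (rule summable_comparison_test'[OF s])
      fix k
      let ?a = "\<bar>f (Suc k) x - f k x\<bar>"
      show "norm (f (Suc k) x - f k x) \<le> (1/2) ^ k + 2 ^ k * (f (Suc k) x - f k x)\<^sup>2"
      proof (cases "?a \<le> (1/2) ^ k")
        case False
        then have "1 \<le> 2 ^ k * ?a" by (simp add: field_simps)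
        then have "?a \<le> 2 ^ k * ?a * ?a"
          using mult_right_mono[of 1 "2 ^ k * ?a" ?a] by simp
        also have "\<dots> = 2 ^ k * (f (Suc k) x - f k x)\<^sup>2"
          by (simp add: power2_eq_square mult.assoc flip: abs_mult)
        finally show ?thesis by (simp add: add_increasing)
      qed (simp add: add_increasing2)
    qed
    then have "convergent (\<lambda>n. (\<Sum>k<n. f (Suc k) x - f k x) + f 0 x)"
      unfolding summable_iff_convergent by (intro convergent_add convergent_const)
    moreover have "(\<Sum>k<n. f (Suc k) x - f k x) + f 0 x = f n x" for n
      using sum_lessThan_telescope[of "\<lambda>k. f k x" n] by simp
    ultimately show ?case by simp
  qed
  define F where "F x = lim (\<lambda>k. f k x)" for x
  have [measurable]: "F \<in> borel_measurable borel"
    unfolding F_def by measurable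
  have tail: "norm (X (k + j) - X k) \<le> 2 * (1/2) ^ k" for j k
  proof -
    \<comment> \<open>The subtracted term strengthens the geometric bound so that the induction
      closes.\<close>
    have "norm (X (k + j) - X k) \<le> 2 * (1/2) ^ k - 2 * (1/2) ^ (k + j)"
    proof (induction j)
      case (Suc j)
      have "norm (X (k + Suc j) - X k) \<le> norm (X (Suc (k + j)) - X (k + j)) + norm (X (k + j) - X k)"
        by (metis add_Suc_right diff_add_cancel add_diff_eq norm_triangle_ineq)
      then show ?case using Suc X[of "k + j"] by simp
    qed simp
    then show ?thesis
      by (smt (verit) zero_le_power divide_nonneg_nonneg)
  qed
  have bound: "(\<integral>\<^sup>+x. ennreal ((F x - f k x)\<^sup>2) \<partial>lborel) \<le> ennreal ((2 * (1/2) ^ k)\<^sup>2)" for k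
  proof -
    have "(\<integral>\<^sup>+x. ennreal ((F x - f k x)\<^sup>2) \<partial>lborel)
        = (\<integral>\<^sup>+x. liminf (\<lambda>j. ennreal ((f (k + j) x - f k x)\<^sup>2)) \<partial>lborel)"
    proof (intro nn_integral_cong_AE eventually_mono[OF conv])
      fix x assume "convergent (\<lambda>k. f k x)"
      then have "(\<lambda>j. f j x) \<longlonglongrightarrow> F x"
        unfolding F_def by (simp add: convergent_LIMSEQ_iff)
      then have "(\<lambda>j. f (k + j) x) \<longlonglongrightarrow> F x"
        by (rule LIMSEQ_ignore_initial_segment[where k=k, unfolded add.commute[of _ k]])
      then have "(\<lambda>j. ennreal ((f (k + j) x - f k x)\<^sup>2)) \<longlonglongrightarrow> ennreal ((F x - f k x)\<^sup>2)"
        by (intro tendsto_ennrealI tendsto_intros)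
      then show "ennreal ((F x - f k x)\<^sup>2) = liminf (\<lambda>j. ennreal ((f (k + j) x - f k x)\<^sup>2))"
        by (rule lim_imp_Liminf[OF trivial_limit_sequentially, symmetric])
    qed
    also have "\<dots> \<le> liminf (\<lambda>j. \<integral>\<^sup>+x. ennreal ((f (k + j) x - f k x)\<^sup>2) \<partial>lborel)"
      by (intro nn_integral_liminf) simp
    also have "\<dots> \<le> ennreal ((2 * (1/2) ^ k)\<^sup>2)"
    proof (rule Liminf_le)
      show "\<forall>\<^sub>F j in sequentially. (\<integral>\<^sup>+x. ennreal ((f (k + j) x - f k x)\<^sup>2) \<partial>lborel) \<le> ennreal ((2 * (1/2) ^ k)\<^sup>2)"
        unfolding diff using tail by (intro always_eventually allI ennreal_leI power_mono) auto
    qed simp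
    finally show ?thesis .
  qed
  have si: "square_integrable (\<lambda>x. F x - f k x)" for k
    unfolding square_integrable_def
  proof (intro conjI integrableI_bounded)
    show "(\<integral>\<^sup>+x. ennreal (norm ((F x - f k x)\<^sup>2)) \<partial>lborel) < \<infinity>"
      using le_less_trans[OF bound[of k]] by simp
  qed auto
  have "square_integrable (\<lambda>x. (F x - f 0 x) + f 0 x)"
    using si[of 0] unfolding f_def by (intro square_integrable_add square_integrable_rep_L2)
  then have F: "square_integrable F" by simp
  have "\<And>k. norm (abs_L2 F - X k) \<le> 2 * (1/2) ^ k"
  proof -
    fix k
    have "ennreal ((norm (abs_L2 F - X k))\<^sup>2) = (\<integral>\<^sup>+x. ennreal ((F x - f k x)\<^sup>2) \<partial>lborel)"
      unfolding nn_integral_norm_L2[symmetric] f_def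
      by (intro nn_integral_cong_AE eventually_mono[OF eventually_conj[OF rep_L2_diff[of "abs_L2 F" "X k"] rep_abs_L2[OF F]]]) auto
    also note bound
    finally have "(norm (abs_L2 F - X k))\<^sup>2 \<le> (2 * (1/2) ^ k)\<^sup>2"
      by (subst (asm) ennreal_le_iff) auto
    then show "norm (abs_L2 F - X k) \<le> 2 * (1/2) ^ k" by (rule power2_le_imp_le) simp
  qed
  then have bd: "\<forall>k. norm (abs_L2 F - X k) \<le> 2 * (1/2) ^ k" by (rule allI)
  have "(\<lambda>k. 2 * (1/2 :: real) ^ k) \<longlonglongrightarrow> 2 * 0"
    by (intro tendsto_mult_left LIMSEQ_realpow_zero) auto
  then have "(\<lambda>k. 2 * (1/2 :: real) ^ k) \<longlonglongrightarrow> 0" by simp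
  then have "(\<lambda>k. abs_L2 F - X k) \<longlonglongrightarrow> 0"
    by (rule Lim_null_comparison[OF always_eventually[OF bd]])
  then have "(\<lambda>k. abs_L2 F - (abs_L2 F - X k)) \<longlonglongrightarrow> abs_L2 F - 0"
    by (intro tendsto_diff tendsto_const)
  then have "X \<longlonglongrightarrow> abs_L2 F" by simp
  then show ?thesis by (rule convergentI)
qed

instance L2 :: (finite) banach
proof
  fix X :: "nat \<Rightarrow> 'a L2" assume X: "Cauchy X"
  have "\<exists>N. \<forall>m\<ge>N. \<forall>n\<ge>N. norm (X m - X n) < (1/2) ^ k" for k :: nat
    using X CauchyD[of X "(1/2) ^ k"] by auto
  then obtain N where N: "\<And>k m n. m \<ge> N k \<Longrightarrow> n \<ge> N k \<Longrightarrow> norm (X m - X n) < (1/2) ^ k"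
    by metis
  define r where "r = rec_nat (N 0) (\<lambda>k n. max (Suc n) (N (Suc k)))"
  have r: "r 0 = N 0" "r (Suc k) = max (Suc (r k)) (N (Suc k))" for k
    by (simp_all add: r_def)
  have mono: "strict_mono r" by (rule strict_monoI_Suc) (simp add: r)
  have rN: "r k \<ge> N k" for k by (cases k) (auto simp: r)
  have "norm ((X \<circ> r) (Suc k) - (X \<circ> r) k) \<le> (1/2) ^ k" for k
    using N[of k "r (Suc k)" "r k"] rN[of k] by (simp add: r less_imp_le)
  then have "convergent (X \<circ> r)" by (rule L2_rapidly_Cauchy_convergent)
  then obtain l where "(X \<circ> r) \<longlonglongrightarrow> l" by (auto simp: convergent_def)
  then have "X \<longlonglongrightarrow> l" using X mono by (rule Cauchy_converges_subseq[rotated 2])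
  then show "convergent X" by (rule convergentI)
qed

section \<open>Componentwise description of norms, limits and derivatives in \<open>H1\<close> and
  \<open>H2\<close>\<close>

lemma norm_H1_squared:
  "(norm u)\<^sup>2 = (norm (L2_of_H1 u))\<^sup>2 + (\<Sum>i\<in>UNIV. (norm (weak_derivative i u))\<^sup>2)"
  by (simp add: power2_norm_eq_inner inner_H1_def)

lemma norm_H2_squared:
  "(norm u)\<^sup>2 = (norm (L2_of_H2 u))\<^sup>2 + (\<Sum>i\<in>UNIV. (norm (weak_derivative_H2 i u))\<^sup>2)"
  by (simp add: power2_norm_eq_inner inner_H2_def)

lemma norm_L2_of_H1_le: "norm (L2_of_H1 u) \<le> norm u"
  by (rule power2_le_imp_le) (auto simp: norm_H1_squared intro!: sum_nonneg)

lemma norm_weak_derivative_le: "norm (weak_derivative i u) \<le> norm u"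
proof (rule power2_le_imp_le)
  have "(norm (weak_derivative i u))\<^sup>2 \<le> (\<Sum>i\<in>UNIV. (norm (weak_derivative i u))\<^sup>2)"
    by (rule member_le_sum) auto
  then show "(norm (weak_derivative i u))\<^sup>2 \<le> (norm u)\<^sup>2"
    by (simp add: norm_H1_squared add_increasing)
qed simp

lemma norm_H1_le:
  "norm u \<le> norm (L2_of_H1 u) + (\<Sum>i\<in>UNIV. norm (weak_derivative i u))"
proof (rule power2_le_imp_le)
  have "(\<Sum>i\<in>I. (norm (weak_derivative i u))\<^sup>2) \<le> (\<Sum>i\<in>I. norm (weak_derivative i u))\<^sup>2" if "finite I" for I
    using that
    by (induction I rule: finite_induct) (auto simp: power2_sum sum_nonneg intro: add_increasing2 add_mono)
  from this[of UNIV] show "(norm u)\<^sup>2 \<le> (norm (L2_of_H1 u) + (\<Sum>i\<in>UNIV. norm (weak_derivative i u)))\<^sup>2"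
    unfolding norm_H1_squared by (simp add: power2_sum sum_nonneg add_increasing2)
qed (simp add: sum_nonneg)

lemma L2_of_H1_minus: "L2_of_H1 (u - v) = L2_of_H1 u - L2_of_H1 v"
  by (rule minus_H1.rep_eq)

lemma bounded_linear_L2_of_H1: "bounded_linear (L2_of_H1 :: 'n::finite H1 \<Rightarrow> 'n L2)"
  by (rule bounded_linear_intro[where K = 1])
    (auto simp: plus_H1.rep_eq scaleR_H1.rep_eq norm_L2_of_H1_le)

lemma bounded_linear_weak_derivative: "bounded_linear (weak_derivative i)"
  by (rule bounded_linear_intro[where K = 1])
    (auto simp: weak_derivative_add weak_derivative_scaleR norm_weak_derivative_le)

text \<open>Lets limits, continuity and differentiability of \<open>H1\<close>-valued maps be
  checked on L2 components, which is where the linear evolution is constructed.\<close>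

lemma tendsto_H1_iff:
  fixes f :: "'b \<Rightarrow> 'n::finite H1"
  shows "(f \<longlongrightarrow> l) F \<longleftrightarrow> ((\<lambda>x. L2_of_H1 (f x)) \<longlongrightarrow> L2_of_H1 l) F \<and>
    (\<forall>i. ((\<lambda>x. weak_derivative i (f x)) \<longlongrightarrow> weak_derivative i l) F)" (is "?l \<longleftrightarrow> ?r")
proof
  assume ?l then show ?r
    by (auto intro: bounded_linear.tendsto[OF bounded_linear_L2_of_H1]
        bounded_linear.tendsto[OF bounded_linear_weak_derivative])
next
  assume r: ?r
  have "((\<lambda>x. norm (L2_of_H1 (f x) - L2_of_H1 l) +
      (\<Sum>i\<in>UNIV. norm (weak_derivative i (f x) - weak_derivative i l))) \<longlongrightarrow>
      0 + (\<Sum>i\<in>(UNIV::'n set). 0)) F"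
    using r by (intro tendsto_add tendsto_sum) (auto simp: tendsto_norm_zero_iff LIM_zero_iff)
  then have lim: "((\<lambda>x. norm (L2_of_H1 (f x - l)) + (\<Sum>i\<in>UNIV. norm (weak_derivative i (f x - l)))) \<longlongrightarrow> 0) F"
    by (simp add: L2_of_H1_minus weak_derivative_diff)
  have "((\<lambda>x. norm (f x - l)) \<longlongrightarrow> 0) F"
    by (rule tendsto_sandwich[OF _ _ tendsto_const lim]) (auto intro: norm_H1_le always_eventually)
  then show ?l by (simp add: tendsto_norm_zero_iff LIM_zero_iff)
qed

text \<open>For a fixed test function both sides of the defining identity are continuous in L2. So
  weak differentiation is a closed operator, and completeness of \<open>H1\<close> follows from that
  of L2.\<close>

lemma has_weak_derivative_closed:
  fixes u v :: "'n::finite L2"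
  assumes "F \<noteq> bot" "(f \<longlongrightarrow> u) F" "(g \<longlongrightarrow> v) F"
    and "\<forall>\<^sub>F x in F. has_weak_derivative (f x) i (g x)"
  shows "has_weak_derivative u i v"
  unfolding has_weak_derivative_inner
proof (intro allI impI)
  fix \<phi> :: "real ^ 'n \<Rightarrow> real" assume \<phi>: "test_function \<phi>"
  have "((\<lambda>x. inner (f x) (abs_L2 (pderivative i \<phi>))) \<longlongrightarrow> inner u (abs_L2 (pderivative i \<phi>))) F"
    "((\<lambda>x. - inner (g x) (abs_L2 \<phi>)) \<longlongrightarrow> - inner v (abs_L2 \<phi>)) F"
    by (intro tendsto_intros assms)+
  moreover have "\<forall>\<^sub>F x in F. inner (f x) (abs_L2 (pderivative i \<phi>)) = - inner (g x) (abs_L2 \<phi>)"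
    using assms(4) \<phi> by (auto simp: has_weak_derivative_inner elim: eventually_mono)
  ultimately show "inner u (abs_L2 (pderivative i \<phi>)) = - inner v (abs_L2 \<phi>)"
    using tendsto_unique[OF assms(1)] Lim_transform_eventually by metis
qed

lemma H1_exists:
  assumes "\<And>i. has_weak_derivative u i (v i)"
  shows "\<exists>x. L2_of_H1 x = u \<and> (\<forall>i. weak_derivative i x = v i)"
proof -
  have "L2_of_H1 (Abs_H1 u) = u" using assms by (intro Abs_H1_inverse) auto
  then show ?thesis using assms weak_derivative_eqI by metis
qed

lemma H2_exists:
  assumes "\<And>i. weak_derivative i u = L2_of_H1 (v i)"
  shows "\<exists>x. H1_of_H2 x = u \<and> (\<forall>i. weak_derivative_H2 i x = v i)"
proof -
  have "H1_of_H2 (Abs_H2 u) = u" using assms by (intro Abs_H2_inverse) auto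
  then show ?thesis using assms weak_derivative_H2_eqI by metis
qed

instance H1 :: (finite) banach
proof
  fix X :: "nat \<Rightarrow> 'a H1" assume X: "Cauchy X"
  have "convergent (\<lambda>n. L2_of_H1 (X n))" "convergent (\<lambda>n. weak_derivative i (X n))" for i
    by (auto intro!: Cauchy_convergent bounded_linear.Cauchy[OF _ X]
        bounded_linear_L2_of_H1 bounded_linear_weak_derivative)
  then obtain u v where u: "(\<lambda>n. L2_of_H1 (X n)) \<longlonglongrightarrow> u"
    and v: "\<And>i. (\<lambda>n. weak_derivative i (X n)) \<longlonglongrightarrow> v i"
    unfolding convergent_def by metis
  have "has_weak_derivative u i (v i)" for i
    by (rule has_weak_derivative_closed[OF _ u v])
      (auto intro: always_eventually has_weak_derivative_weak_derivative)
  then obtain x where "L2_of_H1 x = u" "\<And>i. weak_derivative i x = v i"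
    using H1_exists by metis
  then have "X \<longlonglongrightarrow> x" using u v by (simp add: tendsto_H1_iff)
  then show "convergent X" by (rule convergentI)
qed

lemma H1_of_H2_minus: "H1_of_H2 (u - v) = H1_of_H2 u - H1_of_H2 v"
  by (rule minus_H2.rep_eq)

lemma weak_derivative_H2_diff:
  "weak_derivative_H2 i (u - v) = weak_derivative_H2 i u - weak_derivative_H2 i v"
  by (rule weak_derivative_H2_eqI)
    (simp add: L2_of_H1_minus H1_of_H2_minus weak_derivative_diff L2_of_weak_derivative_H2)

lemma norm_weak_derivative_H2_le: "norm (weak_derivative_H2 i u) \<le> norm u"
proof (rule power2_le_imp_le)
  have "(norm (weak_derivative_H2 i u))\<^sup>2 \<le> (\<Sum>i\<in>UNIV. (norm (weak_derivative_H2 i u))\<^sup>2)"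
    by (rule member_le_sum) auto
  then show "(norm (weak_derivative_H2 i u))\<^sup>2 \<le> (norm u)\<^sup>2"
    by (simp add: norm_H2_squared add_increasing)
qed simp

lemma norm_H1_of_H2_le: "norm (H1_of_H2 u) \<le> norm u"
proof (rule power2_le_imp_le)
  have "(norm (weak_derivative i (H1_of_H2 u)))\<^sup>2 \<le> (norm (weak_derivative_H2 i u))\<^sup>2" for i
    using norm_L2_of_H1_le[of "weak_derivative_H2 i u"]
    by (intro power_mono) (auto simp: L2_of_weak_derivative_H2)
  then show "(norm (H1_of_H2 u))\<^sup>2 \<le> (norm u)\<^sup>2"
    by (simp add: norm_H2_squared norm_H1_squared sum_mono)
qed simp

lemma norm_H2_le:
  "norm u \<le> norm (L2_of_H2 u) + (\<Sum>i\<in>UNIV. norm (weak_derivative_H2 i u))"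
proof (rule power2_le_imp_le)
  have "(\<Sum>i\<in>I. (norm (weak_derivative_H2 i u))\<^sup>2) \<le> (\<Sum>i\<in>I. norm (weak_derivative_H2 i u))\<^sup>2" if "finite I" for I
    using that
    by (induction I rule: finite_induct) (auto simp: power2_sum sum_nonneg intro: add_increasing2 add_mono)
  from this[of UNIV] show "(norm u)\<^sup>2 \<le> (norm (L2_of_H2 u) + (\<Sum>i\<in>UNIV. norm (weak_derivative_H2 i u)))\<^sup>2"
    unfolding norm_H2_squared by (simp add: power2_sum sum_nonneg add_increasing2)
qed (simp add: sum_nonneg)

lemma bounded_linear_H1_of_H2: "bounded_linear (H1_of_H2 :: 'n::finite H2 \<Rightarrow> 'n H1)"
  by (rule bounded_linear_intro[where K = 1])
    (auto simp: plus_H2.rep_eq scaleR_H2.rep_eq norm_H1_of_H2_le)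

lemma bounded_linear_weak_derivative_H2: "bounded_linear (weak_derivative_H2 i)"
  by (rule bounded_linear_intro[where K = 1])
    (auto simp: weak_derivative_H2_add weak_derivative_H2_scaleR norm_weak_derivative_H2_le)

lemma bounded_linear_L2_of_H2: "bounded_linear (L2_of_H2 :: 'n::finite H2 \<Rightarrow> 'n L2)"
  using bounded_linear_compose[OF bounded_linear_L2_of_H1 bounded_linear_H1_of_H2] .

lemma bounded_linear_laplacian: "bounded_linear (laplacian :: 'n::finite H2 \<Rightarrow> 'n L2)"
  unfolding laplacian_def[abs_def]
  by (intro bounded_linear_sum bounded_linear_compose[OF bounded_linear_weak_derivative
        bounded_linear_weak_derivative_H2])

lemma tendsto_H2_iff:
  fixes f :: "'b \<Rightarrow> 'n::finite H2"
  shows "(f \<longlongrightarrow> l) F \<longleftrightarrow> ((\<lambda>x. L2_of_H2 (f x)) \<longlongrightarrow> L2_of_H2 l) F \<and>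
    (\<forall>i. ((\<lambda>x. weak_derivative_H2 i (f x)) \<longlongrightarrow> weak_derivative_H2 i l) F)" (is "?l \<longleftrightarrow> ?r")
proof
  assume ?l then show ?r
    by (auto intro: bounded_linear.tendsto[OF bounded_linear_L2_of_H2]
        bounded_linear.tendsto[OF bounded_linear_weak_derivative_H2])
next
  assume r: ?r
  have "((\<lambda>x. norm (L2_of_H2 (f x) - L2_of_H2 l) +
      (\<Sum>i\<in>UNIV. norm (weak_derivative_H2 i (f x) - weak_derivative_H2 i l))) \<longlongrightarrow>
      0 + (\<Sum>i\<in>(UNIV::'n set). 0)) F"
    using r by (intro tendsto_add tendsto_sum) (auto simp: tendsto_norm_zero_iff LIM_zero_iff)
  then have lim: "((\<lambda>x. norm (L2_of_H2 (f x - l)) + (\<Sum>i\<in>UNIV. norm (weak_derivative_H2 i (f x - l)))) \<longlongrightarrow> 0) F"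
    by (simp add: L2_of_H1_minus H1_of_H2_minus weak_derivative_H2_diff)
  have "((\<lambda>x. norm (f x - l)) \<longlongrightarrow> 0) F"
    by (rule tendsto_sandwich[OF _ _ tendsto_const lim]) (auto intro: norm_H2_le always_eventually)
  then show ?l by (simp add: tendsto_norm_zero_iff LIM_zero_iff)
qed

lemma has_vector_derivative_H1_iff:
  fixes f :: "real \<Rightarrow> 'n::finite H1"
  shows "(f has_vector_derivative f') (at t within I) \<longleftrightarrow>
    ((\<lambda>t. L2_of_H1 (f t)) has_vector_derivative L2_of_H1 f') (at t within I) \<and>
    (\<forall>i. ((\<lambda>t. weak_derivative i (f t)) has_vector_derivative weak_derivative i f') (at t within I))"
  unfolding has_vector_derivative_def has_derivative_within
  by (simp add: tendsto_H1_iff bounded_linear_scaleR_left L2_of_H1_minus plus_H1.rep_eq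
    scaleR_H1.rep_eq zero_H1.rep_eq weak_derivative_zero weak_derivative_add weak_derivative_diff
    weak_derivative_scaleR)

lemma has_vector_derivative_H2_iff:
  fixes f :: "real \<Rightarrow> 'n::finite H2"
  shows "(f has_vector_derivative f') (at t within I) \<longleftrightarrow>
    ((\<lambda>t. L2_of_H2 (f t)) has_vector_derivative L2_of_H2 f') (at t within I) \<and>
    (\<forall>i. ((\<lambda>t. weak_derivative_H2 i (f t)) has_vector_derivative weak_derivative_H2 i f') (at t within I))"
  unfolding has_vector_derivative_def has_derivative_within
  by (simp add: tendsto_H2_iff bounded_linear_scaleR_left H1_of_H2_minus L2_of_H1_minus plus_H1.rep_eq
    scaleR_H1.rep_eq zero_H1.rep_eq plus_H2.rep_eq scaleR_H2.rep_eq zero_H2.rep_eq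
    weak_derivative_H2_zero weak_derivative_H2_add weak_derivative_H2_diff weak_derivative_H2_scaleR)

section \<open>Density of the test functions\<close>

lemma norm_add_squared: "(norm (a + b))\<^sup>2 = (norm a)\<^sup>2 + 2 * inner a b + (norm b)\<^sup>2"
  for a b :: "'a::real_inner"
  unfolding power2_norm_eq_inner by (simp add: inner_add_left inner_add_right inner_commute[of b a])

lemma norm_diff_squared: "(norm (a - b))\<^sup>2 = (norm a)\<^sup>2 - 2 * inner a b + (norm b)\<^sup>2"
  for a b :: "'a::real_inner"
  unfolding power2_norm_eq_inner by (simp add: inner_diff_left inner_diff_right inner_commute[of b a])

text \<open>The projection theorem: a minimising sequence for the distance of \<open>x\<close> to
  \<open>S\<close> is Cauchy by the parallelogram law, and at its limit \<open>l\<close> the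
  difference \<open>x - l\<close> is orthogonal to \<open>S\<close>, hence 0.\<close>

lemma closure_subspace_eq_UNIV:
  fixes S :: "'a::{real_inner,complete_space} set"
  assumes S: "subspace S" and orth: "\<And>x. (\<And>y. y \<in> S \<Longrightarrow> inner x y = 0) \<Longrightarrow> x = 0"
  shows "closure S = UNIV"
proof -
  have "x \<in> closure S" for x
  proof -
    have ne: "S \<noteq> {}" using subspace_0[OF S] by auto
    define d where "d = infdist x S"
    have d: "0 \<le> d" "\<And>y. y \<in> S \<Longrightarrow> d \<le> norm (x - y)"
      unfolding d_def using infdist_le[of _ S x] by (simp_all add: infdist_nonneg dist_norm)
    have "\<exists>y\<in>S. norm (x - y) < d + inverse (real (Suc n))" for n
    proof (rule ccontr)
      assume "\<not> (\<exists>y\<in>S. norm (x - y) < d + inverse (real (Suc n)))"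
      then have "d + inverse (real (Suc n)) \<le> (INF y\<in>S. dist x y)"
        using ne by (intro cINF_greatest) (auto simp: dist_norm not_less)
      then show False using ne unfolding d_def infdist_def by simp
    qed
    then obtain y where y: "\<And>n. y n \<in> S" "\<And>n. norm (x - y n) < d + inverse (real (Suc n))"
      by metis
    have lim: "(\<lambda>n. norm (x - y n)) \<longlonglongrightarrow> d"
      by (rule tendsto_sandwich[where f = "\<lambda>_. d" and h = "\<lambda>n. d + inverse (real (Suc n))"])
        (use d y in \<open>auto intro!: always_eventually less_imp_le LIMSEQ_inverse_real_of_nat_add simp del: of_nat_Suc\<close>)
    \<comment> \<open>The midpoint of \<open>y m\<close> and \<open>y n\<close> lies in
      \<open>S\<close> and so has distance at least \<open>d\<close> from \<open>x\<close>; the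
      parallelogram identity converts this into closeness of \<open>y m\<close> and
      \<open>y n\<close>.\<close>
    have par: "(norm (y m - y n))\<^sup>2 \<le> 2 * ((norm (x - y m))\<^sup>2 - d\<^sup>2) + 2 * ((norm (x - y n))\<^sup>2 - d\<^sup>2)" for m n
    proof -
      have "(1/2) *\<^sub>R (y m + y n) \<in> S" using S y by (intro subspace_scale subspace_add)
      then have "d \<le> norm (x - (1/2) *\<^sub>R (y m + y n))" by (rule d)
      then have "d\<^sup>2 \<le> (norm (x - (1/2) *\<^sub>R (y m + y n)))\<^sup>2" using d by (intro power_mono)
      moreover have "(norm (y m - y n))\<^sup>2 + 4 * (norm (x - (1/2) *\<^sub>R (y m + y n)))\<^sup>2
          = 2 * (norm (x - y m))\<^sup>2 + 2 * (norm (x - y n))\<^sup>2"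
      proof -
        have "y m - y n = (x - y n) - (x - y m)" by simp
        moreover have "(x - y n) + (x - y m) = 2 *\<^sub>R (x - (1/2) *\<^sub>R (y m + y n))"
          by (simp add: scaleR_diff_right scaleR_2)
        then have "4 * (norm (x - (1/2) *\<^sub>R (y m + y n)))\<^sup>2 = (norm ((x - y n) + (x - y m)))\<^sup>2"
          by (simp add: power_mult_distrib)
        moreover have "(norm ((x - y n) - (x - y m)))\<^sup>2 + (norm ((x - y n) + (x - y m)))\<^sup>2
            = 2 * (norm (x - y m))\<^sup>2 + 2 * (norm (x - y n))\<^sup>2"
          unfolding norm_diff_squared[of "x - y n" "x - y m"] norm_add_squared[of "x - y n" "x - y m"] by simp
        ultimately show ?thesis by (simp only:)
      qed
      ultimately show ?thesis by simp
    qed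
    have "Cauchy y"
    proof (rule metric_CauchyI)
      fix e :: real assume e: "e > 0"
      have "(\<lambda>n. (norm (x - y n))\<^sup>2 - d\<^sup>2) \<longlonglongrightarrow> d\<^sup>2 - d\<^sup>2" by (intro tendsto_intros lim)
      then have "\<forall>\<^sub>F n in sequentially. (norm (x - y n))\<^sup>2 - d\<^sup>2 < e\<^sup>2 / 4"
        using e by (intro order_tendstoD(2)) auto
      then obtain N where N: "\<And>n. n \<ge> N \<Longrightarrow> (norm (x - y n))\<^sup>2 - d\<^sup>2 < e\<^sup>2 / 4"
        by (auto simp: eventually_sequentially)
      have "dist (y m) (y n) < e" if "m \<ge> N" "n \<ge> N" for m n
      proof -
        note par[of m n]
        also have "2 * ((norm (x - y m))\<^sup>2 - d\<^sup>2) + 2 * ((norm (x - y n))\<^sup>2 - d\<^sup>2) < 2 * (e\<^sup>2 / 4) + 2 * (e\<^sup>2 / 4)"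
          using N that by (intro add_strict_mono mult_strict_left_mono) auto
        finally have "(norm (y m - y n))\<^sup>2 < e\<^sup>2" by simp
        then show ?thesis using e unfolding dist_norm by (intro power2_less_imp_less[of _ e]) auto
      qed
      then show "\<exists>M. \<forall>m\<ge>M. \<forall>n\<ge>M. dist (y m) (y n) < e" by blast
    qed
    then obtain l where l: "y \<longlonglongrightarrow> l" using Cauchy_convergent convergent_def by blast
    have "(\<lambda>n. norm (x - y n)) \<longlonglongrightarrow> norm (x - l)" by (intro tendsto_intros l)
    then have dl: "norm (x - l) = d" using lim LIMSEQ_unique by blast
    have "inner (x - l) s = 0" if s: "s \<in> S" for s
    proof (rule ccontr)
      assume ns: "inner (x - l) s \<noteq> 0"
      then have s0: "inner s s > 0" by auto
      \<comment> \<open>This \<open>t\<close> minimises the distance from \<open>x\<close> to the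
        line through \<open>l\<close> in direction \<open>s\<close>; a nonzero inner product would
        push it below \<open>d\<close>.\<close>
      define t where "t = inner (x - l) s / inner s s"
      have lim_t: "(\<lambda>n. norm (x - (y n + t *\<^sub>R s))) \<longlonglongrightarrow> norm (x - (l + t *\<^sub>R s))"
        by (intro tendsto_intros l)
      have "d \<le> norm (x - (y n + t *\<^sub>R s))" for n
        by (intro d(2) subspace_add[OF S] subspace_scale[OF S] s y)
      then have "d \<le> norm (x - (l + t *\<^sub>R s))"
        using LIMSEQ_le_const[OF lim_t, of d] by simp
      then have "(norm (x - l))\<^sup>2 \<le> (norm (x - (l + t *\<^sub>R s)))\<^sup>2"
        unfolding dl using d by (intro power_mono)
      also have "\<dots> = (norm ((x - l) - t *\<^sub>R s))\<^sup>2" by (simp only: diff_diff_eq)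
      also have "\<dots> = (norm (x - l))\<^sup>2 - 2 * t * inner (x - l) s + t * t * inner s s"
        by (simp only: norm_diff_squared norm_scaleR power_mult_distrib power2_abs
            power2_norm_eq_inner[of s] inner_scaleR_right power2_eq_square[of t] mult.assoc)
      also have "\<dots> = (norm (x - l))\<^sup>2 - (inner (x - l) s)\<^sup>2 / inner s s"
        using s0 by (simp add: t_def power2_eq_square field_simps)
      finally have "(inner (x - l) s)\<^sup>2 / inner s s \<le> 0" by simp
      then show False using s0 ns by (simp add: divide_le_0_iff)
    qed
    then have "x = l" using orth[of "x - l"] by simp
    then show ?thesis using l y unfolding closure_sequential by blast
  qed
  then show ?thesis by auto
qed

lemma abs_L2_add: "square_integrable f \<Longrightarrow> square_integrable g \<Longrightarrow>
    abs_L2 f + abs_L2 g = abs_L2 (\<lambda>x. f x + g x)"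
  by (rule plus_L2.abs_eq) (auto simp: L2_rel_def)

lemma abs_L2_diff: "square_integrable f \<Longrightarrow> square_integrable g \<Longrightarrow>
    abs_L2 f - abs_L2 g = abs_L2 (\<lambda>x. f x - g x)"
  by (rule minus_L2.abs_eq) (auto simp: L2_rel_def)

lemma abs_L2_scaleR: "square_integrable f \<Longrightarrow> c *\<^sub>R abs_L2 f = abs_L2 (\<lambda>x. c * f x)"
  by (rule scaleR_L2.abs_eq) (auto simp: L2_rel_def)

section \<open>Test functions as a dense subspace of L2\<close>

lemma compact_closureI:
  fixes A :: "'a::heine_borel set"
  assumes "compact K" "closure A \<subseteq> K" shows "compact (closure A)"
  unfolding compact_eq_bounded_closed
  using bounded_subset[OF compact_imp_bounded[OF assms(1)] assms(2)] by (rule conjI) (rule closed_closure)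

lemma test_function_add:
  assumes "test_function f" "test_function g" shows "test_function (\<lambda>x. f x + g x)"
proof -
  have "closure {x. f x + g x \<noteq> 0} \<subseteq> closure ({x. f x \<noteq> 0} \<union> {x. g x \<noteq> 0})"
    by (intro closure_mono) auto
  then have "closure {x. f x + g x \<noteq> 0} \<subseteq> closure {x. f x \<noteq> 0} \<union> closure {x. g x \<noteq> 0}"
    by simp
  moreover have "compact (closure {x. f x \<noteq> 0} \<union> closure {x. g x \<noteq> 0})"
    using assms unfolding test_function_def by (intro compact_Un) auto
  ultimately have "compact (closure {x. f x + g x \<noteq> 0})"
    by (rule compact_closureI[rotated])
  then show ?thesis
    using assms unfolding test_function_def by (auto intro!: Ck_add)
qed

lemma test_function_scale:
  assumes "test_function f" shows "test_function (\<lambda>x. c * f x)"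
proof -
  have "closure {x. c * f x \<noteq> 0} \<subseteq> closure {x. f x \<noteq> 0}"
    by (intro closure_mono) auto
  then have "compact (closure {x. c * f x \<noteq> 0})"
    using assms unfolding test_function_def by (elim conjE compact_closureI)
  then show ?thesis
    using assms unfolding test_function_def by (auto intro!: Ck_mult Ck_const)
qed

text \<open>By the projection criterion this is the fundamental lemma of the calculus of variations:
  only 0 is orthogonal to every test function.\<close>

lemma test_functions_dense: "closure (abs_L2 ` Collect test_function :: 'n::finite L2 set) = UNIV"
proof (rule closure_subspace_eq_UNIV)
  show "subspace (abs_L2 ` Collect test_function :: 'n L2 set)"
  proof (rule subspaceI)
    have "test_function (\<lambda>x :: real ^ 'n. 0)"
      by (auto simp: test_function_def intro: Ck_const)
    then show "0 \<in> (abs_L2 ` Collect test_function :: 'n L2 set)"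
      unfolding zero_L2_def by blast
    show "x + y \<in> (abs_L2 ` Collect test_function :: 'n L2 set)"
      if xy: "x \<in> (abs_L2 ` Collect test_function :: 'n L2 set)"
        "y \<in> (abs_L2 ` Collect test_function :: 'n L2 set)" for x y
    proof -
      obtain f g :: "real ^ 'n \<Rightarrow> real" where "x = abs_L2 f" "y = abs_L2 g" "test_function f" "test_function g"
        using xy by blast
      then have "x + y = abs_L2 (\<lambda>x. f x + g x)" "test_function (\<lambda>x. f x + g x)"
        by (auto intro: abs_L2_add test_function_square_integrable test_function_add)
      then show ?thesis by blast
    qed
    show "c *\<^sub>R x \<in> (abs_L2 ` Collect test_function :: 'n L2 set)"
      if x: "x \<in> (abs_L2 ` Collect test_function :: 'n L2 set)" for c x
    proof -
      obtain f :: "real ^ 'n \<Rightarrow> real" where "x = abs_L2 f" "test_function f"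
        using x by blast
      then have "c *\<^sub>R x = abs_L2 (\<lambda>x. c * f x)" "test_function (\<lambda>x. c * f x)"
        by (auto intro: abs_L2_scaleR test_function_square_integrable test_function_scale)
      then show ?thesis by blast
    qed
  qed
  show "x = 0" if "\<And>y. y \<in> (abs_L2 ` Collect test_function :: 'n L2 set) \<Longrightarrow> inner x y = 0" for x
    by (rule L2_eq_test_functionI) (use that in auto)
qed

lemma test_function_pderivative:
  assumes "test_function \<phi>" shows "test_function (pderivative i \<phi>)"
proof -
  have "closure {x. pderivative i \<phi> x \<noteq> 0} \<subseteq> closure {x. \<phi> x \<noteq> 0}"
    using pderivative_zero by (intro closure_minimal) auto
  then have "compact (closure {x. pderivative i \<phi> x \<noteq> 0})"
    using assms unfolding test_function_def by (elim conjE compact_closureI)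
  moreover have "Ck k (pderivative i \<phi>)" for k
    using assms unfolding test_function_def by (metis Ck.simps(2))
  ultimately show ?thesis by (simp add: test_function_def)
qed

lemma test_function_bounded:
  assumes "test_function \<phi>"
  shows "\<exists>M R. (\<forall>x. \<bar>\<phi> x\<bar> \<le> M) \<and> (\<forall>x. R < norm x \<longrightarrow> \<phi> x = 0)"
proof -
  let ?K = "closure {x. \<phi> x \<noteq> 0}"
  have K: "compact ?K" and c: "continuous_on UNIV \<phi>"
    using assms Ck_continuous unfolding test_function_def by auto
  have 0: "\<phi> x = 0" if "x \<notin> ?K" for x
    using that closure_subset[of "{x. \<phi> x \<noteq> 0}"] by auto
  have "bounded (\<phi> ` ?K)"
    using K c by (intro compact_imp_bounded compact_continuous_image) (auto intro: continuous_on_subset)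
  then obtain M where M: "\<And>x. x \<in> ?K \<Longrightarrow> \<bar>\<phi> x\<bar> \<le> M" by (auto simp: bounded_iff)
  obtain R where R: "\<And>x. x \<in> ?K \<Longrightarrow> norm x \<le> R" using compact_imp_bounded[OF K] by (auto simp: bounded_iff)
  have "\<bar>\<phi> x\<bar> \<le> max M 0" for x using M[of x] 0[of x] by (cases "x \<in> ?K") auto
  moreover have "R < norm x \<Longrightarrow> \<phi> x = 0" for x using R[of x] 0[of x] by force
  ultimately show ?thesis by blast
qed

lemma test_function_directional_derivative:
  assumes "test_function \<phi>"
  shows "((\<lambda>t. \<phi> (x + t *\<^sub>R axis i 1)) has_real_derivative pderivative i \<phi> (x + t *\<^sub>R axis i 1)) (at t)"
proof -
  have "Ck (Suc 0) \<phi>" using assms unfolding test_function_def by blast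
  then have d: "(\<phi> has_derivative frechet_derivative \<phi> (at z)) (at z)" for z
    by (simp add: frechet_derivative_works)
  have "((\<lambda>t. x + t *\<^sub>R axis i 1) has_derivative (\<lambda>h. h *\<^sub>R axis i 1)) (at t)"
    by (auto intro!: derivative_eq_intros)
  from has_derivative_compose[OF this d]
  have "((\<lambda>t. \<phi> (x + t *\<^sub>R axis i 1)) has_derivative
      (\<lambda>h. frechet_derivative \<phi> (at (x + t *\<^sub>R axis i 1)) (h *\<^sub>R axis i 1))) (at t)" .
  moreover have "frechet_derivative \<phi> (at z) (h *\<^sub>R axis i 1) = pderivative i \<phi> z * h" for z h
    using linear_scale[OF has_derivative_linear[OF d]] by (simp add: pderivative_def)
  ultimately show ?thesis by (simp add: has_field_derivative_def)
qed

section \<open>The translation groups\<close>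

lemma AE_lborel_translate:
  fixes y :: "'a::euclidean_space"
  assumes "AE x in lborel. P x" shows "AE x in lborel. P (x + y)"
proof -
  have "AE x in distr lborel borel ((+) y). P x" using assms unfolding lborel_distr_plus .
  then have "AE x in lborel. P (y + x)" by (rule AE_distrD[rotated]) simp
  then show ?thesis by (simp add: add.commute)
qed

lemma integrable_lborel_translate:
  fixes y :: "'a::euclidean_space" and f :: "'a \<Rightarrow> real"
  assumes "integrable lborel f" shows "integrable lborel (\<lambda>x. f (x + y))"
proof -
  have "integrable (distr lborel borel ((+) y)) f" using assms unfolding lborel_distr_plus .
  then have "integrable lborel (\<lambda>x. f (y + x))" by (rule integrable_distr[rotated]) simp
  then show ?thesis by (simp add: add.commute)
qed

lemma integral_lborel_translate:
  fixes y :: "'a::euclidean_space" and f :: "'a \<Rightarrow> real"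
  assumes "f \<in> borel_measurable borel" shows "(LINT x|lborel. f (x + y)) = (LINT x|lborel. f x)"
proof -
  have "(LINT x|lborel. f x) = (LINT x|distr lborel borel ((+) y). f x)" unfolding lborel_distr_plus ..
  also have "\<dots> = (LINT x|lborel. f (y + x))" using assms by (intro integral_distr) auto
  finally show ?thesis by (simp add: add.commute)
qed

lemma square_integrable_translate:
  fixes y :: "real ^ 'n"
  assumes "square_integrable f" shows "square_integrable (\<lambda>x. f (x + y))"
  using assms integrable_lborel_translate[of "\<lambda>x. (f x)\<^sup>2" y] by (auto simp: square_integrable_def)

lift_definition translate :: "real ^ 'n \<Rightarrow> 'n::finite L2 \<Rightarrow> 'n L2" is "\<lambda>y f x. f (x + y)"
  unfolding L2_rel_def by (intro conjI square_integrable_translate AE_lborel_translate) auto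

lemma translate_abs_L2: "square_integrable f \<Longrightarrow> translate y (abs_L2 f) = abs_L2 (\<lambda>x. f (x + y))"
  by (rule translate.abs_eq) (auto simp: L2_rel_def)

lemma inner_translate_translate: "inner (translate y f) (translate y g) = inner f g"
  by transfer (rule integral_lborel_translate, auto simp: L2_rel_def square_integrable_def)

lemma norm_translate [simp]: "norm (translate y f) = norm f"
  by (simp add: norm_eq_sqrt_inner inner_translate_translate)

lemma translate_add: "translate y (f + g) = translate y f + translate y g"
  by transfer (auto simp: L2_rel_def intro!: square_integrable_add square_integrable_translate)

lemma translate_scaleR: "translate y (c *\<^sub>R f) = c *\<^sub>R translate y f"
  by transfer (auto simp: L2_rel_def intro!: square_integrable_scale square_integrable_translate)

lemma translate_translate: "translate y (translate z f) = translate (y + z) f"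
  by transfer (auto simp: L2_rel_def add.assoc square_integrable_translate)

lemma translate_0 [simp]: "translate 0 f = f"
  by transfer (auto simp: L2_rel_def)

lemma bounded_linear_translate: "bounded_linear (translate y)"
  by (rule bounded_linear_intro[where K = 1]) (auto simp: translate_add translate_scaleR)

lemma translate_diff: "translate y (f - g) = translate y f - translate y g"
  by (rule linear_diff[OF bounded_linear.linear[OF bounded_linear_translate]])

lemma inner_translate: "inner (translate y f) g = inner f (translate (- y) g)"
  using inner_translate_translate[of y f "translate (- y) g"] by (simp add: translate_translate)

lemma test_function_translate:
  assumes "test_function \<phi>"
  shows "test_function (\<lambda>x. \<phi> (x + y))" "pderivative i (\<lambda>x. \<phi> (x + y)) = (\<lambda>x. pderivative i \<phi> (x + y))"
proof -
  have hd: "((\<lambda>x. f (x + y)) has_derivative frechet_derivative f (at (x + y))) (at x)"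
    if "\<forall>x. f differentiable (at x)" for f :: "real ^ 'a \<Rightarrow> real" and x
  proof -
    have 1: "((\<lambda>x. x + y) has_derivative (\<lambda>h. h)) (at x)" by (auto intro!: derivative_eq_intros)
    have 2: "(f has_derivative frechet_derivative f (at (x + y))) (at (x + y))"
      using that by (simp add: frechet_derivative_works)
    show ?thesis by (rule has_derivative_compose[OF 1 2])
  qed
  have pd: "pderivative i (\<lambda>x. f (x + y)) x = pderivative i f (x + y)"
    if "\<forall>x. f differentiable (at x)" for f :: "real ^ 'a \<Rightarrow> real" and i x
    using pderivative_eqI[OF hd[OF that]] by (simp only: pderivative_def)
  have ck: "Ck k f \<Longrightarrow> Ck k (\<lambda>x. f (x + y))" for k and f :: "real ^ 'a \<Rightarrow> real"
  proof (induction k arbitrary: f)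
    case 0
    then have f: "continuous_on UNIV f" by simp
    have "continuous_on UNIV (\<lambda>x. f (x + y))"
      by (rule continuous_on_compose2[OF f]) (intro continuous_intros, rule subset_UNIV)
    then show ?case by (simp only: Ck.simps)
  next
    case (Suc k)
    have "(\<lambda>x. f (x + y)) differentiable (at x)" for x
      by (rule differentiableI[OF hd]) (use Suc.prems in simp)
    moreover have "Ck k (pderivative i (\<lambda>x. f (x + y)))" for i
      by (subst ext[OF pd]) (use Suc in simp_all)
    ultimately show ?case by simp
  qed
  have "Ck (Suc 0) \<phi>" using assms unfolding test_function_def by blast
  then show "pderivative i (\<lambda>x. \<phi> (x + y)) = (\<lambda>x. pderivative i \<phi> (x + y))"
    by (intro ext pd) simp
  have "{x. \<phi> (x + y) \<noteq> 0} \<subseteq> (+) (- y) ` closure {x. \<phi> x \<noteq> 0}"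
  proof
    fix x assume "x \<in> {x. \<phi> (x + y) \<noteq> 0}"
    then have "x + y \<in> closure {x. \<phi> x \<noteq> 0}" by (intro subsetD[OF closure_subset]) simp
    then show "x \<in> (+) (- y) ` closure {x. \<phi> x \<noteq> 0}" by (intro image_eqI[of _ _ "x + y"]) auto
  qed
  moreover have K: "compact ((+) (- y) ` closure {x. \<phi> x \<noteq> 0})"
    using assms unfolding test_function_def by (intro compact_translation) auto
  ultimately have "compact (closure {x. \<phi> (x + y) \<noteq> 0})"
    unfolding compact_closure using bounded_subset[OF compact_imp_bounded[OF K]] by blast
  then show "test_function (\<lambda>x. \<phi> (x + y))"
    using assms ck unfolding test_function_def by blast
qed

text \<open>Dominated convergence of the squared differences, with the square of
  \<open>2 * M\<close> on the ball of radius \<open>R\<close> as majorant. It serves translates and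
  difference quotients of test functions, whose supports stay in a common ball.\<close>

lemma abs_L2_tendstoI:
  fixes f :: "nat \<Rightarrow> real ^ 'n::finite \<Rightarrow> real"
  assumes f: "\<And>k. square_integrable (f k)" and g: "square_integrable g"
    and lim: "\<And>x. (\<lambda>k. f k x) \<longlonglongrightarrow> g x"
    and M: "\<And>k x. \<bar>f k x\<bar> \<le> M" and R: "\<And>k x. R < norm x \<Longrightarrow> f k x = 0"
  shows "(\<lambda>k. abs_L2 (f k)) \<longlonglongrightarrow> abs_L2 g"
proof -
  note [measurable] = square_integrable_meas[OF f] square_integrable_meas[OF g]
  have gM: "\<bar>g x\<bar> \<le> M" for x
    by (rule LIMSEQ_le_const2[OF tendsto_rabs[OF lim]]) (use M in auto)
  have gR: "g x = 0" if "R < norm x" for x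
    using lim[of x] R[OF that] by (simp add: LIMSEQ_const_iff)
  have M0: "0 \<le> M" using M[of 0 0] by linarith
  have "(\<lambda>k. LINT x|lborel. (f k x - g x)\<^sup>2) \<longlonglongrightarrow> (LINT x::real^'n|lborel. 0)"
  proof (rule integral_dominated_convergence[where w = "\<lambda>x. (2 * M)\<^sup>2 * indicator (cball 0 R) x"])
    show "integrable lborel (\<lambda>x :: real ^ 'n. (2 * M)\<^sup>2 * indicator (cball 0 R) x :: real)"
      using emeasure_bounded_finite[OF bounded_cball[of "0 :: real ^ 'n" R]]
      by (intro integrable_mult_right integrable_real_indicator) auto
    show "AE x in lborel. (\<lambda>k. (f k x - g x)\<^sup>2) \<longlonglongrightarrow> 0"
    proof (rule AE_I2)
      fix x
      have "(\<lambda>k. (f k x - g x)\<^sup>2) \<longlonglongrightarrow> (g x - g x)\<^sup>2" by (intro tendsto_intros lim)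
      then show "(\<lambda>k. (f k x - g x)\<^sup>2) \<longlonglongrightarrow> 0" by simp
    qed
    show "AE x in lborel. norm ((f k x - g x)\<^sup>2) \<le> (2 * M)\<^sup>2 * indicator (cball 0 R) x" for k
    proof (rule AE_I2)
      fix x
      have "\<bar>f k x - g x\<bar> \<le> 2 * M" using M[of k x] gM[of x] by linarith
      then have "\<bar>f k x - g x\<bar>\<^sup>2 \<le> (2 * M)\<^sup>2" by (intro power_mono) auto
      then show "norm ((f k x - g x)\<^sup>2) \<le> (2 * M)\<^sup>2 * indicator (cball 0 R) x"
        using R[of x k] gR[of x] by (cases "norm x \<le> R") auto
    qed
  qed simp_all
  moreover have "(LINT x|lborel. (f k x - g x)\<^sup>2) = (norm (abs_L2 (f k) - abs_L2 g))\<^sup>2" for k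
    using f g by (simp add: abs_L2_diff norm_abs_L2_squared square_integrable_diff)
  ultimately have "(\<lambda>k. (norm (abs_L2 (f k) - abs_L2 g))\<^sup>2) \<longlonglongrightarrow> 0" by simp
  then have "(\<lambda>k. sqrt ((norm (abs_L2 (f k) - abs_L2 g))\<^sup>2)) \<longlonglongrightarrow> sqrt 0"
    by (rule tendsto_real_sqrt)
  then show ?thesis by (simp add: tendsto_norm_zero_iff LIM_zero_iff)
qed

lemma translate_test_function_tendsto:
  assumes "test_function \<phi>"
  shows "((\<lambda>y. translate y (abs_L2 \<phi>)) \<longlongrightarrow> abs_L2 \<phi>) (at 0)"
  unfolding tendsto_at_iff_sequentially
proof (intro allI impI)
  fix X :: "nat \<Rightarrow> real ^ 'a" assume X: "X \<longlonglongrightarrow> 0"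
  obtain M R where M: "\<And>x. \<bar>\<phi> x\<bar> \<le> M" and R: "\<And>x. R < norm x \<Longrightarrow> \<phi> x = 0"
    using test_function_bounded[OF assms] by metis
  obtain B where B: "\<And>k. norm (X k) \<le> B"
    using convergent_imp_Bseq[OF convergentI[OF X]] by (auto simp: Bseq_def)
  have si: "square_integrable \<phi>" using assms by (rule test_function_square_integrable)
  have "(\<lambda>k. abs_L2 (\<lambda>x. \<phi> (x + X k))) \<longlonglongrightarrow> abs_L2 \<phi>"
  proof (rule abs_L2_tendstoI)
    show "(\<lambda>k. \<phi> (x + X k)) \<longlonglongrightarrow> \<phi> x" for x
    proof -
      have "isCont \<phi> x" using assms Ck_continuous unfolding test_function_def
        by (metis UNIV_I continuous_on_eq_continuous_at open_UNIV)
      moreover have "(\<lambda>k. x + X k) \<longlonglongrightarrow> x + 0" by (intro tendsto_intros X)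
      ultimately show ?thesis by (intro isCont_tendsto_compose[of x \<phi>]) auto
    qed
    show "\<phi> (x + X k) = 0" if "R + B < norm x" for k x
      using R[of "x + X k"] B[of k] that norm_triangle_ineq4[of "x + X k" "X k"] by simp
  qed (use si M square_integrable_translate in auto)
  then show "((\<lambda>y. translate y (abs_L2 \<phi>)) \<circ> X) \<longlonglongrightarrow> abs_L2 \<phi>"
    by (simp add: comp_def translate_abs_L2 si)
qed

text \<open>A three-epsilon argument: test functions are dense, and translations are isometries, so
  the approximation error does not grow.\<close>

lemma translate_tendsto: "((\<lambda>y. translate y f) \<longlongrightarrow> f) (at 0)"
proof (rule metric_LIM_I)
  fix e :: real assume e: "e > 0"
  have "f \<in> closure (abs_L2 ` Collect test_function)" unfolding test_functions_dense by (rule UNIV_I)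
  then have "\<exists>g\<in>abs_L2 ` Collect test_function. dist g f < e / 3"
    using e unfolding closure_approachable by (elim allE[of _ "e / 3"]) simp
  then obtain \<phi> where \<phi>: "test_function \<phi>" and g: "dist (abs_L2 \<phi>) f < e / 3" by auto
  let ?g = "abs_L2 \<phi>"
  have "\<forall>\<^sub>F y in at 0. dist (translate y ?g) ?g < e / 3"
    using e by (intro tendstoD[OF translate_test_function_tendsto[OF \<phi>]]) simp
  then obtain r where r: "r > 0" "\<And>y. y \<noteq> 0 \<Longrightarrow> dist y 0 < r \<Longrightarrow> dist (translate y ?g) ?g < e / 3"
    unfolding eventually_at by auto
  have "dist (translate y f) f < e" if "y \<noteq> 0" "dist y 0 < r" for y
  proof -
    have "dist (translate y f) (translate y ?g) = dist ?g f"
      unfolding dist_norm translate_diff[symmetric] norm_translate by (rule norm_minus_commute)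
    then show ?thesis
      using r(2)[OF that] g dist_triangle[of "translate y f" f "translate y ?g"]
        dist_triangle[of "translate y ?g" f ?g] by linarith
  qed
  then show "\<exists>r>0. \<forall>y. y \<noteq> 0 \<and> dist y 0 < r \<longrightarrow> dist (translate y f) f < e"
    using r(1) by (intro exI[of _ r]) simp
qed

lemma continuous_on_translate: "continuous_on S (\<lambda>y. translate y f)"
proof (intro continuous_at_imp_continuous_on ballI)
  fix y
  show "isCont (\<lambda>y. translate y f) y"
    unfolding isCont_iff using translate_tendsto[of "translate y f"]
    unfolding translate_translate add.commute[of _ y] .
qed

text \<open>A strongly continuous group of isometries whose generator is the weak derivative in
  direction \<open>i\<close>.\<close>

definition shift :: "'n \<Rightarrow> real \<Rightarrow> 'n::finite L2 \<Rightarrow> 'n L2" where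
  "shift i h = translate (h *\<^sub>R axis i 1)"

lemma norm_shift [simp]: "norm (shift i h f) = norm f"
  by (simp add: shift_def)

lemma shift_0 [simp]: "shift i 0 f = f"
  by (simp add: shift_def)

lemma shift_shift: "shift i s (shift i t f) = shift i (s + t) f"
  by (simp add: shift_def translate_translate scaleR_left_distrib)

lemma shift_commute: "shift i s (shift j t f) = shift j t (shift i s f)"
  by (simp add: shift_def translate_translate add.commute)

lemma bounded_linear_shift: "bounded_linear (shift i h)"
  by (simp add: shift_def bounded_linear_translate)

lemma shift_diff: "shift i h (f - g) = shift i h f - shift i h g"
  by (simp add: shift_def translate_diff)

lemma shift_scaleR: "shift i h (c *\<^sub>R f) = c *\<^sub>R shift i h f"
  by (simp add: shift_def translate_scaleR)

lemma shift_add: "shift i h (f + g) = shift i h f + shift i h g"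
  by (simp add: shift_def translate_add)

lemma inner_shift: "inner (shift i h f) g = inner f (shift i (- h) g)"
  by (simp add: shift_def inner_translate)

lemma continuous_on_shift: "continuous_on S (\<lambda>h. shift i h f)"
  unfolding shift_def
  by (rule continuous_on_compose2[OF continuous_on_translate[of UNIV]]) (auto intro!: continuous_intros)

text \<open>Isometry makes strong continuity joint: the error splits into that of \<open>g\<close>
  and that of shifting the fixed limit \<open>f\<close>.\<close>

lemma shift_tendsto:
  assumes "(g \<longlongrightarrow> f) F" "(h \<longlongrightarrow> 0) F" shows "((\<lambda>x. shift i (h x) (g x)) \<longlongrightarrow> f) F"
proof -
  have "((\<lambda>x. shift i (h x) f) \<longlongrightarrow> shift i 0 f) F"
    by (rule continuous_on_tendsto_compose[OF continuous_on_shift[of UNIV] assms(2)]) auto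
  then have "((\<lambda>x. norm (g x - f) + norm (shift i (h x) f - f)) \<longlongrightarrow> 0 + 0) F"
    using assms(1) by (intro tendsto_add) (auto simp: tendsto_norm_zero_iff LIM_zero_iff)
  then have lim: "((\<lambda>x. norm (g x - f) + norm (shift i (h x) f - f)) \<longlongrightarrow> 0) F" by simp
  have "norm (shift i (h x) (g x) - f) \<le> norm (g x - f) + norm (shift i (h x) f - f)" for x
  proof -
    have "shift i (h x) (g x) - f = shift i (h x) (g x - f) + (shift i (h x) f - f)"
      by (simp add: shift_diff)
    also have "norm \<dots> \<le> norm (shift i (h x) (g x - f)) + norm (shift i (h x) f - f)"
      by (rule norm_triangle_ineq)
    finally show ?thesis by simp
  qed
  then have "((\<lambda>x. norm (shift i (h x) (g x) - f)) \<longlongrightarrow> 0) F"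
    by (intro tendsto_sandwich[OF _ _ tendsto_const lim]) (auto intro: always_eventually)
  then show ?thesis by (simp add: tendsto_norm_zero_iff LIM_zero_iff)
qed

lemma shift_abs_L2: "square_integrable f \<Longrightarrow> shift i h (abs_L2 f) = abs_L2 (\<lambda>x. f (x + h *\<^sub>R axis i 1))"
  by (simp add: shift_def translate_abs_L2)

text \<open>The mean value theorem bounds the difference quotients by a bound of the partial
  derivative, and along a null sequence of steps their supports stay in a fixed ball; so pointwise
  convergence suffices.\<close>

lemma shift_test_function_difference_quotient:
  fixes \<phi> :: "real ^ 'n::finite \<Rightarrow> real"
  assumes \<phi>: "test_function \<phi>"
  shows "((\<lambda>h. (1 / h) *\<^sub>R (shift i h (abs_L2 \<phi>) - abs_L2 \<phi>)) \<longlongrightarrow> abs_L2 (pderivative i \<phi>)) (at 0)"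
  unfolding tendsto_at_iff_sequentially
proof (intro allI impI)
  fix X :: "nat \<Rightarrow> real" assume X0: "\<forall>k. X k \<in> UNIV - {0}" and X: "X \<longlonglongrightarrow> 0"
  have nz: "X k \<noteq> 0" for k using X0 by auto
  obtain M where M: "\<And>x. \<bar>pderivative i \<phi> x\<bar> \<le> M"
    using test_function_bounded[OF test_function_pderivative[OF \<phi>, of i]] by metis
  obtain R where R: "\<And>x. R < norm x \<Longrightarrow> \<phi> x = 0"
    using test_function_bounded[OF \<phi>] by metis
  obtain B where B: "\<And>k. \<bar>X k\<bar> \<le> B"
    using convergent_imp_Bseq[OF convergentI[OF X]] by (auto simp: Bseq_def)
  have si: "square_integrable \<phi>" "square_integrable (pderivative i \<phi>)"
    using \<phi> by (auto intro: test_function_square_integrable)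
  let ?f = "\<lambda>k x. (1 / X k) * (\<phi> (x + X k *\<^sub>R axis i 1) - \<phi> x)"
  have sf: "square_integrable (?f k)" for k
    by (intro square_integrable_scale square_integrable_diff square_integrable_translate si)
  have "(\<lambda>k. abs_L2 (?f k)) \<longlonglongrightarrow> abs_L2 (pderivative i \<phi>)"
  proof (rule abs_L2_tendstoI[OF sf si(2)])
    fix x :: "real ^ 'n"
    note d = test_function_directional_derivative[OF \<phi>, of x i]
    show "(\<lambda>k. ?f k x) \<longlonglongrightarrow> pderivative i \<phi> x"
    proof -
      have "((\<lambda>h. (\<phi> (x + h *\<^sub>R axis i 1) - \<phi> x) / h) \<longlongrightarrow> pderivative i \<phi> x) (at 0)"
        using d[of 0] by (simp add: DERIV_def)
      then have "((\<lambda>h. (\<phi> (x + h *\<^sub>R axis i 1) - \<phi> x) / h) \<circ> X) \<longlonglongrightarrow> pderivative i \<phi> x"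
        using X nz unfolding tendsto_at_iff_sequentially by blast
      then show ?thesis by (simp add: comp_def)
    qed
    fix k
    show "\<bar>?f k x\<bar> \<le> M"
    proof -
      have "norm (\<phi> (x + X k *\<^sub>R axis i 1) - \<phi> (x + 0 *\<^sub>R axis i 1)) \<le> M * norm (X k - 0)"
        by (rule field_differentiable_bound[where S = UNIV and f' = "\<lambda>t. pderivative i \<phi> (x + t *\<^sub>R axis i 1)"])
          (use d M in \<open>auto\<close>)
      then show ?thesis using nz[of k] by (simp add: abs_mult divide_le_eq)
    qed
  next
    fix k and x :: "real ^ 'n" assume x: "R + B < norm x"
    have "norm (X k *\<^sub>R axis i (1::real) :: real ^ 'n) \<le> B" using B[of k] by simp
    then have "R < norm (x + X k *\<^sub>R axis i 1)"
      using x norm_triangle_ineq4[of "x + X k *\<^sub>R axis i 1" "X k *\<^sub>R axis i 1"] by simp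
    moreover have "R < norm x" using x B[of k] by linarith
    ultimately show "?f k x = 0" using R by simp
  qed
  then show "((\<lambda>h. (1 / h) *\<^sub>R (shift i h (abs_L2 \<phi>) - abs_L2 \<phi>)) \<circ> X) \<longlonglongrightarrow> abs_L2 (pderivative i \<phi>)"
    by (simp add: comp_def shift_abs_L2 si abs_L2_diff square_integrable_translate abs_L2_scaleR
        square_integrable_diff)
qed

lemma shift_test_function_has_vector_derivative:
  assumes "test_function \<phi>"
  shows "((\<lambda>h. shift i h (abs_L2 \<phi>)) has_vector_derivative shift i t (abs_L2 (pderivative i \<phi>))) (at t)"
  unfolding has_vector_derivative_def has_derivative_at
proof (intro conjI bounded_linear_scaleR_left)
  let ?\<phi> = "abs_L2 \<phi>" and ?d = "abs_L2 (pderivative i \<phi>)"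
  have eq: "norm (shift i (t + h) ?\<phi> - shift i t ?\<phi> - h *\<^sub>R shift i t ?d) / norm h
      = norm ((1 / h) *\<^sub>R (shift i h ?\<phi> - ?\<phi>) - ?d)" if "h \<noteq> 0" for h
  proof -
    have "shift i (t + h) ?\<phi> - shift i t ?\<phi> - h *\<^sub>R shift i t ?d
        = shift i t (h *\<^sub>R ((1 / h) *\<^sub>R (shift i h ?\<phi> - ?\<phi>) - ?d))"
      using that by (simp add: shift_diff shift_scaleR shift_shift scaleR_diff_right)
    then show ?thesis using that by simp
  qed
  have "((\<lambda>h. norm ((1 / h) *\<^sub>R (shift i h ?\<phi> - ?\<phi>) - ?d)) \<longlongrightarrow> 0) (at 0)"
    using shift_test_function_difference_quotient[OF assms, of i]
    by (simp add: tendsto_norm_zero_iff LIM_zero_iff)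
  then show "((\<lambda>h. norm (shift i (t + h) ?\<phi> - shift i t ?\<phi> - h *\<^sub>R shift i t ?d) / norm h) \<longlongrightarrow> 0) (at 0)"
    by (rule Lim_transform_eventually)
      (rule eventually_mono[OF eventually_neq_at_within[of 0 0 UNIV]], rule eq[symmetric])
qed

lemma has_weak_derivative_shift:
  assumes "has_weak_derivative u j v" shows "has_weak_derivative (shift i h u) j (shift i h v)"
  unfolding has_weak_derivative_inner
proof (intro allI impI)
  fix \<phi> :: "real ^ 'a \<Rightarrow> real" assume \<phi>: "test_function \<phi>"
  note t = test_function_translate[OF \<phi>, where y = "(- h) *\<^sub>R axis i 1"]
  have "inner u (abs_L2 (\<lambda>x. pderivative j \<phi> (x + (- h) *\<^sub>R axis i 1)))
      = - inner v (abs_L2 (\<lambda>x. \<phi> (x + (- h) *\<^sub>R axis i 1)))"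
    using assms t unfolding has_weak_derivative_inner by metis
  then show "inner (shift i h u) (abs_L2 (pderivative j \<phi>)) = - inner (shift i h v) (abs_L2 \<phi>)"
    using test_function_square_integrable[OF \<phi>] by (simp add: inner_shift shift_abs_L2)
qed

text \<open>The orbit of a general \<open>u\<close> need not be differentiable. The adjoint moves
  the shift, with reversed sign, onto the test function, whose orbit is.\<close>

lemma inner_shift_test_function_has_vector_derivative:
  assumes \<phi>: "test_function \<phi>"
  shows "((\<lambda>s. inner (shift i s u) (abs_L2 \<phi>)) has_vector_derivative
    - inner (shift i t u) (abs_L2 (pderivative i \<phi>))) (at t within S)"
proof -
  have "((\<lambda>s. shift i s (abs_L2 \<phi>)) has_vector_derivative shift i (- t) (abs_L2 (pderivative i \<phi>))) (at (- t))"
    by (rule shift_test_function_has_vector_derivative[OF \<phi>])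
  then have "((\<lambda>s. shift i (- s) (abs_L2 \<phi>)) has_vector_derivative
      (-1) *\<^sub>R shift i (- t) (abs_L2 (pderivative i \<phi>))) (at t within S)"
    by (intro vector_diff_chain_within[where f = uminus, unfolded comp_def])
      (auto intro!: derivative_eq_intros intro: has_vector_derivative_at_within)
  from bounded_linear.has_vector_derivative[OF bounded_linear_inner_right[of u] this]
  show ?thesis by (simp add: inner_shift)
qed

text \<open>The Steklov mean in one coordinate direction.\<close>

definition shift_mean :: "'n \<Rightarrow> real \<Rightarrow> 'n::finite L2 \<Rightarrow> 'n L2" where
  "shift_mean i h f = (1 / h) *\<^sub>R integral {0..h} (\<lambda>s. shift i s f)"

lemma inner_shift_mean: "inner (shift_mean i h f) g = (1 / h) * integral {0..h} (\<lambda>s. inner (shift i s f) g)"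
proof -
  have "integral {0..h} ((\<lambda>x. inner x g) \<circ> (\<lambda>s. shift i s f)) = inner (integral {0..h} (\<lambda>s. shift i s f)) g"
    by (intro integral_linear integrable_continuous_real continuous_on_shift bounded_linear_inner_left)
  then show ?thesis by (simp add: shift_mean_def comp_def)
qed

text \<open>The fundamental theorem of calculus along the shift group, obtained by testing.
  Difference quotients of \<open>u\<close> are thus averages of its weak derivative, which bounds
  them and is their limit.\<close>

lemma shift_diff_eq_mean:
  assumes w: "has_weak_derivative u i v" and h: "h > 0"
  shows "(1 / h) *\<^sub>R (shift i h u - u) = shift_mean i h v"
proof (rule L2_eq_test_functionI)
  fix \<phi> :: "real ^ 'a \<Rightarrow> real" assume \<phi>: "test_function \<phi>"
  have "((\<lambda>s. - inner (shift i s u) (abs_L2 (pderivative i \<phi>))) has_integral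
      (inner (shift i h u) (abs_L2 \<phi>) - inner (shift i 0 u) (abs_L2 \<phi>))) {0..h}"
    using h \<phi> by (intro fundamental_theorem_of_calculus inner_shift_test_function_has_vector_derivative) auto
  then have "integral {0..h} (\<lambda>s. - inner (shift i s u) (abs_L2 (pderivative i \<phi>)))
      = inner (shift i h u - u) (abs_L2 \<phi>)"
    by (simp only: integral_unique inner_diff_left shift_0)
  moreover have "- inner (shift i s u) (abs_L2 (pderivative i \<phi>)) = inner (shift i s v) (abs_L2 \<phi>)" for s
    using has_weak_derivative_shift[OF w] \<phi> by (simp add: has_weak_derivative_inner)
  ultimately show "inner ((1 / h) *\<^sub>R (shift i h u - u)) (abs_L2 \<phi>) = inner (shift_mean i h v) (abs_L2 \<phi>)"
    by (simp add: inner_shift_mean)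
qed

lemma norm_shift_mean_le: "h > 0 \<Longrightarrow> norm (shift_mean i h f) \<le> norm f"
  using integral_bound[of 0 h "\<lambda>s. shift i s f" "norm f"]
  by (simp add: shift_mean_def continuous_on_shift divide_le_eq)

lemma shift_mean_add: "shift_mean i h (f + g) = shift_mean i h f + shift_mean i h g"
  unfolding shift_mean_def shift_add
  by (subst integral_add) (auto intro!: integrable_continuous_real continuous_on_shift simp: scaleR_right_distrib)

lemma shift_mean_scaleR: "shift_mean i h (c *\<^sub>R f) = c *\<^sub>R shift_mean i h f"
  unfolding shift_mean_def shift_scaleR by simp

lemma shift_mean_tendsto: "((\<lambda>h. shift_mean i h f) \<longlongrightarrow> f) (at_right 0)"
proof (rule tendstoI)
  fix e :: real assume e: "e > 0"
  have "((\<lambda>s. shift i s f) \<longlongrightarrow> f) (at_right 0)"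
    by (rule shift_tendsto) (auto intro: tendsto_ident_at)
  then obtain d where d: "d > 0" "\<And>s. 0 < s \<Longrightarrow> s < d \<Longrightarrow> dist (shift i s f) f < e / 2"
    using tendstoD[of "\<lambda>s. shift i s f" f "at_right 0" "e / 2"] e
    unfolding eventually_at_right_field by auto
  have "dist (shift_mean i h f) f < e" if "0 < h" "h < d" for h
  proof -
    have "f = (1 / h) *\<^sub>R integral {0..h} (\<lambda>s. f)" using that by simp
    then have "shift_mean i h f - f = (1 / h) *\<^sub>R (integral {0..h} (\<lambda>s. shift i s f) - integral {0..h} (\<lambda>s. f))"
      unfolding shift_mean_def by (metis scaleR_diff_right)
    also have "\<dots> = (1 / h) *\<^sub>R integral {0..h} (\<lambda>s. shift i s f - f)"
      by (subst integral_diff) (auto intro!: integrable_continuous_real continuous_on_shift)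
    finally have eq: "norm (shift_mean i h f - f) = (1 / h) * norm (integral {0..h} (\<lambda>s. shift i s f - f))"
      using that by simp
    have "norm (shift i s f - f) \<le> e / 2" if "s \<in> {0..h}" for s
      using d(2)[of s] that \<open>h < d\<close> e by (cases "s = 0") (auto simp: dist_norm)
    then have "norm (integral {0..h} (\<lambda>s. shift i s f - f)) \<le> e / 2 * (h - 0)"
      using that by (intro integral_bound continuous_intros continuous_on_shift) auto
    then have "norm (shift_mean i h f - f) \<le> e / 2"
      unfolding eq using that by (simp add: field_simps)
    then show ?thesis using e by (simp add: dist_norm)
  qed
  then show "\<forall>\<^sub>F h in at_right 0. dist (shift_mean i h f) f < e"
    using d(1) unfolding eventually_at_right_field by auto
qed

lemma difference_quotient_tendsto:
  assumes "has_weak_derivative u i v"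
  shows "((\<lambda>h. (1 / h) *\<^sub>R (shift i h u - u)) \<longlongrightarrow> v) (at_right 0)"
  by (rule Lim_transform_eventually[OF shift_mean_tendsto[of i v]])
    (auto simp: eventually_at_right_less shift_diff_eq_mean[OF assms]
      intro!: eventually_mono[OF eventually_at_right_less[of 0]])

text \<open>Summation by parts carries the quotient over to the test function, with step
  \<open>- h\<close>. Together with \<open>difference_quotient_tendsto\<close> this expresses weak
  differentiability by shifts alone, so every bounded operator commuting with shifts preserves
  it.\<close>

lemma has_weak_derivativeI_difference_quotient:
  assumes lim: "((\<lambda>h. (1 / h) *\<^sub>R (shift i h u - u)) \<longlongrightarrow> v) (at_right 0)"
  shows "has_weak_derivative u i v"
  unfolding has_weak_derivative_inner
proof (intro allI impI)
  fix \<phi> :: "real ^ 'a \<Rightarrow> real" assume \<phi>: "test_function \<phi>"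
  have 1: "((\<lambda>h. inner ((1 / h) *\<^sub>R (shift i h u - u)) (abs_L2 \<phi>)) \<longlongrightarrow> inner v (abs_L2 \<phi>)) (at_right 0)"
    by (intro tendsto_intros lim)
  have "filterlim uminus (at (0::real)) (at_right 0)"
    by (auto simp: filterlim_at eventually_at_right_less intro!: tendsto_eq_intros
        eventually_mono[OF eventually_at_right_less[of "0::real"]])
  from filterlim_compose[OF shift_test_function_difference_quotient[OF \<phi>, of i] this]
  have "((\<lambda>h. - inner u ((1 / - h) *\<^sub>R (shift i (- h) (abs_L2 \<phi>) - abs_L2 \<phi>)))
      \<longlongrightarrow> - inner u (abs_L2 (pderivative i \<phi>))) (at_right 0)"
    by (intro tendsto_intros)
  moreover have "- inner u ((1 / - h) *\<^sub>R (shift i (- h) (abs_L2 \<phi>) - abs_L2 \<phi>))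
      = inner ((1 / h) *\<^sub>R (shift i h u - u)) (abs_L2 \<phi>)" for h
    by (simp add: inner_diff_left inner_diff_right inner_shift)
  ultimately have "((\<lambda>h. inner ((1 / h) *\<^sub>R (shift i h u - u)) (abs_L2 \<phi>))
      \<longlongrightarrow> - inner u (abs_L2 (pderivative i \<phi>))) (at_right 0)" by (simp only:)
  with 1 have "inner v (abs_L2 \<phi>) = - inner u (abs_L2 (pderivative i \<phi>))"
    by (rule tendsto_unique[OF trivial_limit_at_right_real])
  then show "inner u (abs_L2 (pderivative i \<phi>)) = - inner v (abs_L2 \<phi>)" by simp
qed

lemma norm_shift_diff_le:
  assumes "has_weak_derivative u i v" "0 \<le> h"
  shows "norm (shift i h u - u) \<le> h * norm v"
proof (cases "h = 0")
  case False
  then have "norm ((1 / h) *\<^sub>R (shift i h u - u)) \<le> norm v"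
    using assms shift_diff_eq_mean[OF assms(1), of h] norm_shift_mean_le[of h i v] by simp
  then show ?thesis using False assms(2) by (simp add: divide_le_eq mult.commute)
qed simp

text \<open>Difference quotients obey the rule exactly, up to a shift by \<open>- h\<close> in the
  second factor, which disappears in the limit.\<close>

lemma weak_derivative_integration_by_parts:
  assumes u: "has_weak_derivative u i u'" and v: "has_weak_derivative v i v'"
  shows "inner u' v = - inner u v'"
proof -
  have 1: "((\<lambda>h. inner ((1 / h) *\<^sub>R (shift i h u - u)) v) \<longlongrightarrow> inner u' v) (at_right 0)"
    by (intro tendsto_intros difference_quotient_tendsto[OF u])
  have "((\<lambda>h. shift i (- h) ((1 / h) *\<^sub>R (shift i h v - v))) \<longlongrightarrow> v') (at_right 0)"
    by (rule shift_tendsto[OF difference_quotient_tendsto[OF v]]) (auto intro!: tendsto_eq_intros)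
  then have "((\<lambda>h. - inner u (shift i (- h) ((1 / h) *\<^sub>R (shift i h v - v)))) \<longlongrightarrow> - inner u v') (at_right 0)"
    by (intro tendsto_intros)
  moreover have "- inner u (shift i (- h) ((1 / h) *\<^sub>R (shift i h v - v)))
      = inner ((1 / h) *\<^sub>R (shift i h u - u)) v" for h
    by (simp add: shift_scaleR shift_diff shift_shift inner_diff_left inner_diff_right inner_shift)
      (simp add: algebra_simps diff_divide_distrib)
  ultimately show ?thesis using tendsto_unique[OF _ 1] by simp
qed

section \<open>Smoothing\<close>

text \<open>Testing the mean with a partial derivative integrates an exact derivative in
  \<open>s\<close>, which leaves the two end points. This gain of one derivative is the source of
  all smoothing below.\<close>

lemma has_weak_derivative_shift_mean:
  assumes h: "h > 0"
  shows "has_weak_derivative (shift_mean i h f) i ((1 / h) *\<^sub>R (shift i h f - f))"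
  unfolding has_weak_derivative_inner
proof (intro allI impI)
  fix \<phi> :: "real ^ 'a \<Rightarrow> real" assume \<phi>: "test_function \<phi>"
  have "((\<lambda>s. - inner (shift i s f) (abs_L2 (pderivative i \<phi>))) has_integral
      (inner (shift i h f) (abs_L2 \<phi>) - inner (shift i 0 f) (abs_L2 \<phi>))) {0..h}"
    using h \<phi> by (intro fundamental_theorem_of_calculus inner_shift_test_function_has_vector_derivative) auto
  from integral_unique[OF has_integral_neg[OF this]]
  have "integral {0..h} (\<lambda>s. inner (shift i s f) (abs_L2 (pderivative i \<phi>)))
      = - inner (shift i h f - f) (abs_L2 \<phi>)"
    by (simp only: minus_minus inner_diff_left shift_0)
  then show "inner (shift_mean i h f) (abs_L2 (pderivative i \<phi>))
      = - inner ((1 / h) *\<^sub>R (shift i h f - f)) (abs_L2 \<phi>)"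
    by (simp only: inner_shift_mean inner_scaleR_left mult_minus_right)
qed

lemma shift_mean_preserves_weak_derivative:
  assumes "has_weak_derivative f j g"
  shows "has_weak_derivative (shift_mean i h f) j (shift_mean i h g)"
  using has_weak_derivative_shift[OF assms, of i]
  unfolding has_weak_derivative_inner inner_shift_mean by simp

definition iterated_mean :: "'n list \<Rightarrow> real \<Rightarrow> 'n::finite L2 \<Rightarrow> 'n L2" where
  "iterated_mean L h = foldr (\<lambda>i. shift_mean i h) L"

lemma iterated_mean_simps [simp]:
  "iterated_mean [] h f = f"
  "iterated_mean (i # L) h f = shift_mean i h (iterated_mean L h f)"
  "iterated_mean (L @ L') h f = iterated_mean L h (iterated_mean L' h f)"
  by (simp_all add: iterated_mean_def)

lemma iterated_mean_add: "iterated_mean L h (f + g) = iterated_mean L h f + iterated_mean L h g"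
  by (induction L) (auto simp: shift_mean_add)

lemma iterated_mean_scaleR: "iterated_mean L h (c *\<^sub>R f) = c *\<^sub>R iterated_mean L h f"
  by (induction L) (auto simp: shift_mean_scaleR)

lemma iterated_mean_tendsto: "((\<lambda>h. iterated_mean L h f) \<longlongrightarrow> f) (at_right 0)"
proof (induction L)
  case (Cons i L)
  have "((\<lambda>h. norm (iterated_mean L h f - f) + norm (shift_mean i h f - f)) \<longlongrightarrow> 0 + 0) (at_right 0)"
    using Cons shift_mean_tendsto[of i f]
    by (intro tendsto_add) (auto simp: tendsto_norm_zero_iff LIM_zero_iff)
  then have lim: "((\<lambda>h. norm (iterated_mean L h f - f) + norm (shift_mean i h f - f)) \<longlongrightarrow> 0) (at_right 0)"
    by simp
  have "norm (shift_mean i h (iterated_mean L h f) - f) \<le> norm (iterated_mean L h f - f) + norm (shift_mean i h f - f)"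
    if "h > 0" for h
  proof -
    have "shift_mean i h (iterated_mean L h f) = shift_mean i h (iterated_mean L h f - f) + shift_mean i h f"
      by (simp flip: shift_mean_add)
    then have "shift_mean i h (iterated_mean L h f) - f = shift_mean i h (iterated_mean L h f - f) + (shift_mean i h f - f)"
      by simp
    then have "norm (shift_mean i h (iterated_mean L h f) - f)
        \<le> norm (shift_mean i h (iterated_mean L h f - f)) + norm (shift_mean i h f - f)"
      by (metis norm_triangle_ineq)
    then show ?thesis using norm_shift_mean_le[OF that, of i "iterated_mean L h f - f"] by linarith
  qed
  then have "((\<lambda>h. norm (iterated_mean (i # L) h f - f)) \<longlongrightarrow> 0) (at_right 0)"
    by (intro tendsto_sandwich[OF _ _ tendsto_const lim])
      (auto intro!: eventually_mono[OF eventually_at_right_less[of "0::real"]])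
  then show ?case by (simp only: tendsto_norm_zero_iff LIM_zero_iff)
qed simp

lemma iterated_mean_preserves_weak_derivative:
  "has_weak_derivative f j g \<Longrightarrow> has_weak_derivative (iterated_mean L h f) j (iterated_mean L h g)"
  by (induction L) (auto intro: shift_mean_preserves_weak_derivative)

text \<open>The mean in direction \<open>i\<close> creates the derivative, and the means taken after
  it preserve it.\<close>

lemma iterated_mean_has_weak_derivative:
  "h > 0 \<Longrightarrow> i \<in> set L \<Longrightarrow> \<exists>g. has_weak_derivative (iterated_mean L h f) i g"
proof (induction L)
  case (Cons j L)
  then show ?case
    by (cases "i = j") (auto intro: has_weak_derivative_shift_mean shift_mean_preserves_weak_derivative)
qed simp

text \<open>Averages over small cubes, taken twice, map \<open>L\<^sup>2\<close> to \<open>H\<^sup>2\<close> and commute with weak derivatives.\<close>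

lemma smoothing_operators:
  obtains S :: "nat \<Rightarrow> 'n::finite L2 \<Rightarrow> 'n H2"
  where "\<And>m. linear (S m)"
    and "\<And>f. (\<lambda>m. L2_of_H2 (S m f)) \<longlonglongrightarrow> f"
    and "\<And>u. (\<lambda>m. H1_of_H2 (S m (L2_of_H1 u))) \<longlonglongrightarrow> u"
proof -
  obtain L :: "'n list" where L: "set L = UNIV" using finite_list[OF finite[of UNIV]] by blast
  define h where "h m = inverse (real (Suc m))" for m
  have h: "h m > 0" for m by (simp add: h_def)
  have lim_h: "filterlim h (at_right 0) sequentially"
    unfolding filterlim_at h_def using LIMSEQ_inverse_real_of_nat by auto
  \<comment> \<open>The inner copy of \<open>L\<close> provides first derivatives \<open>g i\<close>
    in L2; the outer copy commutes with them and maps each \<open>g i\<close> into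
    \<open>H1\<close>.\<close>
  have "\<exists>x. L2_of_H2 x = iterated_mean (L @ L) (h m) f" for m f
  proof -
    have ex: "\<forall>i. \<exists>g. has_weak_derivative (iterated_mean L (h m) f') i g" for f'
      by (intro allI iterated_mean_has_weak_derivative[OF h]) (simp add: L)
    obtain g where g: "\<And>i. has_weak_derivative (iterated_mean L (h m) f) i (g i)"
      using ex[of f] by metis
    obtain u where u: "L2_of_H1 u = iterated_mean (L @ L) (h m) f"
      "\<And>i. weak_derivative i u = iterated_mean L (h m) (g i)"
      using H1_exists[of "iterated_mean (L @ L) (h m) f" "\<lambda>i. iterated_mean L (h m) (g i)"]
        iterated_mean_preserves_weak_derivative[OF g] by auto
    have "\<exists>v. L2_of_H1 v = iterated_mean L (h m) (g i)" for i
    proof -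
      obtain k where "\<And>j. has_weak_derivative (iterated_mean L (h m) (g i)) j (k j)"
        using ex[of "g i"] by metis
      then show ?thesis using H1_exists by metis
    qed
    then obtain v where "\<And>i. L2_of_H1 (v i) = iterated_mean L (h m) (g i)" by metis
    then show ?thesis using H2_exists[of u v] u by metis
  qed
  then obtain S where S: "\<And>m f. L2_of_H2 (S m f) = iterated_mean (L @ L) (h m) f" by metis
  have inj: "x = y" if "L2_of_H2 x = L2_of_H2 y" for x y :: "'n H2"
    using that by (simp add: L2_of_H1_inject H1_of_H2_inject)
  show ?thesis
  proof (rule that)
    show "linear (S m)" for m
      by (intro linearI inj)
        (simp_all add: S plus_H2.rep_eq plus_H1.rep_eq scaleR_H2.rep_eq scaleR_H1.rep_eq
          iterated_mean_add iterated_mean_scaleR del: iterated_mean_simps)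
    show lim: "(\<lambda>m. L2_of_H2 (S m f)) \<longlonglongrightarrow> f" for f
      unfolding S by (rule filterlim_compose[OF iterated_mean_tendsto lim_h])
    show "(\<lambda>m. H1_of_H2 (S m (L2_of_H1 u))) \<longlonglongrightarrow> u" for u
      unfolding tendsto_H1_iff
    proof (intro conjI allI lim)
      fix i
      have "weak_derivative i (H1_of_H2 (S m (L2_of_H1 u))) = iterated_mean (L @ L) (h m) (weak_derivative i u)" for m
        by (rule weak_derivative_eqI)
          (simp only: S iterated_mean_preserves_weak_derivative has_weak_derivative_weak_derivative)
      then show "(\<lambda>m. weak_derivative i (H1_of_H2 (S m (L2_of_H1 u)))) \<longlonglongrightarrow> weak_derivative i u"
        by (simp only:) (rule filterlim_compose[OF iterated_mean_tendsto lim_h])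
    qed
  qed
qed

section \<open>Semilinear evolution equations in Banach spaces\<close>

text \<open>The integrating factor \<open>exp (- K * (t - a))\<close> is at most 1 and so leaves a
  forcing of at most \<open>c\<close>; after subtracting \<open>c * (t - a)\<close> the function is
  nonincreasing.\<close>

lemma gronwall_differential:
  fixes f f' :: "real \<Rightarrow> real"
  assumes ab: "a \<le> b" and K: "0 \<le> K" and c: "0 \<le> c"
    and d: "\<And>t. t \<in> {a..b} \<Longrightarrow> (f has_real_derivative f' t) (at t within {a..b})"
    and le: "\<And>t. t \<in> {a..b} \<Longrightarrow> f' t \<le> K * f t + c"
  shows "f b \<le> exp (K * (b - a)) * (f a + c * (b - a))"
proof -
  let ?g = "\<lambda>t. exp (- K * (t - a)) * f t - c * (t - a)"
  have dg: "(?g has_real_derivative exp (- K * (t - a)) * (f' t - K * f t) - c) (at t within {a..b})"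
    if "t \<in> {a..b}" for t
    by (rule derivative_eq_intros d that refl)+ (simp add: algebra_simps)
  have "?g b \<le> ?g a"
  proof (rule DERIV_nonpos_imp_decreasing_open[OF ab])
    fix t assume t: "a < t" "t < b"
    have "exp (- K * (t - a)) * (f' t - K * f t) - c \<le> 0"
    proof -
      have "exp (- K * (t - a)) * (f' t - K * f t) \<le> exp (- K * (t - a)) * c"
        using le[of t] t by (intro mult_left_mono) auto
      also have "\<dots> \<le> 1 * c"
        using K c t by (intro mult_right_mono) auto
      finally show ?thesis by simp
    qed
    moreover have "at t within {a..b} = at t" using t by (simp add: at_within_Icc_at)
    ultimately show "\<exists>y. (?g has_real_derivative y) (at t) \<and> y \<le> 0"
      using dg[of t] t by (intro exI conjI) auto
  next
    show "continuous_on {a..b} ?g"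
      unfolding continuous_on_eq_continuous_within using dg DERIV_continuous by blast
  qed
  then have le_a: "exp (- K * (b - a)) * f b - c * (b - a) \<le> f a" by simp
  have "f b = exp (K * (b - a)) * (exp (- K * (b - a)) * f b)"
    by (simp add: mult.assoc[symmetric] exp_add[symmetric])
  also have "\<dots> \<le> exp (K * (b - a)) * (f a + c * (b - a))"
    using le_a by (intro mult_left_mono) auto
  finally show ?thesis .
qed

text \<open>The differential form applied to the primitive of \<phi>, which vanishes at
  \<open>a\<close>.\<close>

lemma gronwall_integral:
  fixes \<phi> :: "real \<Rightarrow> real"
  assumes ab: "a \<le> b" and K: "0 \<le> K" and c: "0 \<le> c" and cont: "continuous_on {a..b} \<phi>"
    and le: "\<And>t. t \<in> {a..b} \<Longrightarrow> \<phi> t \<le> c + K * integral {a..t} \<phi>"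
  shows "\<phi> b \<le> c + K * (exp (K * (b - a)) * (c * (b - a)))"
proof -
  have "integral {a..b} \<phi> \<le> exp (K * (b - a)) * (integral {a..a} \<phi> + c * (b - a))"
  proof (rule gronwall_differential[OF ab K c, where f' = \<phi>])
    show "((\<lambda>t. integral {a..t} \<phi>) has_real_derivative \<phi> t) (at t within {a..b})" if "t \<in> {a..b}" for t
      using integral_has_vector_derivative[OF cont that]
      by (simp add: has_real_derivative_iff_has_vector_derivative)
    show "\<phi> t \<le> K * integral {a..t} \<phi> + c" if "t \<in> {a..b}" for t using le[OF that] by linarith
  qed
  then have "K * integral {a..b} \<phi> \<le> K * (exp (K * (b - a)) * (c * (b - a)))"
    using K by (intro mult_left_mono) auto
  then show ?thesis using le[of b] ab by simp
qed

section \<open>Evolution families and Duhamel integrals\<close>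

lemma at_within_atLeast_eq: "at t within {a..} = at t within {a..b}" if "t < b" for a b t :: real
  by (rule at_within_nhd[of _ "{..<b}"]) (use that in auto)

lemma continuous_on_Icc_bounded:
  fixes u :: "real \<Rightarrow> 'a::real_normed_vector"
  assumes "continuous_on {a..b} u" shows "\<exists>R. \<forall>s\<in>{a..b}. norm (u s) \<le> R"
  using compact_imp_bounded[OF compact_continuous_image[OF assms compact_Icc]]
  by (simp add: bounded_iff)

text \<open>Two parameters, because the damping coefficient depends on time. Only strong continuity
  on triangles and local bounds are assumed, so the nonlinear theory is phrased by integral
  equations. The identity is one instance and gives ordinary differential equations; the propagator
  of the wave equation is the other.\<close>

locale evolution_family =
  fixes \<Psi> :: "real \<Rightarrow> real \<Rightarrow> 'y::banach \<Rightarrow> 'y"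
  assumes linear: "0 \<le> s \<Longrightarrow> s \<le> t \<Longrightarrow> linear (\<Psi> t s)"
    and same: "0 \<le> s \<Longrightarrow> \<Psi> s s y = y"
    and comp: "0 \<le> r \<Longrightarrow> r \<le> s \<Longrightarrow> s \<le> t \<Longrightarrow> \<Psi> t s (\<Psi> s r y) = \<Psi> t r y"
    and bounded: "\<exists>C. \<forall>s t y. 0 \<le> s \<longrightarrow> s \<le> t \<longrightarrow> t \<le> T \<longrightarrow> norm (\<Psi> t s y) \<le> C * norm y"
    and continuous: "continuous_on {(t, s). 0 \<le> s \<and> s \<le> t \<and> t \<le> T} (\<lambda>(t, s). \<Psi> t s y)"
begin

lemma bound:
  obtains C where "C \<ge> 1" "\<And>s t y. 0 \<le> s \<Longrightarrow> s \<le> t \<Longrightarrow> t \<le> T \<Longrightarrow> norm (\<Psi> t s y) \<le> C * norm y"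
proof -
  obtain C where C: "\<And>s t y. 0 \<le> s \<Longrightarrow> s \<le> t \<Longrightarrow> t \<le> T \<Longrightarrow> norm (\<Psi> t s y) \<le> C * norm y"
    using bounded by metis
  show ?thesis
  proof (rule that[of "max C 1"])
    show "norm (\<Psi> t s y) \<le> max C 1 * norm y" if "0 \<le> s" "s \<le> t" "t \<le> T" for s t y
      using C[OF that, of y] mult_right_mono[of C "max C 1" "norm y"] by simp
  qed simp
qed

lemma bounded_linear: "0 \<le> s \<Longrightarrow> s \<le> t \<Longrightarrow> bounded_linear (\<Psi> t s)"
proof -
  assume st: "0 \<le> s" "s \<le> t"
  obtain C where "\<And>y. norm (\<Psi> t s y) \<le> C * norm y"
    using bound[of t] st by (metis order_refl)
  then show ?thesis
    using linear[OF st] by (intro bounded_linear_intro[where K = C])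
      (auto simp: linear_add linear_scale mult.commute)
qed

lemma continuous_joint:
  assumes a: "0 \<le> a" and f: "continuous_on {a..b} f"
  shows "continuous_on {(t, s). a \<le> s \<and> s \<le> t \<and> t \<le> b} (\<lambda>(t, s). \<Psi> t s (f s))"
proof -
  let ?D = "{(t, s). a \<le> s \<and> s \<le> t \<and> t \<le> b}"
  obtain C where C: "C \<ge> 1" "\<And>s t y. 0 \<le> s \<Longrightarrow> s \<le> t \<Longrightarrow> t \<le> b \<Longrightarrow> norm (\<Psi> t s y) \<le> C * norm y"
    using bound by metis
  show ?thesis
    unfolding continuous_on_def
  proof
    fix p assume p: "p \<in> ?D"
    obtain t0 s0 where p': "p = (t0, s0)" by (cases p)
    let ?F = "at p within ?D"
    have inD: "\<forall>\<^sub>F q in ?F. q \<in> ?D" by (simp add: eventually_at_filter)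
    have "continuous_on ?D (\<lambda>q. f (snd q))"
      by (rule continuous_on_compose2[OF f]) (auto intro!: continuous_intros)
    then have "((\<lambda>q. f (snd q)) \<longlongrightarrow> f s0) ?F" using p unfolding continuous_on_def p' by fastforce
    then have "((\<lambda>q. C * norm (f (snd q) - f s0)) \<longlongrightarrow> C * 0) ?F"
      by (intro tendsto_mult_left) (simp add: tendsto_norm_zero_iff LIM_zero_iff)
    moreover have "((\<lambda>q. \<Psi> (fst q) (snd q) (f s0)) \<longlongrightarrow> \<Psi> t0 s0 (f s0)) ?F"
    proof -
      have "continuous_on ?D (\<lambda>(t, s). \<Psi> t s (f s0))"
        by (rule continuous_on_subset[OF continuous[of b]]) (use a in auto)
      then show ?thesis using p unfolding continuous_on_def p' by (auto simp: case_prod_unfold)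
    qed
    then have "((\<lambda>q. norm (\<Psi> (fst q) (snd q) (f s0) - \<Psi> t0 s0 (f s0))) \<longlongrightarrow> 0) ?F"
      by (simp add: tendsto_norm_zero_iff LIM_zero_iff)
    ultimately have lim: "((\<lambda>q. C * norm (f (snd q) - f s0)
        + norm (\<Psi> (fst q) (snd q) (f s0) - \<Psi> t0 s0 (f s0))) \<longlongrightarrow> 0) ?F"
      using tendsto_add by fastforce
    have "\<forall>\<^sub>F q in ?F. norm (\<Psi> (fst q) (snd q) (f (snd q)) - \<Psi> t0 s0 (f s0))
        \<le> C * norm (f (snd q) - f s0) + norm (\<Psi> (fst q) (snd q) (f s0) - \<Psi> t0 s0 (f s0))"
      using inD
    proof eventually_elim
      case (elim q)
      obtain t s where q: "q = (t, s)" "a \<le> s" "s \<le> t" "t \<le> b" using elim by auto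
      have "\<Psi> t s (f s) - \<Psi> t0 s0 (f s0) = \<Psi> t s (f s - f s0) + (\<Psi> t s (f s0) - \<Psi> t0 s0 (f s0))"
        using linear_diff[OF linear, of s t] q a by simp
      then have "norm (\<Psi> t s (f s) - \<Psi> t0 s0 (f s0))
          \<le> norm (\<Psi> t s (f s - f s0)) + norm (\<Psi> t s (f s0) - \<Psi> t0 s0 (f s0))"
        by (metis norm_triangle_ineq)
      then show ?case using C(2)[of s t "f s - f s0"] q a by simp
    qed
    then have "((\<lambda>q. norm (\<Psi> (fst q) (snd q) (f (snd q)) - \<Psi> t0 s0 (f s0))) \<longlongrightarrow> 0) ?F"
      by (intro tendsto_sandwich[OF _ _ tendsto_const lim]) (auto intro: always_eventually)
    then show "((\<lambda>(t, s). \<Psi> t s (f s)) \<longlongrightarrow> (\<lambda>(t, s). \<Psi> t s (f s)) p) ?F"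
      by (simp add: tendsto_norm_zero_iff LIM_zero_iff p' case_prod_unfold)
  qed
qed

definition duhamel :: "real \<Rightarrow> real \<Rightarrow> (real \<Rightarrow> 'y) \<Rightarrow> 'y" where
  "duhamel a t f = integral {a..t} (\<lambda>s. \<Psi> t s (f s))"

lemma duhamel_integrand_continuous:
  assumes "0 \<le> a" "c \<le> t" "continuous_on {a..c} f"
  shows "continuous_on {a..c} (\<lambda>s. \<Psi> t s (f s))"
proof (cases "a \<le> c")
  case True
  \<comment> \<open>Freezing \<open>f\<close> after \<open>c\<close> extends it continuously to
    \<open>{a..t}\<close>, where joint continuity applies.\<close>
  define g where "g s = f (min c s)" for s
  have "continuous_on {a..t} g"
    unfolding g_def using True
    by (intro continuous_on_compose2[OF assms(3)] continuous_intros) auto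
  from continuous_joint[OF assms(1) this]
  have "continuous_on {a..c} (\<lambda>s. (\<lambda>(t, s). \<Psi> t s (g s)) (t, s))"
    by (rule continuous_on_compose2) (use assms(2) in \<open>auto intro!: continuous_intros\<close>)
  then show ?thesis by (rule continuous_on_eq) (simp add: g_def)
qed simp

lemma duhamel_integrable:
  "0 \<le> a \<Longrightarrow> c \<le> t \<Longrightarrow> continuous_on {a..c} f \<Longrightarrow> (\<lambda>s. \<Psi> t s (f s)) integrable_on {a..c}"
  by (intro integrable_continuous_real duhamel_integrand_continuous)

lemma duhamel_cong: "(\<And>s. s \<in> {a..t} \<Longrightarrow> f s = g s) \<Longrightarrow> duhamel a t f = duhamel a t g"
  unfolding duhamel_def by (intro integral_cong) simp

text \<open>Extending the integrand by \<open>f s\<close> to \<open>s > t\<close> keeps it continuous, which reduces the claim to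
  integrals over fixed intervals depending on a parameter.\<close>

lemma duhamel_continuous:
  assumes a: "0 \<le> a" and f: "continuous_on {a..b} f"
  shows "continuous_on {a..b} (\<lambda>t. duhamel a t f)"
proof -
  let ?k = "\<lambda>t s. \<Psi> (max t s) s (f s)"
  have k: "continuous_on ({a..b} \<times> {a..b}) (\<lambda>(t, s). ?k t s)"
  proof -
    have "continuous_on ({a..b} \<times> {a..b}) (\<lambda>p. (\<lambda>(t, s). \<Psi> t s (f s)) (max (fst p) (snd p), snd p))"
      by (rule continuous_on_compose2[OF continuous_joint[OF a f]]) (auto intro!: continuous_intros)
    then show ?thesis by (simp add: case_prod_unfold)
  qed
  have "continuous_on {a..b} (\<lambda>t. integral {a..b} (?k t))"
    using integral_continuous_on_param[of "{a..b}" a b ?k] k by simp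
  moreover have "continuous_on {a..b} (\<lambda>t. integral {t..b} f)"
  proof -
    have "continuous_on {a..b} (\<lambda>t. integral {a..b} f - integral {a..t} f)"
      by (intro continuous_intros indefinite_integral_continuous_1 integrable_continuous_real f)
    moreover have "integral {a..b} f - integral {a..t} f = integral {t..b} f" if "t \<in> {a..b}" for t
      using Henstock_Kurzweil_Integration.integral_combine[of a t b f] that integrable_continuous_real[OF f]
      by (simp add: algebra_simps)
    ultimately show ?thesis by (rule continuous_on_eq)
  qed
  ultimately have "continuous_on {a..b} (\<lambda>t. integral {a..b} (?k t) - integral {t..b} f)"
    by (rule continuous_on_diff)
  moreover have "integral {a..b} (?k t) - integral {t..b} f = duhamel a t f" if t: "t \<in> {a..b}" for t
  proof -
    have "continuous_on {a..b} (\<lambda>s. (\<lambda>(t, s). ?k t s) (t, s))"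
      by (rule continuous_on_compose2[OF k]) (use t in \<open>auto intro!: continuous_intros\<close>)
    then have "continuous_on {a..b} (?k t)" by simp
    then have "integral {a..t} (?k t) + integral {t..b} (?k t) = integral {a..b} (?k t)"
      using t by (intro Henstock_Kurzweil_Integration.integral_combine integrable_continuous_real) auto
    moreover have "integral {a..t} (?k t) = duhamel a t f"
      unfolding duhamel_def by (intro integral_cong) (simp add: max.absorb1)
    moreover have "integral {t..b} (?k t) = integral {t..b} f"
      using a t by (intro integral_cong) (simp add: max.absorb2 same)
    ultimately show ?thesis by (simp add: algebra_simps)
  qed
  ultimately show ?thesis by (rule continuous_on_eq)
qed

lemma norm_duhamel_le:
  assumes "0 \<le> a" "a \<le> t" "continuous_on {a..t} f"
    and C: "\<And>s y. a \<le> s \<Longrightarrow> s \<le> t \<Longrightarrow> norm (\<Psi> t s y) \<le> C * norm y" "0 \<le> C"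
    and B: "\<And>s. a \<le> s \<Longrightarrow> s \<le> t \<Longrightarrow> norm (f s) \<le> B"
  shows "norm (duhamel a t f) \<le> C * B * (t - a)"
  unfolding duhamel_def
proof (rule integral_bound)
  show "norm (\<Psi> t s (f s)) \<le> C * B" if "s \<in> {a..t}" for s
    using C(1)[of s "f s"] mult_left_mono[OF B[of s] C(2)] that by simp
qed (use assms duhamel_integrand_continuous[of a t t f] in auto)

lemma duhamel_diff:
  assumes "0 \<le> a" "continuous_on {a..t} f" "continuous_on {a..t} g"
  shows "duhamel a t f - duhamel a t g = duhamel a t (\<lambda>s. f s - g s)"
proof -
  have "duhamel a t f - duhamel a t g = integral {a..t} (\<lambda>s. \<Psi> t s (f s) - \<Psi> t s (g s))"
    unfolding duhamel_def using assms
    by (intro Henstock_Kurzweil_Integration.integral_diff[symmetric] duhamel_integrable) auto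
  also have "\<dots> = duhamel a t (\<lambda>s. f s - g s)"
    unfolding duhamel_def using assms(1) by (intro integral_cong) (simp add: linear_diff[OF linear])
  finally show ?thesis .
qed

text \<open>Boundedness lets the evolution pass under the integral, where the composition law
  carries it from \<open>r\<close> to \<open>t\<close>. This is what makes the integral equation
  restartable at intermediate times.\<close>

lemma duhamel_restart:
  assumes "0 \<le> a" "a \<le> r" "r \<le> t" and f: "continuous_on {a..t} f"
  shows "\<Psi> t r (duhamel a r f) + duhamel r t f = duhamel a t f"
proof -
  have fr: "continuous_on {a..r} f" using f by (rule continuous_on_subset) (use assms in auto)
  have "\<Psi> t r (duhamel a r f) = integral {a..r} (\<Psi> t r \<circ> (\<lambda>s. \<Psi> r s (f s)))"
    unfolding duhamel_def using assms fr
    by (intro integral_linear[symmetric] duhamel_integrable bounded_linear) auto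
  also have "\<dots> = integral {a..r} (\<lambda>s. \<Psi> t s (f s))"
    using assms by (intro integral_cong) (auto simp: comp)
  finally show ?thesis
    unfolding duhamel_def
    using Henstock_Kurzweil_Integration.integral_combine[of a r t "\<lambda>s. \<Psi> t s (f s)"] assms
      duhamel_integrable[of a t t f] by simp
qed

end

section \<open>Mild solutions of semilinear equations: uniqueness, continuation and blow-up\<close>

locale semilinear = evolution_family \<Psi> for \<Psi> :: "real \<Rightarrow> real \<Rightarrow> 'y::banach \<Rightarrow> 'y" +
  fixes G :: "real \<Rightarrow> 'y \<Rightarrow> 'y"
  assumes lipschitz: "\<exists>L. \<forall>t x y. 0 \<le> t \<longrightarrow> t \<le> T \<longrightarrow> norm x \<le> R \<longrightarrow> norm y \<le> R \<longrightarrow>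
      norm (G t x - G t y) \<le> L * norm (x - y)"
    and continuous_time: "continuous_on {0..} (\<lambda>t. G t x)"
begin

lemma lipschitz_bound:
  obtains L where "L \<ge> 0" "\<And>t x y. 0 \<le> t \<Longrightarrow> t \<le> T \<Longrightarrow> norm x \<le> R \<Longrightarrow> norm y \<le> R \<Longrightarrow>
      norm (G t x - G t y) \<le> L * norm (x - y)"
proof -
  obtain L where L: "\<And>t x y. 0 \<le> t \<Longrightarrow> t \<le> T \<Longrightarrow> norm x \<le> R \<Longrightarrow> norm y \<le> R \<Longrightarrow>
      norm (G t x - G t y) \<le> L * norm (x - y)"
    using lipschitz by metis
  show ?thesis
  proof (rule that[of "max L 0"])
    show "norm (G t x - G t y) \<le> max L 0 * norm (x - y)"
      if "0 \<le> t" "t \<le> T" "norm x \<le> R" "norm y \<le> R" for t x y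
      using L[OF that] mult_right_mono[of L "max L 0" "norm (x - y)"] by simp
  qed simp
qed

lemma continuous_on_G:
  assumes a: "0 \<le> a" and u: "continuous_on {a..b} u"
  shows "continuous_on {a..b} (\<lambda>s. G s (u s))"
  unfolding continuous_on_def
proof
  fix s0 assume s0: "s0 \<in> {a..b}"
  obtain R where R: "\<And>s. s \<in> {a..b} \<Longrightarrow> norm (u s) \<le> R"
    using continuous_on_Icc_bounded[OF u] by metis
  obtain L where L: "L \<ge> 0" "\<And>t x y. 0 \<le> t \<Longrightarrow> t \<le> b \<Longrightarrow> norm x \<le> R \<Longrightarrow> norm y \<le> R \<Longrightarrow>
      norm (G t x - G t y) \<le> L * norm (x - y)" using lipschitz_bound by metis
  let ?F = "at s0 within {a..b}"
  have "(u \<longlongrightarrow> u s0) ?F" using u s0 unfolding continuous_on_def by blast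
  then have "((\<lambda>s. L * norm (u s - u s0)) \<longlongrightarrow> L * 0) ?F"
    by (intro tendsto_mult_left) (simp add: tendsto_norm_zero_iff LIM_zero_iff)
  moreover have "((\<lambda>s. G s (u s0)) \<longlongrightarrow> G s0 (u s0)) ?F"
    using continuous_on_subset[OF continuous_time, of "{a..b}" "u s0"] a s0
    unfolding continuous_on_def by auto
  then have "((\<lambda>s. norm (G s (u s0) - G s0 (u s0))) \<longlongrightarrow> 0) ?F"
    by (simp add: tendsto_norm_zero_iff LIM_zero_iff)
  ultimately have lim: "((\<lambda>s. L * norm (u s - u s0) + norm (G s (u s0) - G s0 (u s0))) \<longlongrightarrow> 0) ?F"
    using tendsto_add by fastforce
  have "\<forall>\<^sub>F s in ?F. s \<in> {a..b}" by (simp add: eventually_at_filter)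
  then have "\<forall>\<^sub>F s in ?F. norm (G s (u s) - G s0 (u s0)) \<le> L * norm (u s - u s0) + norm (G s (u s0) - G s0 (u s0))"
  proof eventually_elim
    case (elim s)
    have "norm (G s (u s) - G s0 (u s0)) \<le> norm (G s (u s) - G s (u s0)) + norm (G s (u s0) - G s0 (u s0))"
      using norm_triangle_ineq[of "G s (u s) - G s (u s0)" "G s (u s0) - G s0 (u s0)"] by simp
    then show ?case using L(2)[of s "u s" "u s0"] R elim s0 a by fastforce
  qed
  then have "((\<lambda>s. norm (G s (u s) - G s0 (u s0))) \<longlongrightarrow> 0) ?F"
    by (intro tendsto_sandwich[OF _ _ tendsto_const lim]) (auto intro: always_eventually)
  then show "((\<lambda>s. G s (u s)) \<longlongrightarrow> G s0 (u s0)) ?F"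
    by (simp add: tendsto_norm_zero_iff LIM_zero_iff)
qed

definition mild :: "real \<Rightarrow> real \<Rightarrow> 'y \<Rightarrow> (real \<Rightarrow> 'y) \<Rightarrow> bool" where
  "mild a b y u \<longleftrightarrow> continuous_on {a..b} u \<and>
    (\<forall>t\<in>{a..b}. u t = \<Psi> t a y + duhamel a t (\<lambda>s. G s (u s)))"

lemma mild_initial: "0 \<le> a \<Longrightarrow> a \<le> b \<Longrightarrow> mild a b y u \<Longrightarrow> u a = y"
  by (auto simp: mild_def duhamel_def same)

lemma mild_trivial: "0 \<le> a \<Longrightarrow> mild a a y (\<lambda>t. y)"
  by (auto simp: mild_def duhamel_def same)

lemma mild_cong:
  assumes "mild a b y u" "\<And>t. t \<in> {a..b} \<Longrightarrow> u t = v t" shows "mild a b y v"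
proof -
  have "continuous_on {a..b} v"
    by (rule continuous_on_eq[of _ u]) (use assms in \<open>auto simp: mild_def\<close>)
  moreover have "v t = \<Psi> t a y + duhamel a t (\<lambda>s. G s (v s))" if t: "t \<in> {a..b}" for t
  proof -
    have "duhamel a t (\<lambda>s. G s (u s)) = duhamel a t (\<lambda>s. G s (v s))"
      using assms(2) t by (intro duhamel_cong) auto
    then show ?thesis using assms t unfolding mild_def by metis
  qed
  ultimately show ?thesis by (simp add: mild_def)
qed

lemma mild_restrict: "mild a b y u \<Longrightarrow> b' \<le> b \<Longrightarrow> mild a b' y u"
  unfolding mild_def by (auto intro: continuous_on_subset)

text \<open>On a compact interval both solutions stay in one ball, where the forcing is Lipschitz;
  Gronwall's inequality with initial constant 0 then makes the difference vanish.\<close>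

lemma mild_unique:
  assumes a: "0 \<le> a" and u: "mild a b y u" and v: "mild a b y v" and t: "t \<in> {a..b}"
  shows "u t = v t"
proof -
  have cu: "continuous_on {a..b} u" and cv: "continuous_on {a..b} v" using u v by (auto simp: mild_def)
  obtain R1 R2 where "\<And>s. s \<in> {a..b} \<Longrightarrow> norm (u s) \<le> R1" "\<And>s. s \<in> {a..b} \<Longrightarrow> norm (v s) \<le> R2"
    using continuous_on_Icc_bounded[OF cu] continuous_on_Icc_bounded[OF cv] by metis
  then have R: "norm (u s) \<le> max R1 R2" "norm (v s) \<le> max R1 R2" if "s \<in> {a..b}" for s
    using that by (auto intro: order_trans[OF _ max.cobounded1] order_trans[OF _ max.cobounded2])
  obtain L where L: "L \<ge> 0" "\<And>t x y. 0 \<le> t \<Longrightarrow> t \<le> b \<Longrightarrow> norm x \<le> max R1 R2 \<Longrightarrow> norm y \<le> max R1 R2 \<Longrightarrow>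
      norm (G t x - G t y) \<le> L * norm (x - y)" using lipschitz_bound by metis
  obtain C where C: "C \<ge> 1" "\<And>s t y. 0 \<le> s \<Longrightarrow> s \<le> t \<Longrightarrow> t \<le> b \<Longrightarrow> norm (\<Psi> t s y) \<le> C * norm y"
    using bound by metis
  let ?\<phi> = "\<lambda>t. norm (u t - v t)"
  have c\<phi>: "continuous_on {a..b} ?\<phi>" by (intro continuous_intros cu cv)
  have le: "?\<phi> r \<le> 0 + (C * L) * integral {a..r} ?\<phi>" if r: "r \<in> {a..t}" for r
  proof -
    have rb: "a \<le> r" "r \<le> b" using r t by auto
    have sub: "continuous_on {a..r} f" if "continuous_on {a..b} f" for f :: "real \<Rightarrow> 'y"
      using that by (rule continuous_on_subset) (use rb in auto)
    have "u r - v r = duhamel a r (\<lambda>s. G s (u s)) - duhamel a r (\<lambda>s. G s (v s))"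
      using u v rb unfolding mild_def by auto
    also have "\<dots> = duhamel a r (\<lambda>s. G s (u s) - G s (v s))"
      by (intro duhamel_diff a continuous_on_G sub cu cv)
    finally have eq: "u r - v r = integral {a..r} (\<lambda>s. \<Psi> r s (G s (u s) - G s (v s)))"
      by (simp add: duhamel_def)
    have "norm (u r - v r) \<le> integral {a..r} (\<lambda>s. (C * L) * ?\<phi> s)"
      unfolding eq
    proof (rule integral_norm_bound_integral)
      show "(\<lambda>s. \<Psi> r s (G s (u s) - G s (v s))) integrable_on {a..r}"
        by (intro duhamel_integrable a continuous_on_diff continuous_on_G sub cu cv order_refl)
      show "(\<lambda>s. (C * L) * ?\<phi> s) integrable_on {a..r}"
        by (intro integrable_continuous_real continuous_intros sub cu cv)
      fix s assume s: "s \<in> {a..r}"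
      have "norm (\<Psi> r s (G s (u s) - G s (v s))) \<le> C * norm (G s (u s) - G s (v s))"
        using s rb a by (intro C) auto
      also have "\<dots> \<le> C * (L * ?\<phi> s)"
        using s rb a C(1) by (intro mult_left_mono L R) auto
      finally show "norm (\<Psi> r s (G s (u s) - G s (v s))) \<le> (C * L) * ?\<phi> s" by (simp add: mult.assoc)
    qed
    then show ?thesis by simp
  qed
  have "?\<phi> t \<le> 0 + (C * L) * (exp ((C * L) * (t - a)) * (0 * (t - a)))"
    by (rule gronwall_integral) (use t C L le c\<phi> in \<open>auto intro: continuous_on_subset\<close>)
  then show ?thesis by simp
qed

text \<open>Restarting the Duhamel integral at \<open>b\<close> merges the two integral equations;
  the two branches agree at \<open>b\<close> because \<open>v\<close> starts from
  \<open>u b\<close>.\<close>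

lemma mild_glue:
  assumes abc: "0 \<le> a" "a \<le> b" "b \<le> c" and u: "mild a b y u" and v: "mild b c (u b) v"
  shows "mild a c y (\<lambda>t. if t \<le> b then u t else v t)"
proof -
  let ?w = "\<lambda>t. if t \<le> b then u t else v t"
  have vb: "v b = u b" using mild_initial[OF _ _ v] abc by simp
  have wu: "?w t = u t" if "t \<in> {a..b}" for t using that by simp
  have wv: "?w t = v t" if "t \<in> {b..c}" for t using that vb by (cases "t = b") auto
  have "continuous_on ({a..b} \<union> {b..c}) ?w"
  proof (intro continuous_on_closed_Un closed_atLeastAtMost)
    show "continuous_on {a..b} ?w" by (rule continuous_on_eq[of _ u]) (use u wu in \<open>auto simp: mild_def\<close>)
    show "continuous_on {b..c} ?w"
      by (rule continuous_on_eq[of _ v]) (use v in \<open>simp add: mild_def\<close>, rule wv[symmetric])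
  qed
  moreover have ac: "{a..b} \<union> {b..c} = {a..c}" using abc by auto
  ultimately have cw: "continuous_on {a..c} ?w" by simp
  have cGw: "continuous_on {a..c} (\<lambda>s. G s (?w s))" by (rule continuous_on_G[OF abc(1) cw])
  have "?w t = \<Psi> t a y + duhamel a t (\<lambda>s. G s (?w s))" if t: "t \<in> {a..c}" for t
  proof (cases "t \<le> b")
    case True
    have "duhamel a t (\<lambda>s. G s (?w s)) = duhamel a t (\<lambda>s. G s (u s))"
      using True by (intro duhamel_cong) auto
    then show ?thesis using u t True by (simp add: mild_def)
  next
    case False
    have "duhamel b t (\<lambda>s. G s (?w s)) = duhamel b t (\<lambda>s. G s (v s))"
      using t by (intro duhamel_cong arg_cong[where f = "G _"] wv) auto
    moreover have "duhamel a b (\<lambda>s. G s (?w s)) = duhamel a b (\<lambda>s. G s (u s))"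
      by (intro duhamel_cong) auto
    moreover have "u b = \<Psi> b a y + duhamel a b (\<lambda>s. G s (u s))"
      using u abc by (auto simp: mild_def)
    moreover have "v t = \<Psi> t b (u b) + duhamel b t (\<lambda>s. G s (v s))"
      using v t False by (auto simp: mild_def)
    ultimately have "v t = \<Psi> t b (\<Psi> b a y + duhamel a b (\<lambda>s. G s (?w s))) + duhamel b t (\<lambda>s. G s (?w s))"
      by simp
    also have "\<dots> = \<Psi> t a y + (\<Psi> t b (duhamel a b (\<lambda>s. G s (?w s))) + duhamel b t (\<lambda>s. G s (?w s)))"
      using abc False by (simp only: linear_add[OF linear, of b t] comp[of a b t] add.assoc)
    also have "\<Psi> t b (duhamel a b (\<lambda>s. G s (?w s))) + duhamel b t (\<lambda>s. G s (?w s)) = duhamel a t (\<lambda>s. G s (?w s))"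
      using abc False t by (intro duhamel_restart continuous_on_subset[OF cGw]) auto
    finally show ?thesis using False by simp
  qed
  then show ?thesis using cw by (simp add: mild_def)
qed

text \<open>A contraction on a ball of bounded continuous functions. The length \<delta> is fixed
  before \<open>a\<close> and \<open>y\<close> and depends on them only through \<open>T\<close> and
  \<open>M\<close>; continuation and the blow-up alternative rest on this uniformity.\<close>

lemma mild_local_existence:
  obtains \<delta> where "\<delta> > 0" "\<And>a y. 0 \<le> a \<Longrightarrow> a \<le> T \<Longrightarrow> norm y \<le> M \<Longrightarrow> \<exists>u. mild a (a + \<delta>) y u"
proof -
  obtain C where C: "C \<ge> 1" "\<And>s t y. 0 \<le> s \<Longrightarrow> s \<le> t \<Longrightarrow> t \<le> T + 1 \<Longrightarrow> norm (\<Psi> t s y) \<le> C * norm y"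
    using bound by metis
  \<comment> \<open>The linear part stays below \<open>C * \<bar>M\<bar>\<close>; the extra 1 is
    room for the Duhamel term.\<close>
  define R where "R = C * \<bar>M\<bar> + 1"
  have R: "R > 0" using C(1) by (simp add: R_def add_nonneg_pos)
  obtain L where L: "L \<ge> 0" "\<And>t x y. 0 \<le> t \<Longrightarrow> t \<le> T + 1 \<Longrightarrow> norm x \<le> R \<Longrightarrow> norm y \<le> R \<Longrightarrow>
      norm (G t x - G t y) \<le> L * norm (x - y)" using lipschitz_bound by metis
  have "continuous_on {0..T + 1} (\<lambda>t. G t 0)"
    by (rule continuous_on_subset[OF continuous_time]) auto
  then obtain B where B: "\<And>t. 0 \<le> t \<Longrightarrow> t \<le> T + 1 \<Longrightarrow> norm (G t 0) \<le> B"
    using continuous_on_Icc_bounded by (metis atLeastAtMost_iff)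
  define K where "K = L * R + \<bar>B\<bar>"
  have K0: "K \<ge> 0" using L(1) R by (simp add: K_def)
  have GK: "norm (G t x) \<le> K" if "0 \<le> t" "t \<le> T + 1" "norm x \<le> R" for t x
  proof -
    have "norm (G t x - G t 0) \<le> L * norm (x - 0)" using that R by (intro L) auto
    also have "\<dots> \<le> L * R" using that L(1) by (intro mult_left_mono) auto
    finally have "norm (G t x - G t 0) \<le> L * R" .
    moreover have "norm (G t x) \<le> norm (G t x - G t 0) + norm (G t 0)"
      using norm_triangle_ineq[of "G t x - G t 0" "G t 0"] by simp
    ultimately show ?thesis using B[OF that(1,2)] by (simp add: K_def)
  qed
  \<comment> \<open>The three entries keep all times below \<open>T + 1\<close>, the Duhamel term
    below 1, and the contraction factor at most 1/2.\<close>
  define \<delta> where "\<delta> = min 1 (min (1 / (C * K + 1)) (1 / (2 * C * L + 1)))"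
  have CK: "C * K \<ge> 0" "C * L \<ge> 0" using C(1) K0 L(1) by auto
  have \<delta>: "\<delta> > 0" "\<delta> \<le> 1" using CK by (auto simp: \<delta>_def add_nonneg_pos)
  have \<delta>K: "C * K * \<delta> \<le> 1"
  proof -
    have "C * K * \<delta> \<le> C * K * (1 / (C * K + 1))" using CK by (intro mult_left_mono) (auto simp: \<delta>_def)
    also have "\<dots> \<le> 1" using CK by (simp add: divide_le_eq)
    finally show ?thesis .
  qed
  have \<delta>L: "C * L * \<delta> \<le> 1 / 2"
  proof -
    have "C * L * \<delta> \<le> C * L * (1 / (2 * C * L + 1))" using CK by (intro mult_left_mono) (auto simp: \<delta>_def)
    also have "\<dots> \<le> 1 / 2" using CK by (simp add: divide_le_eq)
    finally show ?thesis .
  qed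
  have ex: "\<exists>u. mild a (a + \<delta>) y u" if a: "0 \<le> a" "a \<le> T" and y: "norm y \<le> M" for a y
  proof -
    \<comment> \<open>Clamping the time to \<open>{a..a + \<delta>}\<close> turns the integral
      operator into a map on bounded continuous functions on the whole line, a complete
      space.\<close>
    define \<pi> where "\<pi> t = max a (min (a + \<delta>) t)" for t
    have \<pi>: "\<pi> t \<in> {a..a + \<delta>}" for t using \<delta> by (auto simp: \<pi>_def)
    have \<pi>_id: "\<pi> t = t" if "t \<in> {a..a + \<delta>}" for t using that by (auto simp: \<pi>_def)
    define H where "H f t = \<Psi> t a y + duhamel a t (\<lambda>s. G s (f s))" for f :: "real \<Rightarrow> 'y" and t
    have cG: "continuous_on {a..c} (\<lambda>s. G s (apply_bcontfun f s))" for f :: "real \<Rightarrow>\<^sub>C 'y" and c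
      by (intro continuous_on_G a continuous_on_apply_bcontfun)
    have c\<Psi>: "continuous_on {a..a + \<delta>} (\<lambda>t. \<Psi> t a y)"
    proof -
      have "continuous_on {a..a + \<delta>} (\<lambda>t. (\<lambda>(t, s). \<Psi> t s y) (t, a))"
        by (rule continuous_on_compose2[OF continuous[of "a + \<delta>"]])
          (use a in \<open>auto intro!: continuous_intros\<close>)
      then show ?thesis by simp
    qed
    have cH: "continuous_on {a..a + \<delta>} (H (apply_bcontfun f))" for f
      unfolding H_def[abs_def] by (intro continuous_on_add c\<Psi> duhamel_continuous a cG)
    have cH': "continuous_on UNIV (\<lambda>t. H (apply_bcontfun f) (\<pi> t))" for f
      by (rule continuous_on_compose2[OF cH]) (use \<pi> in \<open>auto simp: \<pi>_def intro!: continuous_intros\<close>)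
    have Hb: "(\<lambda>t. H (apply_bcontfun f) (\<pi> t)) \<in> bcontfun" for f
    proof -
      obtain k where "\<And>t. t \<in> {a..a + \<delta>} \<Longrightarrow> norm (H (apply_bcontfun f) t) \<le> k"
        using continuous_on_Icc_bounded[OF cH] by metis
      then show ?thesis using \<pi> by (intro bcontfun_normI[OF cH']) blast
    qed
    define F where "F f = Bcontfun (\<lambda>t. H (apply_bcontfun f) (\<pi> t))" for f
    have F: "apply_bcontfun (F f) t = H (apply_bcontfun f) (\<pi> t)" for f t
      unfolding F_def using Hb by (simp add: Bcontfun_inverse)
    have Ct: "norm (\<Psi> t s z) \<le> C * norm z" if "t \<in> {a..a + \<delta>}" "a \<le> s" "s \<le> t" for t s z
      using that a \<delta> by (intro C) auto
    have ball: "norm (apply_bcontfun f s) \<le> R" if "f \<in> cball 0 R" for f :: "real \<Rightarrow>\<^sub>C 'y" and s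
      using that norm_bounded[of f s] by simp
    have "\<exists>!f\<in>cball 0 R. F f = f"
    proof (rule Banach_fix)
      show "complete (cball 0 R :: (real \<Rightarrow>\<^sub>C 'y) set)" by (simp add: complete_eq_closed)
      show "cball 0 R \<noteq> ({} :: (real \<Rightarrow>\<^sub>C 'y) set)" using R by simp
      show "F ` cball 0 R \<subseteq> cball 0 R"
      proof
        fix g assume "g \<in> F ` cball 0 R"
        then obtain f where f: "f \<in> cball 0 R" and g: "g = F f" by auto
        have "norm (apply_bcontfun (F f) t) \<le> R" for t
        proof -
          have "norm (duhamel a (\<pi> t) (\<lambda>s. G s (apply_bcontfun f s))) \<le> C * K * (\<pi> t - a)"
            using \<pi>[of t] a \<delta> C(1) by (intro norm_duhamel_le cG Ct GK ball[OF f]) auto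
          also have "\<dots> \<le> C * K * \<delta>" using \<pi>[of t] CK by (intro mult_left_mono) auto
          also note \<delta>K
          finally have 1: "norm (duhamel a (\<pi> t) (\<lambda>s. G s (apply_bcontfun f s))) \<le> 1" .
          have "norm (\<Psi> (\<pi> t) a y) \<le> C * norm y" using \<pi>[of t] by (intro Ct) auto
          also have "\<dots> \<le> C * \<bar>M\<bar>" using C(1) y by (intro mult_left_mono) auto
          finally show ?thesis
            unfolding F H_def R_def using 1 by (intro order_trans[OF norm_triangle_ineq] add_mono)
        qed
        then show "g \<in> cball 0 R" unfolding g by (simp add: norm_bound)
      qed
      show "dist (F f) (F g) \<le> 1 / 2 * dist f g" if f: "f \<in> cball 0 R" and g: "g \<in> cball 0 R" for f g
      proof (rule dist_bound)
        fix t
        have "dist (apply_bcontfun (F f) t) (apply_bcontfun (F g) t)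
            = norm (duhamel a (\<pi> t) (\<lambda>s. G s (apply_bcontfun f s)) - duhamel a (\<pi> t) (\<lambda>s. G s (apply_bcontfun g s)))"
          by (simp add: F H_def dist_norm)
        also have "\<dots> = norm (duhamel a (\<pi> t) (\<lambda>s. G s (apply_bcontfun f s) - G s (apply_bcontfun g s)))"
          by (subst duhamel_diff) (auto intro: cG a)
        also have "\<dots> \<le> C * (L * dist f g) * (\<pi> t - a)"
        proof (rule norm_duhamel_le)
          fix s assume s: "a \<le> s" "s \<le> \<pi> t"
          have "norm (G s (apply_bcontfun f s) - G s (apply_bcontfun g s))
              \<le> L * norm (apply_bcontfun f s - apply_bcontfun g s)"
            using s \<pi>[of t] a \<delta> by (intro L ball f g) auto
          also have "\<dots> \<le> L * dist f g"
            using dist_bounded[of f s g] L(1) by (intro mult_left_mono) (auto simp: dist_norm)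
          finally show "norm (G s (apply_bcontfun f s) - G s (apply_bcontfun g s)) \<le> L * dist f g" .
        qed (use \<pi>[of t] a C(1) in \<open>auto intro!: continuous_on_diff cG Ct\<close>)
        also have "\<dots> \<le> C * (L * dist f g) * \<delta>"
          using \<pi>[of t] C(1) L(1) by (intro mult_left_mono) auto
        also have "\<dots> = C * L * \<delta> * dist f g" by (simp add: mult_ac)
        also have "\<dots> \<le> 1 / 2 * dist f g" by (intro mult_right_mono \<delta>L) simp
        finally show "dist (apply_bcontfun (F f) t) (apply_bcontfun (F g) t) \<le> 1 / 2 * dist f g" .
      qed
    qed auto
    then obtain f where f: "F f = f" by blast
    have "mild a (a + \<delta>) y (apply_bcontfun f)"
      unfolding mild_def
    proof (intro conjI ballI)
      fix t assume t: "t \<in> {a..a + \<delta>}"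
      show "apply_bcontfun f t = \<Psi> t a y + duhamel a t (\<lambda>s. G s (apply_bcontfun f s))"
        using F[of f t] \<pi>_id[OF t] unfolding f H_def by simp
    qed simp
    then show ?thesis by blast
  qed
  show ?thesis by (rule that[OF \<delta>(1) ex])
qed

text \<open>\<open>Tm\<close> is the supremum of the end points of solutions. Local existence shows
  that it is not attained, and uniqueness lets all solutions be pieced together into one
  function.\<close>

theorem mild_maximal:
  assumes a: "0 \<le> a"
  obtains Tm u where "ereal a < Tm"
    and "\<And>b. a \<le> b \<Longrightarrow> ereal b < Tm \<Longrightarrow> mild a b y u"
    and "\<And>b v. a \<le> b \<Longrightarrow> mild a b y v \<Longrightarrow> ereal b < Tm"
    and "\<And>\<tau>. Tm = ereal \<tau> \<Longrightarrow> filterlim (\<lambda>t. norm (u t)) at_top (at_left \<tau>)"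
proof -
  define S where "S = {b. a \<le> b \<and> (\<exists>v. mild a b y v)}"
  define Tm where "Tm = Sup (ereal ` S)"
  \<comment> \<open>The value at \<open>t\<close> of some solution on \<open>{a..t}\<close>; by
    uniqueness the choice does not matter.\<close>
  define u where "u t = (SOME v. mild a t y v) t" for t
  have extend: "\<exists>b'>b. b' \<in> S" if b: "b \<in> S" for b
  proof -
    obtain v where v: "mild a b y v" "a \<le> b" using b by (auto simp: S_def)
    obtain \<delta> where \<delta>: "\<delta> > 0" "\<And>c y'. 0 \<le> c \<Longrightarrow> c \<le> b \<Longrightarrow> norm y' \<le> norm (v b) \<Longrightarrow> \<exists>u. mild c (c + \<delta>) y' u"
      using mild_local_existence by metis
    obtain w where "mild b (b + \<delta>) (v b) w" using \<delta>(2)[of b "v b"] a v(2) by auto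
    then have "mild a (b + \<delta>) y (\<lambda>t. if t \<le> b then v t else w t)"
      using a v \<delta>(1) by (intro mild_glue) auto
    then have "b + \<delta> \<in> S" using v(2) \<delta>(1) by (auto simp: S_def)
    then show ?thesis using \<delta>(1) by (intro exI[of _ "b + \<delta>"]) simp
  qed
  have less: "ereal b < Tm" if b: "b \<in> S" for b
  proof -
    obtain b' where "b < b'" "b' \<in> S" using extend[OF b] by blast
    then have "ereal b < ereal b'" "ereal b' \<le> Tm" unfolding Tm_def by (auto intro: Sup_upper)
    then show ?thesis by (rule less_le_trans)
  qed
  have mem: "b \<in> S" if b: "a \<le> b" "ereal b < Tm" for b
  proof -
    obtain b' where "b' \<in> S" "b < b'" using b(2) unfolding Tm_def less_Sup_iff by auto
    then show ?thesis using b(1) mild_restrict[of a b' y _ b] by (auto simp: S_def)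
  qed
  have u: "u t = v t" if v: "mild a b y v" "t \<in> {a..b}" for b v t
  proof -
    have "mild a t y v" using v by (auto intro: mild_restrict)
    then have "mild a t y (SOME v. mild a t y v)" by (rule someI[of "mild a t y"])
    then show ?thesis unfolding u_def
      using mild_unique[OF a _ \<open>mild a t y v\<close>] v(2) by auto
  qed
  have mild_u: "mild a b y u" if b: "a \<le> b" "ereal b < Tm" for b
  proof -
    obtain v where v: "mild a b y v" using mem[OF b] by (auto simp: S_def)
    then show ?thesis by (rule mild_cong) (use u[OF v] in simp)
  qed
  show ?thesis
  proof (rule that[of Tm u])
    show "ereal a < Tm" by (rule less) (use mild_trivial[OF a] in \<open>auto simp: S_def\<close>)
    show "mild a b y u" if "a \<le> b" "ereal b < Tm" for b by (rule mild_u[OF that])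
    show "ereal b < Tm" if "a \<le> b" "mild a b y v" for b v
      by (rule less) (use that in \<open>auto simp: S_def\<close>)
    fix \<tau> assume \<tau>: "Tm = ereal \<tau>"
    have a\<tau>: "a < \<tau>" using \<open>ereal a < Tm\<close> \<tau> by simp
    show "filterlim (\<lambda>t. norm (u t)) at_top (at_left \<tau>)"
      unfolding filterlim_at_top_dense
    proof
      fix M
      obtain \<delta> where \<delta>: "\<delta> > 0" "\<And>c y'. 0 \<le> c \<Longrightarrow> c \<le> \<tau> \<Longrightarrow> norm y' \<le> M \<Longrightarrow> \<exists>u. mild c (c + \<delta>) y' u"
        using mild_local_existence by metis
      \<comment> \<open>A value of norm at most \<open>M\<close> within \<delta> of \<tau> could be
        continued past \<tau>. As this excludes all late times at once, the norm tends to infinity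
        and is not merely unbounded.\<close>
      have "M < norm (u t)" if t: "max a (\<tau> - \<delta>) < t" "t < \<tau>" for t
      proof (rule ccontr)
        assume "\<not> M < norm (u t)"
        then obtain w where w: "mild t (t + \<delta>) (u t) w" using \<delta>(2)[of t "u t"] t a by auto
        have "mild a t y u" using t \<tau> by (intro mild_u) auto
        then have "mild a (t + \<delta>) y (\<lambda>r. if r \<le> t then u r else w r)"
          using a t \<delta>(1) w by (intro mild_glue) auto
        then have "ereal (t + \<delta>) < Tm"
          using t \<delta>(1) by (intro less) (auto simp: S_def)
        then show False using t \<tau> by simp
      qed
      then show "\<forall>\<^sub>F t in at_left \<tau>. M < norm (u t)"
        using a\<tau> \<delta>(1) unfolding eventually_at_left_field
        by (intro exI[of _ "max a (\<tau> - \<delta>)"]) auto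
    qed
  qed
qed

end

text \<open>The semilinear theory over the identity evolution, where a mild solution is a primitive.
  Linear growth and Gronwall's inequality bound it on bounded intervals, so the blow-up alternative
  forces global existence.\<close>

theorem linear_ode_exists:
  fixes B :: "real \<Rightarrow> 'y::banach \<Rightarrow> 'y"
  assumes lin: "\<And>t. linear (B t)"
    and B_bounded: "\<And>T. \<exists>K. \<forall>t x. 0 \<le> t \<longrightarrow> t \<le> T \<longrightarrow> norm (B t x) \<le> K * norm x"
    and cont: "\<And>x. continuous_on {0..} (\<lambda>t. B t x)"
    and a: "0 \<le> a"
  shows "\<exists>u. u a = y \<and> (\<forall>t\<ge>a. (u has_vector_derivative B t (u t)) (at t within {a..}))"
proof -
  interpret semilinear "\<lambda>t s y. y" B
  proof unfold_locales
    show "\<exists>C. \<forall>s t (y :: 'y). 0 \<le> s \<longrightarrow> s \<le> t \<longrightarrow> t \<le> T \<longrightarrow> norm y \<le> C * norm y" for T :: real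
      by (rule exI[of _ 1]) simp
    show "\<exists>L. \<forall>t x y. 0 \<le> t \<longrightarrow> t \<le> T \<longrightarrow> norm x \<le> R \<longrightarrow> norm y \<le> R \<longrightarrow>
        norm (B t x - B t y) \<le> L * norm (x - y)" for T R
      using B_bounded[of T] linear_diff[OF lin] by metis
  qed (auto simp: case_prod_unfold cont)
  obtain Tm u where Tm: "ereal a < Tm" and u: "\<And>b. a \<le> b \<Longrightarrow> ereal b < Tm \<Longrightarrow> mild a b y u"
    and blowup: "\<And>\<tau>. Tm = ereal \<tau> \<Longrightarrow> filterlim (\<lambda>t. norm (u t)) at_top (at_left \<tau>)"
    using mild_maximal[OF a, of y] by metis
  have int: "u t = y + integral {a..t} (\<lambda>s. B s (u s))" if "a \<le> t" "ereal t < Tm" for t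
    using u[OF that] that by (auto simp: mild_def duhamel_def)
  have cu: "continuous_on {a..b} u" if "a \<le> b" "ereal b < Tm" for b
    using u[OF that] by (simp add: mild_def)
  have "Tm = \<infinity>"
  proof (rule ccontr)
    assume "Tm \<noteq> \<infinity>"
    then obtain \<tau> where \<tau>: "Tm = ereal \<tau>" using Tm by (cases Tm) auto
    have a\<tau>: "a < \<tau>" using Tm \<tau> by simp
    obtain K where K: "\<forall>t x. 0 \<le> t \<longrightarrow> t \<le> \<tau> \<longrightarrow> norm (B t x) \<le> K * norm x"
      using B_bounded[of \<tau>] ..
    define K' where "K' = max K 0"
    have K': "0 \<le> K'" "\<And>t x. 0 \<le> t \<Longrightarrow> t \<le> \<tau> \<Longrightarrow> norm (B t x) \<le> K' * norm x"
    proof -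
      fix t x assume "0 \<le> t" "t \<le> \<tau>"
      then have "norm (B t x) \<le> K * norm x" using K by blast
      also have "\<dots> \<le> K' * norm x" by (intro mult_right_mono) (auto simp: K'_def)
      finally show "norm (B t x) \<le> K' * norm x" .
    qed (simp add: K'_def)
    define N where "N = norm y + K' * (exp (K' * (\<tau> - a)) * (norm y * (\<tau> - a)))"
    have bd: "norm (u t) \<le> N" if t: "a < t" "t < \<tau>" for t
    proof -
      have "norm (u t) \<le> norm y + K' * (exp (K' * (t - a)) * (norm y * (t - a)))"
      proof (rule gronwall_integral)
        show "continuous_on {a..t} (\<lambda>t. norm (u t))" using cu[of t] t \<tau> by (intro continuous_intros) auto
        fix r assume r: "r \<in> {a..t}"
        have cr: "continuous_on {a..r} u" using cu[of r] r t \<tau> by auto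
        have "norm (integral {a..r} (\<lambda>s. B s (u s))) \<le> integral {a..r} (\<lambda>s. K' * norm (u s))"
          using r t a by (intro integral_norm_bound_integral integrable_continuous_real continuous_on_G cr
              continuous_intros K') auto
        moreover have "norm (u r) \<le> norm y + norm (integral {a..r} (\<lambda>s. B s (u s)))"
          using int[of r] r t \<tau> norm_triangle_ineq by auto
        ultimately show "norm (u r) \<le> norm y + K' * integral {a..r} (\<lambda>t. norm (u t))" by simp
      qed (use t K' in auto)
      also have "\<dots> \<le> N" unfolding N_def
        using t K' by (intro add_left_mono mult_left_mono mult_mono) (auto intro!: mult_left_mono)
      finally show ?thesis .
    qed
    have "\<forall>\<^sub>F t in at_left \<tau>. N < norm (u t)" using blowup[OF \<tau>] by (simp add: filterlim_at_top_dense)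
    moreover have "\<forall>\<^sub>F t in at_left \<tau>. t \<in> {a<..<\<tau>}" by (rule eventually_at_leftI[OF _ a\<tau>])
    ultimately have "\<forall>\<^sub>F t in at_left \<tau>. False" by eventually_elim (use bd in force)
    then show False by simp
  qed
  then have int: "u t = y + integral {a..t} (\<lambda>s. B s (u s))" if "a \<le> t" for t
    using int that by simp
  have "(u has_vector_derivative B t (u t)) (at t within {a..})" if t: "t \<ge> a" for t
  proof -
    have cu: "continuous_on {a..t + 1} u" using cu \<open>Tm = \<infinity>\<close> t by simp
    have "((\<lambda>t. y + integral {a..t} (\<lambda>s. B s (u s))) has_vector_derivative 0 + B t (u t)) (at t within {a..t + 1})"
      using t by (intro has_vector_derivative_add has_vector_derivative_const
          integral_has_vector_derivative continuous_on_G a cu) auto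
    then have "((\<lambda>t. y + integral {a..t} (\<lambda>s. B s (u s))) has_vector_derivative B t (u t)) (at t within {a..})"
      by (simp add: at_within_atLeast_eq[of t "t + 1" a])
    then show ?thesis
      by (rule has_vector_derivative_transform[rotated 2]) (use int t in auto)
  qed
  moreover have "u a = y" using int[of a] by simp
  ultimately show ?thesis by blast
qed

section \<open>The discrete Laplacian\<close>

text \<open>A bounded operator on L2, so it drives an ordinary differential equation. Its bound
  degenerates as \<open>h\<close> tends to 0; only its sign enters the estimates that are uniform in
  \<open>h\<close>.\<close>

definition disc_laplacian :: "real \<Rightarrow> 'n::finite L2 \<Rightarrow> 'n L2" where
  "disc_laplacian h u = (\<Sum>i\<in>UNIV. (1 / h\<^sup>2) *\<^sub>R (shift i h u + shift i (- h) u - 2 *\<^sub>R u))"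

lemma bounded_linear_disc_laplacian: "bounded_linear (disc_laplacian h)"
  unfolding disc_laplacian_def[abs_def]
  by (intro bounded_linear_sum bounded_linear_compose[OF bounded_linear_scaleR_right]
      bounded_linear_sub bounded_linear_add bounded_linear_shift bounded_linear_scaleR_right)

lemma disc_laplacian_diff: "disc_laplacian h (u - v) = disc_laplacian h u - disc_laplacian h v"
  by (rule linear_diff[OF bounded_linear.linear[OF bounded_linear_disc_laplacian]])

text \<open>Shifts are isometries, so by Cauchy-Schwarz each shifted inner product is at most
  \<open>inner u u\<close>.\<close>

lemma inner_disc_laplacian_nonpos: "inner (disc_laplacian h u) u \<le> 0"
proof -
  have "inner ((1 / h\<^sup>2) *\<^sub>R (shift i h u + shift i (- h) u - 2 *\<^sub>R u)) u \<le> 0" for i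
  proof -
    have "inner (shift i h u) u \<le> inner u u" "inner (shift i (- h) u) u \<le> inner u u"
      using norm_cauchy_schwarz[of "shift i h u" u] norm_cauchy_schwarz[of "shift i (- h) u" u]
      by (simp_all add: power2_eq_square[symmetric] power2_norm_eq_inner)
    then have "(inner (shift i h u) u + inner (shift i (- h) u) u - 2 * inner u u) / h\<^sup>2 \<le> 0"
      by (intro divide_nonpos_nonneg) auto
    then show ?thesis by (simp add: inner_add_left inner_diff_left)
  qed
  then show ?thesis by (simp add: disc_laplacian_def inner_sum_left sum_nonpos)
qed

lemma disc_laplacian_commute:
  assumes P: "linear P" and c: "\<And>i s u. P (shift i s u) = shift i s (P u)"
  shows "disc_laplacian h (P u) = P (disc_laplacian h u)"
  by (simp add: disc_laplacian_def linear_sum[OF P] linear_scale[OF P] linear_diff[OF P]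
      linear_add[OF P] c)

lemma disc_laplacian_shift: "disc_laplacian h (shift i s u) = shift i s (disc_laplacian h u)"
  by (rule disc_laplacian_commute)
    (simp_all add: bounded_linear.linear bounded_linear_shift shift_commute[of _ _ i s])

lemma disc_laplacian_disc_laplacian:
  "disc_laplacian h (disc_laplacian k u) = disc_laplacian k (disc_laplacian h u)"
  by (rule disc_laplacian_commute)
    (simp_all add: bounded_linear.linear bounded_linear_disc_laplacian disc_laplacian_shift)

text \<open>Each central second difference is the double Steklov mean of the second weak derivative,
  shifted back by \<open>h\<close>; strong continuity gives the limit.\<close>

lemma disc_laplacian_tendsto:
  "((\<lambda>h. disc_laplacian h (L2_of_H2 u)) \<longlongrightarrow> laplacian u) (at_right 0)"
  unfolding disc_laplacian_def laplacian_def
proof (rule tendsto_sum)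
  fix i
  let ?u = "L2_of_H2 u" and ?v = "weak_derivative i (H1_of_H2 u)"
    and ?w = "weak_derivative i (weak_derivative_H2 i u)"
  have uv: "has_weak_derivative ?u i ?v" and vw: "has_weak_derivative ?v i ?w"
    using has_weak_derivative_weak_derivative[of "H1_of_H2 u" i]
      has_weak_derivative_weak_derivative[of "weak_derivative_H2 i u" i]
    by (simp_all add: L2_of_weak_derivative_H2)
  have "((\<lambda>h. shift i (- h) (iterated_mean [i, i] h ?w)) \<longlongrightarrow> ?w) (at_right 0)"
    by (rule shift_tendsto[OF iterated_mean_tendsto]) (auto intro!: tendsto_eq_intros)
  moreover have "\<forall>\<^sub>F h in at_right 0. shift i (- h) (iterated_mean [i, i] h ?w)
      = (1 / h\<^sup>2) *\<^sub>R (shift i h ?u + shift i (- h) ?u - 2 *\<^sub>R ?u)"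
    using eventually_at_right_less[of 0]
  proof eventually_elim
    case (elim h)
    define d where "d = (1 / h) *\<^sub>R (shift i h ?u - ?u)"
    have "d = shift_mean i h ?v" unfolding d_def by (rule shift_diff_eq_mean[OF uv elim])
    then have "has_weak_derivative d i (shift_mean i h ?w)"
      using shift_mean_preserves_weak_derivative[OF vw] by simp
    from shift_diff_eq_mean[OF this elim]
    have "iterated_mean [i, i] h ?w = (1 / h) *\<^sub>R (shift i h d - d)" by simp
    then have "shift i (- h) (iterated_mean [i, i] h ?w) = (1 / h) *\<^sub>R (d - shift i (- h) d)"
      by (simp add: shift_scaleR shift_diff shift_shift)
    also have "d - shift i (- h) d = (1 / h) *\<^sub>R (shift i h ?u + shift i (- h) ?u - 2 *\<^sub>R ?u)"
      by (simp add: d_def shift_scaleR shift_diff shift_shift scaleR_diff_right scaleR_add_right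
          scaleR_2[of ?u])
    finally show ?case by (simp add: power2_eq_square)
  qed
  ultimately show "((\<lambda>h. (1 / h\<^sup>2) *\<^sub>R (shift i h ?u + shift i (- h) ?u - 2 *\<^sub>R ?u)) \<longlongrightarrow> ?w) (at_right 0)"
    by (rule Lim_transform_eventually)
qed

definition mesh :: "nat \<Rightarrow> real" where "mesh m = inverse (real (Suc m))"

lemma mesh_pos: "mesh m > 0"
  by (simp add: mesh_def)

lemma filterlim_mesh: "filterlim mesh (at_right 0) sequentially"
  unfolding filterlim_at using LIMSEQ_inverse_real_of_nat mesh_pos by (auto simp: mesh_def[abs_def])

section \<open>Limits of differentiable functions\<close>

lemma has_vector_derivative_uniform_limit:
  fixes f :: "nat \<Rightarrow> real \<Rightarrow> 'a::banach"
  assumes d: "\<And>n t. t \<in> {a..b} \<Longrightarrow> (f n has_vector_derivative f' n t) (at t within {a..b})"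
    and f': "uniform_limit {a..b} f' g' sequentially"
    and f: "\<And>t. t \<in> {a..b} \<Longrightarrow> (\<lambda>n. f n t) \<longlonglongrightarrow> g t"
    and t: "t \<in> {a..b}"
  shows "(g has_vector_derivative g' t) (at t within {a..b})"
proof -
  have "\<exists>g2. \<forall>x\<in>{a..b}. (\<lambda>n. f n x) \<longlonglongrightarrow> g2 x \<and> (g2 has_derivative (\<lambda>h. h *\<^sub>R g' x)) (at x within {a..b})"
  proof (rule has_derivative_sequence)
    show "(f n has_derivative (\<lambda>h. h *\<^sub>R f' n x)) (at x within {a..b})" if "x \<in> {a..b}" for n x
      using d[OF that] by (simp add: has_vector_derivative_def)
    show "\<forall>\<^sub>F n in sequentially. \<forall>x\<in>{a..b}. \<forall>h. norm (h *\<^sub>R f' n x - h *\<^sub>R g' x) \<le> e * norm h" if "e > 0" for e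
      using uniform_limitD[OF f' that]
    proof eventually_elim
      case (elim n)
      have "\<bar>h\<bar> * norm (f' n x - g' x) \<le> \<bar>h\<bar> * e" if "x \<in> {a..b}" for x h
        using elim that by (intro mult_left_mono) (auto simp: dist_norm less_imp_le)
      then show ?case by (simp add: mult.commute flip: scaleR_diff_right)
    qed
    show "(\<lambda>n. f n t) \<longlonglongrightarrow> g t" by (rule f[OF t])
  qed (use t in auto)
  then obtain g2 where g2: "\<And>x. x \<in> {a..b} \<Longrightarrow> (\<lambda>n. f n x) \<longlonglongrightarrow> g2 x"
    "\<And>x. x \<in> {a..b} \<Longrightarrow> (g2 has_vector_derivative g' x) (at x within {a..b})"
    unfolding has_vector_derivative_def by metis
  have "g x = g2 x" if "x \<in> {a..b}" for x using LIMSEQ_unique[OF f g2(1)] that by blast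
  then show ?thesis by (rule has_vector_derivative_transform[OF t _ g2(2)[OF t]])
qed

lemma uniform_limit_scaleR_bounded:
  fixes f :: "'b \<Rightarrow> 'c \<Rightarrow> 'a::real_normed_vector"
  assumes f: "uniform_limit S f g F" and M: "\<And>t. t \<in> S \<Longrightarrow> \<bar>c t\<bar> \<le> M"
  shows "uniform_limit S (\<lambda>n t. c t *\<^sub>R f n t) (\<lambda>t. c t *\<^sub>R g t) F"
proof (rule uniform_limitI)
  fix e :: real assume e: "e > 0"
  have "\<forall>\<^sub>F n in F. \<forall>x\<in>S. dist (f n x) (g x) < e / (\<bar>M\<bar> + 1)"
    using e by (intro uniform_limitD[OF f]) auto
  then show "\<forall>\<^sub>F n in F. \<forall>x\<in>S. dist (c x *\<^sub>R f n x) (c x *\<^sub>R g x) < e"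
  proof eventually_elim
    case (elim n)
    show ?case
    proof
      fix x assume x: "x \<in> S"
      have "dist (c x *\<^sub>R f n x) (c x *\<^sub>R g x) = \<bar>c x\<bar> * dist (f n x) (g x)"
        by (simp add: dist_norm flip: scaleR_diff_right)
      also have "\<dots> \<le> (\<bar>M\<bar> + 1) * dist (f n x) (g x)"
        using M[OF x] by (intro mult_right_mono) auto
      also have "\<dots> < (\<bar>M\<bar> + 1) * (e / (\<bar>M\<bar> + 1))"
        using elim x by (intro mult_strict_left_mono) auto
      also have "\<dots> = e" by (simp add: nonzero_eq_divide_eq)
      finally show "dist (c x *\<^sub>R f n x) (c x *\<^sub>R g x) < e" .
    qed
  qed
qed

section \<open>A degenerate parabolic system\<close>

text \<open>With \<open>q = w + b w'\<close> the damped wave equation turns into the system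
  \<open>w' = \<alpha> (q - w)\<close>, \<open>q' = \<beta> \<Delta>q + \<gamma> (q - w)\<close> for \<open>\<alpha> = 1 / b\<close>, \<open>\<beta> = b\<close>, \<open>\<gamma> = (1 + b') / b\<close>,
  which is well-posed in \<open>L\<^sup>2 \<times> L\<^sup>2\<close>. It is solved as a limit of ordinary differential equations
  in which discrete Laplacians replace \<open>\<Delta>\<close>.\<close>

locale damped_system =
  fixes \<alpha> \<beta> \<gamma> :: "real \<Rightarrow> real"
  assumes cont: "continuous_on {0..} \<alpha>" "continuous_on {0..} \<beta>" "continuous_on {0..} \<gamma>"
    and \<beta>_nonneg: "\<And>t. 0 \<le> t \<Longrightarrow> 0 \<le> \<beta> t"
begin

definition field :: "real \<Rightarrow> real \<Rightarrow> 'n::finite L2 \<times> 'n L2 \<Rightarrow> 'n L2 \<times> 'n L2" where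
  "field h t z = (\<alpha> t *\<^sub>R (snd z - fst z), \<gamma> t *\<^sub>R (snd z - fst z) + \<beta> t *\<^sub>R disc_laplacian h (snd z))"

text \<open>Some common bound of the three coefficients on \<open>{0..T}\<close>, not necessarily
  the least; choosing one per \<open>T\<close> lets later constants be functions of
  \<open>T\<close>.\<close>

definition coeff_sup :: "real \<Rightarrow> real" where
  "coeff_sup T = (SOME M. 0 \<le> M \<and> (\<forall>t. 0 \<le> t \<longrightarrow> t \<le> T \<longrightarrow> \<bar>\<alpha> t\<bar> \<le> M \<and> \<bar>\<beta> t\<bar> \<le> M \<and> \<bar>\<gamma> t\<bar> \<le> M))"

lemma coeff_sup:
  shows coeff_sup_nonneg: "0 \<le> coeff_sup T"
    and \<alpha>_le: "0 \<le> t \<Longrightarrow> t \<le> T \<Longrightarrow> \<bar>\<alpha> t\<bar> \<le> coeff_sup T"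
    and \<beta>_le: "0 \<le> t \<Longrightarrow> t \<le> T \<Longrightarrow> \<bar>\<beta> t\<bar> \<le> coeff_sup T"
    and \<gamma>_le: "0 \<le> t \<Longrightarrow> t \<le> T \<Longrightarrow> \<bar>\<gamma> t\<bar> \<le> coeff_sup T"
proof -
  have "\<exists>R. \<forall>s\<in>{0..T}. norm (f s) \<le> R" if "continuous_on {0..} f" for f :: "real \<Rightarrow> real"
    by (rule continuous_on_Icc_bounded) (rule continuous_on_subset[OF that], auto)
  from this[OF cont(1)] this[OF cont(2)] this[OF cont(3)]
  obtain A B C where "\<forall>s\<in>{0..T}. \<bar>\<alpha> s\<bar> \<le> A" "\<forall>s\<in>{0..T}. \<bar>\<beta> s\<bar> \<le> B" "\<forall>s\<in>{0..T}. \<bar>\<gamma> s\<bar> \<le> C"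
    by auto
  then have "\<exists>M. 0 \<le> M \<and> (\<forall>t. 0 \<le> t \<longrightarrow> t \<le> T \<longrightarrow> \<bar>\<alpha> t\<bar> \<le> M \<and> \<bar>\<beta> t\<bar> \<le> M \<and> \<bar>\<gamma> t\<bar> \<le> M)"
    by (intro exI[of _ "max 0 (max A (max B C))"]) (simp add: le_max_iff_disj)
  from someI_ex[OF this, folded coeff_sup_def]
  show "0 \<le> coeff_sup T" "0 \<le> t \<Longrightarrow> t \<le> T \<Longrightarrow> \<bar>\<alpha> t\<bar> \<le> coeff_sup T"
    "0 \<le> t \<Longrightarrow> t \<le> T \<Longrightarrow> \<bar>\<beta> t\<bar> \<le> coeff_sup T" "0 \<le> t \<Longrightarrow> t \<le> T \<Longrightarrow> \<bar>\<gamma> t\<bar> \<le> coeff_sup T"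
    by auto
qed

text \<open>The rate in the energy estimate: twice the two coupling terms of size
  \<open>2 * M * N\<close> give the 8, Young's inequality for the forcing gives the 1.\<close>

definition growth :: "real \<Rightarrow> real" where "growth T = 8 * coeff_sup T + 1"

lemma growth_nonneg: "0 \<le> growth T"
  using coeff_sup_nonneg[of T] by (simp add: growth_def)

definition evol_const :: "real \<Rightarrow> real" where "evol_const T = exp (growth T * \<bar>T\<bar>)"

lemma evol_const_ge_1: "1 \<le> evol_const T"
  using growth_nonneg[of T] by (simp add: evol_const_def)

lemma linear_field: "linear (field h t)"
proof (rule linearI)
  note l = bounded_linear.linear[OF bounded_linear_disc_laplacian]
  show "field h t (x + y) = field h t x + field h t y" for x y :: "'n::finite L2 \<times> 'n L2"
    by (simp add: field_def linear_add[OF l] scaleR_right_distrib scaleR_diff_right)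
  show "field h t (c *\<^sub>R x) = c *\<^sub>R field h t x" for c and x :: "'n::finite L2 \<times> 'n L2"
    by (simp add: field_def linear_scale[OF l] scaleR_right_distrib scaleR_diff_right mult_ac)
qed

lemma norm_fst_le: "norm (fst z) \<le> norm z" and norm_snd_le: "norm (snd z) \<le> norm z"
  for z :: "'x::real_normed_vector \<times> 'y::real_normed_vector"
  using norm_ge_zero real_sqrt_le_mono[of "(norm (fst z))\<^sup>2" "(norm (fst z))\<^sup>2 + (norm (snd z))\<^sup>2"]
    real_sqrt_le_mono[of "(norm (snd z))\<^sup>2" "(norm (fst z))\<^sup>2 + (norm (snd z))\<^sup>2"]
  by (auto simp: norm_prod_def)

lemma field_bounded: "\<exists>K. \<forall>t (x :: 'n::finite L2 \<times> 'n L2). 0 \<le> t \<longrightarrow> t \<le> T \<longrightarrow> norm (field h t x) \<le> K * norm x"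
proof -
  define M where "M = coeff_sup T"
  note M = coeff_sup_nonneg[of T, folded M_def] \<alpha>_le[of _ T, folded M_def] \<beta>_le[of _ T, folded M_def] \<gamma>_le[of _ T, folded M_def]
  obtain D where D: "D \<ge> 0" "\<And>u :: 'n L2. norm (disc_laplacian h u) \<le> norm u * D"
    using bounded_linear.nonneg_bounded[OF bounded_linear_disc_laplacian] by metis
  have "norm (field h t x) \<le> (M * 2 + (M * 2 + M * D)) * norm x" if "0 \<le> t" "t \<le> T"
    for t and x :: "'n L2 \<times> 'n L2"
  proof -
    let ?d = "snd x - fst x"
    have d: "norm ?d \<le> 2 * norm x"
      using norm_triangle_ineq4[of "snd x" "fst x"] norm_fst_le[of x] norm_snd_le[of x] by linarith
    have m: "norm (c *\<^sub>R y) \<le> M * k" if "\<bar>c\<bar> \<le> M" "norm y \<le> k" for c k and y :: "'n L2"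
      using that M(1) by (simp add: mult_mono)
    have l: "norm (disc_laplacian h (snd x)) \<le> D * norm x"
      using D(2)[of "snd x"] mult_left_mono[OF norm_snd_le[of x] D(1)] by (simp add: mult.commute)
    have "norm (field h t x) \<le> norm (\<alpha> t *\<^sub>R ?d) + norm (\<gamma> t *\<^sub>R ?d + \<beta> t *\<^sub>R disc_laplacian h (snd x))"
      unfolding field_def by (rule norm_Pair_le)
    also have "\<dots> \<le> M * (2 * norm x) + (M * (2 * norm x) + M * (D * norm x))"
      using that M by (intro add_mono order_trans[OF norm_triangle_ineq] m d l) auto
    finally show ?thesis by (simp add: algebra_simps)
  qed
  then show ?thesis by blast
qed

lemma field_continuous: "continuous_on {0..} (\<lambda>t. field h t x)"
  unfolding field_def by (intro continuous_intros cont)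

section \<open>Approximate evolutions and estimates uniform in the mesh\<close>

definition approx :: "real \<Rightarrow> real \<Rightarrow> 'n::finite L2 \<times> 'n L2 \<Rightarrow> real \<Rightarrow> 'n L2 \<times> 'n L2" where
  "approx h s z = (SOME u. u s = z \<and> (\<forall>t\<ge>s. (u has_vector_derivative field h t (u t)) (at t within {s..})))"

lemma approx:
  assumes "0 \<le> s"
  shows approx_initial: "approx h s z s = z"
    and approx_derivative: "\<And>t. s \<le> t \<Longrightarrow>
      (approx h s z has_vector_derivative field h t (approx h s z t)) (at t within {s..})"
  using someI_ex[OF linear_ode_exists[of "field h" s z, OF linear_field field_bounded field_continuous assms], folded approx_def]
  by auto

text \<open>The forcing sits in the second component only: this is where two approximations with
  different meshes differ.\<close>

definition forced_solution :: "real \<Rightarrow> real \<Rightarrow> real \<Rightarrow> (real \<Rightarrow> 'n::finite L2 \<times> 'n L2) \<Rightarrow> (real \<Rightarrow> 'n L2) \<Rightarrow> bool" where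
  "forced_solution h s t u f \<longleftrightarrow>
    (\<forall>r\<in>{s..t}. (u has_vector_derivative field h r (u r) + (0, f r)) (at r within {s..t}))"

text \<open>Gronwall's inequality for the squared norm. The coupling is bounded and the discrete
  Laplacian contributes with a favourable sign, so the constants are independent of
  \<open>h\<close>.\<close>

lemma energy:
  fixes u :: "real \<Rightarrow> 'n::finite L2 \<times> 'n L2"
  assumes st: "0 \<le> s" "s \<le> t" "t \<le> T" and fs: "forced_solution h s t u f"
    and F: "\<And>r. r \<in> {s..t} \<Longrightarrow> norm (f r) \<le> F"
  shows "(norm (u t))\<^sup>2 \<le> exp (growth T * (t - s)) * ((norm (u s))\<^sup>2 + F\<^sup>2 * (t - s))"
proof -
  define M where "M = coeff_sup T"
  note M = coeff_sup_nonneg[of T, folded M_def] \<alpha>_le[of _ T, folded M_def] \<gamma>_le[of _ T, folded M_def]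
  have "(norm (u t))\<^sup>2 \<le> exp ((8 * M + 1) * (t - s)) * ((norm (u s))\<^sup>2 + F\<^sup>2 * (t - s))"
      unfolding power2_norm_eq_inner
    proof (rule gronwall_differential[OF st(2)])
      have u: "(u has_vector_derivative field h r (u r) + (0, f r)) (at r within {s..t})"
        if "r \<in> {s..t}" for r
        using fs that by (simp add: forced_solution_def)
      fix r assume r: "r \<in> {s..t}"
      let ?u' = "field h r (u r) + (0, f r)"
      show "((\<lambda>r. inner (u r) (u r)) has_real_derivative inner (u r) ?u' + inner ?u' (u r)) (at r within {s..t})"
        unfolding has_real_derivative_iff_has_vector_derivative
        by (rule bounded_bilinear.has_vector_derivative[OF bounded_bilinear_inner u[OF r] u[OF r]])
      obtain w q where wq: "u r = (w, q)" by (cases "u r")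
      define N where "N = (norm w)\<^sup>2 + (norm q)\<^sup>2"
      have 1: "c * inner x (q - w) \<le> M * (2 * N)" if c: "\<bar>c\<bar> \<le> M" and x: "norm x \<le> sqrt N" for c x
      proof -
        have "norm w \<le> sqrt N" "norm q \<le> sqrt N" by (auto simp: N_def intro!: real_le_rsqrt)
        then have qw: "norm (q - w) \<le> 2 * sqrt N" using norm_triangle_ineq4[of q w] by linarith
        have N0: "N \<ge> 0" by (simp add: N_def)
        have "c * inner x (q - w) \<le> \<bar>c\<bar> * \<bar>inner x (q - w)\<bar>"
          using abs_ge_self[of "c * inner x (q - w)"] by (simp add: abs_mult)
        also have "\<dots> \<le> M * (norm x * norm (q - w))"
          using c M(1) by (intro mult_mono Cauchy_Schwarz_ineq2) auto
        also have "\<dots> \<le> M * (sqrt N * (2 * sqrt N))"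
          using M(1) N0 by (intro mult_left_mono mult_mono x qw) auto
        also have "\<dots> = M * (2 * N)" using N0 by simp
        finally show ?thesis .
      qed
      have "inner (u r) ?u' = \<alpha> r * inner w (q - w) + \<gamma> r * inner q (q - w)
          + \<beta> r * inner (disc_laplacian h q) q + inner q (f r)"
        by (simp add: wq field_def inner_add_right inner_commute)
      also have "\<dots> \<le> M * (2 * N) + M * (2 * N) + 0 + (N + F\<^sup>2) / 2"
      proof (intro add_mono 1)
        show "\<bar>\<alpha> r\<bar> \<le> M" "\<bar>\<gamma> r\<bar> \<le> M" using r st by (auto intro!: M)
        show "norm w \<le> sqrt N" "norm q \<le> sqrt N" by (auto simp: N_def intro!: real_le_rsqrt)
        show "\<beta> r * inner (disc_laplacian h q) q \<le> 0"
          using r st \<beta>_nonneg[of r] inner_disc_laplacian_nonpos by (intro mult_nonneg_nonpos) auto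
        have "inner q (f r) \<le> norm q * norm (f r)" by (rule norm_cauchy_schwarz)
        also have "\<dots> \<le> norm q * F" using F[OF r] by (intro mult_left_mono) auto
        also have "\<dots> \<le> ((norm q)\<^sup>2 + F\<^sup>2) / 2" using sum_squares_bound[of "norm q" F] by simp
        also have "\<dots> \<le> (N + F\<^sup>2) / 2" by (simp add: N_def)
        finally show "inner q (f r) \<le> (N + F\<^sup>2) / 2" .
      qed
      finally have "inner (u r) ?u' \<le> M * (2 * N) + M * (2 * N) + 0 + (N + F\<^sup>2) / 2" .
      then have "2 * inner (u r) ?u' \<le> 2 * (M * (2 * N) + M * (2 * N) + 0 + (N + F\<^sup>2) / 2)"
        by (rule mult_left_mono) simp
      also have "\<dots> = (8 * M + 1) * N + F\<^sup>2" by (simp add: algebra_simps)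
      finally have "2 * inner (u r) ?u' \<le> (8 * M + 1) * N + F\<^sup>2" .
      moreover have "inner (u r) (u r) = N" by (simp add: wq N_def power2_norm_eq_inner)
      ultimately show "inner (u r) ?u' + inner ?u' (u r) \<le> (8 * M + 1) * inner (u r) (u r) + F\<^sup>2"
        unfolding inner_commute[of ?u' "u r"] by (simp only: mult_2)
    qed (use M in auto)
  then show ?thesis by (simp add: growth_def M_def)
qed

lemma approx_derivative_Icc:
  assumes "0 \<le> s" "r \<in> {s..t}"
  shows "(approx h s z has_vector_derivative field h r (approx h s z r)) (at r within {s..t})"
  by (rule has_vector_derivative_within_subset[OF approx_derivative]) (use assms in auto)

lemma approx_continuous: "0 \<le> s \<Longrightarrow> continuous_on {s..t} (approx h s z)"
  by (rule continuous_on_vector_derivative) (rule approx_derivative_Icc)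

lemma approx_unique:
  assumes s: "0 \<le> s" "s \<le> t" and "u s = z"
    and u: "\<And>r. r \<in> {s..t} \<Longrightarrow> (u has_vector_derivative field h r (u r)) (at r within {s..t})"
  shows "u t = approx h s z t"
proof -
  let ?d = "\<lambda>r. u r - approx h s z r"
  have "forced_solution h s t ?d (\<lambda>_. 0)"
    unfolding forced_solution_def
  proof
    fix r assume r: "r \<in> {s..t}"
    have "(?d has_vector_derivative field h r (u r) - field h r (approx h s z r)) (at r within {s..t})"
      by (intro has_vector_derivative_diff u[OF r] approx_derivative_Icc[OF s(1) r])
    then show "(?d has_vector_derivative field h r (?d r) + (0, 0)) (at r within {s..t})"
      by (simp add: linear_diff[OF linear_field] flip: zero_prod_def)
  qed
  from energy[OF s order_refl this, of 0]
  have "(norm (?d t))\<^sup>2 \<le> exp (growth t * (t - s)) * ((norm (?d s))\<^sup>2 + 0\<^sup>2 * (t - s))" by simp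
  then show ?thesis using assms by (simp add: approx_initial)
qed

lemma approx_bound:
  assumes st: "0 \<le> s" "s \<le> t" "t \<le> T"
  shows "norm (approx h s z t) \<le> evol_const T * norm z"
proof -
  have "forced_solution h s t (approx h s z) (\<lambda>_. 0)"
    unfolding forced_solution_def
  proof
    show "(approx h s z has_vector_derivative field h r (approx h s z r) + (0, 0)) (at r within {s..t})"
      if "r \<in> {s..t}" for r
      using approx_derivative_Icc[OF st(1) that] by (simp flip: zero_prod_def)
  qed
  from energy[OF st this, of 0]
  have "(norm (approx h s z t))\<^sup>2 \<le> exp (growth T * (t - s)) * (norm z)\<^sup>2"
    using st by (simp add: approx_initial)
  also have "\<dots> \<le> (evol_const T)\<^sup>2 * (norm z)\<^sup>2"
  proof (intro mult_right_mono)
    have "exp (growth T * (t - s)) \<le> evol_const T"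
      unfolding evol_const_def using st growth_nonneg[of T] by (auto intro!: mult_left_mono)
    also have "\<dots> \<le> (evol_const T)\<^sup>2"
      using evol_const_ge_1[of T] mult_right_mono[of 1 "evol_const T" "evol_const T"]
      by (simp add: power2_eq_square)
    finally show "exp (growth T * (t - s)) \<le> (evol_const T)\<^sup>2" .
  qed auto
  finally have "(norm (approx h s z t))\<^sup>2 \<le> (evol_const T * norm z)\<^sup>2"
    by (simp only: power_mult_distrib)
  moreover have "0 \<le> evol_const T * norm z"
    using evol_const_ge_1[of T] by (intro mult_nonneg_nonneg) auto
  ultimately show ?thesis by (rule power2_le_imp_le)
qed

lemma approx_add:
  assumes "0 \<le> s" "s \<le> t" shows "approx h s (x + y) t = approx h s x t + approx h s y t"
  by (rule approx_unique[OF assms, symmetric])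
    (auto simp: approx_initial assms linear_add[OF linear_field]
      intro!: has_vector_derivative_add approx_derivative_Icc)

lemma approx_scaleR:
  assumes "0 \<le> s" "s \<le> t" shows "approx h s (c *\<^sub>R x) t = c *\<^sub>R approx h s x t"
  by (rule approx_unique[OF assms, symmetric])
    (auto simp: approx_initial assms linear_scale[OF linear_field]
      intro!: bounded_linear.has_vector_derivative[OF bounded_linear_scaleR_right] approx_derivative_Icc)

lemma linear_approx: "0 \<le> s \<Longrightarrow> s \<le> t \<Longrightarrow> linear (\<lambda>z. approx h s z t)"
  by (intro linearI approx_add approx_scaleR)

text \<open>A bounded operator commuting with the discrete Laplacian maps solutions to solutions,
  and uniqueness does the rest. It is applied to discrete Laplacians of another mesh, for
  convergence, and to shifts, for regularity.\<close>

lemma approx_commute: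
  assumes P: "bounded_linear P" and c: "\<And>u. P (disc_laplacian h u) = disc_laplacian h (P u)"
    and st: "0 \<le> s" "s \<le> t"
  shows "approx h s (P (fst z), P (snd z)) t = (P (fst (approx h s z t)), P (snd (approx h s z t)))"
proof (rule approx_unique[OF st, symmetric])
  fix r assume r: "r \<in> {s..t}"
  note l = bounded_linear.linear[OF P]
  have "bounded_linear (\<lambda>z. (P (fst z), P (snd z)))"
    by (intro bounded_linear_Pair bounded_linear_compose[OF P] bounded_linear_fst bounded_linear_snd)
  from bounded_linear.has_vector_derivative[OF this approx_derivative_Icc[OF st(1) r, of h z]]
  show "((\<lambda>r. (P (fst (approx h s z r)), P (snd (approx h s z r)))) has_vector_derivative
      field h r (P (fst (approx h s z r)), P (snd (approx h s z r)))) (at r within {s..t})"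
    by (simp add: field_def linear_scale[OF l] linear_diff[OF l] linear_add[OF l] c)
qed (simp add: approx_initial st)

definition pair_disc_laplacian :: "real \<Rightarrow> 'n::finite L2 \<times> 'n L2 \<Rightarrow> 'n L2 \<times> 'n L2" where
  "pair_disc_laplacian h z = (disc_laplacian h (fst z), disc_laplacian h (snd z))"

lemma approx_pair_disc_laplacian:
  assumes "0 \<le> s" "s \<le> t"
  shows "approx h s (pair_disc_laplacian k z) t = pair_disc_laplacian k (approx h s z t)"
  unfolding pair_disc_laplacian_def
  by (rule approx_commute[OF bounded_linear_disc_laplacian _ assms]) (rule disc_laplacian_disc_laplacian)

text \<open>The discrete Laplacians commute with each other and hence with the approximate evolutions.
  So the difference of two approximations is driven by the difference of two discrete Laplacians
  applied to the initial value.\<close>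

lemma approx_uniformly_Cauchy_regular:
  assumes conv: "convergent (\<lambda>m. pair_disc_laplacian (mesh m) z)" and s: "0 \<le> s"
  shows "uniformly_Cauchy_on {s..T} (\<lambda>m. approx (mesh m) s (z :: 'n::finite L2 \<times> 'n L2))"
proof -
  let ?A = "\<lambda>m. pair_disc_laplacian (mesh m) :: 'n L2 \<times> 'n L2 \<Rightarrow> _"
  define C where "C = evol_const T"
  note C = evol_const_ge_1[of T, folded C_def] approx_bound[of _ _ T, folded C_def]
  define M where "M = coeff_sup T"
  note M = coeff_sup_nonneg[of T, folded M_def] \<alpha>_le[of _ T, folded M_def] \<beta>_le[of _ T, folded M_def] \<gamma>_le[of _ T, folded M_def]
  define K where "K = growth T"
  have K: "0 \<le> K" using growth_nonneg[of T] by (simp add: K_def)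
  define L where "L = exp (K * \<bar>T\<bar>) * (M * C)\<^sup>2 * \<bar>T\<bar>"
  have est: "(norm (approx (mesh m) s z t - approx (mesh k) s z t))\<^sup>2 \<le> L * (norm (?A m z - ?A k z))\<^sup>2"
    if t: "s \<le> t" "t \<le> T" for t m k
  proof -
    define F where "F = M * (C * norm (?A m z - ?A k z))"
    let ?d = "\<lambda>r. approx (mesh m) s z r - approx (mesh k) s z r"
    let ?f = "\<lambda>r. \<beta> r *\<^sub>R (disc_laplacian (mesh m) (snd (approx (mesh k) s z r))
      - disc_laplacian (mesh k) (snd (approx (mesh k) s z r)))"
    have "forced_solution (mesh m) s t ?d ?f"
      unfolding forced_solution_def
    proof
      fix r assume r: "r \<in> {s..t}"
      have "(?d has_vector_derivative field (mesh m) r (approx (mesh m) s z r)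
          - field (mesh k) r (approx (mesh k) s z r)) (at r within {s..t})"
        by (intro has_vector_derivative_diff approx_derivative_Icc[OF s r])
      moreover have "field (mesh m) r (approx (mesh m) s z r) - field (mesh k) r (approx (mesh k) s z r)
          = field (mesh m) r (?d r) + (0, ?f r)"
        by (simp add: field_def disc_laplacian_diff algebra_simps)
      ultimately show "(?d has_vector_derivative field (mesh m) r (?d r) + (0, ?f r)) (at r within {s..t})"
        by simp
    qed
    moreover have "norm (?f r) \<le> F" if r: "r \<in> {s..t}" for r
    proof -
      have "disc_laplacian (mesh m) (snd (approx (mesh k) s z r)) - disc_laplacian (mesh k) (snd (approx (mesh k) s z r))
          = snd (approx (mesh k) s (?A m z - ?A k z) r)"
        using r s by (simp add: linear_diff[OF linear_approx] approx_pair_disc_laplacian)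
          (simp add: pair_disc_laplacian_def)
      moreover have "norm (snd (approx (mesh k) s (?A m z - ?A k z) r)) \<le> C * norm (?A m z - ?A k z)"
        using r s t by (intro order_trans[OF norm_snd_le] C) auto
      ultimately show ?thesis
        using r s t M by (simp add: F_def mult_mono)
    qed
    ultimately have "(norm (?d t))\<^sup>2 \<le> exp (K * (t - s)) * ((norm (?d s))\<^sup>2 + F\<^sup>2 * (t - s))"
      unfolding K_def by (rule energy[OF s t])
    also have "\<dots> = exp (K * (t - s)) * (F\<^sup>2 * (t - s))" using s by (simp add: approx_initial)
    also have "\<dots> \<le> exp (K * \<bar>T\<bar>) * (F\<^sup>2 * \<bar>T\<bar>)"
      using s t K by (intro mult_mono) (auto intro!: mult_left_mono)
    also have "\<dots> = L * (norm (?A m z - ?A k z))\<^sup>2"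
      by (simp add: L_def F_def power_mult_distrib)
    finally show ?thesis .
  qed
  have L: "L \<ge> 0" by (simp add: L_def)
  show ?thesis
  proof (rule uniformly_Cauchy_onI)
    fix e :: real assume e: "e > 0"
    define e' where "e' = e / sqrt (L + 1)"
    have e': "e' > 0" using e L by (simp add: e'_def)
    have "Cauchy (\<lambda>m. ?A m z)" using conv by (rule convergent_Cauchy)
    then obtain N where N: "\<And>m k. m \<ge> N \<Longrightarrow> k \<ge> N \<Longrightarrow> norm (?A m z - ?A k z) < e'"
      using CauchyD[OF _ e'] by blast
    have "dist (approx (mesh m) s z t) (approx (mesh k) s z t) < e" if "t \<in> {s..T}" "m \<ge> N" "k \<ge> N" for t m k
    proof -
      have "(norm (approx (mesh m) s z t - approx (mesh k) s z t))\<^sup>2 \<le> L * (norm (?A m z - ?A k z))\<^sup>2"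
        using that by (intro est) auto
      also have "\<dots> \<le> L * e'\<^sup>2"
        using N[OF that(2,3)] L by (intro mult_left_mono power_mono) auto
      also have "\<dots> < (L + 1) * e'\<^sup>2" using e' by simp
      also have "\<dots> = e\<^sup>2" using L by (simp add: e'_def power_divide)
      finally show ?thesis using e unfolding dist_norm by (intro power2_less_imp_less[of _ e]) auto
    qed
    then show "\<exists>N. \<forall>t\<in>{s..T}. \<forall>m\<ge>N. \<forall>k\<ge>N. dist (approx (mesh m) s z t) (approx (mesh k) s z t) < e"
      by blast
  qed
qed

lemma pair_disc_laplacian_tendsto:
  "(\<lambda>m. pair_disc_laplacian (mesh m) (L2_of_H2 w, L2_of_H2 q)) \<longlonglongrightarrow> (laplacian w, laplacian q)"
  unfolding pair_disc_laplacian_def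
  unfolding fst_conv snd_conv
  by (intro tendsto_Pair filterlim_compose[OF disc_laplacian_tendsto filterlim_mesh])

text \<open>A three-epsilon argument: smoothed data have convergent discrete Laplacians and are
  dense, and the approximate evolutions are bounded uniformly in the mesh.\<close>

lemma approx_uniformly_Cauchy:
  assumes s: "0 \<le> s"
  shows "uniformly_Cauchy_on {s..T} (\<lambda>m. approx (mesh m) s (z :: 'n::finite L2 \<times> 'n L2))"
proof (rule uniformly_Cauchy_onI)
  fix e :: real assume e: "e > 0"
  define C where "C = evol_const T"
  note C = evol_const_ge_1[of T, folded C_def] approx_bound[of _ _ T, folded C_def]
  obtain S :: "nat \<Rightarrow> 'n L2 \<Rightarrow> 'n H2" where S: "\<And>f. (\<lambda>m. L2_of_H2 (S m f)) \<longlonglongrightarrow> f"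
    using smoothing_operators by metis
  have "(\<lambda>m. (L2_of_H2 (S m (fst z)), L2_of_H2 (S m (snd z)))) \<longlonglongrightarrow> (fst z, snd z)"
    by (intro tendsto_Pair S)
  then have "\<forall>\<^sub>F m in sequentially. dist (L2_of_H2 (S m (fst z)), L2_of_H2 (S m (snd z))) z < e / (3 * C)"
    using e C(1) by (intro tendstoD) auto
  then obtain m0 where m0: "dist (L2_of_H2 (S m0 (fst z)), L2_of_H2 (S m0 (snd z))) z < e / (3 * C)"
    by (auto simp: eventually_sequentially)
  define y where "y = (L2_of_H2 (S m0 (fst z)), L2_of_H2 (S m0 (snd z)))"
  have "convergent (\<lambda>m. pair_disc_laplacian (mesh m) y)"
    unfolding y_def by (rule convergentI[OF pair_disc_laplacian_tendsto])
  from approx_uniformly_Cauchy_regular[OF this s, of T] e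
  obtain N where N: "\<And>t m k. t \<in> {s..T} \<Longrightarrow> m \<ge> N \<Longrightarrow> k \<ge> N \<Longrightarrow>
      dist (approx (mesh m) s y t) (approx (mesh k) s y t) < e / 3"
    unfolding uniformly_Cauchy_on_def by (metis divide_pos_pos zero_less_numeral)
  have zy: "dist (approx h s z t) (approx h s y t) < e / 3" if "t \<in> {s..T}" for h t
  proof -
    have "dist (approx h s z t) (approx h s y t) = norm (approx h s (z - y) t)"
      using s that by (simp add: dist_norm linear_diff[OF linear_approx])
    also have "\<dots> \<le> C * norm (z - y)" using s that by (intro C) auto
    also have "\<dots> < C * (e / (3 * C))"
      using m0 C(1) unfolding y_def[symmetric] by (intro mult_strict_left_mono) (auto simp: dist_norm norm_minus_commute)
    also have "\<dots> = e / 3" using C(1) by simp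
    finally show ?thesis .
  qed
  have "dist (approx (mesh m) s z t) (approx (mesh k) s z t) < e" if "t \<in> {s..T}" "m \<ge> N" "k \<ge> N" for t m k
    using N[OF that] zy[OF that(1), of "mesh m"] zy[OF that(1), of "mesh k"]
      dist_triangle[of "approx (mesh m) s z t" "approx (mesh k) s z t" "approx (mesh m) s y t"]
      dist_triangle[of "approx (mesh m) s y t" "approx (mesh k) s z t" "approx (mesh k) s y t"]
    by (simp add: dist_commute)
  then show "\<exists>N. \<forall>t\<in>{s..T}. \<forall>m\<ge>N. \<forall>k\<ge>N. dist (approx (mesh m) s z t) (approx (mesh k) s z t) < e"
    by blast
qed

section \<open>The limit evolution and its regularity\<close>

definition evol :: "real \<Rightarrow> 'n::finite L2 \<times> 'n L2 \<Rightarrow> real \<Rightarrow> 'n L2 \<times> 'n L2" where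
  "evol s z t = lim (\<lambda>m. approx (mesh m) s z t)"

lemma evol_uniform_limit:
  "0 \<le> s \<Longrightarrow> uniform_limit {s..T} (\<lambda>m. approx (mesh m) s z) (evol s z) sequentially"
  using Cauchy_uniformly_convergent[OF approx_uniformly_Cauchy]
  unfolding uniformly_convergent_uniform_limit_iff evol_def[abs_def] .

lemma evol_tendsto: "0 \<le> s \<Longrightarrow> s \<le> t \<Longrightarrow> (\<lambda>m. approx (mesh m) s z t) \<longlonglongrightarrow> evol s z t"
  by (rule tendsto_uniform_limitI[OF evol_uniform_limit[where T = t]]) auto

lemma evol_initial: "0 \<le> s \<Longrightarrow> evol s z s = z"
  using LIMSEQ_unique[OF evol_tendsto[of s s z]] by (simp add: approx_initial LIMSEQ_const_iff)

lemma evol_bound: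
  assumes st: "0 \<le> s" "s \<le> t" "t \<le> T" shows "norm (evol s z t) \<le> evol_const T * norm z"
proof -
  have "(\<lambda>m. norm (approx (mesh m) s z t)) \<longlonglongrightarrow> norm (evol s z t)"
    using st by (intro tendsto_norm evol_tendsto)
  then show ?thesis
    by (rule LIMSEQ_le_const2) (intro exI allI impI approx_bound st)
qed

lemma linear_evol:
  assumes st: "0 \<le> s" "s \<le> t" shows "linear (\<lambda>z. evol s z t)"
proof (rule linearI)
  fix x y :: "'n::finite L2 \<times> 'n L2" and c :: real
  have "(\<lambda>m. approx (mesh m) s (x + y) t) \<longlonglongrightarrow> evol s x t + evol s y t"
    unfolding approx_add[OF st] by (intro tendsto_add evol_tendsto st)
  then show "evol s (x + y) t = evol s x t + evol s y t"
    using LIMSEQ_unique[OF evol_tendsto[OF st]] by blast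
  have "(\<lambda>m. approx (mesh m) s (c *\<^sub>R x) t) \<longlonglongrightarrow> c *\<^sub>R evol s x t"
    unfolding approx_scaleR[OF st] by (intro tendsto_scaleR tendsto_const evol_tendsto st)
  then show "evol s (c *\<^sub>R x) t = c *\<^sub>R evol s x t"
    using LIMSEQ_unique[OF evol_tendsto[OF st]] by blast
qed

lemma bounded_linear_evol:
  assumes st: "0 \<le> s" "s \<le> t" shows "bounded_linear (\<lambda>z :: 'n::finite L2 \<times> 'n L2. evol s z t)"
proof -
  note l = linear_evol[OF st]
  show ?thesis
  proof (rule bounded_linear_intro[where K = "evol_const t"])
    show "evol s (x + y) t = evol s x t + evol s y t" for x y :: "'n L2 \<times> 'n L2" by (rule linear_add[OF l])
    show "evol s (c *\<^sub>R x) t = c *\<^sub>R evol s x t" for c and x :: "'n L2 \<times> 'n L2" by (rule linear_scale[OF l])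
    show "norm (evol s x t) \<le> norm x * evol_const t" for x :: "'n L2 \<times> 'n L2"
      using evol_bound[OF st order_refl, of x] by (simp only: mult.commute)
  qed
qed

lemma evol_continuous_Icc: "0 \<le> s \<Longrightarrow> continuous_on {s..T} (evol s z)"
  by (rule uniform_limit_theorem[OF _ evol_uniform_limit])
    (auto intro: always_eventually approx_continuous)

text \<open>The limit evolution commutes with shifts, hence with difference quotients. For weakly
  differentiable data these converge, and continuity of the evolution passes the convergence on to
  the solution.\<close>

lemma evol_weak_derivative:
  assumes st: "0 \<le> s" "s \<le> t"
    and w: "has_weak_derivative w i w'" and q: "has_weak_derivative q i q'"
  shows "has_weak_derivative (fst (evol s (w, q) t)) i (fst (evol s (w', q') t))"
    and "has_weak_derivative (snd (evol s (w, q) t)) i (snd (evol s (w', q') t))"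
proof -
  let ?S = "\<lambda>h z. (shift i h (fst z), shift i h (snd z))"
  have S: "evol s (?S h z) t = ?S h (evol s z t)" for h z
  proof -
    have "(\<lambda>m. ?S h (approx (mesh m) s z t)) \<longlonglongrightarrow> ?S h (evol s z t)"
      by (intro tendsto_Pair bounded_linear.tendsto[OF bounded_linear_shift] tendsto_fst tendsto_snd evol_tendsto st)
    moreover have "?S h (approx (mesh m) s z t) = approx (mesh m) s (?S h z) t" for m
      by (rule approx_commute[OF bounded_linear_shift _ st, symmetric]) (simp add: disc_laplacian_shift)
    ultimately show ?thesis using LIMSEQ_unique[OF evol_tendsto[OF st]] by simp
  qed
  have "((\<lambda>h. ((1 / h) *\<^sub>R (shift i h w - w), (1 / h) *\<^sub>R (shift i h q - q))) \<longlongrightarrow> (w', q')) (at_right 0)"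
    by (intro tendsto_Pair difference_quotient_tendsto w q)
  then have lim: "((\<lambda>h. evol s ((1 / h) *\<^sub>R (shift i h w - w), (1 / h) *\<^sub>R (shift i h q - q)) t) \<longlongrightarrow> evol s (w', q') t) (at_right 0)"
    by (rule bounded_linear.tendsto[OF bounded_linear_evol[OF st]])
  have eq: "evol s ((1 / h) *\<^sub>R (shift i h w - w), (1 / h) *\<^sub>R (shift i h q - q)) t
      = (1 / h) *\<^sub>R (?S h (evol s (w, q) t) - evol s (w, q) t)" for h
  proof -
    have "((1 / h) *\<^sub>R (shift i h w - w), (1 / h) *\<^sub>R (shift i h q - q)) = (1 / h) *\<^sub>R (?S h (w, q) - (w, q))"
      by simp
    then show ?thesis
      by (simp only: linear_scale[OF linear_evol[OF st]] linear_diff[OF linear_evol[OF st]] S)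
  qed
  show "has_weak_derivative (fst (evol s (w, q) t)) i (fst (evol s (w', q') t))"
    using tendsto_fst[OF lim] unfolding eq by (intro has_weak_derivativeI_difference_quotient) simp
  show "has_weak_derivative (snd (evol s (w, q) t)) i (snd (evol s (w', q') t))"
    using tendsto_snd[OF lim] unfolding eq by (intro has_weak_derivativeI_difference_quotient) simp
qed

lemma evol_fst_derivative_Icc:
  assumes s: "0 \<le> s" and t: "t \<in> {s..T}"
  shows "((\<lambda>t. fst (evol s z t)) has_vector_derivative \<alpha> t *\<^sub>R (snd (evol s z t) - fst (evol s z t))) (at t within {s..T})"
proof (rule has_vector_derivative_uniform_limit[OF _ _ _ t])
  define M where "M = coeff_sup T"
  note M = coeff_sup_nonneg[of T, folded M_def] \<alpha>_le[of _ T, folded M_def] \<beta>_le[of _ T, folded M_def] \<gamma>_le[of _ T, folded M_def]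
  show "((\<lambda>t. fst (approx (mesh m) s z t)) has_vector_derivative
      \<alpha> t *\<^sub>R (snd (approx (mesh m) s z t) - fst (approx (mesh m) s z t))) (at t within {s..T})"
    if "t \<in> {s..T}" for m t
    using bounded_linear.has_vector_derivative[OF bounded_linear_fst approx_derivative_Icc[OF s that]]
    by (simp add: field_def)
  show "uniform_limit {s..T} (\<lambda>m t. \<alpha> t *\<^sub>R (snd (approx (mesh m) s z t) - fst (approx (mesh m) s z t)))
      (\<lambda>t. \<alpha> t *\<^sub>R (snd (evol s z t) - fst (evol s z t))) sequentially"
    by (rule uniform_limit_scaleR_bounded[where M = M])
      (use s M in \<open>auto intro!: uniform_limit_minus bounded_linear.uniform_limit[OF bounded_linear_fst]
        bounded_linear.uniform_limit[OF bounded_linear_snd] evol_uniform_limit\<close>)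
qed (use s in \<open>auto intro!: tendsto_fst evol_tendsto\<close>)

text \<open>The discrete Laplacian of an approximate solution is the approximate evolution of the
  discrete Laplacian of the data, and this converges uniformly. So \<Delta>q appears here as the
  evolution of the Laplacians \<open>y\<close> of the data.\<close>

lemma evol_snd_derivative_Icc:
  fixes w q :: "'n::finite H2"
  assumes s: "0 \<le> s" and t: "t \<in> {s..T}"
  defines "z \<equiv> (L2_of_H2 w, L2_of_H2 q)" and "y \<equiv> (laplacian w, laplacian q)"
  shows "((\<lambda>t. snd (evol s z t)) has_vector_derivative
    \<gamma> t *\<^sub>R (snd (evol s z t) - fst (evol s z t)) + \<beta> t *\<^sub>R snd (evol s y t)) (at t within {s..T})"
proof (rule has_vector_derivative_uniform_limit[OF _ _ _ t])
  define M where "M = coeff_sup T"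
  note M = coeff_sup_nonneg[of T, folded M_def] \<alpha>_le[of _ T, folded M_def] \<beta>_le[of _ T, folded M_def] \<gamma>_le[of _ T, folded M_def]
  let ?A = "\<lambda>m. pair_disc_laplacian (mesh m) z"
  have A: "?A \<longlonglongrightarrow> y" unfolding z_def y_def by (rule pair_disc_laplacian_tendsto)
  show "((\<lambda>t. snd (approx (mesh m) s z t)) has_vector_derivative
      \<gamma> t *\<^sub>R (snd (approx (mesh m) s z t) - fst (approx (mesh m) s z t))
      + \<beta> t *\<^sub>R snd (approx (mesh m) s (?A m) t)) (at t within {s..T})"
    if "t \<in> {s..T}" for m t
    using bounded_linear.has_vector_derivative[OF bounded_linear_snd approx_derivative_Icc[OF s that, of "mesh m" z]]
      s that
    by (simp add: field_def approx_pair_disc_laplacian) (simp add: pair_disc_laplacian_def)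
  define C where "C = evol_const T"
  note C = evol_const_ge_1[of T, folded C_def] approx_bound[of _ _ T, folded C_def]
  have unif: "uniform_limit {s..T} (\<lambda>m t. approx (mesh m) s (?A m) t) (evol s y) sequentially"
  proof (rule uniform_limitI)
    fix e :: real assume e: "e > 0"
    have "\<forall>\<^sub>F m in sequentially. dist (?A m) y < e / (2 * C)" using A e C(1) by (intro tendstoD) auto
    moreover have "\<forall>\<^sub>F m in sequentially. \<forall>t\<in>{s..T}. dist (approx (mesh m) s y t) (evol s y t) < e / 2"
      using e by (intro uniform_limitD[OF evol_uniform_limit[OF s]]) auto
    ultimately show "\<forall>\<^sub>F m in sequentially. \<forall>t\<in>{s..T}. dist (approx (mesh m) s (?A m) t) (evol s y t) < e"
    proof eventually_elim
      case (elim m)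
      show ?case
      proof
        fix t assume t: "t \<in> {s..T}"
        have "dist (approx (mesh m) s (?A m) t) (approx (mesh m) s y t) = norm (approx (mesh m) s (?A m - y) t)"
          using s t by (simp add: dist_norm linear_diff[OF linear_approx])
        also have "\<dots> \<le> C * norm (?A m - y)" using s t by (intro C) auto
        also have "\<dots> < C * (e / (2 * C))"
          using elim(1) C(1) by (intro mult_strict_left_mono) (auto simp: dist_norm)
        also have "\<dots> = e / 2" using C(1) by simp
        finally show "dist (approx (mesh m) s (?A m) t) (evol s y t) < e"
          using elim(2) t dist_triangle[of "approx (mesh m) s (?A m) t" "evol s y t" "approx (mesh m) s y t"]
          by fastforce
      qed
    qed
  qed
  have "uniform_limit {s..T} (\<lambda>m t. \<gamma> t *\<^sub>R (snd (approx (mesh m) s z t) - fst (approx (mesh m) s z t)))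
      (\<lambda>t. \<gamma> t *\<^sub>R (snd (evol s z t) - fst (evol s z t))) sequentially"
    by (rule uniform_limit_scaleR_bounded[where M = M])
      (use s M in \<open>auto intro!: uniform_limit_minus bounded_linear.uniform_limit[OF bounded_linear_fst]
        bounded_linear.uniform_limit[OF bounded_linear_snd] evol_uniform_limit\<close>)
  moreover have "uniform_limit {s..T} (\<lambda>m t. \<beta> t *\<^sub>R snd (approx (mesh m) s (?A m) t))
      (\<lambda>t. \<beta> t *\<^sub>R snd (evol s y t)) sequentially"
    by (rule uniform_limit_scaleR_bounded[where M = M])
      (use s M in \<open>auto intro!: bounded_linear.uniform_limit[OF bounded_linear_snd] unif\<close>)
  ultimately show "uniform_limit {s..T} (\<lambda>m t. \<gamma> t *\<^sub>R (snd (approx (mesh m) s z t) - fst (approx (mesh m) s z t))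
      + \<beta> t *\<^sub>R snd (approx (mesh m) s (?A m) t))
      (\<lambda>t. \<gamma> t *\<^sub>R (snd (evol s z t) - fst (evol s z t)) + \<beta> t *\<^sub>R snd (evol s y t)) sequentially"
    by (rule uniform_limit_add)
qed (use s in \<open>auto intro!: tendsto_snd evol_tendsto\<close>)

end

section \<open>Strong solutions of the damped wave equation\<close>

lemma continuous_on_H1_iff:
  fixes f :: "'b::topological_space \<Rightarrow> 'n::finite H1"
  shows "continuous_on S f \<longleftrightarrow> continuous_on S (\<lambda>t. L2_of_H1 (f t)) \<and>
    (\<forall>i. continuous_on S (\<lambda>t. weak_derivative i (f t)))"
  unfolding continuous_on_def tendsto_H1_iff by blast

lemma continuous_on_H2_iff:
  fixes f :: "'b::topological_space \<Rightarrow> 'n::finite H2"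
  shows "continuous_on S f \<longleftrightarrow> continuous_on S (\<lambda>t. L2_of_H2 (f t)) \<and>
    (\<forall>i. continuous_on S (\<lambda>t. weak_derivative_H2 i (f t)))"
  unfolding continuous_on_def tendsto_H2_iff by blast

lemma L2_of_H2_eq_iff: "L2_of_H2 x = L2_of_H2 y \<longleftrightarrow> x = y"
  by (simp add: L2_of_H1_inject H1_of_H2_inject)

lemma inner_laplacian:
  "inner (laplacian u) (L2_of_H1 v) = - (\<Sum>i\<in>UNIV. inner (weak_derivative i (H1_of_H2 u)) (weak_derivative i v))"
proof -
  have "inner (weak_derivative i (weak_derivative_H2 i u)) (L2_of_H1 v)
      = - inner (weak_derivative i (H1_of_H2 u)) (weak_derivative i v)" for i
    using weak_derivative_integration_by_parts[OF
        has_weak_derivative_weak_derivative[of "weak_derivative_H2 i u" i] has_weak_derivative_weak_derivative[of v i]]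
    by (simp add: L2_of_weak_derivative_H2)
  then show ?thesis by (simp add: laplacian_def inner_sum_left sum_negf)
qed

lemma norm_diff_le_of_derivative:
  fixes f :: "real \<Rightarrow> 'a::banach"
  assumes "s \<le> t" "\<And>r. r \<in> {s..t} \<Longrightarrow> (f has_vector_derivative f' r) (at r within {s..t})"
    and "\<And>r. r \<in> {s..t} \<Longrightarrow> norm (f' r) \<le> B"
  shows "norm (f t - f s) \<le> B * (t - s)"
proof -
  have B: "0 \<le> B" using order_trans[OF norm_ge_zero assms(3)[of s]] assms(1) by simp
  have "(f' has_integral f t - f s) {s..t}"
    using assms(1,2) by (rule fundamental_theorem_of_calculus)
  from has_integral_bound_real[OF B finite.emptyI this] show ?thesis
    using assms(1,3) by simp
qed

lemma norm_prod_squared: "(norm z)\<^sup>2 = (norm (fst z))\<^sup>2 + (norm (snd z))\<^sup>2"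
  for z :: "'x::real_normed_vector \<times> 'y::real_normed_vector"
  by (simp add: norm_prod_def)

locale damped_wave =
  fixes b0 \<beta> :: real
  assumes b0_pos: "b0 > 0"
begin

definition b :: "real \<Rightarrow> real" where "b t = b0 / (1 + t) powr \<beta>"

definition b' :: "real \<Rightarrow> real" where "b' t = - \<beta> * b t / (1 + t)"

lemma b_pos: "0 \<le> t \<Longrightarrow> b t > 0"
  using b0_pos by (simp add: b_def)

lemma b_derivative: "0 \<le> t \<Longrightarrow> (b has_real_derivative b' t) (at t within S)"
proof -
  assume t: "0 \<le> t"
  have "((\<lambda>t. b0 * (1 + t) powr (- \<beta>)) has_real_derivative b0 * (- \<beta> * (1 + t) powr (- \<beta> - 1))) (at t within S)"
    using t by (auto intro!: derivative_eq_intros)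
  moreover have "(\<lambda>t. b0 * (1 + t) powr (- \<beta>)) = b"
    by (auto simp: b_def powr_minus divide_inverse)
  moreover have "b0 * (- \<beta> * (1 + t) powr (- \<beta> - 1)) = b' t"
    using t by (simp add: b'_def b_def powr_diff powr_minus divide_inverse)
  ultimately show ?thesis by simp
qed

lemma b_continuous: "continuous_on {0..} b"
  by (rule DERIV_continuous_on[where D = b']) (auto intro: b_derivative)

lemma b'_continuous: "continuous_on {0..} b'"
  unfolding b'_def by (intro continuous_intros b_continuous) auto

text \<open>The third coefficient comes from differentiating \<open>q = w + b w'\<close> with
  \<open>w'' = \<Delta>q\<close>: this gives \<open>q' = (1 + b') w' + b \<Delta>q\<close>, where
  \<open>w' = (q - w) / b\<close>.\<close>

sublocale damped_system "\<lambda>t. 1 / b t" b "\<lambda>t. (1 + b' t) / b t"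
proof
  show "continuous_on {0..} (\<lambda>t. 1 / b t)" "continuous_on {0..} (\<lambda>t. (1 + b' t) / b t)"
    using b_pos by (auto intro!: continuous_intros b_continuous b'_continuous simp: less_imp_neq[THEN not_sym])
qed (auto intro: b_continuous less_imp_le b_pos)

section \<open>Lifting the evolution to \<open>H1\<close> and \<open>H2\<close>, and construction of
  strong solutions\<close>

lemma evol_continuous: "0 \<le> s \<Longrightarrow> continuous_on {s..} (evol s z)"
proof -
  assume s: "0 \<le> s"
  have "continuous (at t within {s..}) (evol s z)" if "t \<in> {s..}" for t
    using evol_continuous_Icc[OF s, of "t + 1" z] that
    by (simp add: continuous_on_eq_continuous_within at_within_atLeast_eq[of t "t + 1" s])
  then show ?thesis by (simp add: continuous_on_eq_continuous_within)
qed

lemma evol_fst_derivative: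
  assumes "0 \<le> s" "s \<le> t"
  shows "((\<lambda>t. fst (evol s z t)) has_vector_derivative (1 / b t) *\<^sub>R (snd (evol s z t) - fst (evol s z t))) (at t within {s..})"
  using evol_fst_derivative_Icc[OF assms(1), of t "t + 1" z] assms
  by (simp add: at_within_atLeast_eq[of t "t + 1" s])

lemma evol_snd_derivative:
  fixes w q :: "'n::finite H2"
  assumes "0 \<le> s" "s \<le> t"
  defines "z \<equiv> (L2_of_H2 w, L2_of_H2 q)" and "y \<equiv> (laplacian w, laplacian q)"
  shows "((\<lambda>t. snd (evol s z t)) has_vector_derivative
    ((1 + b' t) / b t) *\<^sub>R (snd (evol s z t) - fst (evol s z t)) + b t *\<^sub>R snd (evol s y t)) (at t within {s..})"
  unfolding z_def y_def
  using evol_snd_derivative_Icc[OF assms(1), of t "t + 1" w q] assms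
  by (simp add: at_within_atLeast_eq[of t "t + 1" s])

text \<open>A lift of the evolution through its L2 components: each weak derivative evolves by the
  same system. The lift to \<open>H2\<close> repeats this one order higher.\<close>

definition evol_H1 :: "real \<Rightarrow> 'n::finite H1 \<times> 'n H1 \<Rightarrow> real \<Rightarrow> 'n H1 \<times> 'n H1" where
  "evol_H1 s z t = (SOME x. (L2_of_H1 (fst x), L2_of_H1 (snd x)) = evol s (L2_of_H1 (fst z), L2_of_H1 (snd z)) t \<and>
    (\<forall>i. (weak_derivative i (fst x), weak_derivative i (snd x))
      = evol s (weak_derivative i (fst z), weak_derivative i (snd z)) t))"

lemma evol_H1:
  assumes st: "0 \<le> s" "s \<le> t"
  shows L2_of_evol_H1: "L2_of_H1 (fst (evol_H1 s z t)) = fst (evol s (L2_of_H1 (fst z), L2_of_H1 (snd z)) t)"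
    "L2_of_H1 (snd (evol_H1 s z t)) = snd (evol s (L2_of_H1 (fst z), L2_of_H1 (snd z)) t)"
    and weak_derivative_evol_H1:
      "weak_derivative i (fst (evol_H1 s z t)) = fst (evol s (weak_derivative i (fst z), weak_derivative i (snd z)) t)"
      "weak_derivative i (snd (evol_H1 s z t)) = snd (evol s (weak_derivative i (fst z), weak_derivative i (snd z)) t)"
proof -
  let ?e = "evol s (L2_of_H1 (fst z), L2_of_H1 (snd z)) t"
    and ?d = "\<lambda>i. evol s (weak_derivative i (fst z), weak_derivative i (snd z)) t"
  have "\<exists>w. L2_of_H1 w = fst ?e \<and> (\<forall>i. weak_derivative i w = fst (?d i))"
    by (intro H1_exists evol_weak_derivative(1) st has_weak_derivative_weak_derivative)
  moreover have "\<exists>q. L2_of_H1 q = snd ?e \<and> (\<forall>i. weak_derivative i q = snd (?d i))"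
    by (intro H1_exists evol_weak_derivative(2) st has_weak_derivative_weak_derivative)
  ultimately obtain w q where "L2_of_H1 w = fst ?e" "\<And>i. weak_derivative i w = fst (?d i)"
    "L2_of_H1 q = snd ?e" "\<And>i. weak_derivative i q = snd (?d i)"
    by blast
  then have "\<exists>x. (L2_of_H1 (fst x), L2_of_H1 (snd x)) = ?e \<and>
      (\<forall>i. (weak_derivative i (fst x), weak_derivative i (snd x)) = ?d i)"
    by (intro exI[of _ "(w, q)"]) simp
  from someI_ex[OF this, folded evol_H1_def]
  have 1: "(L2_of_H1 (fst (evol_H1 s z t)), L2_of_H1 (snd (evol_H1 s z t))) = ?e"
    and 2: "(weak_derivative i (fst (evol_H1 s z t)), weak_derivative i (snd (evol_H1 s z t))) = ?d i" for i
    by blast+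
  show "L2_of_H1 (fst (evol_H1 s z t)) = fst ?e" "L2_of_H1 (snd (evol_H1 s z t)) = snd ?e"
    "weak_derivative i (fst (evol_H1 s z t)) = fst (?d i)" "weak_derivative i (snd (evol_H1 s z t)) = snd (?d i)"
    unfolding 1[symmetric] 2[symmetric] by simp_all
qed

definition evol_H2 :: "real \<Rightarrow> 'n::finite H2 \<times> 'n H2 \<Rightarrow> real \<Rightarrow> 'n H2 \<times> 'n H2" where
  "evol_H2 s z t = (SOME x. (H1_of_H2 (fst x), H1_of_H2 (snd x)) = evol_H1 s (H1_of_H2 (fst z), H1_of_H2 (snd z)) t \<and>
    (\<forall>i. (weak_derivative_H2 i (fst x), weak_derivative_H2 i (snd x))
      = evol_H1 s (weak_derivative_H2 i (fst z), weak_derivative_H2 i (snd z)) t))"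

lemma evol_H2:
  assumes st: "0 \<le> s" "s \<le> t"
  shows H1_of_evol_H2: "H1_of_H2 (fst (evol_H2 s z t)) = fst (evol_H1 s (H1_of_H2 (fst z), H1_of_H2 (snd z)) t)"
    "H1_of_H2 (snd (evol_H2 s z t)) = snd (evol_H1 s (H1_of_H2 (fst z), H1_of_H2 (snd z)) t)"
    and weak_derivative_evol_H2:
      "weak_derivative_H2 i (fst (evol_H2 s z t)) = fst (evol_H1 s (weak_derivative_H2 i (fst z), weak_derivative_H2 i (snd z)) t)"
      "weak_derivative_H2 i (snd (evol_H2 s z t)) = snd (evol_H1 s (weak_derivative_H2 i (fst z), weak_derivative_H2 i (snd z)) t)"
proof -
  let ?e = "evol_H1 s (H1_of_H2 (fst z), H1_of_H2 (snd z)) t"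
    and ?d = "\<lambda>i. evol_H1 s (weak_derivative_H2 i (fst z), weak_derivative_H2 i (snd z)) t"
  have "\<exists>w. H1_of_H2 w = fst ?e \<and> (\<forall>i. weak_derivative_H2 i w = fst (?d i))"
    by (rule H2_exists) (simp add: evol_H1[OF st] L2_of_weak_derivative_H2)
  moreover have "\<exists>q. H1_of_H2 q = snd ?e \<and> (\<forall>i. weak_derivative_H2 i q = snd (?d i))"
    by (rule H2_exists) (simp add: evol_H1[OF st] L2_of_weak_derivative_H2)
  ultimately obtain w q where "H1_of_H2 w = fst ?e" "\<And>i. weak_derivative_H2 i w = fst (?d i)"
    "H1_of_H2 q = snd ?e" "\<And>i. weak_derivative_H2 i q = snd (?d i)"
    by blast
  then have "\<exists>x. (H1_of_H2 (fst x), H1_of_H2 (snd x)) = ?e \<and>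
      (\<forall>i. (weak_derivative_H2 i (fst x), weak_derivative_H2 i (snd x)) = ?d i)"
    by (intro exI[of _ "(w, q)"]) simp
  from someI_ex[OF this, folded evol_H2_def]
  have 1: "(H1_of_H2 (fst (evol_H2 s z t)), H1_of_H2 (snd (evol_H2 s z t))) = ?e"
    and 2: "(weak_derivative_H2 i (fst (evol_H2 s z t)), weak_derivative_H2 i (snd (evol_H2 s z t))) = ?d i" for i
    by blast+
  show "H1_of_H2 (fst (evol_H2 s z t)) = fst ?e" "H1_of_H2 (snd (evol_H2 s z t)) = snd ?e"
    "weak_derivative_H2 i (fst (evol_H2 s z t)) = fst (?d i)" "weak_derivative_H2 i (snd (evol_H2 s z t)) = snd (?d i)"
    unfolding 1[symmetric] 2[symmetric] by simp_all
qed

lemma evol_H1_continuous: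
  assumes s: "0 \<le> s"
  shows "continuous_on {s..} (\<lambda>t. fst (evol_H1 s z t))" "continuous_on {s..} (\<lambda>t. snd (evol_H1 s z t))"
  unfolding continuous_on_H1_iff
  by (auto simp: evol_H1[OF s] intro!: continuous_on_fst continuous_on_snd evol_continuous[OF s] cong: continuous_on_cong_simp)

lemma evol_H2_continuous:
  assumes s: "0 \<le> s"
  shows "continuous_on {s..} (\<lambda>t. fst (evol_H2 s z t))" "continuous_on {s..} (\<lambda>t. snd (evol_H2 s z t))"
  unfolding continuous_on_H2_iff
  by (auto simp: evol_H2[OF s] evol_H1[OF s] intro!: continuous_on_fst continuous_on_snd evol_continuous[OF s]
      evol_H1_continuous[OF s] cong: continuous_on_cong_simp)

lemma has_vector_derivative_cong_atLeast:
  assumes "(f has_vector_derivative d) (at t within {s..})" "\<And>r. s \<le> r \<Longrightarrow> g r = f r" "s \<le> t"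
  shows "(g has_vector_derivative d) (at t within {s..})"
  by (rule has_vector_derivative_transform[OF _ _ assms(1)]) (use assms in auto)

lemma evol_H1_fst_derivative:
  assumes st: "0 \<le> s" "s \<le> t"
  shows "((\<lambda>t. fst (evol_H1 s z t)) has_vector_derivative
    (1 / b t) *\<^sub>R (snd (evol_H1 s z t) - fst (evol_H1 s z t))) (at t within {s..})"
  unfolding has_vector_derivative_H1_iff
proof (intro conjI allI)
  show "((\<lambda>t. L2_of_H1 (fst (evol_H1 s z t))) has_vector_derivative
      L2_of_H1 ((1 / b t) *\<^sub>R (snd (evol_H1 s z t) - fst (evol_H1 s z t)))) (at t within {s..})"
    unfolding scaleR_H1.rep_eq L2_of_H1_minus evol_H1[OF st]
    by (rule has_vector_derivative_cong_atLeast[OF evol_fst_derivative[OF st] evol_H1(1)[OF st(1)] st(2)])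
  show "((\<lambda>t. weak_derivative i (fst (evol_H1 s z t))) has_vector_derivative
      weak_derivative i ((1 / b t) *\<^sub>R (snd (evol_H1 s z t) - fst (evol_H1 s z t)))) (at t within {s..})" for i
    unfolding weak_derivative_scaleR weak_derivative_diff evol_H1[OF st]
    by (rule has_vector_derivative_cong_atLeast[OF evol_fst_derivative[OF st] evol_H1(3)[OF st(1)] st(2)])
qed

lemma L2_of_evol_H2:
  assumes st: "0 \<le> s" "s \<le> t"
  shows "L2_of_H2 (fst (evol_H2 s z t)) = fst (evol s (L2_of_H2 (fst z), L2_of_H2 (snd z)) t)"
    "L2_of_H2 (snd (evol_H2 s z t)) = snd (evol s (L2_of_H2 (fst z), L2_of_H2 (snd z)) t)"
  by (simp_all add: evol_H2[OF st] evol_H1[OF st])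

lemma evol_H2_fst_derivative:
  assumes st: "0 \<le> s" "s \<le> t"
  shows "((\<lambda>t. fst (evol_H2 s z t)) has_vector_derivative
    (1 / b t) *\<^sub>R (snd (evol_H2 s z t) - fst (evol_H2 s z t))) (at t within {s..})"
  unfolding has_vector_derivative_H2_iff
proof (intro conjI allI)
  show "((\<lambda>t. L2_of_H2 (fst (evol_H2 s z t))) has_vector_derivative
      L2_of_H2 ((1 / b t) *\<^sub>R (snd (evol_H2 s z t) - fst (evol_H2 s z t)))) (at t within {s..})"
    unfolding scaleR_H2.rep_eq H1_of_H2_minus scaleR_H1.rep_eq L2_of_H1_minus L2_of_evol_H2[OF st]
    by (rule has_vector_derivative_cong_atLeast[OF evol_fst_derivative[OF st] L2_of_evol_H2(1)[OF st(1)] st(2)])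
  show "((\<lambda>t. weak_derivative_H2 i (fst (evol_H2 s z t))) has_vector_derivative
      weak_derivative_H2 i ((1 / b t) *\<^sub>R (snd (evol_H2 s z t) - fst (evol_H2 s z t)))) (at t within {s..})" for i
    unfolding weak_derivative_H2_scaleR weak_derivative_H2_diff evol_H2[OF st]
    by (rule has_vector_derivative_cong_atLeast[OF evol_H1_fst_derivative[OF st] evol_H2(3)[OF st(1)] st(2)])
qed

lemma laplacian_evol_H2:
  assumes st: "0 \<le> s" "s \<le> t"
  shows "laplacian (snd (evol_H2 s z t)) = snd (evol s (laplacian (fst z), laplacian (snd z)) t)"
proof -
  let ?y = "\<lambda>i. (weak_derivative i (weak_derivative_H2 i (fst z)), weak_derivative i (weak_derivative_H2 i (snd z)))"
  have "laplacian (snd (evol_H2 s z t)) = (\<Sum>i\<in>UNIV. snd (evol s (?y i) t))"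
    by (simp add: laplacian_def evol_H2[OF st] evol_H1[OF st])
  also have "\<dots> = snd (\<Sum>i\<in>UNIV. evol s (?y i) t)"
    by (simp add: snd_sum)
  also have "(\<Sum>i\<in>UNIV. evol s (?y i) t) = evol s (\<Sum>i\<in>UNIV. ?y i) t"
    by (rule linear_sum[OF linear_evol[OF st], symmetric])
  also have "(\<Sum>i\<in>UNIV. ?y i) = (laplacian (fst z), laplacian (snd z))"
    by (simp add: prod_eq_iff fst_sum snd_sum laplacian_def)
  finally show ?thesis .
qed

text \<open>Initial values in the variables \<open>(w, q)\<close>. The next three definitions
  recover \<open>w\<close>, then \<open>w' = (q - w) / b\<close> and \<open>w'' = \<Delta>q\<close>
  from the solution of the system.\<close>

definition data :: "real \<Rightarrow> 'n::finite H2 \<times> 'n H2 \<Rightarrow> 'n H2 \<times> 'n H2" where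
  "data s g = (fst g, fst g + b s *\<^sub>R snd g)"

definition W :: "real \<Rightarrow> 'n::finite H2 \<times> 'n H2 \<Rightarrow> real \<Rightarrow> 'n H2" where
  "W s g t = fst (evol_H2 s (data s g) t)"

definition V :: "real \<Rightarrow> 'n::finite H2 \<times> 'n H2 \<Rightarrow> real \<Rightarrow> 'n H2" where
  "V s g t = (1 / b t) *\<^sub>R (snd (evol_H2 s (data s g) t) - fst (evol_H2 s (data s g) t))"

definition V' :: "real \<Rightarrow> 'n::finite H2 \<times> 'n H2 \<Rightarrow> real \<Rightarrow> 'n L2" where
  "V' s g t = laplacian (snd (evol_H2 s (data s g) t))"

definition solves :: "real \<Rightarrow> 'n::finite H2 \<times> 'n H2 \<Rightarrow> (real \<Rightarrow> 'n H2) \<Rightarrow> (real \<Rightarrow> 'n H2) \<Rightarrow> (real \<Rightarrow> 'n L2) \<Rightarrow> bool" where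
  "solves s g w w' w'' \<longleftrightarrow> C1_with_derivative {s..} w w' \<and>
    C1_with_derivative {s..} (\<lambda>t. L2_of_H2 (w' t)) w'' \<and> w s = fst g \<and> w' s = snd g \<and>
    (\<forall>t\<ge>s. w'' t - laplacian (w t) - b t *\<^sub>R laplacian (w' t) = 0)"

lemma strong_solution_iff: "strong_solution b0 \<beta> s g0 g1 w \<longleftrightarrow> (\<exists>w' w''. solves s (g0, g1) w w' w'')"
  by (simp add: strong_solution_def solves_def b_def)

lemma solves_W:
  assumes s: "0 \<le> s" shows "solves s g (W s g) (V s g) (V' s g)"
  unfolding solves_def C1_with_derivative_def
proof (intro conjI ballI allI impI)
  let ?z = "data s g"
  let ?y = "(L2_of_H2 (fst ?z), L2_of_H2 (snd ?z))" and ?l = "(laplacian (fst ?z), laplacian (snd ?z))"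
  note ll = bounded_linear.linear[OF bounded_linear_laplacian]
  have bnz: "b t \<noteq> 0" if "s \<le> t" for t using b_pos[of t] s that by auto
  show "(W s g has_vector_derivative V s g t) (at t within {s..})" if "t \<in> {s..}" for t
    unfolding W_def[abs_def] V_def using evol_H2_fst_derivative[OF s, of t ?z] that by simp
  have cb: "continuous_on {s..} (\<lambda>t. 1 / b t)"
    using s by (intro continuous_on_subset[OF cont(1)]) auto
  show "continuous_on {s..} (V s g)"
    unfolding V_def by (intro continuous_on_scaleR cb continuous_on_diff evol_H2_continuous s)
  have V'_eq: "V' s g t = snd (evol s ?l t)" if "s \<le> t" for t
    using that s by (simp add: V'_def laplacian_evol_H2)
  have "continuous_on {s..} (\<lambda>t. snd (evol s ?l t))"
    by (intro continuous_on_snd evol_continuous s)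
  then show "continuous_on {s..} (V' s g)"
    by (rule continuous_on_eq) (simp add: V'_eq)
  show "((\<lambda>t. L2_of_H2 (V s g t)) has_vector_derivative V' s g t) (at t within {s..})" if "t \<in> {s..}" for t
  proof -
    have t: "s \<le> t" "0 \<le> t" using that s by auto
    let ?d = "\<lambda>t. snd (evol s ?y t) - fst (evol s ?y t)"
    have db: "((\<lambda>t. 1 / b t) has_real_derivative - b' t / (b t)\<^sup>2) (at t within {s..})"
      using bnz[OF t(1)] b_derivative[OF t(2), of "{s..}"]
      by (auto intro!: derivative_eq_intros simp: power2_eq_square)
    have "((\<lambda>t. (1 / b t) *\<^sub>R ?d t) has_vector_derivative
        (1 / b t) *\<^sub>R ((((1 + b' t) / b t) *\<^sub>R ?d t + b t *\<^sub>R snd (evol s ?l t)) - (1 / b t) *\<^sub>R ?d t)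
        + (- b' t / (b t)\<^sup>2) *\<^sub>R ?d t) (at t within {s..})"
      by (intro has_vector_derivative_scaleR db has_vector_derivative_diff evol_snd_derivative evol_fst_derivative s t)
    \<comment> \<open>The coefficient \<open>(1 + b') / b\<close> is the one for which all multiples
      of \<open>q - w\<close> cancel, including the one from differentiating
      \<open>1 / b\<close>.\<close>
    moreover have "(1 / b t) *\<^sub>R ((((1 + b' t) / b t) *\<^sub>R x + b t *\<^sub>R y) - (1 / b t) *\<^sub>R x)
        + (- b' t / (b t)\<^sup>2) *\<^sub>R x = y" for x y :: "'a L2"
    proof -
      have "(1 / b t) *\<^sub>R ((((1 + b' t) / b t) *\<^sub>R x + b t *\<^sub>R y) - (1 / b t) *\<^sub>R x) + (- b' t / (b t)\<^sup>2) *\<^sub>R x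
          = ((1 / b t) * ((1 + b' t) / b t) - (1 / b t) * (1 / b t) - b' t / (b t)\<^sup>2) *\<^sub>R x + ((1 / b t) * b t) *\<^sub>R y"
        by (simp add: scaleR_diff_right scaleR_add_right scaleR_diff_left)
      also have "(1 / b t) * ((1 + b' t) / b t) - (1 / b t) * (1 / b t) - b' t / (b t)\<^sup>2 = 0"
        by (simp add: power2_eq_square add_divide_distrib)
      finally show ?thesis using bnz[OF t(1)] by simp
    qed
    ultimately have "((\<lambda>t. (1 / b t) *\<^sub>R ?d t) has_vector_derivative snd (evol s ?l t)) (at t within {s..})"
      by simp
    then have "((\<lambda>t. L2_of_H2 (V s g t)) has_vector_derivative snd (evol s ?l t)) (at t within {s..})"
      by (rule has_vector_derivative_cong_atLeast[OF _ _ t(1)])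
        (simp add: V_def scaleR_H2.rep_eq scaleR_H1.rep_eq H1_of_H2_minus L2_of_H1_minus L2_of_evol_H2[OF s])
    then show ?thesis by (simp add: V'_eq t)
  qed
  have "L2_of_H2 (W s g s) = L2_of_H2 (fst g)"
    by (simp add: W_def L2_of_evol_H2[OF s order_refl] evol_initial[OF s] data_def)
  then show Ws: "W s g s = fst g" by (simp only: L2_of_H2_eq_iff)
  have "L2_of_H2 (V s g s) = L2_of_H2 (snd g)"
    using bnz[of s]
    by (simp add: V_def L2_of_evol_H2[OF s order_refl] evol_initial[OF s] data_def scaleR_H2.rep_eq
        scaleR_H1.rep_eq H1_of_H2_minus L2_of_H1_minus plus_H2.rep_eq plus_H1.rep_eq)
  then show "V s g s = snd g" by (simp only: L2_of_H2_eq_iff)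
  fix t assume t: "s \<le> t"
  have "b t *\<^sub>R laplacian (V s g t) = laplacian (b t *\<^sub>R V s g t)" by (simp add: linear_scale[OF ll])
  also have "b t *\<^sub>R V s g t = snd (evol_H2 s ?z t) - W s g t" using bnz[OF t] by (simp add: V_def W_def)
  finally show "V' s g t - laplacian (W s g t) - b t *\<^sub>R laplacian (V s g t) = 0"
    by (simp add: V'_def linear_diff[OF ll])
qed

section \<open>Linearity, energy bounds and uniqueness for strong solutions\<close>

lemma solves_add:
  assumes "solves s g w w' w''" "solves s h v v' v''"
  shows "solves s (g + h) (\<lambda>t. w t + v t) (\<lambda>t. w' t + v' t) (\<lambda>t. w'' t + v'' t)"
proof -
  have "(w'' t + v'' t) - laplacian (w t + v t) - b t *\<^sub>R laplacian (w' t + v' t)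
      = (w'' t - laplacian (w t) - b t *\<^sub>R laplacian (w' t)) + (v'' t - laplacian (v t) - b t *\<^sub>R laplacian (v' t))" for t
    by (simp add: linear_add[OF bounded_linear.linear[OF bounded_linear_laplacian]] scaleR_add_right)
  moreover have "w'' t - laplacian (w t) - b t *\<^sub>R laplacian (w' t) = 0"
    "v'' t - laplacian (v t) - b t *\<^sub>R laplacian (v' t) = 0" if "s \<le> t" for t
    using assms that unfolding solves_def by blast+
  ultimately have eq0: "(w'' t + v'' t) - laplacian (w t + v t) - b t *\<^sub>R laplacian (w' t + v' t) = 0"
    if "s \<le> t" for t using that by (simp only: add_0_left)
  show ?thesis
    unfolding solves_def C1_with_derivative_def
  proof (intro conjI ballI allI impI)
    show "((\<lambda>t. w t + v t) has_vector_derivative w' t + v' t) (at t within {s..})"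
      "((\<lambda>t. L2_of_H2 (w' t + v' t)) has_vector_derivative w'' t + v'' t) (at t within {s..})"
      if "t \<in> {s..}" for t
      unfolding plus_H2.rep_eq plus_H1.rep_eq
      by (intro has_vector_derivative_add; use assms that in \<open>simp add: solves_def C1_with_derivative_def\<close>)+
    show "continuous_on {s..} (\<lambda>t. w' t + v' t)" "continuous_on {s..} (\<lambda>t. w'' t + v'' t)"
      by (intro continuous_on_add; use assms in \<open>simp add: solves_def C1_with_derivative_def\<close>)+
  qed (use assms eq0 in \<open>simp_all add: solves_def\<close>)
qed

lemma solves_scaleR:
  assumes "solves s g w w' w''"
  shows "solves s (c *\<^sub>R g) (\<lambda>t. c *\<^sub>R w t) (\<lambda>t. c *\<^sub>R w' t) (\<lambda>t. c *\<^sub>R w'' t)"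
proof -
  have "c *\<^sub>R w'' t - laplacian (c *\<^sub>R w t) - b t *\<^sub>R laplacian (c *\<^sub>R w' t)
      = c *\<^sub>R (w'' t - laplacian (w t) - b t *\<^sub>R laplacian (w' t))" for t
    by (simp add: linear_scale[OF bounded_linear.linear[OF bounded_linear_laplacian]] scaleR_diff_right mult.commute)
  then show ?thesis
    using assms unfolding solves_def C1_with_derivative_def
    by (auto intro!: bounded_linear.has_vector_derivative[OF bounded_linear_scaleR_right] continuous_on_scaleR continuous_on_const
        simp: scaleR_H2.rep_eq scaleR_H1.rep_eq)
qed

lemma solves_restrict:
  assumes "solves s g w w' w''" "s \<le> r" shows "solves r (w r, w' r) w w' w''"
  using assms unfolding solves_def C1_with_derivative_def
  by (auto intro: has_vector_derivative_within_subset continuous_on_subset)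

text \<open>The energy identity: \<open>d/dt (|w'|\<^sup>2 + |\<nabla>w|\<^sup>2) = - 2 b |\<nabla>w'|\<^sup>2\<close>.\<close>

lemma solves_energy:
  fixes g :: "'n::finite H2 \<times> 'n H2"
  assumes sol: "solves s g w w' w''" and st: "0 \<le> s" "s \<le> t"
  shows "(norm (L2_of_H2 (w' t)))\<^sup>2 + (\<Sum>i\<in>UNIV. (norm (weak_derivative i (H1_of_H2 (w t))))\<^sup>2)
    \<le> (norm (L2_of_H2 (snd g)))\<^sup>2 + (\<Sum>i\<in>UNIV. (norm (weak_derivative i (H1_of_H2 (fst g))))\<^sup>2)"
proof -
  let ?D = "\<lambda>i u. weak_derivative i (H1_of_H2 u)"
  let ?e = "\<lambda>t. inner (L2_of_H2 (w' t)) (L2_of_H2 (w' t)) + (\<Sum>i\<in>UNIV. inner (?D i (w t)) (?D i (w t)))"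
  let ?e' = "\<lambda>t. (inner (L2_of_H2 (w' t)) (w'' t) + inner (w'' t) (L2_of_H2 (w' t)))
    + (\<Sum>i\<in>UNIV. inner (?D i (w t)) (?D i (w' t)) + inner (?D i (w' t)) (?D i (w t)))"
  \<comment> \<open>Gronwall's inequality with both constants 0, that is, monotonicity of the
    energy.\<close>
  have "?e t \<le> exp (0 * (t - s)) * (?e s + 0 * (t - s))"
  proof (rule gronwall_differential[OF st(2), where f' = ?e'])
    fix r assume r: "r \<in> {s..t}"
    have w: "(w has_vector_derivative w' r) (at r within {s..t})"
      and w': "((\<lambda>t. L2_of_H2 (w' t)) has_vector_derivative w'' r) (at r within {s..t})"
      using sol r unfolding solves_def C1_with_derivative_def
      by (auto intro: has_vector_derivative_within_subset)
    have "bounded_linear (?D i)" for i :: 'n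
      by (rule bounded_linear_compose[OF bounded_linear_weak_derivative bounded_linear_H1_of_H2])
    from bounded_linear.has_vector_derivative[OF this w]
    have Dw: "((\<lambda>t. ?D i (w t)) has_vector_derivative ?D i (w' r)) (at r within {s..t})" for i .
    show "(?e has_real_derivative ?e' r) (at r within {s..t})"
      unfolding has_real_derivative_iff_has_vector_derivative
      by (intro has_vector_derivative_add has_vector_derivative_sum w' Dw
          bounded_bilinear.has_vector_derivative[OF bounded_bilinear_inner])
    have "w'' r = laplacian (w r) + b r *\<^sub>R laplacian (w' r)"
      using sol r unfolding solves_def by (simp add: algebra_simps)
    then have "inner (w'' r) (L2_of_H2 (w' r)) = - (\<Sum>i\<in>UNIV. inner (?D i (w r)) (?D i (w' r)))
        - b r * (\<Sum>i\<in>UNIV. inner (?D i (w' r)) (?D i (w' r)))"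
      by (simp add: inner_add_left inner_laplacian)
    then have "?e' r = - 2 * (b r * (\<Sum>i\<in>UNIV. inner (?D i (w' r)) (?D i (w' r))))"
      by (simp add: inner_commute[of "L2_of_H2 (w' r)"] inner_commute[of "?D _ (w' r)" "?D _ (w r)"] sum.distrib
          sum_distrib_left[symmetric])
    also have "\<dots> \<le> 0"
      using b_pos[of r] r st by (auto intro!: mult_nonneg_nonneg sum_nonneg)
    finally show "?e' r \<le> 0 * ?e r + 0" by simp
  qed auto
  then show ?thesis
    using sol unfolding solves_def by (simp add: power2_norm_eq_inner)
qed

text \<open>The inclusion of \<open>H2 \<times> H2\<close> in the energy space, in whose norm the
  flow is bounded and will be extended.\<close>

definition embed :: "'n::finite H2 \<times> 'n H2 \<Rightarrow> 'n H1 \<times> 'n L2" where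
  "embed g = (H1_of_H2 (fst g), L2_of_H2 (snd g))"

lemma bounded_linear_embed: "bounded_linear embed"
  unfolding embed_def[abs_def]
  by (intro bounded_linear_Pair bounded_linear_compose[OF bounded_linear_H1_of_H2 bounded_linear_fst]
      bounded_linear_compose[OF bounded_linear_L2_of_H2 bounded_linear_snd])

lemma embed_0: "embed 0 = 0"
  by (rule linear_0[OF bounded_linear.linear[OF bounded_linear_embed]])

lemma embed_eq_iff: "embed g = embed h \<longleftrightarrow> g = h"
  by (auto simp: embed_def prod_eq_iff H1_of_H2_inject L2_of_H2_eq_iff)

text \<open>The energy controls the gradient and the velocity, but not \<open>w\<close> itself in
  L2; that norm is bounded by integrating the velocity in time, whence the factor
  \<open>2 + T\<close>.\<close>

lemma solves_bound:
  fixes g :: "'n::finite H2 \<times> 'n H2"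
  assumes sol: "solves s g w w' w''" and st: "0 \<le> s" "s \<le> t" "t \<le> T"
  shows "norm (embed (w t, w' t)) \<le> (2 + T) * norm (embed g)"
proof -
  let ?N = "norm (embed g)"
  let ?grad = "\<lambda>u. \<Sum>i\<in>UNIV. (norm (weak_derivative i (H1_of_H2 u)))\<^sup>2"
  have N: "?N\<^sup>2 = (norm (L2_of_H2 (fst g)))\<^sup>2 + ?grad (fst g) + (norm (L2_of_H2 (snd g)))\<^sup>2"
    by (simp add: norm_prod_squared embed_def norm_H1_squared)
  have en: "(norm (L2_of_H2 (w' r)))\<^sup>2 + ?grad (w r) \<le> ?N\<^sup>2" if "s \<le> r" for r
    using solves_energy[OF sol st(1) that] N zero_le_power2[of "norm (L2_of_H2 (fst g))"] by linarith
  have "norm (L2_of_H2 (w t) - L2_of_H2 (w s)) \<le> ?N * (t - s)"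
  proof (rule norm_diff_le_of_derivative[OF st(2)])
    fix r assume r: "r \<in> {s..t}"
    have "(w has_vector_derivative w' r) (at r within {s..t})"
      using sol r unfolding solves_def C1_with_derivative_def
      by (auto intro: has_vector_derivative_within_subset)
    then show "((\<lambda>t. L2_of_H2 (w t)) has_vector_derivative L2_of_H2 (w' r)) (at r within {s..t})"
      by (rule bounded_linear.has_vector_derivative[OF bounded_linear_L2_of_H2])
    have "0 \<le> ?grad (w r)" by (intro sum_nonneg zero_le_power2)
    moreover have "(norm (L2_of_H2 (w' r)))\<^sup>2 + ?grad (w r) \<le> ?N\<^sup>2" using r by (intro en) simp
    ultimately have "(norm (L2_of_H2 (w' r)))\<^sup>2 \<le> ?N\<^sup>2" by linarith
    then show "norm (L2_of_H2 (w' r)) \<le> ?N" by (rule power2_le_imp_le) simp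
  qed
  also have "\<dots> \<le> ?N * T" using st by (intro mult_left_mono) auto
  finally have "norm (L2_of_H2 (w t) - L2_of_H2 (w s)) \<le> ?N * T" .
  moreover have "norm (L2_of_H2 (w s)) \<le> ?N"
    using sol order_trans[OF norm_L2_of_H1_le norm_fst_le[of "embed g"]]
    by (auto simp: solves_def embed_def)
  ultimately have "norm (L2_of_H2 (w t)) \<le> ?N * (1 + T)"
    using norm_triangle_ineq[of "L2_of_H2 (w t) - L2_of_H2 (w s)" "L2_of_H2 (w s)"]
    by (simp add: algebra_simps)
  then have "(norm (L2_of_H2 (w t)))\<^sup>2 \<le> (?N * (1 + T))\<^sup>2" by (intro power_mono) auto
  then have "(norm (embed (w t, w' t)))\<^sup>2 \<le> (?N * (1 + T))\<^sup>2 + ?N\<^sup>2"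
    using en[OF st(2)] by (simp add: norm_prod_squared embed_def norm_H1_squared)
  also have "\<dots> = ?N\<^sup>2 * ((1 + T)\<^sup>2 + 1)" 
    unfolding power_mult_distrib by (simp only: distrib_left mult_1_right)
  also have "\<dots> \<le> ?N\<^sup>2 * (2 + T)\<^sup>2"
    using st by (intro mult_left_mono) (auto simp: power2_eq_square algebra_simps)
  also have "\<dots> = ((2 + T) * ?N)\<^sup>2" by (simp add: power_mult_distrib)
  finally show ?thesis by (rule power2_le_imp_le) (use st in auto)
qed

lemma solves_unique:
  assumes w: "solves s g w w' w''" and v: "solves s g v v' v''" and st: "0 \<le> s" "s \<le> t"
  shows "w t = v t" "w' t = v' t"
proof -
  have "solves s (g + (-1) *\<^sub>R g) (\<lambda>t. w t + (-1) *\<^sub>R v t) (\<lambda>t. w' t + (-1) *\<^sub>R v' t) (\<lambda>t. w'' t + (-1) *\<^sub>R v'' t)"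
    by (intro solves_add solves_scaleR w v)
  from solves_bound[OF this st order_refl]
  have "norm (embed (w t - v t, w' t - v' t)) \<le> (2 + t) * norm (embed (g - g))" by simp
  then have "embed (w t - v t, w' t - v' t) = embed 0" by (simp add: embed_0)
  then show "w t = v t" "w' t = v' t" by (simp_all add: embed_eq_iff zero_prod_def)
qed

lemma R_strong_eq:
  assumes st: "0 \<le> s" "s \<le> t" shows "R_strong b0 \<beta> t s g0 g1 = W s (g0, g1) t"
  unfolding R_strong_def
proof (rule the_equality)
  show "\<exists>w. strong_solution b0 \<beta> s g0 g1 w \<and> W s (g0, g1) t = w t"
    using solves_W[OF st(1)] strong_solution_iff by blast
  fix v assume "\<exists>w. strong_solution b0 \<beta> s g0 g1 w \<and> v = w t"
  then show "v = W s (g0, g1) t"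
    using solves_unique(1)[OF _ solves_W[OF st(1)] st] strong_solution_iff by metis
qed

definition flow :: "real \<Rightarrow> real \<Rightarrow> 'n::finite H2 \<times> 'n H2 \<Rightarrow> 'n H2 \<times> 'n H2" where
  "flow t s g = (W s g t, V s g t)"

lemma flow_bound: "0 \<le> s \<Longrightarrow> s \<le> t \<Longrightarrow> t \<le> T \<Longrightarrow> norm (embed (flow t s g)) \<le> (2 + T) * norm (embed g)"
  unfolding flow_def by (rule solves_bound[OF solves_W])

lemma linear_flow:
  assumes st: "0 \<le> s" "s \<le> t" shows "linear (flow t s)"
proof (rule linearI)
  fix g h :: "'n::finite H2 \<times> 'n H2" and c :: real
  show "flow t s (g + h) = flow t s g + flow t s h"
    using solves_unique[OF solves_W[OF st(1)] solves_add[OF solves_W[OF st(1)] solves_W[OF st(1)]] st, of g h]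
    by (simp add: flow_def)
  show "flow t s (c *\<^sub>R g) = c *\<^sub>R flow t s g"
    using solves_unique[OF solves_W[OF st(1)] solves_scaleR[OF solves_W[OF st(1)]] st, of c g]
    by (simp add: flow_def)
qed

lemma flow_same: "0 \<le> s \<Longrightarrow> flow s s g = g"
  using solves_W[of s g] by (simp add: flow_def solves_def)

lemma flow_flow:
  assumes "0 \<le> r" "r \<le> s" "s \<le> t" shows "flow t s (flow s r g) = flow t r g"
proof -
  have "solves s (flow s r g) (W r g) (V r g) (V' r g)"
    unfolding flow_def by (rule solves_restrict[OF solves_W]) (use assms in auto)
  from solves_unique[OF solves_W this, of t] show ?thesis using assms by (simp add: flow_def)
qed

end

section \<open>The solution operators on \<open>H\<^sup>1 \<times> L\<^sup>2\<close>\<close>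

text \<open>One fixed family, so that the extension to the energy space can be defined as a limit
  along it.\<close>

definition smoothing :: "nat \<Rightarrow> 'n::finite L2 \<Rightarrow> 'n H2" where
  "smoothing = (SOME S. (\<forall>m. linear (S m)) \<and> (\<forall>f. (\<lambda>m. L2_of_H2 (S m f)) \<longlonglongrightarrow> f) \<and>
    (\<forall>u. (\<lambda>m. H1_of_H2 (S m (L2_of_H1 u))) \<longlonglongrightarrow> u))"

lemma smoothing:
  fixes f :: "'n::finite L2" and u :: "'n H1"
  shows linear_smoothing: "linear (smoothing m :: 'n L2 \<Rightarrow> 'n H2)"
    and smoothing_tendsto_L2: "(\<lambda>m. L2_of_H2 (smoothing m f)) \<longlonglongrightarrow> f"
    and smoothing_tendsto_H1: "(\<lambda>m. H1_of_H2 (smoothing m (L2_of_H1 u))) \<longlonglongrightarrow> u"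
proof -
  obtain S :: "nat \<Rightarrow> 'n L2 \<Rightarrow> 'n H2" where "\<And>m. linear (S m)" "\<And>f. (\<lambda>m. L2_of_H2 (S m f)) \<longlonglongrightarrow> f"
    "\<And>u. (\<lambda>m. H1_of_H2 (S m (L2_of_H1 u))) \<longlonglongrightarrow> u"
    by (rule smoothing_operators) (blast)
  then have "\<exists>S :: nat \<Rightarrow> 'n L2 \<Rightarrow> 'n H2. (\<forall>m. linear (S m)) \<and> (\<forall>f. (\<lambda>m. L2_of_H2 (S m f)) \<longlonglongrightarrow> f) \<and>
      (\<forall>u. (\<lambda>m. H1_of_H2 (S m (L2_of_H1 u))) \<longlonglongrightarrow> u)"
    by (intro exI[of _ S]) simp
  from someI_ex[OF this, folded smoothing_def]
  show "linear (smoothing m :: 'n L2 \<Rightarrow> 'n H2)" "(\<lambda>m. L2_of_H2 (smoothing m f)) \<longlonglongrightarrow> f"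
    "(\<lambda>m. H1_of_H2 (smoothing m (L2_of_H1 u))) \<longlonglongrightarrow> u"
    by blast+
qed

definition smooth_data :: "nat \<Rightarrow> 'n::finite H1 \<times> 'n L2 \<Rightarrow> 'n H2 \<times> 'n H2" where
  "smooth_data m y = (smoothing m (L2_of_H1 (fst y)), smoothing m (snd y))"

lemma linear_smooth_data: "linear (smooth_data m)"
  by (rule linearI)
    (simp_all add: smooth_data_def linear_add[OF linear_smoothing] linear_scale[OF linear_smoothing]
      plus_H1.rep_eq scaleR_H1.rep_eq)

context damped_wave
begin

lemma embed_smooth_data_tendsto: "(\<lambda>m. embed (smooth_data m y)) \<longlonglongrightarrow> y"
proof -
  have "(\<lambda>m. (H1_of_H2 (smoothing m (L2_of_H1 (fst y))), L2_of_H2 (smoothing m (snd y)))) \<longlonglongrightarrow> (fst y, snd y)"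
    by (intro tendsto_Pair smoothing_tendsto_H1 smoothing_tendsto_L2)
  then show ?thesis by (simp add: smooth_data_def embed_def)
qed

lemma linear_embed: "linear embed"
  by (rule bounded_linear.linear[OF bounded_linear_embed])

lemma evol_H1_bound:
  fixes z :: "'n::finite H1 \<times> 'n H1"
  assumes st: "0 \<le> s" "s \<le> t" "t \<le> T"
  defines "K \<equiv> evol_const T * ((1 + real CARD('n)) * (norm (fst z) + norm (snd z)))"
  shows "norm (fst (evol_H1 s z t)) \<le> K" "norm (snd (evol_H1 s z t)) \<le> K"
proof -
  let ?m = "norm (fst z) + norm (snd z)"
  have c: "norm (evol s (x, y) t) \<le> evol_const T * ?m" if "norm x \<le> norm (fst z)" "norm y \<le> norm (snd z)" for x y :: "'n L2"
  proof -
    have "norm (evol s (x, y) t) \<le> evol_const T * norm (x, y)" by (rule evol_bound[OF st])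
    also have "\<dots> \<le> evol_const T * ?m"
      using evol_const_ge_1[of T] that norm_Pair_le[of x y] by (intro mult_left_mono) auto
    finally show ?thesis .
  qed
  have K: "evol_const T * ?m + (\<Sum>i\<in>(UNIV :: 'n set). evol_const T * ?m) = K"
    by (simp add: K_def algebra_simps)
  show "norm (fst (evol_H1 s z t)) \<le> K"
    unfolding K[symmetric]
  proof (rule order_trans[OF norm_H1_le], intro add_mono sum_mono)
    show "norm (L2_of_H1 (fst (evol_H1 s z t))) \<le> evol_const T * ?m"
      unfolding evol_H1[OF st(1,2)] by (intro order_trans[OF norm_fst_le] c norm_L2_of_H1_le)
    show "norm (weak_derivative i (fst (evol_H1 s z t))) \<le> evol_const T * ?m" for i
      unfolding evol_H1[OF st(1,2)] by (intro order_trans[OF norm_fst_le] c norm_weak_derivative_le)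
  qed
  show "norm (snd (evol_H1 s z t)) \<le> K"
    unfolding K[symmetric]
  proof (rule order_trans[OF norm_H1_le], intro add_mono sum_mono)
    show "norm (L2_of_H1 (snd (evol_H1 s z t))) \<le> evol_const T * ?m"
      unfolding evol_H1[OF st(1,2)] by (intro order_trans[OF norm_snd_le] c norm_L2_of_H1_le)
    show "norm (weak_derivative i (snd (evol_H1 s z t))) \<le> evol_const T * ?m" for i
      unfolding evol_H1[OF st(1,2)] by (intro order_trans[OF norm_snd_le] c norm_weak_derivative_le)
  qed
qed

lemma norm_scaleR_le: "\<bar>c\<bar> \<le> M \<Longrightarrow> norm x \<le> N \<Longrightarrow> norm (c *\<^sub>R x) \<le> M * N"
  by (simp add: mult_mono' order_trans[OF abs_ge_zero])

text \<open>For \<open>H2\<close> data, \<open>w'\<close> is bounded in \<open>H1\<close> and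
  \<open>w''\<close> in L2, uniformly in the starting time. General data lack this regularity, so
  continuity in time is obtained here and handed on by uniform limits.\<close>

lemma flow_lipschitz_time:
  fixes g :: "'n::finite H2 \<times> 'n H2"
  shows "\<exists>B\<ge>0. \<forall>s t t'. 0 \<le> s \<longrightarrow> s \<le> t \<longrightarrow> t \<le> t' \<longrightarrow> t' \<le> T \<longrightarrow>
    norm (embed (flow t' s g) - embed (flow t s g)) \<le> B * (t' - t)"
proof -
  define M where "M = coeff_sup T"
  note M = coeff_sup_nonneg[of T, folded M_def] \<alpha>_le[of _ T, folded M_def] \<beta>_le[of _ T, folded M_def]
  note hl = bounded_linear.linear[OF bounded_linear_H1_of_H2] and ll = bounded_linear.linear[OF bounded_linear_laplacian]
  define K where "K = evol_const T * ((1 + real CARD('n)) * (norm (H1_of_H2 (fst g)) + (norm (H1_of_H2 (fst g)) + M * norm (H1_of_H2 (snd g)))))"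
  define B1 where "B1 = M * (K + K)"
  define B2 where "B2 = evol_const T * (norm (laplacian (fst g)) + (norm (laplacian (fst g)) + M * norm (laplacian (snd g))))"
  have e0: "0 \<le> evol_const T" using evol_const_ge_1[of T] by simp
  have b1: "norm (H1_of_H2 (V s g r)) \<le> B1" if s: "0 \<le> s" "s \<le> r" "r \<le> T" for s r
  proof -
    let ?z = "(H1_of_H2 (fst (data s g)), H1_of_H2 (snd (data s g)))"
    have "norm (H1_of_H2 (snd (data s g))) \<le> norm (H1_of_H2 (fst g)) + M * norm (H1_of_H2 (snd g))"
      unfolding data_def snd_conv linear_add[OF hl] linear_scale[OF hl]
      using s by (intro order_trans[OF norm_triangle_ineq] add_left_mono norm_scaleR_le M) auto
    then have "evol_const T * ((1 + real CARD('n)) * (norm (fst ?z) + norm (snd ?z))) \<le> K"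
      unfolding K_def using e0 by (intro mult_left_mono add_mono) (auto simp: data_def)
    then have "norm (fst (evol_H1 s ?z r)) \<le> K" "norm (snd (evol_H1 s ?z r)) \<le> K"
      using evol_H1_bound[OF s, of ?z] by linarith+
    then have "norm (snd (evol_H1 s ?z r) - fst (evol_H1 s ?z r)) \<le> K + K"
      by (intro order_trans[OF norm_triangle_ineq4] add_mono)
    moreover have "H1_of_H2 (V s g r) = (1 / b r) *\<^sub>R (snd (evol_H1 s ?z r) - fst (evol_H1 s ?z r))"
      by (simp add: V_def scaleR_H2.rep_eq H1_of_H2_minus evol_H2[OF s(1,2)])
    ultimately show ?thesis
      unfolding B1_def using M(2)[of r] s by (simp only:) (rule norm_scaleR_le, simp_all)
  qed
  have b2: "norm (V' s g r) \<le> B2" if s: "0 \<le> s" "s \<le> r" "r \<le> T" for s r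
  proof -
    let ?y = "(laplacian (fst (data s g)), laplacian (snd (data s g)))"
    have "norm (V' s g r) \<le> evol_const T * norm ?y"
      unfolding V'_def laplacian_evol_H2[OF s(1,2)] by (rule order_trans[OF norm_snd_le evol_bound[OF s]])
    also have "\<dots> \<le> B2"
      unfolding B2_def
    proof (intro mult_left_mono e0)
      have "norm (laplacian (snd (data s g))) \<le> norm (laplacian (fst g)) + M * norm (laplacian (snd g))"
        unfolding data_def snd_conv linear_add[OF ll] linear_scale[OF ll]
        using s by (intro order_trans[OF norm_triangle_ineq] add_left_mono norm_scaleR_le M) auto
      then show "norm ?y \<le> norm (laplacian (fst g)) + (norm (laplacian (fst g)) + M * norm (laplacian (snd g)))"
        by (intro order_trans[OF norm_Pair_le] add_mono) (auto simp: data_def)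
    qed
    finally show ?thesis .
  qed
  have "norm (embed (flow t' s g) - embed (flow t s g)) \<le> (B1 + B2) * (t' - t)"
    if st: "0 \<le> s" "s \<le> t" "t \<le> t'" "t' \<le> T" for s t t'
  proof -
    note sol = solves_W[OF st(1), of g, unfolded solves_def C1_with_derivative_def]
    have 1: "norm (H1_of_H2 (W s g t') - H1_of_H2 (W s g t)) \<le> B1 * (t' - t)"
    proof (rule norm_diff_le_of_derivative[OF st(3)])
      fix r assume r: "r \<in> {t..t'}"
      have "(W s g has_vector_derivative V s g r) (at r within {s..})" using sol r st by auto
      then have "(W s g has_vector_derivative V s g r) (at r within {t..t'})"
        by (rule has_vector_derivative_within_subset) (use st in auto)
      then show "((\<lambda>t. H1_of_H2 (W s g t)) has_vector_derivative H1_of_H2 (V s g r)) (at r within {t..t'})"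
        by (rule bounded_linear.has_vector_derivative[OF bounded_linear_H1_of_H2])
      show "norm (H1_of_H2 (V s g r)) \<le> B1" using r st by (intro b1) auto
    qed
    have 2: "norm (L2_of_H2 (V s g t') - L2_of_H2 (V s g t)) \<le> B2 * (t' - t)"
    proof (rule norm_diff_le_of_derivative[OF st(3)])
      fix r assume r: "r \<in> {t..t'}"
      have "((\<lambda>t. L2_of_H2 (V s g t)) has_vector_derivative V' s g r) (at r within {s..})" using sol r st by auto
      then show "((\<lambda>t. L2_of_H2 (V s g t)) has_vector_derivative V' s g r) (at r within {t..t'})"
        by (rule has_vector_derivative_within_subset) (use st in auto)
      show "norm (V' s g r) \<le> B2" using r st by (intro b2) auto
    qed
    have "embed (flow t' s g) - embed (flow t s g)
        = (H1_of_H2 (W s g t') - H1_of_H2 (W s g t), L2_of_H2 (V s g t') - L2_of_H2 (V s g t))"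
      by (simp add: embed_def flow_def)
    then have "norm (embed (flow t' s g) - embed (flow t s g)) \<le> B1 * (t' - t) + B2 * (t' - t)"
      using 1 2 by (simp only:) (intro order_trans[OF norm_Pair_le] add_mono)
    then show ?thesis by (simp add: algebra_simps)
  qed
  moreover have "0 \<le> B1 + B2"
    unfolding B1_def B2_def K_def using M(1) e0
    by (intro add_nonneg_nonneg mult_nonneg_nonneg) auto
  ultimately show ?thesis by blast
qed

section \<open>Joint continuity of the flow and its extension to the energy space\<close>

definition triangle :: "real \<Rightarrow> (real \<times> real) set" where
  "triangle T = {(t, s). 0 \<le> s \<and> s \<le> t \<and> t \<le> T}"

text \<open>By the composition law, moving the starting time from \<open>s\<close> to
  \<open>s'\<close> amounts to changing the data at \<open>s'\<close> by the increment of the flow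
  over \<open>{s..s'}\<close>. So the Lipschitz bound in the final time, together with the flow
  bound, yields one in the starting time.\<close>

lemma flow_continuous: "continuous_on (triangle T) (\<lambda>p. embed (flow (fst p) (snd p) g))"
proof (cases "0 \<le> T")
  case T: True
  obtain B where B: "B \<ge> 0" and lip: "\<And>s t t'. 0 \<le> s \<Longrightarrow> s \<le> t \<Longrightarrow> t \<le> t' \<Longrightarrow> t' \<le> T \<Longrightarrow>
    norm (embed (flow t' s g) - embed (flow t s g)) \<le> B * (t' - t)"
    using flow_lipschitz_time[of T g] by blast
  have lip_t: "norm (embed (flow t' s g) - embed (flow t s g)) \<le> B * \<bar>t' - t\<bar>"
    if "0 \<le> s" "s \<le> t" "s \<le> t'" "t \<le> T" "t' \<le> T" for s t t'
    using lip[of s t t'] lip[of s t' t] that by (cases "t \<le> t'") (auto simp: norm_minus_commute)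
  have lip_s: "norm (embed (flow t s g) - embed (flow t s' g)) \<le> (2 + T) * B * (s' - s)"
    if s: "0 \<le> s" "s \<le> s'" "s' \<le> t" "t \<le> T" for s s' t
  proof -
    have "embed (flow t s g) - embed (flow t s' g) = embed (flow t s' (flow s' s g - g))"
      using s by (simp add: linear_diff[OF linear_flow] linear_diff[OF linear_embed] flow_flow)
    also have "norm \<dots> \<le> (2 + T) * norm (embed (flow s' s g - g))"
      using s by (intro flow_bound) auto
    also have "embed (flow s' s g - g) = embed (flow s' s g) - embed (flow s s g)"
      using s by (simp add: linear_diff[OF linear_embed] flow_same)
    also have "(2 + T) * norm (embed (flow s' s g) - embed (flow s s g)) \<le> (2 + T) * (B * (s' - s))"
      using s T by (intro mult_left_mono lip) auto
    finally show ?thesis by (simp add: mult.assoc)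
  qed
  have main: "norm (embed (flow t s g) - embed (flow t' s' g)) \<le> (2 + T) * B * \<bar>s' - s\<bar> + B * \<bar>t' - t\<bar>"
    if "s \<le> s'" "0 \<le> s" "s \<le> t" "t \<le> T" "s' \<le> t'" "t' \<le> T" for s s' t t'
  proof -
    have "embed (flow t s g) - embed (flow t' s' g)
        = (embed (flow t' s g) - embed (flow t' s' g)) - (embed (flow t' s g) - embed (flow t s g))" by simp
    also have "norm \<dots> \<le> norm (embed (flow t' s g) - embed (flow t' s' g)) + norm (embed (flow t' s g) - embed (flow t s g))"
      by (rule norm_triangle_ineq4)
    also have "\<dots> \<le> (2 + T) * B * (s' - s) + B * \<bar>t' - t\<bar>"
      using that by (intro add_mono lip_s lip_t) auto
    finally show ?thesis using that by simp
  qed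
  have "((2 + T) * B + B)-lipschitz_on (triangle T) (\<lambda>p. embed (flow (fst p) (snd p) g))"
  proof (rule lipschitz_onI)
    fix p q assume p: "p \<in> triangle T" and q: "q \<in> triangle T"
    obtain t s t' s' where pq: "p = (t, s)" "q = (t', s')" by (cases p, cases q)
    have d: "\<bar>t' - t\<bar> \<le> dist p q" "\<bar>s' - s\<bar> \<le> dist p q"
      using dist_fst_le[of p q] dist_snd_le[of p q] by (simp_all add: pq dist_real_def abs_minus_commute)
    have "norm (embed (flow t s g) - embed (flow t' s' g)) \<le> (2 + T) * B * \<bar>s' - s\<bar> + B * \<bar>t' - t\<bar>"
    proof (cases "s \<le> s'")
      case True
      then show ?thesis using p q by (intro main) (auto simp: triangle_def pq)
    next
      case False
      then have "norm (embed (flow t' s' g) - embed (flow t s g)) \<le> (2 + T) * B * \<bar>s - s'\<bar> + B * \<bar>t - t'\<bar>"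
        using p q by (intro main) (auto simp: triangle_def pq)
      then show ?thesis by (simp add: norm_minus_commute abs_minus_commute)
    qed
    also have "\<dots> \<le> (2 + T) * B * dist p q + B * dist p q"
      using B T d by (intro add_mono mult_left_mono) auto
    finally show "dist (embed (flow (fst p) (snd p) g)) (embed (flow (fst q) (snd q) g)) \<le> ((2 + T) * B + B) * dist p q"
      by (simp add: pq dist_norm algebra_simps)
  qed (use B T in auto)
  then show ?thesis by (rule lipschitz_on_continuous_on)
next
  case False
  then have "triangle T = {}" by (auto simp: triangle_def)
  then show ?thesis by simp
qed

text \<open>The continuous extension of the flow to the energy space, computed along the smoothing
  sequence.\<close>

definition propagator :: "real \<Rightarrow> real \<Rightarrow> 'n::finite H1 \<times> 'n L2 \<Rightarrow> 'n H1 \<times> 'n L2" where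
  "propagator t s y = lim (\<lambda>m. embed (flow t s (smooth_data m y)))"

text \<open>The flow bound is uniform over the triangle, so convergence of the smoothed data gives
  uniform convergence of their flows, and joint continuity survives.\<close>

lemma propagator_uniform_limit:
  "uniform_limit (triangle T) (\<lambda>m p. embed (flow (fst p) (snd p) (smooth_data m y)))
    (\<lambda>p. propagator (fst p) (snd p) y) sequentially"
proof -
  have "uniformly_Cauchy_on (triangle T) (\<lambda>m p. embed (flow (fst p) (snd p) (smooth_data m y)))"
  proof (rule uniformly_Cauchy_onI)
    fix e :: real assume e: "e > 0"
    have "Cauchy (\<lambda>m. embed (smooth_data m y))"
      by (rule convergent_Cauchy[OF convergentI[OF embed_smooth_data_tendsto]])
    then obtain N where N: "\<And>m k. m \<ge> N \<Longrightarrow> k \<ge> N \<Longrightarrow>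
        norm (embed (smooth_data m y) - embed (smooth_data k y)) < e / (2 + \<bar>T\<bar>)"
      using CauchyD[of _ "e / (2 + \<bar>T\<bar>)"] e by (metis add_pos_nonneg abs_ge_zero divide_pos_pos zero_less_numeral)
    have "dist (embed (flow (fst p) (snd p) (smooth_data m y))) (embed (flow (fst p) (snd p) (smooth_data k y))) < e"
      if p: "p \<in> triangle T" and mk: "m \<ge> N" "k \<ge> N" for p m k
    proof -
      have ts: "0 \<le> snd p" "snd p \<le> fst p" "fst p \<le> T" using p by (auto simp: triangle_def)
      have "dist (embed (flow (fst p) (snd p) (smooth_data m y))) (embed (flow (fst p) (snd p) (smooth_data k y)))
          = norm (embed (flow (fst p) (snd p) (smooth_data m y - smooth_data k y)))"
        using ts by (simp add: dist_norm linear_diff[OF linear_flow] linear_diff[OF linear_embed])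
      also have "\<dots> \<le> (2 + T) * norm (embed (smooth_data m y - smooth_data k y))"
        by (rule flow_bound[OF ts])
      also have "\<dots> < (2 + T) * (e / (2 + \<bar>T\<bar>))"
        using N[OF mk] ts by (intro mult_strict_left_mono) (auto simp: linear_diff[OF linear_embed])
      also have "\<dots> = e" using ts by simp
      finally show ?thesis .
    qed
    then show "\<exists>N. \<forall>p\<in>triangle T. \<forall>m\<ge>N. \<forall>k\<ge>N.
        dist (embed (flow (fst p) (snd p) (smooth_data m y))) (embed (flow (fst p) (snd p) (smooth_data k y))) < e"
      by blast
  qed
  from Cauchy_uniformly_convergent[OF this] show ?thesis
    unfolding uniformly_convergent_uniform_limit_iff propagator_def .
qed

lemma propagator_tendsto:
  assumes "0 \<le> s" "s \<le> t" shows "(\<lambda>m. embed (flow t s (smooth_data m y))) \<longlonglongrightarrow> propagator t s y"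
  using tendsto_uniform_limitI[OF propagator_uniform_limit[where T = t and y = y], of "(t, s)"] assms
  by (simp add: triangle_def)

lemma propagator_bound:
  assumes "0 \<le> s" "s \<le> t" "t \<le> T" shows "norm (propagator t s y) \<le> (2 + T) * norm y"
proof (rule LIMSEQ_le)
  show "(\<lambda>m. norm (embed (flow t s (smooth_data m y)))) \<longlonglongrightarrow> norm (propagator t s y)"
    using assms by (intro tendsto_norm propagator_tendsto)
  show "(\<lambda>m. (2 + T) * norm (embed (smooth_data m y))) \<longlonglongrightarrow> (2 + T) * norm y"
    by (intro tendsto_mult_left tendsto_norm embed_smooth_data_tendsto)
qed (use flow_bound[OF assms] in blast)

lemma linear_propagator:
  assumes st: "0 \<le> s" "s \<le> t" shows "linear (propagator t s)"
proof (rule linearI)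
  fix x y :: "'n::finite H1 \<times> 'n L2" and c :: real
  have eq: "embed (flow t s (smooth_data m (x + y))) = embed (flow t s (smooth_data m x)) + embed (flow t s (smooth_data m y))"
    "embed (flow t s (smooth_data m (c *\<^sub>R x))) = c *\<^sub>R embed (flow t s (smooth_data m x))" for m
    by (simp_all add: linear_add[OF linear_smooth_data] linear_add[OF linear_flow[OF st]] linear_add[OF linear_embed]
        linear_scale[OF linear_smooth_data] linear_scale[OF linear_flow[OF st]] linear_scale[OF linear_embed])
  have "(\<lambda>m. embed (flow t s (smooth_data m (x + y)))) \<longlonglongrightarrow> propagator t s x + propagator t s y"
    unfolding eq by (intro tendsto_add propagator_tendsto st)
  then show "propagator t s (x + y) = propagator t s x + propagator t s y"
    by (rule LIMSEQ_unique[OF propagator_tendsto[OF st]])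
  have "(\<lambda>m. embed (flow t s (smooth_data m (c *\<^sub>R x)))) \<longlonglongrightarrow> c *\<^sub>R propagator t s x"
    unfolding eq by (intro tendsto_scaleR tendsto_const propagator_tendsto st)
  then show "propagator t s (c *\<^sub>R x) = c *\<^sub>R propagator t s x"
    by (rule LIMSEQ_unique[OF propagator_tendsto[OF st]])
qed

lemma bounded_linear_propagator:
  assumes st: "0 \<le> s" "s \<le> t" shows "bounded_linear (propagator t s)"
proof (rule bounded_linear_intro[where K = "2 + t"])
  fix x y :: "'n::finite H1 \<times> 'n L2" and c :: real
  show "propagator t s (x + y) = propagator t s x + propagator t s y"
    by (rule linear_add[OF linear_propagator[OF st]])
  show "propagator t s (c *\<^sub>R x) = c *\<^sub>R propagator t s x"
    by (rule linear_scale[OF linear_propagator[OF st]])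
  show "norm (propagator t s x) \<le> norm x * (2 + t)"
    using propagator_bound[OF st order_refl, of x] by (simp only: mult.commute)
qed

text \<open>Smoothing need not fix \<open>H2\<close> data, but its error tends to 0 in the energy
  norm, where the flow is bounded.\<close>

lemma propagator_embed:
  assumes st: "0 \<le> s" "s \<le> t" shows "propagator t s (embed g) = embed (flow t s g)"
proof (rule LIMSEQ_unique[OF propagator_tendsto[OF st]])
  have "(\<lambda>m. embed (smooth_data m (embed g)) - embed g) \<longlonglongrightarrow> 0"
    using embed_smooth_data_tendsto by (simp add: LIM_zero_iff)
  then have "(\<lambda>m. (2 + t) * norm (embed (smooth_data m (embed g)) - embed g)) \<longlonglongrightarrow> (2 + t) * 0"
    by (intro tendsto_mult_left tendsto_norm_zero)
  then have lim: "(\<lambda>m. (2 + t) * norm (embed (smooth_data m (embed g)) - embed g)) \<longlonglongrightarrow> 0" by simp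
  have "norm (embed (flow t s (smooth_data m (embed g))) - embed (flow t s g))
      \<le> (2 + t) * norm (embed (smooth_data m (embed g)) - embed g)" for m
    using flow_bound[OF st order_refl, of "smooth_data m (embed g) - g"]
    by (simp add: linear_diff[OF linear_flow[OF st]] linear_diff[OF linear_embed])
  then have "(\<lambda>m. embed (flow t s (smooth_data m (embed g))) - embed (flow t s g)) \<longlonglongrightarrow> 0"
    by (intro Lim_null_comparison[OF _ lim] always_eventually allI)
  then show "(\<lambda>m. embed (flow t s (smooth_data m (embed g)))) \<longlonglongrightarrow> embed (flow t s g)"
    by (simp add: LIM_zero_iff)
qed

lemma propagator_same: "0 \<le> s \<Longrightarrow> propagator s s y = y"
  using LIMSEQ_unique[OF propagator_tendsto[of s s y] ] embed_smooth_data_tendsto[of y]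
  by (simp add: flow_same)

lemma propagator_propagator:
  assumes rst: "0 \<le> r" "r \<le> s" "s \<le> t"
  shows "propagator t s (propagator s r y) = propagator t r y"
proof (rule LIMSEQ_unique)
  have "(\<lambda>m. propagator t s (embed (flow s r (smooth_data m y)))) \<longlonglongrightarrow> propagator t s (propagator s r y)"
    using rst by (intro bounded_linear.tendsto[OF bounded_linear_propagator] propagator_tendsto) auto
  then show "(\<lambda>m. embed (flow t r (smooth_data m y))) \<longlonglongrightarrow> propagator t s (propagator s r y)"
    using rst by (simp add: propagator_embed flow_flow)
  show "(\<lambda>m. embed (flow t r (smooth_data m y))) \<longlonglongrightarrow> propagator t r y"
    using rst by (intro propagator_tendsto) auto
qed

lemma propagator_continuous: "continuous_on (triangle T) (\<lambda>p. propagator (fst p) (snd p) y)"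
  by (rule uniform_limit_theorem[OF _ propagator_uniform_limit])
    (auto intro: always_eventually flow_continuous)

sublocale evolution_family propagator
proof
  show "\<exists>C. \<forall>s t (y :: 'n::finite H1 \<times> 'n L2). 0 \<le> s \<longrightarrow> s \<le> t \<longrightarrow> t \<le> T \<longrightarrow> norm (propagator t s y) \<le> C * norm y" for T
    using propagator_bound by blast
  show "continuous_on {(t, s). 0 \<le> s \<and> s \<le> t \<and> t \<le> T} (\<lambda>(t, s). propagator t s y)" for T and y :: "'n::finite H1 \<times> 'n L2"
    using propagator_continuous[of T y] unfolding triangle_def case_prod_unfold .
qed (auto simp: propagator_same propagator_propagator linear_add[OF linear_propagator] linear_scale[OF linear_propagator])

lemma propagator_continuous_time:
  assumes s: "0 \<le> s" shows "continuous_on {s..} (\<lambda>t. propagator t s y)"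
proof -
  have "continuous (at t within {s..}) (\<lambda>t. propagator t s y)" if t: "t \<in> {s..}" for t
  proof -
    have "continuous_on {s..t + 1} (\<lambda>r. (\<lambda>p. propagator (fst p) (snd p) y) (r, s))"
      by (rule continuous_on_compose2[OF propagator_continuous[of "t + 1"]])
        (use s in \<open>auto simp: triangle_def intro!: continuous_intros\<close>)
    then show ?thesis
      using t by (simp add: continuous_on_eq_continuous_within at_within_atLeast_eq[of t "t + 1" s])
  qed
  then show ?thesis by (simp add: continuous_on_eq_continuous_within)
qed

text \<open>For smoothed data the second component is the derivative of the first, and both
  components converge uniformly on compact time intervals.\<close>

lemma propagator_derivative:
  assumes s: "0 \<le> s" and t: "s \<le> t"
  shows "((\<lambda>t. L2_of_H1 (fst (propagator t s y))) has_vector_derivative snd (propagator t s y)) (at t within {s..})"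
proof -
  have "((\<lambda>t. L2_of_H1 (fst (propagator t s y))) has_vector_derivative snd (propagator t s y)) (at t within {s..t + 1})"
  proof (rule has_vector_derivative_uniform_limit)
    show "((\<lambda>t. L2_of_H1 (fst (embed (flow t s (smooth_data m y))))) has_vector_derivative
        snd (embed (flow r s (smooth_data m y)))) (at r within {s..t + 1})" if "r \<in> {s..t + 1}" for m r
    proof -
      have "(W s (smooth_data m y) has_vector_derivative V s (smooth_data m y) r) (at r within {s..})"
        using solves_W[OF s, of "smooth_data m y"] that by (auto simp: solves_def C1_with_derivative_def)
      then have "(W s (smooth_data m y) has_vector_derivative V s (smooth_data m y) r) (at r within {s..t + 1})"
        by (rule has_vector_derivative_within_subset) auto
      from bounded_linear.has_vector_derivative[OF bounded_linear_L2_of_H2 this]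
      show ?thesis by (simp add: embed_def flow_def)
    qed
    have "uniform_limit {s..t + 1} (\<lambda>m r. embed (flow r s (smooth_data m y))) (\<lambda>r. propagator r s y) sequentially"
    proof (rule uniform_limitI)
      fix e :: real assume "e > 0"
      from uniform_limitD[OF propagator_uniform_limit[where T = "t + 1" and y = y] this]
      show "\<forall>\<^sub>F m in sequentially. \<forall>r\<in>{s..t + 1}. dist (embed (flow r s (smooth_data m y))) (propagator r s y) < e"
        by eventually_elim (use s in \<open>auto simp: triangle_def\<close>)
    qed
    then show "uniform_limit {s..t + 1} (\<lambda>m r. snd (embed (flow r s (smooth_data m y)))) (\<lambda>r. snd (propagator r s y)) sequentially"
      by (rule bounded_linear.uniform_limit[OF bounded_linear_snd])
    show "(\<lambda>m. L2_of_H1 (fst (embed (flow r s (smooth_data m y))))) \<longlonglongrightarrow> L2_of_H1 (fst (propagator r s y))"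
      if "r \<in> {s..t + 1}" for r
      using that s by (intro bounded_linear.tendsto[OF bounded_linear_L2_of_H1] tendsto_fst propagator_tendsto) auto
  qed (use t in auto)
  then show ?thesis using at_within_atLeast_eq[of t "t + 1" s] by simp
qed

lemma extends_R_strong_propagator:
  assumes s: "0 \<le> s"
  shows "extends_R_strong b0 \<beta> s (\<lambda>y t. fst (propagator t s y))"
  unfolding extends_R_strong_def
proof (intro conjI allI impI exI[of _ "\<lambda>y t. snd (propagator t s y)"])
  show "fst (propagator t s (H1_of_H2 g0, L2_of_H2 g1)) = H1_of_H2 (R_strong b0 \<beta> t s g0 g1)" if "s \<le> t" for g0 g1 t
    using propagator_embed[OF s that, of "(g0, g1)"] by (simp add: embed_def flow_def R_strong_eq[OF s that])
  show "linear (\<lambda>g. fst (propagator t s g))" if "s \<le> t" for t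
    using linear_compose[OF linear_propagator[OF s that] linear_fst] by (simp add: comp_def)
  show "continuous_on {s..} (\<lambda>t. fst (propagator t s g))" for g
    by (intro continuous_on_fst propagator_continuous_time s)
  show "C1_with_derivative {s..} (\<lambda>t. L2_of_H1 (fst (propagator t s g))) (\<lambda>t. snd (propagator t s g))" for g
    unfolding C1_with_derivative_def
    by (auto intro!: propagator_derivative continuous_on_snd propagator_continuous_time s)
  show "\<exists>C. \<forall>g. \<forall>t\<in>{s..T}. norm (fst (propagator t s g)) + norm (snd (propagator t s g)) \<le> C * norm g" for T
  proof (intro exI[of _ "(2 + T) + (2 + T)"] allI ballI)
    fix g t assume "t \<in> {s..T}"
    then have "norm (propagator t s g) \<le> (2 + T) * norm g" using s by (intro propagator_bound) auto
    then show "norm (fst (propagator t s g)) + norm (snd (propagator t s g)) \<le> ((2 + T) + (2 + T)) * norm g"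
      unfolding distrib_right by (intro add_mono order_trans[OF norm_fst_le] order_trans[OF norm_snd_le])
  qed
qed

text \<open>Both operators agree on embedded \<open>H2\<close> data, and the local bound makes
  \<open>F\<close> continuous at each fixed time; smoothed data approximate
  \<open>g\<close>.\<close>

lemma extends_R_strong_unique:
  fixes F :: "'n::finite H1 \<times> 'n L2 \<Rightarrow> real \<Rightarrow> 'n H1"
  assumes F: "extends_R_strong b0 \<beta> s F" and st: "0 \<le> s" "s \<le> t"
  shows "F g t = fst (propagator t s g)"
proof -
  have lin: "linear (\<lambda>g. F g t)"
    using F st unfolding extends_R_strong_def by blast
  have "F (H1_of_H2 g0, L2_of_H2 g1) t = H1_of_H2 (R_strong b0 \<beta> t s g0 g1)" for g0 g1 :: "'n H2"
    using F st unfolding extends_R_strong_def by blast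
  moreover have "fst (propagator t s (H1_of_H2 g0, L2_of_H2 g1)) = H1_of_H2 (R_strong b0 \<beta> t s g0 g1)" for g0 g1 :: "'n H2"
    using extends_R_strong_propagator[OF st(1)] st unfolding extends_R_strong_def by blast
  ultimately have ext: "F (embed g) t = fst (propagator t s (embed g))" for g
    unfolding embed_def by (simp only:)
  obtain C where C: "\<And>g. norm (F g t) \<le> C * norm g"
  proof -
    obtain F' :: "'n H1 \<times> 'n L2 \<Rightarrow> real \<Rightarrow> 'n L2" and C where "\<forall>g. \<forall>r\<in>{s..t}. norm (F g r) + norm (F' g r) \<le> C * norm g"
      using F st unfolding extends_R_strong_def by blast
    then have "norm (F g t) \<le> C * norm g" for g
      using st norm_ge_zero[of "F' g t"] by (smt (verit) atLeastAtMost_iff)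
    then show ?thesis by (rule that)
  qed
  have "bounded_linear (\<lambda>g. F g t)"
    by (rule bounded_linear_intro[where K = C])
      (use C linear_add[OF lin] linear_scale[OF lin] in \<open>simp_all add: mult.commute\<close>)
  then have "(\<lambda>m. F (embed (smooth_data m g)) t) \<longlonglongrightarrow> F g t"
    by (rule bounded_linear.tendsto[OF _ embed_smooth_data_tendsto])
  moreover have "(\<lambda>m. fst (propagator t s (embed (smooth_data m g)))) \<longlonglongrightarrow> fst (propagator t s g)"
    by (intro tendsto_fst bounded_linear.tendsto[OF bounded_linear_propagator[OF st]] embed_smooth_data_tendsto)
  ultimately show ?thesis unfolding ext by (rule LIMSEQ_unique)
qed

lemma solution_operator_eq:
  assumes "0 \<le> s" "s \<le> t" shows "solution_operator b0 \<beta> t s g = fst (propagator t s g)"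
  unfolding solution_operator_def
  using extends_R_strong_unique[OF _ assms] extends_R_strong_propagator[OF assms(1)]
  by (intro the_equality) blast+

end

section \<open>Sobolev embedding\<close>

lemma sum_power2_le:
  fixes f :: "'a \<Rightarrow> real"
  assumes "finite I" "\<And>i. i \<in> I \<Longrightarrow> 0 \<le> f i"
  shows "(\<Sum>i\<in>I. (f i)\<^sup>2) \<le> (\<Sum>i\<in>I. f i)\<^sup>2"
  using assms
proof (induction I rule: finite_induct)
  case (insert i I)
  have "0 \<le> 2 * f i * (\<Sum>i\<in>I. f i)" using insert by (intro mult_nonneg_nonneg sum_nonneg) auto
  then show ?case using insert by (simp add: power2_sum)
qed simp

text \<open>The truncation method: the part of \<open>a\<close> between \<open>2 ^ k\<close> and
  \<open>2 ^ Suc k\<close>, lowered to start at 0. The slices add up exactly to the part of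
  \<open>a\<close> above 1.\<close>

definition slice :: "nat \<Rightarrow> real \<Rightarrow> real" where
  "slice k a = min (max (a - 2 ^ k) 0) (2 ^ k)"

lemma slice_bounds: "0 \<le> slice k a" "slice k a \<le> 2 ^ k"
  by (auto simp: slice_def)

lemma slice_mono: "a \<le> a' \<Longrightarrow> slice k a \<le> slice k a'"
  by (auto simp: slice_def)

lemma slice_eq_0: "a \<le> 2 ^ k \<Longrightarrow> slice k a = 0"
  by (auto simp: slice_def)

lemma slice_eq_top: "2 ^ Suc k \<le> a \<Longrightarrow> slice k a = 2 ^ k"
  by (auto simp: slice_def)

lemma slice_le: "0 \<le> a \<Longrightarrow> slice k a \<le> a"
  by (auto simp: slice_def)

lemma sum_slice: "(\<Sum>k<N. slice k a) = min (max (a - 1) 0) (2 ^ N - 1)"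
proof (induction N)
  case (Suc N)
  define c :: real where "c = 2 ^ N"
  have "c \<ge> 1" by (simp add: c_def)
  then have "min (max (a - 1) 0) (c - 1) + min (max (a - c) 0) c = min (max (a - 1) 0) (2 * c - 1)"
    by (auto simp: min_def max_def)
  then show ?case using Suc by (simp add: slice_def c_def)
qed simp

text \<open>All slices are monotone, so their increments have one sign and the sum of squares is at
  most the square of the telescoping sum. This replaces the fact that the gradients of the slices
  have disjoint supports.\<close>

lemma sum_slice_diff_squared: "(\<Sum>k<N. (slice k a - slice k a')\<^sup>2) \<le> (a - a')\<^sup>2"
proof -
  have *: "(\<Sum>k<N. (slice k a - slice k a')\<^sup>2) \<le> (a - a')\<^sup>2" if "a' \<le> a" for a a'
  proof -
    have "(\<Sum>k<N. (slice k a - slice k a')\<^sup>2) \<le> (\<Sum>k<N. slice k a - slice k a')\<^sup>2"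
      using slice_mono[OF that] by (intro sum_power2_le) auto
    also have "(\<Sum>k<N. slice k a - slice k a') = min (max (a - 1) 0) (2 ^ N - 1) - min (max (a' - 1) 0) (2 ^ N - 1)"
      by (simp add: sum_subtractf sum_slice)
    also have "(\<dots>)\<^sup>2 \<le> (a - a')\<^sup>2"
      using that by (intro power_mono) (auto simp: min_def max_def)
    finally show ?thesis .
  qed
  show ?thesis
  proof (cases "a' \<le> a")
    case False
    then have "(\<Sum>k<N. (slice k a' - slice k a)\<^sup>2) \<le> (a' - a)\<^sup>2" by (intro *) simp
    then show ?thesis by (simp add: power2_commute)
  qed (rule *)
qed

lemma measurable_slice [measurable]: "slice k \<in> borel_measurable borel"
  unfolding slice_def[abs_def] by measurable

section \<open>From dyadic steps to arbitrary translations\<close>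

lemma norm_shift_multiple_le: "norm (shift i (real m * h) g - g) \<le> real m * norm (shift i h g - g)"
proof (induction m)
  case (Suc m)
  have "shift i (real (Suc m) * h) g - g = shift i h (shift i (real m * h) g - g) + (shift i h g - g)"
    by (simp add: shift_diff shift_shift algebra_simps)
  also have "norm \<dots> \<le> norm (shift i (real m * h) g - g) + norm (shift i h g - g)"
    by (rule order_trans[OF norm_triangle_ineq]) simp
  finally show ?case using Suc by (simp add: algebra_simps)
qed simp

text \<open>Integer multiples of \<open>1 / 2 ^ j\<close> inherit the bound by subadditivity; they
  approximate \<open>h\<close> from below, and shifts are strongly continuous.\<close>

lemma norm_shift_le_of_dyadic:
  assumes c: "\<And>j. norm (shift i (1 / 2 ^ j) g - g) \<le> c / 2 ^ j" and c0: "0 \<le> c" and h: "0 \<le> h"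
  shows "norm (shift i h g - g) \<le> h * c"
proof -
  define m where "m j = nat \<lfloor>h * 2 ^ j\<rfloor>" for j :: nat
  have m: "real (m j) \<le> h * 2 ^ j" "h * 2 ^ j < real (m j) + 1" for j
    using h by (auto simp: m_def)
  have "(\<lambda>j. real (m j) * (1 / 2 ^ j)) \<longlonglongrightarrow> h"
  proof (rule tendsto_sandwich[where f = "\<lambda>j. h - (1 / 2) ^ j" and h = "\<lambda>_. h"])
    show "\<forall>\<^sub>F j in sequentially. h - (1 / 2) ^ j \<le> real (m j) * (1 / 2 ^ j)"
    proof (intro always_eventually allI)
      fix j
      have "h < (real (m j) + 1) / 2 ^ j" using m(2)[of j] by (simp add: less_divide_eq)
      then show "h - (1 / 2) ^ j \<le> real (m j) * (1 / 2 ^ j)" by (simp add: add_divide_distrib power_divide)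
    qed
    show "\<forall>\<^sub>F j in sequentially. real (m j) * (1 / 2 ^ j) \<le> h"
      using m(1) by (intro always_eventually allI) (simp add: divide_le_eq)
    have "(\<lambda>j. h - (1 / 2) ^ j) \<longlonglongrightarrow> h - 0" by (intro tendsto_intros LIMSEQ_realpow_zero) auto
    then show "(\<lambda>j. h - (1 / 2) ^ j) \<longlonglongrightarrow> h" by simp
  qed simp
  then have "(\<lambda>j. norm (shift i (real (m j) * (1 / 2 ^ j)) g - g)) \<longlonglongrightarrow> norm (shift i h g - g)"
    by (intro tendsto_norm tendsto_diff tendsto_const continuous_on_tendsto_compose[OF continuous_on_shift[of UNIV]]) auto
  moreover have "norm (shift i (real (m j) * (1 / 2 ^ j)) g - g) \<le> h * c" for j
  proof -
    have "norm (shift i (real (m j) * (1 / 2 ^ j)) g - g) \<le> real (m j) * (c / 2 ^ j)"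
      by (rule order_trans[OF norm_shift_multiple_le mult_left_mono[OF c]]) simp
    also have "\<dots> \<le> h * 2 ^ j * (c / 2 ^ j)" using m(1) c0 by (intro mult_right_mono) auto
    finally show ?thesis by simp
  qed
  ultimately show ?thesis by (intro LIMSEQ_le_const2) auto
qed

lemma norm_translate_sum_le:
  assumes "finite I"
  shows "norm (translate (\<Sum>i\<in>I. (y $ i) *\<^sub>R axis i 1) g - g) \<le> (\<Sum>i\<in>I. norm (shift i (y $ i) g - g))"
  using assms
proof (induction I rule: finite_induct)
  case (insert i I)
  let ?v = "\<Sum>i\<in>I. (y $ i) *\<^sub>R axis i 1"
  have "translate (\<Sum>i\<in>insert i I. (y $ i) *\<^sub>R axis i 1) g - g
      = translate ((y $ i) *\<^sub>R axis i 1) (translate ?v g - g) + (shift i (y $ i) g - g)"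
    using insert by (simp add: translate_diff translate_translate shift_def)
  also have "norm \<dots> \<le> norm (translate ?v g - g) + norm (shift i (y $ i) g - g)"
    by (rule order_trans[OF norm_triangle_ineq]) simp
  finally show ?case using insert by simp
qed simp

lemma norm_translate_diff_le:
  fixes g :: "'n::finite L2"
  assumes c: "\<And>i h. 0 \<le> h \<Longrightarrow> norm (shift i h g - g) \<le> h * c" and c0: "0 \<le> c"
    and y: "\<And>i. 0 \<le> y $ i" "\<And>i. y $ i \<le> r"
  shows "norm (translate y g - g) \<le> real CARD('n) * (r * c)"
proof -
  have y_eq: "y = (\<Sum>i\<in>UNIV. (y $ i) *\<^sub>R axis i 1)"
    by (simp add: vec_eq_iff axis_def if_distrib cong: if_cong)
  have "norm (translate y g - g) \<le> (\<Sum>i\<in>UNIV. norm (shift i (y $ i) g - g))"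
    by (subst (1) y_eq) (rule norm_translate_sum_le, simp)
  also have "\<dots> \<le> (\<Sum>i\<in>(UNIV :: 'n set). r * c)"
    using y c0 by (intro sum_mono order_trans[OF c] mult_right_mono) auto
  finally show ?thesis by simp
qed

text \<open>By \<open>small\<close> the averages of \<open>g\<close> over cubes of side \<open>r\<close> are at most \<open>c / 2\<close>, while \<open>g = c\<close> on \<open>A\<close>.\<close>

lemma measure_top_set_le:
  fixes g :: "real ^ 'n::finite \<Rightarrow> real"
  assumes g: "square_integrable g" "integrable lborel g" "\<And>x. 0 \<le> g x" "\<And>x. g x \<le> c"
    and A: "A \<in> sets lborel" "\<And>x. x \<in> A \<Longrightarrow> g x = c"
    and r: "r > 0" and small: "2 * (LINT x|lborel. g x) \<le> c * r ^ CARD('n)"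
    and d: "\<And>y. (\<forall>i. 0 \<le> y $ i \<and> y $ i \<le> r) \<Longrightarrow> norm (translate y (abs_L2 g) - abs_L2 g) \<le> d"
  shows "emeasure lborel A * ennreal ((c / 2)\<^sup>2) \<le> ennreal (d\<^sup>2)"
proof -
  define Q :: "(real ^ 'n) set" where "Q = cbox 0 (\<chi> i. r)"
  have Q: "y \<in> Q \<longleftrightarrow> (\<forall>i. 0 \<le> y $ i \<and> y $ i \<le> r)" for y
    by (simp add: Q_def mem_box_cart)
  have "cbox 0 (\<chi> i. r) \<noteq> ({} :: (real ^ 'n) set)"
    using r by (simp add: interval_ne_empty_cart less_imp_le)
  from content_cbox_cart[OF this] have mQ: "measure lborel Q = r ^ CARD('n)"
    by (simp add: Q_def)
  have Qs [measurable]: "Q \<in> sets borel" by (simp add: Q_def)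
  have eQ: "emeasure lborel Q = ennreal (r ^ CARD('n))"
    unfolding mQ[symmetric] by (intro emeasure_eq_ennreal_measure) (simp add: Q_def emeasure_lborel_cbox_eq)
  have [measurable]: "g \<in> borel_measurable borel" by (rule square_integrable_meas[OF g(1)])
  have c0: "0 \<le> c" using g(3)[of 0] g(4)[of 0] by linarith
  have intQ: "integrable lborel (\<lambda>y. indicator Q y * h y)"
    if [measurable]: "h \<in> borel_measurable borel" and h: "\<And>y. \<bar>h y\<bar> \<le> B" for h :: "real ^ 'n \<Rightarrow> real" and B
  proof (rule Bochner_Integration.integrable_bound[where f = "\<lambda>y. B * indicator Q y"])
    show "integrable lborel (\<lambda>y. B * indicator Q y :: real)"
      using eQ by (intro integrable_mult_right integrable_real_indicator) auto
    show "AE y in lborel. norm (indicator Q y * h y) \<le> norm (B * indicator Q y)"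
      using h by (intro AE_I2) (auto simp: indicator_def order_trans[OF _ abs_ge_self])
  qed simp
  let ?s = "\<lambda>x y. (g (x + y) - g x)\<^sup>2"
  have s_le: "\<bar>?s x y\<bar> \<le> c\<^sup>2" for x y
  proof -
    have "\<bar>g (x + y) - g x\<bar> \<le> c" using g(3)[of x] g(3)[of "x + y"] g(4)[of x] g(4)[of "x + y"] by linarith
    then have "\<bar>g (x + y) - g x\<bar>\<^sup>2 \<le> c\<^sup>2" by (intro power_mono) auto
    then show ?thesis by simp
  qed
  have low: "ennreal ((c / 2)\<^sup>2 * r ^ CARD('n)) \<le> (\<integral>\<^sup>+y. indicator Q y * ennreal (?s x y) \<partial>lborel)" if x: "x \<in> A" for x
  proof -
    have gx: "g x = c" by (rule A(2)[OF x])
    have i1: "integrable lborel (\<lambda>y. indicator Q y * g (x + y))"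
      using g by (intro intQ[where B = c]) auto
    have i2: "integrable lborel (\<lambda>y. indicator Q y :: real)"
      using eQ by (intro integrable_real_indicator) auto
    have i3: "integrable lborel (\<lambda>y. indicator Q y * ?s x y)"
      by (intro intQ[OF _ s_le]) simp
    have ig: "integrable lborel (\<lambda>y. g (x + y))"
      using integrable_lborel_translate[OF g(2), of x] by (simp add: add.commute)
    have "(LINT y|lborel. indicator Q y * g (x + y)) \<le> (LINT y|lborel. g (x + y))"
      using g(3) by (intro integral_mono i1 ig) (auto simp: indicator_def)
    also have "\<dots> = (LINT y|lborel. g y)"
      using integral_lborel_translate[of g x] by (simp add: add.commute)
    finally have small': "2 * (LINT y|lborel. indicator Q y * g (x + y)) \<le> c * r ^ CARD('n)"
      using small by simp
    have "(c / 2)\<^sup>2 * r ^ CARD('n) \<le> (3 / 4) * c\<^sup>2 * r ^ CARD('n) - c * (LINT y|lborel. indicator Q y * g (x + y))"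
      using mult_left_mono[OF small' c0] by (simp add: power2_eq_square algebra_simps)
    also have "\<dots> = (LINT y|lborel. (3 / 4) * c\<^sup>2 * indicator Q y - c * (indicator Q y * g (x + y)))"
      using i1 i2 by (simp add: mQ)
    also have "\<dots> \<le> (LINT y|lborel. indicator Q y * ?s x y)"
    proof (intro integral_mono i3 Bochner_Integration.integrable_diff integrable_mult_right i1 i2)
      fix y
      \<comment> \<open>This square is the difference of the two sides below. It bounds the squared
        increment from below by an expression linear in \<open>g\<close>, to which
        \<open>small'\<close> applies: a quarter of \<open>c\<close> squared remains per unit of
        volume.\<close>
      have "0 \<le> (g (x + y) - c / 2)\<^sup>2" by simp
      then have "(3 / 4) * c\<^sup>2 - c * g (x + y) \<le> ?s x y"
        by (simp add: gx power2_eq_square algebra_simps)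
      then show "(3 / 4) * c\<^sup>2 * indicator Q y - c * (indicator Q y * g (x + y)) \<le> indicator Q y * ?s x y"
        by (auto simp: indicator_def)
    qed
    finally have "ennreal ((c / 2)\<^sup>2 * r ^ CARD('n)) \<le> ennreal (LINT y|lborel. indicator Q y * ?s x y)"
      by (rule ennreal_leI)
    also have "\<dots> = (\<integral>\<^sup>+y. ennreal (indicator Q y * ?s x y) \<partial>lborel)"
      by (intro nn_integral_eq_integral[symmetric] i3) auto
    also have "\<dots> = (\<integral>\<^sup>+y. indicator Q y * ennreal (?s x y) \<partial>lborel)"
      by (intro nn_integral_cong) (auto simp: indicator_def)
    finally show ?thesis .
  qed
  have up: "(\<integral>\<^sup>+x. ennreal (?s x y) \<partial>lborel) \<le> ennreal (d\<^sup>2)" if y: "y \<in> Q" for y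
  proof -
    have si: "square_integrable (\<lambda>x. g (x + y) - g x)"
      by (intro square_integrable_diff square_integrable_translate g)
    have "(\<integral>\<^sup>+x. ennreal (?s x y) \<partial>lborel) = ennreal (LINT x|lborel. ?s x y)"
      using si by (intro nn_integral_eq_integral) (auto simp: square_integrable_def)
    also have "(LINT x|lborel. ?s x y) = (norm (translate y (abs_L2 g) - abs_L2 g))\<^sup>2"
      using g(1) si by (simp add: translate_abs_L2 abs_L2_diff square_integrable_translate norm_abs_L2_squared)
    also have "ennreal \<dots> \<le> ennreal (d\<^sup>2)"
      using y d by (intro ennreal_leI power_mono) (auto simp: Q)
    finally show ?thesis .
  qed
  have A': "A \<in> sets borel" using A(1) by simp
  have [measurable]: "A \<in> sets borel" by (rule A')
  \<comment> \<open>Integrating the lower bound over \<open>A\<close> and exchanging the integrals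
    compares it with the L2 increments; the volume of the cube occurs on both sides and
    cancels.\<close>
  have "emeasure lborel A * ennreal ((c / 2)\<^sup>2 * r ^ CARD('n)) = (\<integral>\<^sup>+x. ennreal ((c / 2)\<^sup>2 * r ^ CARD('n)) * indicator A x \<partial>lborel)"
    by (subst nn_integral_cmult_indicator) (auto simp: mult.commute)
  also have "\<dots> \<le> (\<integral>\<^sup>+x. (\<integral>\<^sup>+y. indicator Q y * ennreal (?s x y) \<partial>lborel) \<partial>lborel)"
    using low by (intro nn_integral_mono) (auto simp: indicator_def)
  also have "\<dots> = (\<integral>\<^sup>+y. (\<integral>\<^sup>+x. indicator Q y * ennreal (?s x y) \<partial>lborel) \<partial>lborel)"
    by (rule lborel_pair.Fubini'[symmetric]) simp
  also have "\<dots> = (\<integral>\<^sup>+y. indicator Q y * (\<integral>\<^sup>+x. ennreal (?s x y) \<partial>lborel) \<partial>lborel)"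
    by (intro nn_integral_cong nn_integral_cmult) simp
  also have "\<dots> \<le> (\<integral>\<^sup>+y. ennreal (d\<^sup>2) * indicator Q y \<partial>lborel)"
    using up by (intro nn_integral_mono) (auto simp: indicator_def)
  also have "\<dots> = ennreal (d\<^sup>2) * ennreal (r ^ CARD('n))"
    by (simp add: nn_integral_cmult_indicator eQ)
  also have "ennreal ((c / 2)\<^sup>2 * r ^ CARD('n)) = ennreal ((c / 2)\<^sup>2) * ennreal (r ^ CARD('n))"
    using r by (intro ennreal_mult) auto
  finally have "ennreal (r ^ CARD('n)) * (emeasure lborel A * ennreal ((c / 2)\<^sup>2)) \<le> ennreal (r ^ CARD('n)) * ennreal (d\<^sup>2)"
    by (simp only: mult_ac)
  moreover have "ennreal (r ^ CARD('n)) \<noteq> 0" using r by simp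
  ultimately show ?thesis by (subst (asm) ennreal_mult_le_mult_iff) auto
qed

section \<open>The distribution function at dyadic heights and the resulting embedding\<close>

definition level :: "'n::finite H1 \<Rightarrow> nat \<Rightarrow> real" where
  "level u k = measure lborel {x. 2 ^ k < \<bar>rep_L2 (L2_of_H1 u) x\<bar>}"

lemma level_nonneg: "0 \<le> level u k"
  by (simp add: level_def)

text \<open>Chebyshev's inequality for the square of the function.\<close>

lemma level:
  fixes u :: "'n::finite H1"
  assumes u: "norm u \<le> 1"
  shows emeasure_level: "emeasure lborel {x. 2 ^ k < \<bar>rep_L2 (L2_of_H1 u) x\<bar>} = ennreal (level u k)"
    and level_le: "4 ^ k * level u k \<le> 1"
proof -
  let ?f = "rep_L2 (L2_of_H1 u)" and ?S = "{x. 2 ^ k < \<bar>rep_L2 (L2_of_H1 u) x\<bar>}"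
  have "ennreal (4 ^ k) * emeasure lborel ?S = (\<integral>\<^sup>+x. ennreal (4 ^ k) * indicator ?S x \<partial>lborel)"
    by (rule nn_integral_cmult_indicator[symmetric]) simp
  also have "\<dots> \<le> (\<integral>\<^sup>+x. ennreal ((?f x)\<^sup>2) \<partial>lborel)"
  proof (intro nn_integral_mono)
    fix x
    have "(4 :: real) ^ k \<le> (?f x)\<^sup>2" if "x \<in> ?S"
    proof -
      have "(2 ^ k)\<^sup>2 \<le> \<bar>?f x\<bar>\<^sup>2" using that by (intro power_mono) auto
      also have "(2 ^ k)\<^sup>2 = (4 :: real) ^ k"
        by (simp add: power2_eq_square power_mult_distrib[symmetric])
      finally show ?thesis by simp
    qed
    then show "ennreal (4 ^ k) * indicator ?S x \<le> ennreal ((?f x)\<^sup>2)"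
      by (cases "x \<in> ?S") (auto intro: ennreal_leI)
  qed
  also have "\<dots> \<le> ennreal 1"
    unfolding nn_integral_norm_L2
    using order_trans[OF norm_L2_of_H1_le u] by (intro ennreal_leI power_le_one) auto
  finally have le: "ennreal (4 ^ k) * emeasure lborel ?S \<le> 1" by simp
  have "emeasure lborel ?S \<noteq> \<infinity>"
  proof
    assume "emeasure lborel ?S = \<infinity>"
    then show False using le by (simp add: ennreal_mult_top top_unique)
  qed
  then show *: "emeasure lborel ?S = ennreal (level u k)"
    unfolding level_def by (intro emeasure_eq_ennreal_measure) simp
  have "ennreal (4 ^ k * level u k) \<le> ennreal 1"
    using le unfolding * by (simp add: ennreal_mult level_nonneg)
  then show "4 ^ k * level u k \<le> 1" by (subst (asm) ennreal_le_iff) auto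
qed

definition slice_L2 :: "'n::finite H1 \<Rightarrow> nat \<Rightarrow> 'n L2" where
  "slice_L2 u k = abs_L2 (\<lambda>x. slice k \<bar>rep_L2 (L2_of_H1 u) x\<bar>)"

lemma square_integrable_mono:
  assumes [measurable]: "g \<in> borel_measurable borel" and f: "square_integrable f"
    and le: "\<And>x. \<bar>g x\<bar> \<le> \<bar>f x\<bar>"
  shows "square_integrable g"
  unfolding square_integrable_def
proof (intro conjI)
  show "integrable lborel (\<lambda>x. (g x)\<^sup>2)"
  proof (rule Bochner_Integration.integrable_bound)
    show "integrable lborel (\<lambda>x. (f x)\<^sup>2)" using f by (simp add: square_integrable_def)
    show "AE x in lborel. norm ((g x)\<^sup>2) \<le> norm ((f x)\<^sup>2)"
    proof (rule AE_I2)
      fix x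
      have "\<bar>g x\<bar>\<^sup>2 \<le> \<bar>f x\<bar>\<^sup>2" by (intro power_mono le) simp
      then show "norm ((g x)\<^sup>2) \<le> norm ((f x)\<^sup>2)" by simp
    qed
  qed simp
qed simp

lemma square_integrable_slice: "square_integrable (\<lambda>x. slice k \<bar>rep_L2 f x\<bar>)"
  by (rule square_integrable_mono[OF _ square_integrable_rep_L2[of f]])
    (use slice_bounds slice_le in \<open>auto simp: abs_of_nonneg\<close>)

lemma norm_shift_abs_L2_squared:
  assumes "square_integrable f"
  shows "(norm (shift i h (abs_L2 f) - abs_L2 f))\<^sup>2 = (LINT x|lborel. (f (x + h *\<^sub>R axis i 1) - f x)\<^sup>2)"
  using assms by (simp add: shift_abs_L2 abs_L2_diff square_integrable_translate square_integrable_diff norm_abs_L2_squared)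

lemma abs_L2_rep_L2: "abs_L2 (rep_L2 f) = f"
  by (rule Quotient3_abs_rep[OF Quotient3_L2])

text \<open>The pointwise bound on increments of slices, integrated; passing to absolute values only
  decreases increments.\<close>

lemma sum_norm_shift_slice_le:
  "(\<Sum>k<N. (norm (shift i h (slice_L2 u k) - slice_L2 u k))\<^sup>2) \<le> (norm (shift i h (L2_of_H1 u) - L2_of_H1 u))\<^sup>2"
proof -
  let ?f = "rep_L2 (L2_of_H1 u)" and ?e = "h *\<^sub>R axis i (1::real)"
  have si: "integrable lborel (\<lambda>x. (slice k \<bar>?f (x + ?e)\<bar> - slice k \<bar>?f x\<bar>)\<^sup>2)" for k
    using square_integrable_diff[OF square_integrable_translate[OF square_integrable_slice] square_integrable_slice]
    by (simp add: square_integrable_def)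
  have "(\<Sum>k<N. (norm (shift i h (slice_L2 u k) - slice_L2 u k))\<^sup>2)
      = (\<Sum>k<N. (LINT x|lborel. (slice k \<bar>?f (x + ?e)\<bar> - slice k \<bar>?f x\<bar>)\<^sup>2))"
    by (simp add: slice_L2_def norm_shift_abs_L2_squared square_integrable_slice)
  also have "\<dots> = (LINT x|lborel. (\<Sum>k<N. (slice k \<bar>?f (x + ?e)\<bar> - slice k \<bar>?f x\<bar>)\<^sup>2))"
    using si by (intro Bochner_Integration.integral_sum[symmetric]) auto
  also have "\<dots> \<le> (LINT x|lborel. (?f (x + ?e) - ?f x)\<^sup>2)"
  proof (rule integral_mono)
    show "integrable lborel (\<lambda>x. \<Sum>k<N. (slice k \<bar>?f (x + ?e)\<bar> - slice k \<bar>?f x\<bar>)\<^sup>2)"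
      using si by (intro Bochner_Integration.integrable_sum) auto
    show "integrable lborel (\<lambda>x. (?f (x + ?e) - ?f x)\<^sup>2)"
      using square_integrable_diff[OF square_integrable_translate[OF square_integrable_rep_L2] square_integrable_rep_L2]
      by (simp add: square_integrable_def)
    show "(\<Sum>k<N. (slice k \<bar>?f (x + ?e)\<bar> - slice k \<bar>?f x\<bar>)\<^sup>2) \<le> (?f (x + ?e) - ?f x)\<^sup>2" for x
    proof -
      have "(\<bar>?f (x + ?e)\<bar> - \<bar>?f x\<bar>)\<^sup>2 \<le> (?f (x + ?e) - ?f x)\<^sup>2"
        using abs_triangle_ineq3[of "?f (x + ?e)" "?f x"] by (subst abs_le_square_iff[symmetric])
      then show ?thesis using sum_slice_diff_squared[where a = "\<bar>?f (x + ?e)\<bar>" and a' = "\<bar>?f x\<bar>" and N = N] by linarith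
    qed
  qed
  also have "\<dots> = (norm (shift i h (L2_of_H1 u) - L2_of_H1 u))\<^sup>2"
    using norm_shift_abs_L2_squared[OF square_integrable_rep_L2, of i h "L2_of_H1 u"] by (simp add: abs_L2_rep_L2)
  finally show ?thesis .
qed

text \<open>The difference quotients of the slices with dyadic steps are monotone in the step and their
  squares sum up to at most \<open>|\<nabla>u|\<^sup>2\<close>. So the numbers \<open>E k\<close> play the role of \<open>|\<nabla>(slice k u)|\<^sup>2\<close>,
  without a chain rule for weak derivatives.\<close>

lemma slice_energy:
  fixes u :: "'n::finite H1"
  assumes u: "norm u \<le> 1"
  obtains E where "\<And>k. 0 \<le> E k" "\<And>N. (\<Sum>k<N. E k) \<le> 1"
    "\<And>k i h. 0 \<le> h \<Longrightarrow> norm (shift i h (slice_L2 u k) - slice_L2 u k) \<le> h * sqrt (E k)"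
proof -
  define s where "s i j k = (2 ^ j * norm (shift i (1 / 2 ^ j) (slice_L2 u k) - slice_L2 u k))\<^sup>2" for i j k
  define e where "e j k = (\<Sum>i\<in>UNIV. s i j k)" for j k
  have e_le: "(\<Sum>k<N. e j k) \<le> 1" for N j
  proof -
    have "(\<Sum>k<N. s i j k) \<le> (norm (weak_derivative i u))\<^sup>2" for i
    proof -
      have "(\<Sum>k<N. s i j k) = (2 ^ j)\<^sup>2 * (\<Sum>k<N. (norm (shift i (1 / 2 ^ j) (slice_L2 u k) - slice_L2 u k))\<^sup>2)"
        by (simp add: s_def power_mult_distrib sum_distrib_left)
      also have "\<dots> \<le> (2 ^ j)\<^sup>2 * (norm (shift i (1 / 2 ^ j) (L2_of_H1 u) - L2_of_H1 u))\<^sup>2"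
        by (intro mult_left_mono sum_norm_shift_slice_le) simp
      also have "\<dots> \<le> (2 ^ j)\<^sup>2 * ((1 / 2 ^ j) * norm (weak_derivative i u))\<^sup>2"
        by (intro mult_left_mono power_mono norm_shift_diff_le has_weak_derivative_weak_derivative) auto
      finally show ?thesis by (simp add: power_mult_distrib power_divide)
    qed
    then have "(\<Sum>i\<in>UNIV. \<Sum>k<N. s i j k) \<le> (\<Sum>i\<in>UNIV. (norm (weak_derivative i u))\<^sup>2)"
      by (intro sum_mono)
    also have "\<dots> \<le> (norm u)\<^sup>2" by (simp add: norm_H1_squared)
    also have "\<dots> \<le> 1" using u by (simp add: power_le_one)
    finally show ?thesis unfolding e_def by (subst sum.swap)
  qed
  have e_nonneg: "0 \<le> e j k" for j k by (simp add: e_def s_def sum_nonneg)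
  have e_le1: "e j k \<le> 1" for j k
    using e_le[of j "Suc k"] sum_nonneg[of "{..<k}" "e j"] e_nonneg by simp
  have s_mono: "s i j k \<le> s i (Suc j) k" for i j k
  proof -
    have "norm (shift i (1 / 2 ^ j) (slice_L2 u k) - slice_L2 u k)
        \<le> 2 * norm (shift i (1 / 2 ^ Suc j) (slice_L2 u k) - slice_L2 u k)"
      using norm_shift_multiple_le[of i 2 "1 / 2 ^ Suc j" "slice_L2 u k"] by simp
    then show ?thesis unfolding s_def by (intro power_mono) auto
  qed
  have "incseq (\<lambda>j. e j k)" for k unfolding e_def by (intro incseq_SucI sum_mono s_mono)
  then have "\<exists>L. (\<lambda>j. e j k) \<longlonglongrightarrow> L \<and> (\<forall>j. e j k \<le> L)" for k
    by (rule incseq_convergent) (use e_le1 in blast)+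
  then obtain E where E: "\<And>k. (\<lambda>j. e j k) \<longlonglongrightarrow> E k" "\<And>k j. e j k \<le> E k" by metis
  show ?thesis
  proof (rule that[of E])
    show E0: "0 \<le> E k" for k using e_nonneg[of 0 k] E(2)[of 0 k] by linarith
    have "(\<lambda>j. \<Sum>k<N. e j k) \<longlonglongrightarrow> (\<Sum>k<N. E k)" for N by (intro tendsto_sum E)
    then show "(\<Sum>k<N. E k) \<le> 1" for N by (rule LIMSEQ_le_const2) (use e_le in auto)
    fix k i and h :: real assume h: "0 \<le> h"
    show "norm (shift i h (slice_L2 u k) - slice_L2 u k) \<le> h * sqrt (E k)"
    proof (rule norm_shift_le_of_dyadic[OF _ _ h])
      fix j
      have "s i j k \<le> e j k" unfolding e_def by (rule member_le_sum) (auto simp: s_def)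
      then have "2 ^ j * norm (shift i (1 / 2 ^ j) (slice_L2 u k) - slice_L2 u k) \<le> sqrt (E k)"
        using E(2)[of j k] unfolding s_def by (intro real_le_rsqrt) linarith
      then show "norm (shift i (1 / 2 ^ j) (slice_L2 u k) - slice_L2 u k) \<le> sqrt (E k) / 2 ^ j"
        by (simp add: field_simps)
    qed (use E0 in auto)
  qed
qed

text \<open>The slice has height \<open>2 ^ k\<close>, equals it on the next level set and vanishes
  off the present one. Over a cube of twice the measure of that set its averages are at most half
  the height, while translations within the cube change it by at most
  \<open>n * (r * sqrt E)\<close>. The 16 is 4 from halving the height times 4 from
  \<open>2 powr (2 / n) \<le> 4\<close>.\<close>

lemma level_step:
  fixes u :: "'n::finite H1"
  assumes u: "norm u \<le> 1" and E: "0 \<le> E"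
    and s: "\<And>i h. 0 \<le> h \<Longrightarrow> norm (shift i h (slice_L2 u k) - slice_L2 u k) \<le> h * sqrt E"
  shows "4 ^ k * level u (Suc k) \<le> 16 * (real CARD('n))\<^sup>2 * level u k powr (2 / real CARD('n)) * E"
proof (cases "level u k = 0")
  case True
  have "emeasure lborel {x. 2 ^ Suc k < \<bar>rep_L2 (L2_of_H1 u) x\<bar>} \<le> emeasure lborel {x. 2 ^ k < \<bar>rep_L2 (L2_of_H1 u) x\<bar>}"
    by (intro emeasure_mono) (auto intro: le_less_trans[rotated])
  then have "level u (Suc k) = 0"
    unfolding emeasure_level[OF u] True using level_nonneg[of u "Suc k"] by simp
  then show ?thesis using True by simp
next
  case False
  define n where "n = real CARD('n)"
  have n: "n > 0" by (simp add: n_def)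
  define m where "m = level u k"
  have m: "m > 0" using False level_nonneg[of u k] by (simp add: m_def)
  \<comment> \<open>The cube of side \<open>r\<close> has volume \<open>2 * m\<close>, twice the
    measure of the set where the slice can be nonzero.\<close>
  define r where "r = (2 * m) powr (1 / n)"
  have r: "r > 0" using m by (simp add: r_def)
  have rn: "r ^ CARD('n) = 2 * m"
  proof -
    have "r ^ CARD('n) = r powr n" using r by (simp add: powr_realpow n_def)
    also have "\<dots> = 2 * m" using m n by (simp add: r_def powr_powr)
    finally show ?thesis .
  qed
  let ?f = "\<lambda>x. \<bar>rep_L2 (L2_of_H1 u) x\<bar>" and ?g = "\<lambda>x. slice k \<bar>rep_L2 (L2_of_H1 u) x\<bar>"
  let ?S = "{x. 2 ^ k < ?f x}" and ?A = "{x. 2 ^ Suc k < ?f x}"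
  have iS: "integrable lborel (\<lambda>x. 2 ^ k * indicator ?S x :: real)"
    using emeasure_level[OF u, of k] by (intro integrable_mult_right integrable_real_indicator) auto
  have gS: "?g x \<le> 2 ^ k * indicator ?S x" for x
    using slice_bounds[of k "?f x"] slice_eq_0[of "?f x" k] by (auto simp: indicator_def)
  have ig: "integrable lborel ?g"
    by (rule Bochner_Integration.integrable_bound[OF iS])
      (use gS slice_bounds in \<open>auto intro!: AE_I2 simp: abs_of_nonneg\<close>)
  have "(LINT x|lborel. ?g x) \<le> (LINT x|lborel. 2 ^ k * indicator ?S x)"
    by (intro integral_mono ig iS gS)
  also have "\<dots> = 2 ^ k * m" by (simp add: m_def level_def)
  finally have small: "2 * (LINT x|lborel. ?g x) \<le> 2 ^ k * r ^ CARD('n)" by (simp add: rn)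
  have "emeasure lborel ?A * ennreal ((2 ^ k / 2)\<^sup>2) \<le> ennreal ((n * (r * sqrt E))\<^sup>2)"
  proof (rule measure_top_set_le[OF square_integrable_slice ig _ _ _ _ r small])
    show "?g x = 2 ^ k" if "x \<in> ?A" for x using that by (intro slice_eq_top) auto
    show "norm (translate y (abs_L2 ?g) - abs_L2 ?g) \<le> n * (r * sqrt E)" if "\<forall>i. 0 \<le> y $ i \<and> y $ i \<le> r" for y
      using norm_translate_diff_le[of "slice_L2 u k" "sqrt E" y r] s that E
      by (simp add: slice_L2_def n_def)
  qed (auto simp: slice_bounds)
  then have "ennreal (level u (Suc k) * (2 ^ k / 2)\<^sup>2) \<le> ennreal ((n * (r * sqrt E))\<^sup>2)"
    unfolding emeasure_level[OF u] by (subst ennreal_mult) (auto simp: level_nonneg)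
  then have "level u (Suc k) * (2 ^ k / 2)\<^sup>2 \<le> (n * (r * sqrt E))\<^sup>2"
    by (subst (asm) ennreal_le_iff) auto
  moreover have "(2 ^ k)\<^sup>2 = (4 :: real) ^ k"
    by (simp add: power2_eq_square power_mult_distrib[symmetric])
  ultimately have 1: "4 ^ k * level u (Suc k) \<le> 4 * (n\<^sup>2 * (r\<^sup>2 * E))"
    using E by (simp add: power_mult_distrib power_divide mult.commute)
  have "r\<^sup>2 = (2 * m) powr (2 / n)"
    using r m by (simp add: r_def powr_powr flip: powr_realpow)
  also have "\<dots> = 2 powr (2 / n) * m powr (2 / n)" using m by (simp add: powr_mult)
  also have "\<dots> \<le> 2 powr 2 * m powr (2 / n)"
    using n by (intro mult_right_mono powr_mono) (auto simp: n_def divide_le_eq)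
  finally have "r\<^sup>2 \<le> 4 * m powr (2 / n)" by simp
  then have "4 * (n\<^sup>2 * (r\<^sup>2 * E)) \<le> 4 * (n\<^sup>2 * (4 * m powr (2 / n) * E))"
    using E by (intro mult_left_mono mult_right_mono) auto
  then show ?thesis using 1 by (simp add: m_def n_def mult_ac)
qed

text \<open>Here the exponent \<open>2 / n\<close> is at least 1 and the levels are at most 1, so
  the step inequality gains a factor \<open>4 ^ k\<close> at every step. \<open>B\<close> iterates
  it, and \<open>D\<close> combines its constant with the growth of the weight; the decay beats the
  weight for every exponent \<open>p\<close>.\<close>

lemma level_sum_bounded_low_dim:
  assumes p: "p > 0" and n: "CARD('n) \<le> 2"
  shows "\<exists>C. \<forall>(u :: 'n::finite H1) N. norm u \<le> 1 \<longrightarrow> (\<Sum>k<N. 4 powr (p * real k) * level u k) \<le> C"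
proof -
  define D where "D = 4 powr p * (16 * (real CARD('n))\<^sup>2)"
  have D: "D \<ge> 0" by (simp add: D_def)
  define B where "B = rec_nat 1 (\<lambda>k b. D / 4 ^ k * b)"
  have B: "B 0 = 1" "B (Suc k) = D / 4 ^ k * B k" for k by (simp_all add: B_def)
  have B0: "0 \<le> B k" for k by (induction k) (use D in \<open>auto simp: B\<close>)
  have le: "4 powr (p * real k) * level u k \<le> B k" if u: "norm u \<le> 1" for u :: "'n H1" and k
  proof -
    obtain E where E: "\<And>k. 0 \<le> E k" "\<And>N. (\<Sum>k<N. E k) \<le> 1"
      "\<And>k i h. 0 \<le> h \<Longrightarrow> norm (shift i h (slice_L2 u k) - slice_L2 u k) \<le> h * sqrt (E k)"
      using slice_energy[OF u] by metis
    have E1: "E k \<le> 1" for k using E(2)[of "Suc k"] sum_nonneg[of "{..<k}" E] E(1) by simp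
    have l1: "level u k \<le> 1" for k
    proof -
      have "1 * level u k \<le> 4 ^ k * level u k" by (intro mult_right_mono level_nonneg) simp
      then show ?thesis using level_le[OF u, of k] by simp
    qed
    show ?thesis
    proof (induction k)
      case 0
      then show ?case using l1[of 0] by (simp add: B)
    next
      case (Suc k)
      have "level u k powr (2 / real CARD('n)) * E k \<le> level u k * 1"
      proof (intro mult_mono E1 E level_nonneg)
        show "level u k powr (2 / real CARD('n)) \<le> level u k"
        proof (cases "level u k = 0")
          case False
          then have "level u k powr (2 / real CARD('n)) \<le> level u k powr 1"
            using n level_nonneg[of u k] l1[of k] by (intro powr_mono') (auto simp: le_divide_eq)
          then show ?thesis using level_nonneg[of u k] by simp
        qed simp
      qed
      then have "16 * (real CARD('n))\<^sup>2 * (level u k powr (2 / real CARD('n)) * E k) \<le> 16 * (real CARD('n))\<^sup>2 * level u k"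
        by (intro mult_left_mono) auto
      moreover have "4 ^ k * level u (Suc k) \<le> 16 * (real CARD('n))\<^sup>2 * (level u k powr (2 / real CARD('n)) * E k)"
        using level_step[OF u E(1)[of k] E(3)] by (simp only: mult.assoc)
      ultimately have "4 ^ k * level u (Suc k) \<le> 16 * (real CARD('n))\<^sup>2 * level u k"
        by (rule order_trans[rotated])
      then have st: "level u (Suc k) \<le> 16 * (real CARD('n))\<^sup>2 / 4 ^ k * level u k"
        by (simp add: field_simps)
      have "4 powr (p * real (Suc k)) * level u (Suc k) = 4 powr p * (4 powr (p * real k) * level u (Suc k))"
        by (simp add: distrib_left powr_add)
      also have "\<dots> \<le> 4 powr p * (4 powr (p * real k) * (16 * (real CARD('n))\<^sup>2 / 4 ^ k * level u k))"
        by (intro mult_left_mono st) auto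
      also have "\<dots> = D / 4 ^ k * (4 powr (p * real k) * level u k)" by (simp add: D_def)
      also have "\<dots> \<le> D / 4 ^ k * B k" using D by (intro mult_left_mono Suc) auto
      finally show ?case by (simp add: B)
    qed
  qed
  have sB: "summable B"
  proof -
    have "(\<lambda>k. D * (1 / 4) ^ k) \<longlonglongrightarrow> D * 0" by (intro tendsto_mult_left LIMSEQ_realpow_zero) auto
    then have "\<forall>\<^sub>F k in sequentially. D * (1 / 4) ^ k < 1 / 2" by (intro order_tendstoD(2)) auto
    then obtain K where K: "\<And>k. k \<ge> K \<Longrightarrow> D * (1 / 4) ^ k < 1 / 2" by (auto simp: eventually_sequentially)
    show ?thesis
    proof (rule summable_ratio_test[where c = "1 / 2" and N = K])
      fix k assume "k \<ge> K"
      then have "D / 4 ^ k * B k \<le> 1 / 2 * B k"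
        using K[of k] B0 by (intro mult_right_mono) (auto simp: power_divide)
      then show "norm (B (Suc k)) \<le> 1 / 2 * norm (B k)" using B0 D by (simp add: B)
    qed simp
  qed
  have "(\<Sum>k<N. 4 powr (p * real k) * level u k) \<le> suminf B" if "norm u \<le> 1" for u :: "'n H1" and N
    by (rule order_trans[OF sum_mono[OF le[OF that]] sum_le_suminf[OF sB]]) (use B0 in auto)
  then show ?thesis by blast
qed

text \<open>At the critical exponent the weights absorb the powers of 4 exactly: the weighted levels
  satisfy \<open>a (Suc k) \<le> K * (a k powr \<theta> * E k)\<close> with \<theta> < 1. As the
  numbers \<open>E k\<close> have sum at most 1, a partial sum \<open>S\<close> obeys
  \<open>S \<le> 1 + K * S powr \<theta>\<close>, a sublinear self-estimate.\<close>

lemma level_sum_bounded_high_dim: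
  assumes n: "CARD('n) \<ge> 3" and p: "p = real CARD('n) / (real CARD('n) - 2)"
  shows "\<exists>C. \<forall>(u :: 'n::finite H1) N. norm u \<le> 1 \<longrightarrow> (\<Sum>k<N. 4 powr (p * real k) * level u k) \<le> C"
proof -
  define n where "n = real CARD('n)"
  have n3: "n \<ge> 3" using \<open>CARD('n) \<ge> 3\<close> by (simp add: n_def)
  define \<theta> where "\<theta> = 2 / n"
  have \<theta>: "0 < \<theta>" "\<theta> < 1" using n3 by (auto simp: \<theta>_def)
  \<comment> \<open>The identity that singles out the critical exponent; it matches the weight on
    the right of the step inequality.\<close>
  have p\<theta>: "p * \<theta> = p - 1" using n3 by (simp add: p \<theta>_def n_def[symmetric] field_simps)
  define K where "K = 4 powr p * (16 * n\<^sup>2)"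
  have K: "K \<ge> 0" by (simp add: K_def)
  \<comment> \<open>The solution of \<open>S = (1 + K) * S powr \<theta>\<close>, to which the
    self-estimate leads when \<open>S > 1\<close>.\<close>
  define C where "C = (1 + K) powr (1 / (1 - \<theta>))"
  have C1: "C \<ge> 1" using K \<theta> by (simp add: C_def ge_one_powr_ge_zero)
  have "(\<Sum>k<N. 4 powr (p * real k) * level u k) \<le> C" if u: "norm u \<le> 1" for u :: "'n H1" and N
  proof -
    obtain E where E: "\<And>k. 0 \<le> E k" "\<And>N. (\<Sum>k<N. E k) \<le> 1"
      "\<And>k i h. 0 \<le> h \<Longrightarrow> norm (shift i h (slice_L2 u k) - slice_L2 u k) \<le> h * sqrt (E k)"
      using slice_energy[OF u] by metis
    define a where "a k = 4 powr (p * real k) * level u k" for k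
    have a0: "0 \<le> a k" for k by (simp add: a_def level_nonneg)
    have step: "a (Suc k) \<le> K * (a k powr \<theta> * E k)" for k
    proof -
      have "a (Suc k) = 4 powr p * (4 powr ((p - 1) * real k) * (4 ^ k * level u (Suc k)))"
      proof -
        have "4 powr (p * real (Suc k)) = 4 powr p * (4 powr ((p - 1) * real k) * 4 powr real k)"
          by (simp flip: powr_add add: algebra_simps)
        then show ?thesis by (simp add: a_def powr_realpow)
      qed
      also have "\<dots> \<le> 4 powr p * (4 powr ((p - 1) * real k) * (16 * n\<^sup>2 * level u k powr \<theta> * E k))"
        using level_step[OF u E(1)[of k] E(3)] by (intro mult_left_mono) (auto simp: n_def \<theta>_def)
      also have "\<dots> = K * ((4 powr (p * real k)) powr \<theta> * level u k powr \<theta> * E k)"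
        by (simp add: K_def powr_powr p\<theta>[symmetric] mult_ac)
      also have "(4 powr (p * real k)) powr \<theta> * level u k powr \<theta> = a k powr \<theta>"
        by (simp add: a_def powr_mult level_nonneg)
      finally show ?thesis .
    qed
    \<comment> \<open>One term more than the claim: the step inequality bounds the terms after the
      first by those with index below \<open>N\<close>, each of which is at most
      \<open>S\<close>.\<close>
    define S where "S = (\<Sum>k<Suc N. a k)"
    have S0: "0 \<le> S" by (simp add: S_def sum_nonneg a0 del: sum.lessThan_Suc)
    have "S = a 0 + (\<Sum>k<N. a (Suc k))" unfolding S_def by (rule sum.lessThan_Suc_shift)
    also have "\<dots> \<le> 1 + (\<Sum>k<N. K * (S powr \<theta> * E k))"
    proof (intro add_mono sum_mono)
      show "a 0 \<le> 1" using level_le[OF u, of 0] by (simp add: a_def)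
      fix k assume k: "k \<in> {..<N}"
      have "a k \<le> S" unfolding S_def by (rule member_le_sum) (use k a0 in auto)
      then have "a k powr \<theta> \<le> S powr \<theta>" using \<theta> a0 by (intro powr_mono2) auto
      then have "K * (a k powr \<theta> * E k) \<le> K * (S powr \<theta> * E k)"
        using K E(1) by (intro mult_left_mono mult_right_mono) auto
      then show "a (Suc k) \<le> K * (S powr \<theta> * E k)" using step[of k] by linarith
    qed
    also have "\<dots> = 1 + K * S powr \<theta> * (\<Sum>k<N. E k)" by (simp add: sum_distrib_left mult_ac)
    also have "\<dots> \<le> 1 + K * S powr \<theta> * 1"
      using K E(2) by (intro add_left_mono mult_left_mono) auto
    finally have S: "S \<le> 1 + K * S powr \<theta>" by simp
    have "S \<le> C"
    proof (cases "S \<le> 1")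
      case False
      then have "1 \<le> S powr \<theta>" using \<theta> by (simp add: ge_one_powr_ge_zero)
      then have "S \<le> (1 + K) * S powr \<theta>" using S by (simp add: algebra_simps)
      moreover have "S = S powr (1 - \<theta>) * S powr \<theta>" using False by (simp flip: powr_add)
      ultimately have "S powr (1 - \<theta>) * S powr \<theta> \<le> (1 + K) * S powr \<theta>" by simp
      then have "S powr (1 - \<theta>) \<le> 1 + K" using \<open>1 \<le> S powr \<theta>\<close> by (subst (asm) mult_le_cancel_right) auto
      then have "(S powr (1 - \<theta>)) powr (1 / (1 - \<theta>)) \<le> C"
        unfolding C_def using \<theta> by (intro powr_mono2) auto
      then show ?thesis using \<theta> False by (simp add: powr_powr)
    qed (use C1 in simp)
    moreover have "(\<Sum>k<N. a k) \<le> S" unfolding S_def using a0[of N] by simp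
    ultimately show ?thesis by (simp add: a_def)
  qed
  then show ?thesis by blast
qed

lemma level_sum_bounded:
  assumes p: "p > 0" and crit: "CARD('n) \<ge> 3 \<Longrightarrow> p \<le> real CARD('n) / (real CARD('n) - 2)"
  shows "\<exists>C. \<forall>(u :: 'n::finite H1) N. norm u \<le> 1 \<longrightarrow> (\<Sum>k<N. 4 powr (p * real k) * level u k) \<le> C"
proof (cases "CARD('n) \<ge> 3")
  case True
  define q where "q = real CARD('n) / (real CARD('n) - 2)"
  obtain C where C: "\<And>(u :: 'n H1) N. norm u \<le> 1 \<Longrightarrow> (\<Sum>k<N. 4 powr (q * real k) * level u k) \<le> C"
    using level_sum_bounded_high_dim[OF True q_def] by blast
  have "(\<Sum>k<N. 4 powr (p * real k) * level u k) \<le> C" if u: "norm u \<le> 1" for u :: "'n H1" and N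
  proof -
    have "(\<Sum>k<N. 4 powr (p * real k) * level u k) \<le> (\<Sum>k<N. 4 powr (q * real k) * level u k)"
      using crit[OF True] by (intro sum_mono mult_right_mono powr_mono level_nonneg mult_right_mono) (auto simp: q_def)
    then show ?thesis using C[OF u, of N] by linarith
  qed
  then show ?thesis by blast
next
  case False
  then show ?thesis using p by (intro level_sum_bounded_low_dim) auto
qed

text \<open>A layer-cake estimate. Where \<open>|u| \<le> 1\<close>, the power is at most the
  square; elsewhere \<open>2 ^ k < |u| \<le> 2 ^ Suc k\<close> for some \<open>k\<close>, and the
  power is at most \<open>4 powr (p * real (Suc k))\<close>, which the level sums account
  for.\<close>

lemma sobolev_unit_ball:
  assumes p: "p > 1" and crit: "CARD('n) \<ge> 3 \<Longrightarrow> p \<le> real CARD('n) / (real CARD('n) - 2)"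
  shows "\<exists>C\<ge>0. \<forall>u :: 'n::finite H1. norm u \<le> 1 \<longrightarrow>
    (\<integral>\<^sup>+x. ennreal (\<bar>rep_L2 (L2_of_H1 u) x\<bar> powr (2 * p)) \<partial>lborel) \<le> ennreal C"
proof -
  obtain C where C: "\<And>(u :: 'n H1) N. norm u \<le> 1 \<Longrightarrow> (\<Sum>k<N. 4 powr (p * real k) * level u k) \<le> C"
    using level_sum_bounded[OF less_trans[OF zero_less_one p] crit] by fast
  have C0: "C \<ge> 0" using C[of 0 0] by simp
  have "(\<integral>\<^sup>+x. ennreal (\<bar>rep_L2 (L2_of_H1 u) x\<bar> powr (2 * p)) \<partial>lborel) \<le> ennreal (1 + 4 powr p * C)"
    if u: "norm u \<le> 1" for u :: "'n H1"
  proof -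
    let ?f = "\<lambda>x. \<bar>rep_L2 (L2_of_H1 u) x\<bar>"
    let ?S = "\<lambda>k. {x. 2 ^ k < ?f x}"
    let ?c = "\<lambda>k. 4 powr p * 4 powr (p * real k)"
    have pt: "ennreal (?f x powr (2 * p)) \<le> ennreal ((rep_L2 (L2_of_H1 u) x)\<^sup>2) + (\<Sum>k. ennreal (?c k) * indicator (?S k) x)" for x
    proof (cases "?f x \<le> 1")
      case True
      have "?f x powr (2 * p) \<le> ?f x powr 2"
        using True p by (cases "?f x = 0") (simp, intro powr_mono', auto)
      also have "\<dots> = (rep_L2 (L2_of_H1 u) x)\<^sup>2" by simp
      finally show ?thesis by (intro add_increasing2 ennreal_leI) auto
    next
      case False
      define k where "k = (LEAST k. ?f x \<le> 2 ^ Suc k)"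
      obtain j where "?f x < 2 ^ j" using real_arch_pow[of 2 "?f x"] by auto
      then have "\<exists>j. ?f x \<le> 2 ^ Suc j"
        by (intro exI[of _ j]) (auto intro: order_trans[OF less_imp_le])
      then have k1: "?f x \<le> 2 ^ Suc k" unfolding k_def by (rule LeastI_ex)
      have k2: "2 ^ k < ?f x"
      proof (cases k)
        case (Suc j)
        then have "\<not> ?f x \<le> 2 ^ Suc j" using not_less_Least[of j "\<lambda>k. ?f x \<le> 2 ^ Suc k"] by (auto simp: k_def)
        then show ?thesis by (simp add: Suc)
      qed (use False in simp)
      have "?f x powr (2 * p) \<le> (2 ^ Suc k) powr (2 * p)"
        using k1 p by (intro powr_mono2) auto
      also have "\<dots> = ?c k"
      proof -
        have "(2 ^ Suc k) powr (2 * p) = (2 powr real (Suc k)) powr (2 * p)" by (simp only: powr_realpow zero_less_numeral)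
        also have "\<dots> = (2 powr 2) powr (p * real (Suc k))" by (simp only: powr_powr mult_ac)
        also have "\<dots> = 4 powr (p + p * real k)" by (simp add: algebra_simps)
        finally show ?thesis by (simp only: powr_add)
      qed
      finally have "ennreal (?f x powr (2 * p)) \<le> ennreal (?c k) * indicator (?S k) x"
        using k2 by (simp add: ennreal_leI)
      also have "\<dots> \<le> (\<Sum>k. ennreal (?c k) * indicator (?S k) x)"
        using sum_le_suminf[of "\<lambda>k. ennreal (?c k) * indicator (?S k) x" "{k}"]
        by (simp only: sum.insert finite.emptyI empty_iff not_False_eq_True sum.empty add_0_right summableI zero_le simp_thms finite.insertI)
      finally show ?thesis by (rule order_trans) (simp add: add_increasing)
    qed
    have "(\<integral>\<^sup>+x. ennreal (?f x powr (2 * p)) \<partial>lborel)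
        \<le> (\<integral>\<^sup>+x. ennreal ((rep_L2 (L2_of_H1 u) x)\<^sup>2) + (\<Sum>k. ennreal (?c k) * indicator (?S k) x) \<partial>lborel)"
      by (intro nn_integral_mono pt)
    also have "\<dots> = ennreal ((norm (L2_of_H1 u))\<^sup>2) + (\<Sum>k. ennreal (?c k) * emeasure lborel (?S k))"
      by (subst nn_integral_add) (auto simp: nn_integral_norm_L2 nn_integral_suminf nn_integral_cmult_indicator)
    also have "\<dots> \<le> ennreal 1 + ennreal (4 powr p * C)"
    proof (intro add_mono ennreal_leI)
      show "(norm (L2_of_H1 u))\<^sup>2 \<le> 1" using order_trans[OF norm_L2_of_H1_le u] by (simp add: power_le_one)
      have "(\<Sum>k. ennreal (?c k) * emeasure lborel (?S k)) = (\<Sum>k. ennreal (4 powr p * (4 powr (p * real k) * level u k)))"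
        by (intro suminf_cong) (simp add: emeasure_level[OF u] ennreal_mult level_nonneg mult.assoc)
      also have "\<dots> \<le> ennreal (4 powr p * C)"
      proof (rule suminf_le_const)
        fix N
        have "(\<Sum>k<N. ennreal (4 powr p * (4 powr (p * real k) * level u k)))
            = ennreal (\<Sum>k<N. 4 powr p * (4 powr (p * real k) * level u k))"
          by (rule sum_ennreal) (simp add: level_nonneg)
        also have "\<dots> = ennreal (4 powr p * (\<Sum>k<N. 4 powr (p * real k) * level u k))"
          by (simp add: sum_distrib_left)
        also have "\<dots> \<le> ennreal (4 powr p * C)"
          by (intro ennreal_leI mult_left_mono C[OF u]) simp
        finally show "(\<Sum>k<N. ennreal (4 powr p * (4 powr (p * real k) * level u k))) \<le> ennreal (4 powr p * C)" .
      qed simp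
      finally show "(\<Sum>k. ennreal (?c k) * emeasure lborel (?S k)) \<le> ennreal (4 powr p * C)" .
    qed
    also have "\<dots> = ennreal (1 + 4 powr p * C)" using C0 by (subst ennreal_plus) auto
    finally show ?thesis .
  qed
  then show ?thesis using C0 by (intro exI[of _ "1 + 4 powr p * C"]) auto
qed

text \<open>Scaling to the unit ball. Dividing by a positive upper bound \<open>R\<close> of the
  norm, instead of the norm itself, includes \<open>u = 0\<close>.\<close>

theorem sobolev_embedding:
  assumes p: "p > 1" and crit: "CARD('n) \<ge> 3 \<Longrightarrow> p \<le> real CARD('n) / (real CARD('n) - 2)"
  shows "\<exists>C\<ge>0. \<forall>(u :: 'n::finite H1) R. norm u \<le> R \<longrightarrow> 0 < R \<longrightarrow>
    (\<integral>\<^sup>+x. ennreal (\<bar>rep_L2 (L2_of_H1 u) x / R\<bar> powr (2 * p)) \<partial>lborel) \<le> ennreal C"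
proof -
  obtain C where C: "C \<ge> 0" "\<And>u :: 'n H1. norm u \<le> 1 \<Longrightarrow>
      (\<integral>\<^sup>+x. ennreal (\<bar>rep_L2 (L2_of_H1 u) x\<bar> powr (2 * p)) \<partial>lborel) \<le> ennreal C"
    using sobolev_unit_ball[OF p crit] by blast
  have "(\<integral>\<^sup>+x. ennreal (\<bar>rep_L2 (L2_of_H1 u) x / R\<bar> powr (2 * p)) \<partial>lborel) \<le> ennreal C"
    if u: "norm u \<le> R" "0 < R" for u :: "'n H1" and R
  proof -
    have "L2_of_H1 ((1 / R) *\<^sub>R u) = (1 / R) *\<^sub>R abs_L2 (rep_L2 (L2_of_H1 u))"
      by (simp add: scaleR_H1.rep_eq abs_L2_rep_L2)
    also have "\<dots> = abs_L2 (\<lambda>x. (1 / R) * rep_L2 (L2_of_H1 u) x)"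
      by (rule abs_L2_scaleR[OF square_integrable_rep_L2])
    finally have "AE x in lborel. rep_L2 (L2_of_H1 ((1 / R) *\<^sub>R u)) x = (1 / R) * rep_L2 (L2_of_H1 u) x"
      using rep_abs_L2[OF square_integrable_scale[OF square_integrable_rep_L2[of "L2_of_H1 u"]], of "1 / R"] by simp
    then have "(\<integral>\<^sup>+x. ennreal (\<bar>rep_L2 (L2_of_H1 u) x / R\<bar> powr (2 * p)) \<partial>lborel)
        = (\<integral>\<^sup>+x. ennreal (\<bar>rep_L2 (L2_of_H1 ((1 / R) *\<^sub>R u)) x\<bar> powr (2 * p)) \<partial>lborel)"
      by (intro nn_integral_cong_AE) (auto elim: eventually_mono)
    also have "\<dots> \<le> ennreal C" using u by (intro C) (auto simp: divide_le_eq)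
    finally show ?thesis .
  qed
  then show ?thesis using C(1) by blast
qed

section \<open>The nonlinearity\<close>

lemma powr_diff_le:
  fixes x y p :: real
  assumes p: "p > 1" and xy: "0 \<le> y" "y \<le> x"
  shows "x powr p - y powr p \<le> p * x powr (p - 1) * (x - y)"
proof (cases "x = y")
  case False
  then have "y < x" using xy by simp
  have "\<exists>l z. y < z \<and> z < x \<and> ((\<lambda>x. x powr p) has_real_derivative l) (at z) \<and> x powr p - y powr p = (x - y) * l"
  proof (rule MVT[OF \<open>y < x\<close>])
    show "continuous_on {y..x} (\<lambda>x. x powr p)"
      using xy p by (intro continuous_on_powr' continuous_intros) auto
    show "(\<lambda>x. x powr p) differentiable (at z)" if "y < z" "z < x" for z
      using that xy has_real_derivative_powr[of z p] by (auto simp: real_differentiable_def)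
  qed
  then obtain l z where z: "y < z" "z < x" "((\<lambda>x. x powr p) has_real_derivative l) (at z)"
    and eq: "x powr p - y powr p = (x - y) * l" by blast
  have "l = p * z powr (p - 1)"
    using DERIV_unique[OF z(3) has_real_derivative_powr] z xy by simp
  also have "\<dots> \<le> p * x powr (p - 1)"
    using p z xy by (intro mult_left_mono powr_mono2) auto
  finally have "(x - y) * l \<le> (x - y) * (p * x powr (p - 1))" using xy by (intro mult_left_mono) auto
  then show ?thesis using eq by (simp add: mult_ac)
qed simp

lemma powr_abs_diff_le:
  fixes a a' p :: real
  assumes p: "p > 1"
  shows "\<bar>\<bar>a\<bar> powr p - \<bar>a'\<bar> powr p\<bar> \<le> p * max \<bar>a\<bar> \<bar>a'\<bar> powr (p - 1) * \<bar>a - a'\<bar>"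
proof -
  have *: "\<bar>\<bar>a\<bar> powr p - \<bar>a'\<bar> powr p\<bar> \<le> p * max \<bar>a\<bar> \<bar>a'\<bar> powr (p - 1) * \<bar>a - a'\<bar>" if "\<bar>a'\<bar> \<le> \<bar>a\<bar>" for a a' :: real
  proof -
    have "\<bar>a'\<bar> powr p \<le> \<bar>a\<bar> powr p" using that p by (intro powr_mono2) auto
    then have "\<bar>\<bar>a\<bar> powr p - \<bar>a'\<bar> powr p\<bar> = \<bar>a\<bar> powr p - \<bar>a'\<bar> powr p" by simp
    also have "\<dots> \<le> p * \<bar>a\<bar> powr (p - 1) * (\<bar>a\<bar> - \<bar>a'\<bar>)" using that by (intro powr_diff_le p) auto
    also have "\<dots> \<le> p * \<bar>a\<bar> powr (p - 1) * \<bar>a - a'\<bar>" using p by (intro mult_left_mono) auto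
    finally show ?thesis using that by (simp add: max_def)
  qed
  show ?thesis using *[of a' a] *[of a a'] by (cases "\<bar>a'\<bar> \<le> \<bar>a\<bar>") (auto simp: abs_minus_commute max.commute)
qed

text \<open>A pointwise substitute for Hoelder's inequality: both factors are bounded by powers of
  the larger of \<open>x\<close> and \<open>y\<close>.\<close>

lemma young_powr:
  fixes x y p :: real
  assumes p: "p > 1" and "0 \<le> x" "0 \<le> y"
  shows "(x powr (p - 1) * y)\<^sup>2 \<le> x powr (2 * p) + y powr (2 * p)"
proof -
  have e: "(z powr (p - 1) * z)\<^sup>2 = z powr (2 * p)" if "0 \<le> z" for z
  proof (cases "z = 0")
    case False
    then have "z powr (p - 1) * z = z powr p" using that by (simp add: powr_diff)
    then show ?thesis using that by (simp add: power2_eq_square flip: powr_add)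
  qed simp
  have "x powr (p - 1) * y \<le> max x y powr (p - 1) * max x y"
    using assms by (intro mult_mono powr_mono2) auto
  then have "(x powr (p - 1) * y)\<^sup>2 \<le> (max x y powr (p - 1) * max x y)\<^sup>2"
    using assms by (intro power_mono) auto
  also have "\<dots> = max x y powr (2 * p)" using assms by (intro e) auto
  also have "\<dots> \<le> x powr (2 * p) + y powr (2 * p)" by (simp add: max_def)
  finally show ?thesis .
qed

definition power_map :: "real \<Rightarrow> 'n::finite H1 \<Rightarrow> 'n L2" where
  "power_map p u = abs_L2 (\<lambda>x. \<bar>rep_L2 (L2_of_H1 u) x\<bar> powr p)"

lemma square_integrable_power:
  assumes p: "p > 1" and crit: "CARD('n) \<ge> 3 \<Longrightarrow> p \<le> real CARD('n) / (real CARD('n) - 2)"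
  shows "square_integrable (\<lambda>x. \<bar>rep_L2 (L2_of_H1 (u :: 'n::finite H1)) x\<bar> powr p)"
proof -
  define R where "R = norm u + 1"
  have R: "R > 0" "norm u \<le> R" by (auto simp: R_def add_nonneg_pos)
  obtain C where C: "(\<integral>\<^sup>+x. ennreal (\<bar>rep_L2 (L2_of_H1 u) x / R\<bar> powr (2 * p)) \<partial>lborel) \<le> ennreal C"
    using sobolev_embedding[OF p crit] R by blast
  have "integrable lborel (\<lambda>x. \<bar>rep_L2 (L2_of_H1 u) x / R\<bar> powr (2 * p))"
    using le_less_trans[OF C ennreal_less_top] by (intro integrableI_bounded) auto
  then have "integrable lborel (\<lambda>x. R powr (2 * p) * \<bar>rep_L2 (L2_of_H1 u) x / R\<bar> powr (2 * p))"
    by (rule integrable_mult_right)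
  moreover have "R powr (2 * p) * \<bar>rep_L2 (L2_of_H1 u) x / R\<bar> powr (2 * p) = (\<bar>rep_L2 (L2_of_H1 u) x\<bar> powr p)\<^sup>2" for x
    using R by (simp add: powr_divide power2_eq_square flip: powr_add)
  ultimately have "integrable lborel (\<lambda>x. (\<bar>rep_L2 (L2_of_H1 u) x\<bar> powr p)\<^sup>2)" by (simp only:)
  then show ?thesis by (simp add: square_integrable_def)
qed

lemma rep_power_map:
  assumes p: "p > 1" and crit: "CARD('n) \<ge> 3 \<Longrightarrow> p \<le> real CARD('n) / (real CARD('n) - 2)"
  shows "AE x in lborel. rep_L2 (power_map p (u :: 'n::finite H1)) x = \<bar>rep_L2 (L2_of_H1 u) x\<bar> powr p"
  unfolding power_map_def by (rule rep_abs_L2[OF square_integrable_power[OF p crit]])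

text \<open>The mean value bound has the form of a power times the difference. Scaling
  \<open>u\<close> and \<open>v\<close> by \<open>M\<close>, and the difference by its own norm
  \<open>D\<close>, lets the additive inequality of Young type give a bound proportional to
  \<open>D\<close>. The embedding bounds each of the three scaled integrals by \<open>C\<close>,
  whence \<open>3 * C\<close>.\<close>

lemma power_map_lipschitz:
  assumes p: "p > 1" and crit: "CARD('n) \<ge> 3 \<Longrightarrow> p \<le> real CARD('n) / (real CARD('n) - 2)"
  shows "\<exists>L. \<forall>u v :: 'n::finite H1. norm u \<le> R \<longrightarrow> norm v \<le> R \<longrightarrow>
    norm (power_map p u - power_map p v) \<le> L * norm (u - v)"
proof -
  obtain C where C: "C \<ge> 0" "\<And>(u :: 'n H1) R. norm u \<le> R \<Longrightarrow> 0 < R \<Longrightarrow>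
      (\<integral>\<^sup>+x. ennreal (\<bar>rep_L2 (L2_of_H1 u) x / R\<bar> powr (2 * p)) \<partial>lborel) \<le> ennreal C"
    using sobolev_embedding[OF p crit] by blast
  define M where "M = \<bar>R\<bar> + 1"
  have M: "M > 0" by (simp add: M_def)
  define K where "K = p * M powr (p - 1)"
  have K: "K \<ge> 0" using p by (simp add: K_def)
  have "norm (power_map p u - power_map p v) \<le> sqrt (K\<^sup>2 * (3 * C)) * norm (u - v)"
    if uv: "norm u \<le> R" "norm v \<le> R" for u v :: "'n H1"
  proof (cases "u = v")
    case False
    define D where "D = norm (u - v)"
    have D: "D > 0" using False by (simp add: D_def)
    have uM: "norm u \<le> M" "norm v \<le> M" using uv by (auto simp: M_def)
    let ?f = "rep_L2 (L2_of_H1 u)" and ?g = "rep_L2 (L2_of_H1 v)" and ?d = "rep_L2 (L2_of_H1 (u - v))"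
    have AEd: "AE x in lborel. ?d x = ?f x - ?g x" unfolding L2_of_H1_minus by (rule rep_L2_diff)
    have pt: "ennreal ((\<bar>?f x\<bar> powr p - \<bar>?g x\<bar> powr p)\<^sup>2)
        \<le> ennreal ((K * D)\<^sup>2) * (ennreal (\<bar>?f x / M\<bar> powr (2 * p)) + ennreal (\<bar>?g x / M\<bar> powr (2 * p)) + ennreal (\<bar>?d x / D\<bar> powr (2 * p)))"
      if dx: "?d x = ?f x - ?g x" for x
    proof -
      define m where "m = max \<bar>?f x / M\<bar> \<bar>?g x / M\<bar>"
      have mM: "max \<bar>?f x\<bar> \<bar>?g x\<bar> = M * m" using M by (simp add: m_def max_mult_distrib_left)
      have m0: "0 \<le> m" by (simp add: m_def le_max_iff_disj)
      have "\<bar>\<bar>?f x\<bar> powr p - \<bar>?g x\<bar> powr p\<bar> \<le> p * (M * m) powr (p - 1) * \<bar>?d x\<bar>"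
        using powr_abs_diff_le[OF p, of "?f x" "?g x"] unfolding mM dx .
      also have "\<dots> = K * D * (m powr (p - 1) * \<bar>?d x / D\<bar>)"
        using M m0 D by (simp add: K_def powr_mult)
      finally have "\<bar>\<bar>?f x\<bar> powr p - \<bar>?g x\<bar> powr p\<bar>\<^sup>2 \<le> (K * D * (m powr (p - 1) * \<bar>?d x / D\<bar>))\<^sup>2"
        by (intro power_mono) auto
      also have "\<dots> = (K * D)\<^sup>2 * (m powr (p - 1) * \<bar>?d x / D\<bar>)\<^sup>2" by (simp only: power_mult_distrib)
      also have "\<dots> \<le> (K * D)\<^sup>2 * (m powr (2 * p) + \<bar>?d x / D\<bar> powr (2 * p))"
        by (intro mult_left_mono young_powr p m0) auto
      also have "\<dots> \<le> (K * D)\<^sup>2 * (\<bar>?f x / M\<bar> powr (2 * p) + \<bar>?g x / M\<bar> powr (2 * p) + \<bar>?d x / D\<bar> powr (2 * p))"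
        by (intro mult_left_mono add_right_mono) (auto simp: m_def max_def)
      finally have "ennreal ((\<bar>?f x\<bar> powr p - \<bar>?g x\<bar> powr p)\<^sup>2)
          \<le> ennreal ((K * D)\<^sup>2 * (\<bar>?f x / M\<bar> powr (2 * p) + \<bar>?g x / M\<bar> powr (2 * p) + \<bar>?d x / D\<bar> powr (2 * p)))"
        by (intro ennreal_leI) simp
      then show ?thesis by (simp add: ennreal_mult ennreal_plus del: abs_divide)
    qed
    have "ennreal ((norm (power_map p u - power_map p v))\<^sup>2) = (\<integral>\<^sup>+x. ennreal ((\<bar>?f x\<bar> powr p - \<bar>?g x\<bar> powr p)\<^sup>2) \<partial>lborel)"
    proof -
      note si = square_integrable_power[OF p crit, of u] square_integrable_power[OF p crit, of v]
      have "(norm (power_map p u - power_map p v))\<^sup>2 = (LINT x|lborel. (\<bar>?f x\<bar> powr p - \<bar>?g x\<bar> powr p)\<^sup>2)"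
        by (simp add: power_map_def abs_L2_diff[OF si] norm_abs_L2_squared[OF square_integrable_diff[OF si]])
      then show ?thesis
        using square_integrable_diff[OF si] by (simp add: nn_integral_eq_integral square_integrable_def)
    qed
    also have "\<dots> \<le> (\<integral>\<^sup>+x. ennreal ((K * D)\<^sup>2) * (ennreal (\<bar>?f x / M\<bar> powr (2 * p))
        + ennreal (\<bar>?g x / M\<bar> powr (2 * p)) + ennreal (\<bar>?d x / D\<bar> powr (2 * p))) \<partial>lborel)"
      by (rule nn_integral_mono_AE) (use AEd pt in \<open>auto elim!: eventually_mono simp del: abs_divide\<close>)
    also have "\<dots> = ennreal ((K * D)\<^sup>2) * ((\<integral>\<^sup>+x. ennreal (\<bar>?f x / M\<bar> powr (2 * p)) \<partial>lborel)
        + (\<integral>\<^sup>+x. ennreal (\<bar>?g x / M\<bar> powr (2 * p)) \<partial>lborel) + (\<integral>\<^sup>+x. ennreal (\<bar>?d x / D\<bar> powr (2 * p)) \<partial>lborel))"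
      by (simp add: nn_integral_cmult nn_integral_add del: abs_divide)
    also have "\<dots> \<le> ennreal ((K * D)\<^sup>2) * (ennreal C + ennreal C + ennreal C)"
      using M D uM by (intro mult_left_mono add_mono C) (auto simp: D_def)
    also have "\<dots> = ennreal (K\<^sup>2 * (3 * C) * D\<^sup>2)"
      using C(1) by (simp add: ennreal_mult[symmetric] ennreal_plus[symmetric] power_mult_distrib mult_ac del: ennreal_plus)
    finally have "(norm (power_map p u - power_map p v))\<^sup>2 \<le> K\<^sup>2 * (3 * C) * D\<^sup>2"
      using C(1) by (subst (asm) ennreal_le_iff) auto
    also have "\<dots> = (sqrt (K\<^sup>2 * (3 * C)) * D)\<^sup>2" using C(1) by (simp add: power_mult_distrib)
    finally have "norm (power_map p u - power_map p v) \<le> sqrt (K\<^sup>2 * (3 * C)) * D"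
      by (rule power2_le_imp_le) (use C(1) D in auto)
    then show ?thesis by (simp add: D_def)
  qed simp
  then show ?thesis by blast
qed

section \<open>Maximal mild solutions\<close>

locale cauchy_problem = damped_wave b0 \<beta> for b0 \<beta> :: real +
  fixes p :: real and u0 :: "'n::finite H1" and u1 :: "'n L2"
  assumes p: "p > 1" and p_le: "CARD('n) \<ge> 3 \<Longrightarrow> p \<le> real CARD('n) / (real CARD('n) - 2)"
begin

definition forcing :: "real \<Rightarrow> 'n H1 \<times> 'n L2 \<Rightarrow> 'n H1 \<times> 'n L2" where
  "forcing t y = (0, power_map p (fst y))"

sublocale nl: semilinear "propagator :: real \<Rightarrow> real \<Rightarrow> 'n H1 \<times> 'n L2 \<Rightarrow> 'n H1 \<times> 'n L2" forcing
proof
  fix T R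
  obtain L where L: "\<And>u v :: 'n H1. norm u \<le> R \<Longrightarrow> norm v \<le> R \<Longrightarrow>
      norm (power_map p u - power_map p v) \<le> L * norm (u - v)"
    using power_map_lipschitz[OF p p_le, of R] by blast
  have "norm (forcing t x - forcing t y) \<le> \<bar>L\<bar> * norm (x - y)" if "norm x \<le> R" "norm y \<le> R" for t x y
  proof -
    have "norm (forcing t x - forcing t y) = norm (power_map p (fst x) - power_map p (fst y))"
      by (simp add: forcing_def norm_Pair)
    also have "\<dots> \<le> L * norm (fst x - fst y)"
      using that norm_fst_le order_trans by (intro L) blast+
    also have "\<dots> \<le> \<bar>L\<bar> * norm (x - y)"
      using norm_fst_le[of "x - y"] by (intro mult_mono) auto
    finally show ?thesis .
  qed
  then show "\<exists>L. \<forall>t x y. 0 \<le> t \<longrightarrow> t \<le> T \<longrightarrow> norm x \<le> R \<longrightarrow> norm y \<le> R \<longrightarrow>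
      norm (forcing t x - forcing t y) \<le> L * norm (x - y)" by blast
  show "continuous_on {0..} (\<lambda>t. forcing t x)" for x by (simp add: forcing_def)
qed

lemma AE_power_map: "AE x in lborel. rep_L2 (power_map p u) x = \<bar>rep_L2 (L2_of_H1 (u :: 'n H1)) x\<bar> powr p"
  by (rule rep_power_map[OF p p_le])

text \<open>Identifies the function \<open>f\<close> whose existence a mild solution asserts, so
  that it can be replaced by the Lipschitz map.\<close>

lemma AE_eq_power_iff:
  "(AE x in lborel. rep_L2 f x = \<bar>rep_L2 (L2_of_H1 u) x\<bar> powr p) \<longleftrightarrow> f = power_map p (u :: 'n H1)"
proof
  assume "AE x in lborel. rep_L2 f x = \<bar>rep_L2 (L2_of_H1 u) x\<bar> powr p"
  with AE_power_map[of u] have "AE x in lborel. rep_L2 f x = rep_L2 (power_map p u) x"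
    by eventually_elim simp
  then show "f = power_map p u" by (rule L2_eqI)
next
  assume "f = power_map p u"
  then show "AE x in lborel. rep_L2 f x = \<bar>rep_L2 (L2_of_H1 u) x\<bar> powr p"
    by (simp only: AE_power_map)
qed

text \<open>The position component starts at 0 and its velocity is bounded. The gained factor
  \<open>t - s\<close> makes the Duhamel term quadratically small over short intervals.\<close>

lemma norm_L2_duhamel_operator_le:
  assumes st: "0 \<le> s" "s \<le> t" "t \<le> T"
  shows "norm (L2_of_H1 (fst (propagator t s (0, g :: 'n L2)))) \<le> (2 + T) * norm g * (t - s)"
proof -
  have "norm (L2_of_H1 (fst (propagator t s (0, g))) - L2_of_H1 (fst (propagator s s (0, g)))) \<le> (2 + T) * norm g * (t - s)"
  proof (rule norm_diff_le_of_derivative[OF st(2)])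
    fix r assume r: "r \<in> {s..t}"
    show "((\<lambda>t. L2_of_H1 (fst (propagator t s (0, g)))) has_vector_derivative snd (propagator r s (0, g))) (at r within {s..t})"
      by (rule has_vector_derivative_within_subset[OF propagator_derivative]) (use r st in auto)
    have "norm (snd (propagator r s (0, g))) \<le> norm (propagator r s (0, g))" by (rule norm_snd_le)
    also have "\<dots> \<le> (2 + T) * norm (0 :: 'n H1, g)" using r st by (intro propagator_bound) auto
    finally show "norm (snd (propagator r s (0, g))) \<le> (2 + T) * norm g" by (simp add: norm_Pair)
  qed
  then show ?thesis by (simp add: propagator_same[OF st(1)] zero_H1.rep_eq)
qed

text \<open>Over a short time interval the linear evolution is differentiable in \<open>L\<^sup>2\<close>, and the Duhamel
  term is quadratically small in \<open>L\<^sup>2\<close>.\<close>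

lemma mild_derivative:
  assumes U: "nl.mild 0 T y U" and t: "t \<in> {0..T}"
  shows "((\<lambda>t. L2_of_H1 (fst (U t))) has_vector_derivative snd (U t)) (at t within {0..T})"
  unfolding has_vector_derivative_def has_derivative_within_alt
proof (intro conjI allI impI bounded_linear_scaleR_left)
  fix e :: real assume e: "e > 0"
  have cU: "continuous_on {0..T} U" using U by (simp add: nl.mild_def)
  have cF: "continuous_on {0..T} (\<lambda>s. forcing s (U s))" by (rule nl.continuous_on_G[OF order_refl cU])
  obtain B where B: "\<And>s. s \<in> {0..T} \<Longrightarrow> norm (forcing s (U s)) \<le> B"
    using continuous_on_Icc_bounded[OF cF] by metis
  define K where "K = (2 + T) * B"
  have T: "0 \<le> T" using t by simp
  have K: "0 \<le> K" using order_trans[OF norm_ge_zero B[OF t]] T by (simp add: K_def)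
  have duh: "norm (L2_of_H1 (fst (duhamel a b (\<lambda>s. forcing s (U s))))) \<le> K * (b - a) * (b - a)"
    if ab: "0 \<le> a" "a \<le> b" "b \<le> T" for a b
  proof -
    have cab: "continuous_on {a..b} (\<lambda>s. forcing s (U s))"
      by (rule continuous_on_subset[OF cF]) (use ab in auto)
    have bl: "bounded_linear (\<lambda>z :: 'n H1 \<times> 'n L2. L2_of_H1 (fst z))"
      by (rule bounded_linear_compose[OF bounded_linear_L2_of_H1 bounded_linear_fst])
    have c: "continuous_on {a..b} (\<lambda>s. propagator b s (forcing s (U s)))"
      by (rule duhamel_integrand_continuous[OF ab(1) order_refl cab])
    have "L2_of_H1 (fst (duhamel a b (\<lambda>s. forcing s (U s))))
        = integral {a..b} (\<lambda>s. L2_of_H1 (fst (propagator b s (forcing s (U s)))))"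
      using integral_linear[OF integrable_continuous_real[OF c] bl] by (simp add: duhamel_def comp_def)
    also have "norm \<dots> \<le> K * (b - a) * (b - a)"
    proof (rule integral_bound[OF ab(2)])
      show "continuous_on {a..b} (\<lambda>s. L2_of_H1 (fst (propagator b s (forcing s (U s)))))"
        by (rule bounded_linear.continuous_on[OF bl c])
      fix s assume s: "s \<in> {a..b}"
      have "norm (L2_of_H1 (fst (propagator b s (forcing s (U s))))) \<le> (2 + T) * norm (power_map p (fst (U s))) * (b - s)"
        unfolding forcing_def using s ab by (intro norm_L2_duhamel_operator_le) auto
      also have "\<dots> \<le> K * (b - a)"
        unfolding K_def using B[of s] s ab T K by (intro mult_mono) (auto simp: forcing_def norm_Pair K_def)
      finally show "norm (L2_of_H1 (fst (propagator b s (forcing s (U s))))) \<le> K * (b - a)" .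
    qed
    finally show ?thesis .
  qed
  let ?D = "{(r, a). 0 \<le> a \<and> a \<le> r \<and> r \<le> T}"
  have "continuous_on ?D (\<lambda>(r, a). propagator r a (U a))"
    by (rule continuous_joint[OF order_refl cU])
  moreover have "(t, t) \<in> ?D" using t by simp
  ultimately have "\<exists>d>0. \<forall>z\<in>?D. dist z (t, t) < d \<longrightarrow>
      dist ((\<lambda>(r, a). propagator r a (U a)) z) ((\<lambda>(r, a). propagator r a (U a)) (t, t)) < e / 2"
    unfolding continuous_on_iff using half_gt_zero[OF e] by blast
  then obtain d where d: "d > 0" "\<forall>z\<in>?D. dist z (t, t) < d \<longrightarrow>
      dist ((\<lambda>(r, a). propagator r a (U a)) z) ((\<lambda>(r, a). propagator r a (U a)) (t, t)) < e / 2"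
    by blast
  have near: "norm (snd (propagator r a (U a)) - snd (U t)) \<le> e / 2"
    if "0 \<le> a" "a \<le> r" "r \<le> T" "\<bar>r - t\<bar> < d / 2" "\<bar>a - t\<bar> < d / 2" for r a
  proof -
    have "dist (r, a) (t, t) \<le> \<bar>r - t\<bar> + \<bar>a - t\<bar>"
      using norm_Pair_le[of "r - t" "a - t"] by (simp add: dist_norm)
    then have "dist (propagator r a (U a)) (U t) < e / 2"
      using bspec[OF d(2), of "(r, a)"] that propagator_same[of t "U t"] t by simp
    then show ?thesis
      using norm_snd_le[of "propagator r a (U a) - U t"] by (simp add: dist_norm)
  qed
  \<comment> \<open>The evolution runs forward only, so the increment is always computed by
    restarting at its left end \<open>a\<close>; this covers increments on both sides of
    \<open>t\<close>.\<close>
  have incr: "norm (L2_of_H1 (fst (U b)) - L2_of_H1 (fst (U a)) - (b - a) *\<^sub>R snd (U t)) \<le> e * (b - a)"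
    if ab: "0 \<le> a" "a \<le> b" "b \<le> T" and n: "\<bar>a - t\<bar> < d / 2" "\<bar>b - t\<bar> < d / 2" and small: "K * (b - a) \<le> e / 2" for a b
  proof -
    define D where "D = duhamel a b (\<lambda>s. forcing s (U s))"
    have cb: "continuous_on {0..b} (\<lambda>s. forcing s (U s))"
      by (rule continuous_on_subset[OF cF]) (use ab in auto)
    have eqs: "U a = propagator a 0 y + duhamel 0 a (\<lambda>s. forcing s (U s))"
      "U b = propagator b 0 y + duhamel 0 b (\<lambda>s. forcing s (U s))"
      using U ab by (auto simp: nl.mild_def)
    have "U b = propagator b a (U a) + D"
      unfolding eqs D_def duhamel_restart[OF order_refl ab(1,2) cb, symmetric]
        linear_add[OF linear_propagator[OF ab(1,2)]]
      using ab by (simp add: propagator_propagator)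
    then have "L2_of_H1 (fst (U b)) = L2_of_H1 (fst (propagator b a (U a))) + L2_of_H1 (fst D)"
      by (simp add: plus_H1.rep_eq)
    moreover have "norm ((L2_of_H1 (fst (propagator b a (U a))) - b *\<^sub>R snd (U t))
        - (L2_of_H1 (fst (propagator a a (U a))) - a *\<^sub>R snd (U t))) \<le> e / 2 * (b - a)"
    proof (rule norm_diff_le_of_derivative[OF ab(2)])
      fix r assume r: "r \<in> {a..b}"
      have "((\<lambda>r. L2_of_H1 (fst (propagator r a (U a)))) has_vector_derivative snd (propagator r a (U a))) (at r within {a..b})"
        by (rule has_vector_derivative_within_subset[OF propagator_derivative]) (use r ab in auto)
      moreover have "((\<lambda>r. r *\<^sub>R snd (U t)) has_vector_derivative 1 *\<^sub>R snd (U t)) (at r within {a..b})"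
        by (rule bounded_linear.has_vector_derivative[OF bounded_linear_scaleR_left has_vector_derivative_id])
      ultimately show "((\<lambda>r. L2_of_H1 (fst (propagator r a (U a))) - r *\<^sub>R snd (U t)) has_vector_derivative
          snd (propagator r a (U a)) - 1 *\<^sub>R snd (U t)) (at r within {a..b})"
        by (rule has_vector_derivative_diff)
      show "norm (snd (propagator r a (U a)) - 1 *\<^sub>R snd (U t)) \<le> e / 2"
        using near[of a r] r ab n by (simp add: abs_if split: if_splits)
    qed
    moreover have "norm (L2_of_H1 (fst D)) \<le> e / 2 * (b - a)"
      using duh[OF ab] mult_right_mono[OF small, of "b - a"] ab(2) by (simp add: D_def)
    ultimately show ?thesis
      using norm_triangle_ineq[of "L2_of_H1 (fst (propagator b a (U a))) - L2_of_H1 (fst (U a)) - (b - a) *\<^sub>R snd (U t)" "L2_of_H1 (fst D)"]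
      by (simp add: propagator_same[OF ab(1)] algebra_simps)
  qed
  \<comment> \<open>The first entry keeps both times in the range of \<open>near\<close>, the second
    makes the Duhamel part at most \<open>e / 2\<close> per unit of time; \<open>K + 1\<close>
    avoids a zero denominator.\<close>
  define \<delta> where "\<delta> = min (d / 2) (e / (2 * (K + 1)))"
  have \<delta>: "\<delta> > 0" using d(1) e K by (simp add: \<delta>_def)
  have K\<delta>: "K * h \<le> e / 2" if "0 \<le> h" "h < \<delta>" for h
  proof -
    have "K * h \<le> (K + 1) * (e / (2 * (K + 1)))"
      using that K by (intro mult_mono) (auto simp: \<delta>_def)
    also have "\<dots> = e / 2" using K by (simp add: divide_simps)
    finally show ?thesis .
  qed
  show "\<exists>d>0. \<forall>r\<in>{0..T}. norm (r - t) < d \<longrightarrow>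
    norm (L2_of_H1 (fst (U r)) - L2_of_H1 (fst (U t)) - (r - t) *\<^sub>R snd (U t)) \<le> e * norm (r - t)"
  proof (intro exI[of _ \<delta>] conjI ballI impI \<delta>)
    fix r assume r: "r \<in> {0..T}" "norm (r - t) < \<delta>"
    have rd: "\<bar>r - t\<bar> < d / 2" "\<bar>t - t\<bar> < d / 2" using r d(1) by (auto simp: \<delta>_def)
    show "norm (L2_of_H1 (fst (U r)) - L2_of_H1 (fst (U t)) - (r - t) *\<^sub>R snd (U t)) \<le> e * norm (r - t)"
    proof (cases "t \<le> r")
      case True
      then show ?thesis using incr[OF _ True _ rd(2,1) K\<delta>] r t by simp
    next
      case False
      have "L2_of_H1 (fst (U r)) - L2_of_H1 (fst (U t)) - (r - t) *\<^sub>R snd (U t)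
          = - (L2_of_H1 (fst (U t)) - L2_of_H1 (fst (U r)) - (t - r) *\<^sub>R snd (U t))"
        by (simp add: algebra_simps)
      then show ?thesis using incr[OF _ _ _ rd K\<delta>] r t False by (simp only: norm_minus_cancel) simp
    qed
  qed
qed

lemma fst_duhamel:
  assumes t: "0 \<le> t" and f: "continuous_on {0..t} (\<lambda>s. (0, f s) :: 'n H1 \<times> 'n L2)"
  shows "((\<lambda>s. duhamel_operator b0 \<beta> t s (f s)) has_integral fst (duhamel 0 t (\<lambda>s. (0, f s)))) {0..t}"
proof -
  have "((\<lambda>s. fst (propagator t s (0, f s))) has_integral fst (duhamel 0 t (\<lambda>s. (0, f s)))) {0..t}"
    using has_integral_linear[OF integrable_integral[OF duhamel_integrable[OF order_refl order_refl f]] bounded_linear_fst]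
    by (simp add: duhamel_def comp_def)
  then show ?thesis
    by (rule has_integral_eq[rotated]) (simp add: duhamel_operator_def solution_operator_eq)
qed

text \<open>The forcing depends on the first component only, so from \<open>u\<close> alone the
  Duhamel formula rebuilds a pair whose first component is \<open>u\<close>. Conversely,
  differentiability of a mild pair shows that its second component is the time derivative that the
  definition asks for.\<close>

lemma mild_solution_on_iff:
  assumes T: "0 \<le> T"
  shows "mild_solution_on b0 \<beta> p u0 u1 T u \<longleftrightarrow> (\<exists>U. nl.mild 0 T (u0, u1) U \<and> (\<forall>t\<in>{0..T}. u t = fst (U t)))"
proof
  assume "mild_solution_on b0 \<beta> p u0 u1 T u"
  then have cu: "continuous_on {0..T} u" by (simp add: mild_solution_on_def)
  obtain f where f: "\<forall>s\<in>{0..T}. AE x in lborel. rep_L2 (f s) x = \<bar>rep_L2 (L2_of_H1 (u s)) x\<bar> powr p"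
    "\<forall>t\<in>{0..T}. ((\<lambda>s. duhamel_operator b0 \<beta> t s (f s)) has_integral u t - solution_operator b0 \<beta> t 0 (u0, u1)) {0..t}"
    using \<open>mild_solution_on b0 \<beta> p u0 u1 T u\<close> unfolding mild_solution_on_def by blast
  have f_eq: "f s = power_map p (u s)" if "s \<in> {0..T}" for s
    using f(1) that by (simp add: AE_eq_power_iff)
  define F where "F s = (0 :: 'n H1, power_map p (u s))" for s
  have cF: "continuous_on {0..T} F"
    using nl.continuous_on_G[OF order_refl continuous_on_Pair[OF cu continuous_on_const[of _ 0]]]
    by (simp add: F_def[abs_def] forcing_def)
  define U where "U t = propagator t 0 (u0, u1) + duhamel 0 t F" for t
  have cU: "continuous_on {0..T} U"
    unfolding U_def
    by (intro continuous_on_add duhamel_continuous[OF order_refl cF]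
        continuous_on_subset[OF propagator_continuous_time[OF order_refl]]) auto
  have fst_U: "fst (U t) = u t" if t: "t \<in> {0..T}" for t
  proof -
    have "continuous_on {0..t} F" by (rule continuous_on_subset[OF cF]) (use t in auto)
    then have "((\<lambda>s. duhamel_operator b0 \<beta> t s (power_map p (u s))) has_integral fst (duhamel 0 t F)) {0..t}"
      using fst_duhamel[of t "\<lambda>s. power_map p (u s)"] t by (simp add: F_def[abs_def])
    moreover have "((\<lambda>s. duhamel_operator b0 \<beta> t s (power_map p (u s))) has_integral
        u t - solution_operator b0 \<beta> t 0 (u0, u1)) {0..t}"
      by (rule has_integral_eq[OF _ f(2)[rule_format, OF t]]) (use t f_eq in simp)
    ultimately have "fst (duhamel 0 t F) = u t - solution_operator b0 \<beta> t 0 (u0, u1)"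
      by (rule has_integral_unique)
    then show ?thesis using t by (simp add: U_def solution_operator_eq)
  qed
  have "nl.mild 0 T (u0, u1) U"
    unfolding nl.mild_def
  proof (intro conjI cU ballI)
    fix t assume t: "t \<in> {0..T}"
    have "duhamel 0 t F = duhamel 0 t (\<lambda>s. forcing s (U s))"
      using t fst_U by (intro duhamel_cong) (simp add: F_def forcing_def)
    then show "U t = propagator t 0 (u0, u1) + duhamel 0 t (\<lambda>s. forcing s (U s))" by (simp add: U_def)
  qed
  then show "\<exists>U. nl.mild 0 T (u0, u1) U \<and> (\<forall>t\<in>{0..T}. u t = fst (U t))" using fst_U by metis
next
  assume "\<exists>U. nl.mild 0 T (u0, u1) U \<and> (\<forall>t\<in>{0..T}. u t = fst (U t))"
  then obtain U where U: "nl.mild 0 T (u0, u1) U" and u: "\<And>t. t \<in> {0..T} \<Longrightarrow> u t = fst (U t)" by blast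
  have cU: "continuous_on {0..T} U" using U by (simp add: nl.mild_def)
  have U0: "U 0 = (u0, u1)" by (rule nl.mild_initial[OF order_refl T U])
  have cF: "continuous_on {0..T} (\<lambda>s. forcing s (U s))" by (rule nl.continuous_on_G[OF order_refl cU])
  show "mild_solution_on b0 \<beta> p u0 u1 T u"
    unfolding mild_solution_on_def
  proof (intro conjI)
    show "continuous_on {0..T} u"
      by (rule continuous_on_eq[OF continuous_on_fst[OF cU]]) (simp add: u)
    have "C1_with_derivative {0..T} (\<lambda>t. L2_of_H1 (u t)) (\<lambda>t. snd (U t))"
      unfolding C1_with_derivative_def
    proof (intro conjI ballI continuous_on_snd cU)
      fix t assume t: "t \<in> {0..T}"
      show "((\<lambda>t. L2_of_H1 (u t)) has_vector_derivative snd (U t)) (at t within {0..T})"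
        by (rule has_vector_derivative_transform[OF t _ mild_derivative[OF U t]]) (simp add: u)
    qed
    then show "\<exists>u'. C1_with_derivative {0..T} (\<lambda>t. L2_of_H1 (u t)) u' \<and> u' 0 = u1"
      by (intro exI[of _ "\<lambda>t. snd (U t)"]) (simp add: U0)
    show "u 0 = u0" using U0 u T by auto
  next
    show "\<exists>f. (\<forall>s\<in>{0..T}. AE x in lborel. rep_L2 (f s) x = \<bar>rep_L2 (L2_of_H1 (u s)) x\<bar> powr p) \<and>
      (\<forall>t\<in>{0..T}. ((\<lambda>s. duhamel_operator b0 \<beta> t s (f s)) has_integral
        u t - solution_operator b0 \<beta> t 0 (u0, u1)) {0..t})"
    proof (intro exI[of _ "\<lambda>s. power_map p (u s)"] conjI ballI)
      fix t assume t: "t \<in> {0..T}"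
      show "AE x in lborel. rep_L2 (power_map p (u t)) x = \<bar>rep_L2 (L2_of_H1 (u t)) x\<bar> powr p"
        by (rule AE_power_map)
    next
      fix t assume t: "t \<in> {0..T}"
      have F: "forcing s (U s) = (0, power_map p (u s))" if "s \<in> {0..t}" for s
        using that t by (simp add: forcing_def u)
      have "continuous_on {0..t} (\<lambda>s. (0 :: 'n H1, power_map p (u s)))"
        by (rule continuous_on_eq[OF continuous_on_subset[OF cF] F]) (use t in auto)
      moreover have "fst (duhamel 0 t (\<lambda>s. (0, power_map p (u s)))) = u t - solution_operator b0 \<beta> t 0 (u0, u1)"
      proof -
        have "U t = propagator t 0 (u0, u1) + duhamel 0 t (\<lambda>s. forcing s (U s))"
          using U t by (simp add: nl.mild_def)
        also have "duhamel 0 t (\<lambda>s. forcing s (U s)) = duhamel 0 t (\<lambda>s. (0, power_map p (u s)))"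
          by (rule duhamel_cong[OF F])
        finally have "fst (U t) = fst (propagator t 0 (u0, u1)) + fst (duhamel 0 t (\<lambda>s. (0, power_map p (u s))))"
          by (simp only: fst_add)
        then show ?thesis using u[OF t] t by (simp add: solution_operator_eq)
      qed
      ultimately show "((\<lambda>s. duhamel_operator b0 \<beta> t s (power_map p (u s))) has_integral
          u t - solution_operator b0 \<beta> t 0 (u0, u1)) {0..t}"
        using fst_duhamel[of t "\<lambda>s. power_map p (u s)"] t by simp
    qed
  qed
qed

text \<open>Every mild solution is the first component of a mild pair and agrees with
  \<open>u\<close> on its interval. A competitor ending before \<open>Tm\<close> is extended by
  \<open>u\<close> to a closed interval; one ending later would contain a solution up to
  \<open>Tm\<close> itself, which maximality of the pair excludes.\<close>

lemma exists_unique_maximal_mild_solution: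
  "\<exists>Tmax u. maximal_mild_solution b0 \<beta> p u0 u1 Tmax u \<and>
    (\<forall>T v. maximal_mild_solution b0 \<beta> p u0 u1 T v \<longrightarrow>
      T = Tmax \<and> (\<forall>t. 0 \<le> t \<and> ereal t < Tmax \<longrightarrow> v t = u t)) \<and>
    (Tmax < \<infinity> \<longrightarrow>
      filterlim (\<lambda>t. norm (u t) + norm (vector_derivative (\<lambda>\<tau>. L2_of_H1 (u \<tau>)) (at t)))
        at_top (at_left (real_of_ereal Tmax)))"
proof -
  obtain Tm U where Tm: "ereal 0 < Tm"
    and U: "\<And>T. 0 \<le> T \<Longrightarrow> ereal T < Tm \<Longrightarrow> nl.mild 0 T (u0, u1) U"
    and max: "\<And>T V. 0 \<le> T \<Longrightarrow> nl.mild 0 T (u0, u1) V \<Longrightarrow> ereal T < Tm"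
    and blow_up: "\<And>\<tau>. Tm = ereal \<tau> \<Longrightarrow> filterlim (\<lambda>t. norm (U t)) at_top (at_left \<tau>)"
    using nl.mild_maximal[OF order_refl, of "(u0, u1)"] by metis
  define u where "u t = fst (U t)" for t
  have sol_u: "mild_solution_on b0 \<beta> p u0 u1 T u" if "0 \<le> T" "ereal T < Tm" for T
    using U[OF that] that(1) by (auto simp: mild_solution_on_iff u_def)
  have sol: "ereal T < Tm \<and> (\<forall>t\<in>{0..T}. v t = u t)"
    if T: "0 \<le> T" and v: "mild_solution_on b0 \<beta> p u0 u1 T v" for T v
  proof -
    obtain V where V: "nl.mild 0 T (u0, u1) V" "\<forall>t\<in>{0..T}. v t = fst (V t)"
      using v T by (auto simp: mild_solution_on_iff)
    have TTm: "ereal T < Tm" by (rule max[OF T V(1)])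
    have "V t = U t" if "t \<in> {0..T}" for t
      by (rule nl.mild_unique[OF order_refl V(1) U[OF T TTm] that])
    then show ?thesis using TTm V(2) by (simp add: u_def)
  qed
  \<comment> \<open>Solutions on half-open intervals are restricted to closed intervals of positive
    length only, so a positive \<open>r\<close> is also required for \<open>t = 0\<close>.\<close>
  have dense_time: "\<exists>r. t \<le> r \<and> 0 < r \<and> ereal r < S" if S: "0 \<le> t" "0 < S" "ereal t < S" for t S
  proof -
    have "max (ereal t) 0 < S" using S by simp
    then obtain r where r: "max (ereal t) 0 < ereal r" "ereal r < S" using ereal_dense2 by blast
    then show ?thesis by (intro exI[of _ r]) (auto simp: zero_ereal_def)
  qed
  have agree: "v t = u t" if v: "mild_solution_before b0 \<beta> p u0 u1 S v" and S: "0 \<le> t" "0 < S" "ereal t < S" for v S t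
  proof -
    obtain r where r: "t \<le> r" "0 < r" "ereal r < S" using dense_time[OF S] by blast
    then have "mild_solution_on b0 \<beta> p u0 u1 r v" using v by (simp add: mild_solution_before_def)
    then show ?thesis using sol[of r v] r S(1) by auto
  qed
  have max_u: "maximal_mild_solution b0 \<beta> p u0 u1 Tm u"
    unfolding maximal_mild_solution_def
  proof (intro conjI)
    show "0 < Tm" using Tm by (simp add: zero_ereal_def)
    show "mild_solution_before b0 \<beta> p u0 u1 Tm u" by (simp add: mild_solution_before_def sol_u)
    show "\<not> (\<exists>T v. Tm \<le> ereal T \<and> mild_solution_on b0 \<beta> p u0 u1 T v \<and> (\<forall>t. 0 \<le> t \<and> ereal t < Tm \<longrightarrow> v t = u t))"
    proof clarify
      fix T v assume T: "Tm \<le> ereal T" "mild_solution_on b0 \<beta> p u0 u1 T v"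
      have "ereal 0 < ereal T" using Tm T(1) by (rule less_le_trans)
      then show False using sol[OF _ T(2)] T(1) by (simp add: leD)
    qed
  qed
  moreover have "T = Tm \<and> (\<forall>t. 0 \<le> t \<and> ereal t < Tm \<longrightarrow> v t = u t)"
    if v: "maximal_mild_solution b0 \<beta> p u0 u1 T v" for T v
  proof -
    have T: "0 < T" and before: "mild_solution_before b0 \<beta> p u0 u1 T v"
      and ext: "\<And>S w. T \<le> ereal S \<Longrightarrow> mild_solution_on b0 \<beta> p u0 u1 S w \<Longrightarrow>
        \<not> (\<forall>t. 0 \<le> t \<and> ereal t < T \<longrightarrow> w t = v t)"
      using v unfolding maximal_mild_solution_def by blast+
    have "\<not> T < Tm"
    proof
      assume lt: "T < Tm"
      obtain \<tau> where \<tau>: "T = ereal \<tau>" using T lt by (cases T) auto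
      have "mild_solution_on b0 \<beta> p u0 u1 \<tau> u" using T lt by (intro sol_u) (auto simp: \<tau> zero_ereal_def)
      then show False using ext[of \<tau> u] agree[OF before] T by (auto simp: \<tau>)
    qed
    moreover have "\<not> Tm < T"
    proof
      assume lt: "Tm < T"
      obtain \<tau> where \<tau>: "Tm = ereal \<tau>" using Tm lt by (cases Tm) auto
      have "mild_solution_on b0 \<beta> p u0 u1 \<tau> v" using before Tm lt by (simp add: mild_solution_before_def \<tau>)
      then show False using sol[of \<tau> v] Tm by (simp add: \<tau>)
    qed
    ultimately have "T = Tm" by simp
    then show ?thesis using agree[OF before] T by simp
  qed
  moreover have "filterlim (\<lambda>t. norm (u t) + norm (vector_derivative (\<lambda>\<tau>. L2_of_H1 (u \<tau>)) (at t)))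
      at_top (at_left (real_of_ereal Tm))" if fin: "Tm < \<infinity>"
  proof -
    obtain \<tau> where \<tau>: "Tm = ereal \<tau>" using fin Tm by (cases Tm) auto
    have \<tau>0: "0 < \<tau>" using Tm by (simp add: \<tau>)
    have "norm (U t) \<le> norm (u t) + norm (vector_derivative (\<lambda>\<tau>. L2_of_H1 (u \<tau>)) (at t))" if t: "t \<in> {0<..<\<tau>}" for t
    proof -
      \<comment> \<open>A time strictly between \<open>t\<close> and \<tau> makes \<open>t\<close>
        an interior point, where the one-sided derivative is the full one.\<close>
      define r where "r = (t + \<tau>) / 2"
      have r: "0 \<le> r" "ereal r < Tm" "t < r" using t by (auto simp: r_def \<tau>)
      have "((\<lambda>t. L2_of_H1 (u t)) has_vector_derivative snd (U t)) (at t within {0..r})"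
        using mild_derivative[OF U[OF r(1,2)], of t] t r by (simp add: u_def)
      then have "((\<lambda>t. L2_of_H1 (u t)) has_vector_derivative snd (U t)) (at t)"
        using t r by (simp add: at_within_Icc_at)
      then have "vector_derivative (\<lambda>\<tau>. L2_of_H1 (u \<tau>)) (at t) = snd (U t)" by (rule vector_derivative_at)
      then show ?thesis using norm_Pair_le[of "fst (U t)" "snd (U t)"] by (simp add: u_def)
    qed
    then have "\<forall>\<^sub>F t in at_left \<tau>. norm (U t) \<le> norm (u t) + norm (vector_derivative (\<lambda>\<tau>. L2_of_H1 (u \<tau>)) (at t))"
      by (rule eventually_at_leftI[OF _ \<tau>0])
    then show ?thesis using filterlim_at_top_mono[OF blow_up[OF \<tau>]] by (simp add: \<tau>)
  qed
  ultimately show ?thesis by blast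
qed

end

text \<open>The dimension is \<open>CARD('n)\<close>. Uniqueness compares only times in
  \<open>[0, Tmax)\<close>, because the functions are total and their values elsewhere are
  arbitrary.\<close>

theorem proposition3:
  fixes b0 \<beta> p :: real
    and u0 :: "'n::finite H1" and u1 :: "'n L2"
  assumes "b0 > 0" and "p > 1"
    and "CARD('n) \<ge> 3 \<Longrightarrow> p \<le> real CARD('n) / (real CARD('n) - 2)"
  shows "\<exists>Tmax u.
    maximal_mild_solution b0 \<beta> p u0 u1 Tmax u \<and>
    (\<forall>T v. maximal_mild_solution b0 \<beta> p u0 u1 T v \<longrightarrow>
      T = Tmax \<and> (\<forall>t. 0 \<le> t \<and> ereal t < Tmax \<longrightarrow> v t = u t)) \<and>
    (Tmax < \<infinity> \<longrightarrow>
      filterlim (\<lambda>t. norm (u t) + norm (vector_derivative (\<lambda>\<tau>. L2_of_H1 (u \<tau>)) (at t)))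
        at_top (at_left (real_of_ereal Tmax)))"
proof -
  interpret cauchy_problem b0 \<beta> p u0 u1
    by unfold_locales (use assms in auto)
  show ?thesis by (rule exists_unique_maximal_mild_solution)
qed

end
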